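(* Let $K/k$ be a cyclic extension of number fields with Galois group $G=\langle\sigma\rangle$. Let $\mathfrak m$ be a nonzero integral ideal (modulus) of $k$ with support $T$ (the set of prime ideals dividing $\mathfrak m$), also viewed (by extension of ideals) as a modulus of $K$. Let $\mathcal I$ be a subgroup of $I_{K,T}$ such that $\mathcal H:=\mathcal I\cdot P_{K,\mathfrak m}^+/P_{K,\mathfrak m}^+$ is a sub-$G$-module of $\mathcal C\ell_{K,\mathfrak m}^+=I_{K,T}/P^+_{K,\mathfrak m}$, and put $$\widetilde{\mathcal H}=\{h\in \mathcal C\ell_{K,\mathfrak m}^+ : h^{1-\sigma}\in\mathcal H\},\qquad {}_{\rm N}\mathcal H=\ker\big(\mathrm N_{K/k}:\mathcal H\to \mathcal C\ell^+_{k,\mathfrak m}\big),$$ $$\Lambda=\{x\in U_{k,\mathfrak m}^+ : (x)\in \mathrm N_{K/k}(\mathcal I)\}.$$ Then $(\widetilde{\mathcal H})^{1-\sigma}\subseteq {}_{\rm N}\mathcal H$ and there is an exact sequence $$1\longrightarrow \big(E_{k,\mathfrak m}^+\,\mathrm N_{K/k}(U_{K,\mathfrak m}^+)\big)\cap\Lambda\longrightarrow \Lambda\xrightarrow{\ \varphi\ } {}_{\rm N}\mathcal H/(\widetilde{\mathcal H})^{1-\sigma}\longrightarrow 1,$$ where for $x\in\Lambda$, $\varphi(x)=c\ell_K(\mathfrak A)\cdot(\widetilde{\mathcal H})^{1-\sigma}$ for any $\mathfrak A\in\mathcal I$ with $\mathrm N_{K/k}(\mathfrak A)=(x)$ (this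 being well defined).
   Context: For a number field $F$ and a modulus $\mathfrak m$ with support $T$: $I_{F,T}$ is the group of fractional ideals of $F$ prime to $T$; $F^{\times+}$ is the group of totally positive elements of $F^\times$; $U_{F,\mathfrak m}^+=\{x\in F^{\times+}: v_{\mathfrak p}(x)=0\ \forall\mathfrak p\in T,\ x\equiv1\pmod{\mathfrak m}\}$; $P_{F,\mathfrak m}^+=\{(x): x\in U^+_{F,\mathfrak m}\}$ is the ray group modulo $\mathfrak m$ in the narrow sense; $\mathcal C\ell^+_{F,\mathfrak m}=I_{F,T}/P^+_{F,\mathfrak m}$ is the narrow ray class group, with class map $c\ell_F:I_{F,T}\to\mathcal C\ell^+_{F,\mathfrak m}$; $E_{F,\mathfrak m}^+$ is the group of totally positive units $\varepsilon$ of $F$ with $\varepsilon\equiv1\pmod{\mathfrak m}$. $\mathrm N_{K/k}$ denotes the arithmetical norm on ideals ($\mathrm N_{K/k}(\mathfrak P)=\mathfrak p^{f_{\mathfrak p}}$, $f_{\mathfrak p}$ the residue degree), the usual norm on elements, and the induced map on ray class groups $\mathcal C\ell^+_{K,\mathfrak m}\to\mathcal C\ell^+_{k,\mathfrak m}$. $G$ acts on $\mathcal C\ell^+_{K,\mathfrak m}$ via its action on ideals. *)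

theory Defs
  imports "HOL-Algebra.Algebra" "HOL-Algebra.Algebraic_Closure_Type"
begin

text \<open>
  All fields live inside an arbitrary ambient field of characteristic 0, given by the
  type \<^typ>\<open>'a\<close>; a number field is a subset of that type. Ideals are sets of field elements.
\<close>

subsection \<open>Number fields\<close>

abbreviation ring_on :: "'a::field_char_0 set \<Rightarrow> 'a ring" where
  "ring_on S \<equiv> ring_of_type_algebra\<lparr>carrier := S\<rparr>"

definition number_field :: "'a::field_char_0 set \<Rightarrow> bool" where
  "number_field F \<longleftrightarrow> subfield F (ring_of_type_algebra :: 'a ring) \<and>
     (\<exists>n. ring.dimension (ring_of_type_algebra :: 'a ring) n \<rat> F)"

definition ints_of :: "'a::field_char_0 set \<Rightarrow> 'a set" where
  "ints_of F = {x \<in> F. algebraic_int x}"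

definition tot_pos :: "'a::field_char_0 set \<Rightarrow> 'a set" where
  "tot_pos F = {x \<in> F. x \<noteq> 0 \<and>
     (\<forall>\<tau> \<in> ring_hom (ring_on F) (ring_of_type_algebra :: real ring). \<tau> x > 0)}"

subsection \<open>Galois extensions\<close>

definition gal_group :: "'a::field_char_0 set \<Rightarrow> 'a set \<Rightarrow> ('a \<Rightarrow> 'a) monoid" where
  "gal_group K k = (BijGroup K)\<lparr>carrier :=
     {s \<in> Bij K. s \<in> ring_hom (ring_on K) (ring_on K) \<and> (\<forall>x\<in>k. s x = x)}\<rparr>"

definition galois_ext :: "'a::field_char_0 set \<Rightarrow> 'a set \<Rightarrow> bool" where
  "galois_ext K k \<longleftrightarrow> k \<subseteq> K \<and> {x \<in> K. \<forall>s \<in> carrier (gal_group K k). s x = x} = k"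

text \<open>The norm on elements, for a Galois extension \<open>K/k\<close>.\<close>

definition elem_norm :: "'a::field_char_0 set \<Rightarrow> 'a set \<Rightarrow> 'a \<Rightarrow> 'a" where
  "elem_norm K k x = (\<Prod>s \<in> carrier (gal_group K k). s x)"

subsection \<open>Fractional ideals\<close>

definition ideal_mult :: "'a::field_char_0 set \<Rightarrow> 'a set \<Rightarrow> 'a set" where
  "ideal_mult A B =
     {\<Sum>i<n. f i * g i | (n::nat) f g. (\<forall>i<n. f i \<in> A) \<and> (\<forall>i<n. g i \<in> B)}"

definition frac_ideals :: "'a::field_char_0 set \<Rightarrow> 'a set set" where
  "frac_ideals F = {A. A \<subseteq> F \<and> A \<noteq> {0} \<and> 0 \<in> A \<and> (\<forall>a\<in>A. \<forall>b\<in>A. a + b \<in> A) \<and>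
     (\<forall>r\<in>ints_of F. \<forall>a\<in>A. r * a \<in> A) \<and>
     (\<exists>d\<in>ints_of F. d \<noteq> 0 \<and> (\<forall>a\<in>A. d * a \<in> ints_of F))}"

definition integral_ideals :: "'a::field_char_0 set \<Rightarrow> 'a set set" where
  "integral_ideals F = {A \<in> frac_ideals F. A \<subseteq> ints_of F}"

definition frac_group :: "'a::field_char_0 set \<Rightarrow> 'a set monoid" where
  "frac_group F = \<lparr>carrier = frac_ideals F, monoid.mult = ideal_mult, one = ints_of F\<rparr>"

definition principal :: "'a::field_char_0 set \<Rightarrow> 'a \<Rightarrow> 'a set" where
  "principal F x = (\<lambda>r. x * r) ` ints_of F"

definition primes_of :: "'a::field_char_0 set \<Rightarrow> 'a set set" where
  "primes_of F = {P. primeideal P (ring_on (ints_of F)) \<and> P \<noteq> {0}}"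

text \<open>\<open>ideal_val F A P\<close> is the exponent of the prime \<open>P\<close> in the factorization of \<open>A\<close>.\<close>

definition ideal_val :: "'a::field_char_0 set \<Rightarrow> 'a set \<Rightarrow> 'a set \<Rightarrow> int" where
  "ideal_val F A = (THE e. finite {P. e P \<noteq> 0} \<and> {P. e P \<noteq> 0} \<subseteq> primes_of F \<and>
     A = finprod (frac_group F) (\<lambda>P. P [^]\<^bsub>frac_group F\<^esub> e P) {P. e P \<noteq> 0})"

definition elem_val :: "'a::field_char_0 set \<Rightarrow> 'a \<Rightarrow> 'a set \<Rightarrow> int" where
  "elem_val F x P = ideal_val F (principal F x) P"

subsection \<open>Norms of ideals\<close>

text \<open>
  The degree of \<open>O\<^sub>K/P\<close> over \<open>O\<^sub>k/(P \<inter> O\<^sub>k)\<close>, the latter being identified with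
  the image of \<open>O\<^sub>k\<close> in \<open>O\<^sub>K/P\<close>.
\<close>

definition res_degree :: "'a::field_char_0 set \<Rightarrow> 'a set \<Rightarrow> 'a set \<Rightarrow> nat" where
  "res_degree K k P = (let R = ring_on (ints_of K) in
     THE n. ring.dimension (R Quot P) n ((\<lambda>x. P +>\<^bsub>R\<^esub> x) ` ints_of k) (carrier (R Quot P)))"

definition ideal_norm :: "'a::field_char_0 set \<Rightarrow> 'a set \<Rightarrow> 'a set \<Rightarrow> 'a set" where
  "ideal_norm K k A = finprod (frac_group k)
     (\<lambda>P. (P \<inter> ints_of k) [^]\<^bsub>frac_group k\<^esub> (int (res_degree K k P) * ideal_val K A P))
     {P \<in> primes_of K. ideal_val K A P \<noteq> 0}"

subsection \<open>Moduli and ray class groups\<close>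

definition modulus_ext :: "'a::field_char_0 set \<Rightarrow> 'a set \<Rightarrow> 'a set" where
  "modulus_ext K \<mm> = ideal_mult \<mm> (ints_of K)"

definition supp :: "'a::field_char_0 set \<Rightarrow> 'a set \<Rightarrow> 'a set set" where
  "supp F \<mm> = {P \<in> primes_of F. \<exists>C \<in> integral_ideals F. \<mm> = ideal_mult P C}"

definition ideal_group :: "'a::field_char_0 set \<Rightarrow> 'a set set \<Rightarrow> 'a set monoid" where
  "ideal_group F T = (frac_group F)\<lparr>carrier :=
     {A \<in> frac_ideals F. \<forall>P\<in>T. ideal_val F A P = 0}\<rparr>"

text \<open>
  The congruence \<open>x \<equiv> 1 (mod \<mm>)\<close> for an element \<open>x\<close> of \<open>F\<close>, not necessarily integral:
  \<open>v\<^sub>P(x - 1) \<ge> v\<^sub>P(\<mm>)\<close> for all \<open>P\<close> dividing \<open>\<mm>\<close>, where \<open>v\<^sub>P(0) = \<infinity>\<close>.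
\<close>

definition cong_one :: "'a::field_char_0 set \<Rightarrow> 'a set \<Rightarrow> 'a \<Rightarrow> bool" where
  "cong_one F \<mm> x \<longleftrightarrow>
     x = 1 \<or> (\<forall>P \<in> supp F \<mm>. elem_val F (x - 1) P \<ge> ideal_val F \<mm> P)"

definition ray_elems :: "'a::field_char_0 set \<Rightarrow> 'a set \<Rightarrow> 'a set" where
  "ray_elems F \<mm> =
     {x \<in> tot_pos F. (\<forall>P \<in> supp F \<mm>. elem_val F x P = 0) \<and> cong_one F \<mm> x}"

definition ray_units :: "'a::field_char_0 set \<Rightarrow> 'a set \<Rightarrow> 'a set" where
  "ray_units F \<mm> =
     {x \<in> tot_pos F. x \<in> Units (ring_on (ints_of F)) \<and> cong_one F \<mm> x}"

definition ray_group :: "'a::field_char_0 set \<Rightarrow> 'a set \<Rightarrow> 'a set set" where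
  "ray_group F \<mm> = principal F ` ray_elems F \<mm>"

definition ray_class_group :: "'a::field_char_0 set \<Rightarrow> 'a set \<Rightarrow> 'a set set monoid" where
  "ray_class_group F \<mm> = ideal_group F (supp F \<mm>) Mod ray_group F \<mm>"

definition ray_class :: "'a::field_char_0 set \<Rightarrow> 'a set \<Rightarrow> 'a set \<Rightarrow> 'a set set" where
  "ray_class F \<mm> A = ray_group F \<mm> #>\<^bsub>ideal_group F (supp F \<mm>)\<^esub> A"

text \<open>
  Classes are cosets, i.e. sets of ideals. The union below ranges over equal cosets, so
  it is their common value: the map induced on classes by the norm of ideals.
\<close>

definition class_norm :: "'a::field_char_0 set \<Rightarrow> 'a set \<Rightarrow> 'a set \<Rightarrow> 'a set set \<Rightarrow> 'a set set" where
  "class_norm K k \<mm> c = (\<Union>A\<in>c. ray_class k \<mm> (ideal_norm K k A))"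

definition class_act :: "('a::field_char_0 \<Rightarrow> 'a) \<Rightarrow> 'a set set \<Rightarrow> 'a set set" where
  "class_act s c = (\<lambda>A. s ` A) ` c"

subsection \<open>Exact sequences\<close>

definition mult_group_on :: "'a::field_char_0 set \<Rightarrow> 'a monoid" where
  "mult_group_on S = \<lparr>carrier = S, monoid.mult = (*), one = 1\<rparr>"

text \<open>
  Exactness of \<open>1 \<rightarrow> A \<rightarrow> B \<rightarrow> C \<rightarrow> 1\<close> for groups over different types, which the
  predicate \<^const>\<open>exact_seq\<close> does not allow.
\<close>

definition short_exact ::
  "'a monoid \<Rightarrow> ('a \<Rightarrow> 'b) \<Rightarrow> 'b monoid \<Rightarrow> ('b \<Rightarrow> 'c) \<Rightarrow> 'c monoid \<Rightarrow> bool" where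
  "short_exact A f B g C \<longleftrightarrow> group_hom A B f \<and> group_hom B C g \<and>
     inj_on f (carrier A) \<and> f ` carrier A = kernel B C g \<and> g ` carrier B = carrier C"

end

theory Submission
  imports Defs
begin

text \<open>
  Everything rests on two facts about the norm of ideals. First, extending \<open>N(A)\<close> to \<open>K\<close> gives the
  product of the conjugates of \<open>A\<close>: for a prime \<open>P\<close> above \<open>p\<close> both sides are Galois invariant and
  supported on the orbit of \<open>P\<close>, hence comparable, and they have the same absolute norm because
  \<open>O\<^sub>K / p O\<^sub>K\<close> has dimension \<open>[K : k]\<close> over \<open>O\<^sub>k / p\<close>. As extension of ideals is injective,
  \<open>N((y)) = (N y)\<close> and \<open>N(\<sigma> A) = N(A)\<close>. Second, an ideal prime to \<open>T\<close> of norm \<open>1\<close> is \<open>B\<^bsup>1-\<sigma>\<^esup>\<close> for an ideal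
  \<open>B\<close> prime to \<open>T\<close>. So if \<open>N(A) = (x)\<close> and \<open>x = \<epsilon> N(y)\<close> with \<open>\<epsilon>\<close> a unit, then \<open>A (y)\<^bsup>-1\<^esup>\<close> has norm \<open>1\<close> and the
  class of \<open>A\<close> is \<open>cl(B)\<^bsup>1-\<sigma>\<^esup>\<close>; conversely \<open>A = (y) B\<^bsup>1-\<sigma>\<^esup>\<close> has norm \<open>(N y)\<close>.
\<close>

section \<open>Algebraic integers\<close>

text \<open>The rings of integers are built up from one source, the finiteness of
  \<open>\<O>\<close> modulo a positive integer, which replaces an integral basis: two equal
  residues among powers give the integrality of elements that stabilize an ideal and inverses modulo
  a prime, and the index of an ideal is the induction measure for factorization. \<open>OK\<close>
  need not be free over \<open>Ok\<close>, so the dimension of its residue space cannot be read off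
  a basis either: it is bounded above by relations scaled to be integral but not all zero modulo the
  prime, and below by a trace argument. Finally, the norm must carry \<open>UK\<close> into
  \<open>Uk\<close>, or it would not act on ray classes. Valuations transfer through ramification
  indices, but positivity at a real embedding of \<open>k\<close> is not formal, since that
  embedding may extend to \<open>K\<close> only as a complex one. Complex conjugation then acts
  through an element of the Galois group and pairs the factors of the norm into squares of absolute
  values.\<close>

lemma algebraic_int_powerI:
  fixes z :: "'a::field_char_0"
  assumes "z ^ n = (\<Sum>i<n. of_int (c i) * z ^ i)"
  shows "algebraic_int z"
proof (rule algebraic_int.intros)
  define q :: "'a poly" where "q = (\<Sum>i<n. monom (of_int (c i)) i)"
  define p where "p = monom 1 n - q"
  have cq: "Polynomial.coeff q j = (if j < n then of_int (c j) else 0)" for j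
    unfolding q_def by (simp add: Polynomial.coeff_sum sum.delta' if_distrib cong: if_cong)
  have cp: "Polynomial.coeff p j = (if j = n then 1 else if j < n then - of_int (c j) else 0)" for j
    unfolding p_def by (simp add: cq)
  have "Polynomial.degree p = n"
  proof (rule antisym)
    show "Polynomial.degree p \<le> n" by (rule degree_le) (simp add: cp)
    show "n \<le> Polynomial.degree p" by (rule le_degree) (simp add: cp)
  qed
  then show "lead_coeff p = 1" by (simp add: cp)
  show "\<forall>i. Polynomial.coeff p i \<in> \<int>" by (simp add: cp)
  show "poly p z = 0"
    using assms by (simp add: p_def q_def poly_monom poly_sum)
qed

lemma algebraic_int_powerE:
  fixes z :: "'a::field_char_0"
  assumes "algebraic_int z"
  obtains n and c :: "nat \<Rightarrow> int" where "n > 0" "z ^ n = (\<Sum>i<n. of_int (c i) * z ^ i)"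
proof -
  obtain p where p: "poly (map_poly of_int p) z = 0" "lead_coeff p = 1"
    using assms by (auto simp: algebraic_int_altdef_ipoly)
  define n where "n = Polynomial.degree p"
  define c where "c = (\<lambda>i. - Polynomial.coeff p i)"
  have deg: "Polynomial.degree (map_poly of_int p :: 'a poly) = n"
    by (simp add: n_def degree_map_poly)
  have "0 = (\<Sum>i\<le>n. of_int (Polynomial.coeff p i) * z ^ i)"
    using p(1) by (simp add: poly_altdef deg coeff_map_poly del: degree_map_poly)
  also have "\<dots> = (\<Sum>i<n. of_int (Polynomial.coeff p i) * z ^ i) + z ^ n"
    using p(2) by (simp add: lessThan_Suc_atMost[symmetric] n_def)
  finally have eq: "z ^ n = (\<Sum>i<n. of_int (c i) * z ^ i)"
    by (simp add: c_def sum_negf eq_neg_iff_add_eq_0 add.commute)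
  have "n > 0"
  proof (rule ccontr)
    assume "\<not> n > 0"
    with eq show False by simp
  qed
  with eq that show ?thesis by blast
qed

section \<open>Additive subgroups and ascending chains in finitely generated abelian groups\<close>

definition add_sub :: "'a::ab_group_add set \<Rightarrow> bool" where
  "add_sub A \<longleftrightarrow> 0 \<in> A \<and> (\<forall>x\<in>A. \<forall>y\<in>A. x - y \<in> A)"

lemma add_sub_zero: "add_sub A \<Longrightarrow> 0 \<in> A"
  and add_sub_diff: "add_sub A \<Longrightarrow> x \<in> A \<Longrightarrow> y \<in> A \<Longrightarrow> x - y \<in> A"
  by (auto simp: add_sub_def)

lemma add_sub_uminus: "add_sub A \<Longrightarrow> x \<in> A \<Longrightarrow> - x \<in> A"
  using add_sub_diff[of A 0 x] add_sub_zero[of A] by simp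

lemma add_sub_add: "add_sub A \<Longrightarrow> x \<in> A \<Longrightarrow> y \<in> A \<Longrightarrow> x + y \<in> A"
  using add_sub_diff[of A x "- y"] add_sub_uminus[of A y] by simp

lemma add_sub_sum: "add_sub A \<Longrightarrow> (\<And>i. i \<in> I \<Longrightarrow> f i \<in> A) \<Longrightarrow> sum f I \<in> A"
  by (induction I rule: infinite_finite_induct) (auto simp: add_sub_zero add_sub_add)

lemma add_sub_of_int_mult:
  fixes x :: "'a::ring_1"
  assumes A: "add_sub A" and x: "x \<in> A" shows "of_int n * x \<in> A"
proof (induction n rule: int_induct[where k = 0])
  case (step1 i) then show ?case using add_sub_add[OF A _ x] by (simp add: distrib_right)
next
  case (step2 i) then show ?case using add_sub_diff[OF A _ x] by (simp add: left_diff_distrib)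
qed (simp add: add_sub_zero[OF A])

text \<open>The union of the chain is a subgroup of the integers, generated by its least positive
  element, and this generator already lies in some member of the chain.\<close>

lemma int_add_sub_stationary:
  fixes I :: "nat \<Rightarrow> int set"
  assumes I: "\<And>j. add_sub (I j)" and mono: "\<And>j. I j \<subseteq> I (Suc j)"
  shows "\<exists>m. \<forall>n. I n \<subseteq> I m"
proof (cases "\<forall>n. I n \<subseteq> {0}")
  case True
  then show ?thesis using add_sub_zero[OF I] by blast
next
  case False
  have mono': "I i \<subseteq> I j" if "i \<le> j" for i j using lift_Suc_mono_le[of I, OF mono that] .
  have U: "add_sub (\<Union>n. I n)"
    unfolding add_sub_def
  proof (intro conjI ballI)
    fix x y assume "x \<in> (\<Union>n. I n)" "y \<in> (\<Union>n. I n)"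
    then obtain i j where "x \<in> I i" "y \<in> I j" by blast
    then have "x \<in> I (max i j)" "y \<in> I (max i j)" using mono'[of i "max i j"] mono'[of j "max i j"] by auto
    then show "x - y \<in> (\<Union>n. I n)" using add_sub_diff[OF I] by blast
  qed (use add_sub_zero[OF I] in blast)
  from False obtain x n where x: "x \<in> I n" "x \<noteq> 0" by blast
  have ex: "\<exists>g::nat. g > 0 \<and> int g \<in> (\<Union>n. I n)"
    using x add_sub_uminus[OF I x(1)]
    by (intro exI[of _ "nat \<bar>x\<bar>"]) (cases "x > 0"; auto)
  define g where "g = (LEAST g::nat. g > 0 \<and> int g \<in> (\<Union>n. I n))"
  have g: "g > 0" "int g \<in> (\<Union>n. I n)" using LeastI_ex[OF ex] by (auto simp: g_def)
  then obtain m where m: "int g \<in> I m" by blast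
  have "y \<in> I m" if "y \<in> I n" for y n
  proof -
    have "y mod int g = y - of_int (y div int g) * int g" by (simp add: minus_div_mult_eq_mod)
    also have "\<dots> \<in> (\<Union>n. I n)"
      using that by (intro add_sub_diff[OF U] add_sub_of_int_mult[OF U] g) blast
    finally have *: "int (nat (y mod int g)) \<in> (\<Union>n. I n)" using g(1) by simp
    have "nat (y mod int g) = 0"
    proof (rule ccontr)
      assume "nat (y mod int g) \<noteq> 0"
      with * have "g \<le> nat (y mod int g)" unfolding g_def by (intro Least_le) simp
      moreover have "y mod int g < int g" using g(1) by simp
      ultimately show False using g(1) by linarith
    qed
    then have "y mod int g = 0" using g(1) by (metis nat_eq_iff of_nat_0 pos_mod_sign of_nat_0_less_iff)
    then have "y = of_int (y div int g) * int g" by auto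
    then show ?thesis using add_sub_of_int_mult[OF I m] by metis
  qed
  then show ?thesis by blast
qed

definition int_span :: "('b \<Rightarrow> 'a) \<Rightarrow> 'b set \<Rightarrow> 'a::comm_ring_1 set" where
  "int_span v J = {(\<Sum>i\<in>J. of_int (c i) * v i) | c. True}"

lemma int_span_add_sub: "add_sub (int_span v J)"
  unfolding add_sub_def
proof (intro conjI ballI)
  show "0 \<in> int_span v J" by (auto simp: int_span_def intro!: exI[of _ "\<lambda>_. 0"])
  fix x y assume "x \<in> int_span v J" "y \<in> int_span v J"
  then obtain c d where "x = (\<Sum>i\<in>J. of_int (c i) * v i)" "y = (\<Sum>i\<in>J. of_int (d i) * v i)"
    by (auto simp: int_span_def)
  then show "x - y \<in> int_span v J"
    by (auto simp: int_span_def sum_subtractf[symmetric] left_diff_distrib[symmetric]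
        simp flip: of_int_diff)
qed

text \<open>The ascending chain condition, by induction on the number of generators. For a new
  generator \<open>v b\<close>, two chains become stationary: the ideals of coefficients of
  \<open>v b\<close>, and the intersections with the span of the other generators. Together they
  control \<open>N n\<close>.\<close>

lemma int_span_stationary:
  assumes "finite J" and "\<And>n. add_sub (N n)" and "\<And>n. N n \<subseteq> int_span v J"
    and "\<And>n. N n \<subseteq> N (Suc n)"
  shows "\<exists>m. \<forall>n. N n \<subseteq> N m"
  using assms
proof (induction J arbitrary: N rule: finite_induct)
  case empty
  then have "N n = {0}" for n using add_sub_zero[of "N n"] by (force simp: int_span_def)
  then show ?case by blast
next
  case (insert b J)
  note N = insert.prems(1) and sub = insert.prems(2) and mono = insert.prems(3)
  have mono': "N i \<subseteq> N j" if "i \<le> j" for i j using lift_Suc_mono_le[of N, OF mono that] .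
  define S where "S = int_span v J"
  have S: "add_sub S" by (simp add: S_def int_span_add_sub)
  have split: "\<exists>c. \<exists>s\<in>S. x = of_int c * v b + s" if x: "x \<in> N n" for x n
  proof -
    obtain c where "x = (\<Sum>i\<in>insert b J. of_int (c i) * v i)"
      using sub[of n] x by (auto simp: int_span_def)
    then have "x = of_int (c b) * v b + (\<Sum>i\<in>J. of_int (c i) * v i)"
      using insert.hyps by simp
    then show ?thesis by (auto simp: S_def int_span_def)
  qed
  \<comment> \<open>The family \<open>v\<close> may be dependent, so the coefficient of
    \<open>v b\<close> is not determined; \<open>I n\<close> collects every coefficient that occurs
    in some representation.\<close>
  define I where "I = (\<lambda>n. {c. \<exists>s\<in>S. of_int c * v b + s \<in> N n})"
  have "add_sub (I n)" for n
    unfolding add_sub_def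
  proof (intro conjI ballI)
    show "0 \<in> I n" using add_sub_zero[OF S] add_sub_zero[OF N] by (auto simp: I_def)
    fix c d assume "c \<in> I n" "d \<in> I n"
    then obtain s t where st: "s \<in> S" "t \<in> S" "of_int c * v b + s \<in> N n" "of_int d * v b + t \<in> N n"
      by (auto simp: I_def)
    then have "of_int (c - d) * v b + (s - t) \<in> N n"
      using add_sub_diff[OF N st(3,4)] by (simp add: algebra_simps)
    then show "c - d \<in> I n" using add_sub_diff[OF S st(1,2)] by (auto simp: I_def)
  qed
  moreover have "I n \<subseteq> I (Suc n)" for n using mono[of n] by (auto simp: I_def)
  ultimately obtain m where m: "\<And>n. I n \<subseteq> I m" using int_add_sub_stationary[of I] by blast
  have "add_sub (N n \<inter> S)" for n using N[of n] S by (auto simp: add_sub_def)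
  then have "\<exists>m. \<forall>n. N n \<inter> S \<subseteq> N m \<inter> S"
    by (intro insert.IH) (use mono in \<open>auto simp: S_def\<close>)
  then obtain m' where m': "\<And>n. N n \<inter> S \<subseteq> N m' \<inter> S" by blast
  \<comment> \<open>An element of \<open>N n\<close> shares its coefficient of \<open>v b\<close>
    with an element of \<open>N m\<close>; their difference lies in \<open>S\<close> and is caught
    at stage \<open>m'\<close>.\<close>
  have "N n \<subseteq> N (max m m')" for n
  proof
    fix x assume x: "x \<in> N n"
    then obtain c s where c: "s \<in> S" "x = of_int c * v b + s" using split by blast
    then have "c \<in> I m" using x m[of n] by (auto simp: I_def)
    then obtain t where t: "t \<in> S" "of_int c * v b + t \<in> N m" by (auto simp: I_def)
    have "x \<in> N (max n m)" "of_int c * v b + t \<in> N (max n m)"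
      using x t mono'[of n "max n m"] mono'[of m "max n m"] by auto
    then have "x - (of_int c * v b + t) \<in> N (max n m)" by (rule add_sub_diff[OF N])
    then have "s - t \<in> N (max n m) \<inter> S" using add_sub_diff[OF S c(1) t(1)] c by simp
    then have "s - t \<in> N (max m m')" using m' mono'[of m' "max m m'"] by auto
    moreover have "of_int c * v b + t \<in> N (max m m')" using t mono'[of m "max m m'"] by auto
    ultimately have "(s - t) + (of_int c * v b + t) \<in> N (max m m')" by (rule add_sub_add[OF N])
    then show "x \<in> N (max m m')" using c by (simp add: algebra_simps)
  qed
  then show ?case by blast
qed

text \<open>Instead of a characteristic polynomial this uses the chain condition: the groups
  generated by the powers of \<open>z\<close> below \<open>n\<close> all lie in the
  \<open>z\<close>-stable group \<open>?M\<close>, so the chain stops, and where it stops a power of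
  \<open>z\<close> is an integral combination of lower ones. The vector with value \<open>1\<close>
  is what places the powers of \<open>z\<close> in \<open>?M\<close>.\<close>

lemma algebraic_int_eigenI:
  fixes z :: "'a::field_char_0" and A :: "'b \<Rightarrow> 'b \<Rightarrow> int"
  assumes fin: "finite J" and one: "i0 \<in> J" "v i0 = 1"
    and ev: "\<And>i. i \<in> J \<Longrightarrow> z * v i = (\<Sum>j\<in>J. of_int (A i j) * v j)"
  shows "algebraic_int z"
proof -
  let ?M = "int_span v J"
  have vM: "v i \<in> ?M" if "i \<in> J" for i
  proof -
    have "(\<Sum>j\<in>J. of_int (if j = i then 1 else 0) * v j) = (\<Sum>j\<in>J. if j = i then v j else 0)"
      by (intro sum.cong) auto
    also have "\<dots> = v i" using fin that by simp
    finally show ?thesis unfolding int_span_def mem_Collect_eq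
      by (intro exI[of _ "\<lambda>j. if j = i then 1 else 0"]) simp
  qed
  have zv: "z * v i \<in> ?M" if "i \<in> J" for i
    using ev[OF that] by (auto simp: int_span_def)
  have zM: "z * x \<in> ?M" if x: "x \<in> ?M" for x
  proof -
    obtain c where "x = (\<Sum>i\<in>J. of_int (c i) * v i)" using x by (auto simp: int_span_def)
    then have "z * x = (\<Sum>i\<in>J. of_int (c i) * (z * v i))"
      by (simp add: sum_distrib_left mult.left_commute)
    then show ?thesis
      using zv by (auto intro!: add_sub_sum[OF int_span_add_sub] add_sub_of_int_mult[OF int_span_add_sub])
  qed
  have pow: "z ^ n \<in> ?M" for n
    by (induction n) (use vM[OF one(1)] one(2) zM in auto)
  define N where "N = (\<lambda>n. int_span (\<lambda>i. z ^ i) {..<n})"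
  have "N n \<subseteq> N (Suc n)" for n
  proof
    fix x assume "x \<in> N n"
    then obtain c where c: "x = (\<Sum>i<n. of_int (c i) * z ^ i)" by (auto simp: N_def int_span_def)
    have "x = (\<Sum>i<Suc n. of_int ((c(n := 0)) i) * z ^ i)" by (simp add: c)
    then show "x \<in> N (Suc n)" unfolding N_def int_span_def by blast
  qed
  moreover have "N n \<subseteq> ?M" for n
    using pow by (auto simp: N_def int_span_def[of "\<lambda>i. z ^ i"]
        intro!: add_sub_sum[OF int_span_add_sub] add_sub_of_int_mult[OF int_span_add_sub])
  ultimately obtain m where m: "\<And>n. N n \<subseteq> N m"
    using int_span_stationary[OF fin, of N v] by (auto simp: N_def int_span_add_sub)
  have "z ^ m \<in> N (Suc m)"
  proof -
    have "z ^ m = (\<Sum>i<Suc m. of_int (if i = m then 1 else 0) * z ^ i)" by simp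
    then show ?thesis unfolding N_def int_span_def
      by (intro CollectI exI[of _ "\<lambda>i. if i = m then 1 else 0"]) simp
  qed
  then have "z ^ m \<in> N m" using m by blast
  then obtain c where "z ^ m = (\<Sum>i<m. of_int (c i) * z ^ i)" by (auto simp: N_def int_span_def)
  then show ?thesis by (rule algebraic_int_powerI)
qed

lemma algebraic_int_companion:
  fixes x :: "'a::field_char_0"
  assumes "algebraic_int x"
  obtains n and A :: "nat \<Rightarrow> nat \<Rightarrow> int"
  where "n > 0" "\<And>i. i < n \<Longrightarrow> x * x ^ i = (\<Sum>j<n. of_int (A i j) * x ^ j)"
proof -
  obtain n and c :: "nat \<Rightarrow> int" where n: "n > 0" "x ^ n = (\<Sum>i<n. of_int (c i) * x ^ i)"
    using algebraic_int_powerE[OF assms] .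
  define A where "A = (\<lambda>i j. if Suc i = n then c j else if j = Suc i then 1 else 0)"
  have "x * x ^ i = (\<Sum>j<n. of_int (A i j) * x ^ j)" if "i < n" for i
  proof (cases "Suc i = n")
    case True
    then have "x * x ^ i = x ^ n" by auto
    with True n(2) show ?thesis by (simp add: A_def)
  next
    case False
    then have "Suc i < n" using that by simp
    have "(\<Sum>j<n. of_int (A i j) * x ^ j) = (\<Sum>j<n. if j = Suc i then x ^ j else 0)"
      using False by (intro sum.cong) (auto simp: A_def)
    with \<open>Suc i < n\<close> show ?thesis by simp
  qed
  with n(1) that show ?thesis by blast
qed

text \<open>The products \<open>x ^ i * y ^ j\<close> span a group stable under \<open>x\<close> and
  \<open>y\<close>. On it, \<open>x + y\<close> acts by the matrix
  \<open>A \<otimes> 1 + 1 \<otimes> B\<close> and \<open>x * y\<close> by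
  \<open>A \<otimes> B\<close>, with \<open>A\<close> and \<open>B\<close> the companion
  matrices.\<close>

lemma
  fixes x y :: "'a::field_char_0"
  assumes "algebraic_int x" "algebraic_int y"
  shows algebraic_int_add: "algebraic_int (x + y)"
    and algebraic_int_mult: "algebraic_int (x * y)"
proof -
  obtain m and A :: "nat \<Rightarrow> nat \<Rightarrow> int"
    where m: "m > 0" and A: "\<And>i. i < m \<Longrightarrow> x * x ^ i = (\<Sum>j<m. of_int (A i j) * x ^ j)"
    using algebraic_int_companion[OF assms(1)] by blast
  obtain n and B :: "nat \<Rightarrow> nat \<Rightarrow> int"
    where n: "n > 0" and B: "\<And>i. i < n \<Longrightarrow> y * y ^ i = (\<Sum>j<n. of_int (B i j) * y ^ j)"
    using algebraic_int_companion[OF assms(2)] by blast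
  define J where "J = {..<m} \<times> {..<n}"
  define v where "v = (\<lambda>(i, j). x ^ i * y ^ j)"
  have J: "finite J" by (simp add: J_def)
  have one: "(0, 0) \<in> J" "v (0, 0) = 1"
    using m n by (auto simp: J_def v_def)
  have delta: "(\<Sum>j<n. of_int (if j = l then 1 else 0) * f j) = f l" if "l < n" for l n and f :: "nat \<Rightarrow> 'a"
    using that by (simp add: if_distrib[of of_int] if_distrib[of "\<lambda>t. t * _"] cong: if_cong)
  have prod: "(\<Sum>a<m. of_int (C a) * x ^ a) * (\<Sum>b<n. of_int (D b) * y ^ b) =
      (\<Sum>p\<in>J. of_int (C (fst p) * D (snd p)) * v p)" for C D :: "nat \<Rightarrow> int"
    unfolding J_def sum_product sum.cartesian_product
    by (intro sum.cong) (auto simp: v_def algebra_simps)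
  show "algebraic_int (x + y)"
  proof (rule algebraic_int_eigenI[where v = v, OF J one])
    fix p assume "p \<in> J"
    obtain a b where p: "p = (a, b)" "a < m" "b < n" using \<open>p \<in> J\<close> by (auto simp: J_def)
    have "(x + y) * v p = (x * x ^ a) * y ^ b + x ^ a * (y * y ^ b)"
      by (simp add: p v_def algebra_simps)
    also have "(x * x ^ a) * y ^ b =
        (\<Sum>i<m. of_int (A a i) * x ^ i) * (\<Sum>j<n. of_int (if j = b then 1 else 0) * y ^ j)"
      using A[OF p(2)] delta[OF p(3)] by simp
    also have "x ^ a * (y * y ^ b) =
        (\<Sum>i<m. of_int (if i = a then 1 else 0) * x ^ i) * (\<Sum>j<n. of_int (B b j) * y ^ j)"
      using B[OF p(3)] delta[OF p(2)] by simp
    finally show "(x + y) * v p = (\<Sum>q\<in>J. of_int (A (fst p) (fst q) * (if snd q = snd p then 1 else 0)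
        + (if fst q = fst p then 1 else 0) * B (snd p) (snd q)) * v q)"
      unfolding prod by (simp add: p sum.distrib[symmetric] algebra_simps)
  qed
  show "algebraic_int (x * y)"
  proof (rule algebraic_int_eigenI[where v = v, OF J one])
    fix p assume "p \<in> J"
    obtain a b where p: "p = (a, b)" "a < m" "b < n" using \<open>p \<in> J\<close> by (auto simp: J_def)
    have "(x * y) * v p = (x * x ^ a) * (y * y ^ b)"
      by (simp add: p v_def algebra_simps)
    then show "(x * y) * v p = (\<Sum>q\<in>J. of_int (A (fst p) (fst q) * B (snd p) (snd q)) * v q)"
      unfolding A[OF p(2)] B[OF p(3)] prod by (simp add: p)
  qed
qed

text \<open>Substituting into the equation of \<open>z ^ j - z ^ i\<close> keeps it monic.\<close>

lemma algebraic_int_power_diff: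
  fixes z :: "'a::field_char_0"
  assumes "algebraic_int (z ^ j - z ^ i)" "i < j"
  shows "algebraic_int z"
proof -
  define q :: "'a poly" where "q = monom 1 j - monom 1 i"
  have cq: "Polynomial.coeff q l = (if l = j then 1 else if l = i then -1 else 0)" for l
    using assms(2) by (auto simp: q_def)
  have dq: "Polynomial.degree q = j"
    by (rule antisym) (use assms(2) in \<open>auto intro!: degree_le le_degree simp: cq\<close>)
  show ?thesis
    by (rule algebraic_int_root[OF assms(1), of q])
       (use assms(2) in \<open>auto simp: q_def[symmetric] dq cq, auto simp: q_def poly_monom\<close>)
qed

section \<open>Linear algebra over a subfield\<close>

text \<open>Subfields in terms of the type class operations, so that ordinary arithmetic and its
  simplification rules apply. Since \<open>inverse 0 = 0\<close>, closure under
  \<open>inverse\<close> can be stated without a side condition.\<close>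

locale subfld =
  fixes F :: "'a::field_char_0 set"
  assumes one_mem: "1 \<in> F"
    and diff_mem: "x \<in> F \<Longrightarrow> y \<in> F \<Longrightarrow> x - y \<in> F"
    and mult_mem: "x \<in> F \<Longrightarrow> y \<in> F \<Longrightarrow> x * y \<in> F"
    and inverse_mem: "x \<in> F \<Longrightarrow> inverse x \<in> F"
begin

lemma zero_mem: "0 \<in> F"
  using diff_mem[OF one_mem one_mem] by simp

lemma add_sub: "add_sub F"
  by (simp add: add_sub_def zero_mem diff_mem)

lemmas add_mem = add_sub_add[OF add_sub]
lemmas uminus_mem = add_sub_uminus[OF add_sub]
lemmas sum_mem = add_sub_sum[OF add_sub]

lemma divide_mem: "x \<in> F \<Longrightarrow> y \<in> F \<Longrightarrow> x / y \<in> F"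
  by (simp add: divide_inverse mult_mem inverse_mem)

lemma power_mem: "x \<in> F \<Longrightarrow> x ^ n \<in> F"
  by (induction n) (auto simp: one_mem mult_mem)

lemma prod_mem: "(\<And>i. i \<in> I \<Longrightarrow> f i \<in> F) \<Longrightarrow> prod f I \<in> F"
  by (induction I rule: infinite_finite_induct) (auto simp: one_mem mult_mem)

lemma of_int_mem: "of_int n \<in> F"
  using add_sub_of_int_mult[OF add_sub one_mem, of n] by simp

lemma of_nat_mem: "of_nat n \<in> F"
  using of_int_mem[of "int n"] by simp

lemma Rats_subset: "\<rat> \<subseteq> F"
  by (auto elim!: Rats_cases' simp: divide_mem of_int_mem)

text \<open>Gaussian elimination: an equation \<open>r\<close> with a nonzero coefficient at
  \<open>l\<close> eliminates the unknown \<open>l\<close>, which lowers the number of equations and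
  of unknowns by one each.\<close>

lemma homogeneous_system:
  assumes "finite I" "finite J" "card I < card J"
    and "\<And>i j. i \<in> I \<Longrightarrow> j \<in> J \<Longrightarrow> a i j \<in> F"
  shows "\<exists>c. (\<forall>j\<in>J. c j \<in> F) \<and> (\<exists>j\<in>J. c j \<noteq> 0) \<and> (\<forall>i\<in>I. (\<Sum>j\<in>J. a i j * c j) = 0)"
  using assms
proof (induction I arbitrary: J a rule: finite_induct)
  case empty
  then have "J \<noteq> {}" by auto
  then show ?case using one_mem by (intro exI[of _ "\<lambda>_. 1"]) auto
next
  case (insert r I)
  show ?case
  proof (cases "\<forall>j\<in>J. a r j = 0")
    case True
    have "\<exists>c. (\<forall>j\<in>J. c j \<in> F) \<and> (\<exists>j\<in>J. c j \<noteq> 0) \<and> (\<forall>i\<in>I. (\<Sum>j\<in>J. a i j * c j) = 0)"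
      using insert.prems insert.hyps by (intro insert.IH) auto
    then show ?thesis using True by auto
  next
    case False
    then obtain l where l: "l \<in> J" "a r l \<noteq> 0" by blast
    define J' where "J' = J - {l}"
    define b where "b = (\<lambda>i j. a i j - a i l * a r j / a r l)"
    have J': "finite J'" "l \<notin> J'" "J = insert l J'" using insert.prems(1) l by (auto simp: J'_def)
    have "\<exists>c. (\<forall>j\<in>J'. c j \<in> F) \<and> (\<exists>j\<in>J'. c j \<noteq> 0) \<and> (\<forall>i\<in>I. (\<Sum>j\<in>J'. b i j * c j) = 0)"
      using insert.prems insert.hyps J'
      by (intro insert.IH) (auto simp: b_def intro!: diff_mem mult_mem divide_mem)
    then obtain c where c: "\<And>j. j \<in> J' \<Longrightarrow> c j \<in> F" "\<exists>j\<in>J'. c j \<noteq> 0"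
      "\<And>i. i \<in> I \<Longrightarrow> (\<Sum>j\<in>J'. b i j * c j) = 0" by blast
    \<comment> \<open>The value of the eliminated unknown, read off from equation
      \<open>r\<close>.\<close>
    define t where "t = - (\<Sum>j\<in>J'. a r j * c j) / a r l"
    define d where "d = c(l := t)"
    have t: "t \<in> F" using c(1) insert.prems(3) l J'
      unfolding t_def by (intro divide_mem uminus_mem sum_mem mult_mem) auto
    have sum_d: "(\<Sum>j\<in>J. a i j * d j) = a i l * t + (\<Sum>j\<in>J'. a i j * c j)" for i
      using J' by (auto simp: d_def intro!: sum.cong)
    have "(\<Sum>j\<in>J. a i j * d j) = 0" if "i \<in> insert r I" for i
    proof (cases "i = r")
      case True
      then show ?thesis unfolding sum_d using l by (simp add: t_def)
    next
      case False
      then have "0 = (\<Sum>j\<in>J'. b i j * c j)" using c(3) that by simp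
      also have "\<dots> = (\<Sum>j\<in>J'. a i j * c j) - a i l / a r l * (\<Sum>j\<in>J'. a r j * c j)"
        by (simp add: b_def left_diff_distrib sum_subtractf sum_distrib_left mult.assoc)
      finally show ?thesis unfolding sum_d by (simp add: t_def)
    qed
    moreover have "\<forall>j\<in>J. d j \<in> F" using c(1) t J' by (auto simp: d_def)
    moreover have "\<exists>j\<in>J. d j \<noteq> 0" using c(2) J' by (auto simp: d_def)
    ultimately show ?thesis by blast
  qed
qed

end

lemma subfield_imp_subfld:
  assumes "subfield F (ring_of_type_algebra :: 'a::field_char_0 ring)"
  shows "subfld F"
proof -
  let ?R = "ring_of_type_algebra :: 'a ring"
  interpret R: Ring.field ?R by (rule field_from_type_algebra)
  have R: "x \<otimes>\<^bsub>?R\<^esub> y = x * y" "x \<oplus>\<^bsub>?R\<^esub> y = x + y" "\<zero>\<^bsub>?R\<^esub> = 0" "\<one>\<^bsub>?R\<^esub> = 1" "carrier ?R = UNIV" for x y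
    by (auto simp: ring_of_type_algebra_def)
  have minus: "\<ominus>\<^bsub>?R\<^esub> x = - x" for x
    using R.minus_equality[of "-x" x] by (simp add: R)
  have inv: "inv\<^bsub>?R\<^esub> x = inverse x" if "x \<noteq> 0" for x
    using that by (intro R.comm_inv_char) (auto simp: R)
  note sr = subringE[OF subfieldE(1)[OF assms]]
  show ?thesis
  proof
    show "1 \<in> F" using sr(3) by (simp add: R)
    fix x y assume xy: "x \<in> F" "y \<in> F"
    show "x - y \<in> F" using sr(7)[OF xy(1) sr(5)[OF xy(2)]] by (simp add: R minus)
    show "x * y \<in> F" using sr(6)[OF xy] by (simp add: R)
    show "inverse x \<in> F"
    proof (cases "x = 0")
      case False
      then show ?thesis using R.subfield_m_inv(1)[OF assms, of x] xy by (simp add: R inv)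
    qed (use xy in simp)
  qed
qed

text \<open>\<open>basis\<close> is only a rational spanning family, so \<open>d\<close> is an upper
  bound for the degree over the rationals; the counting arguments ask for such a bound.\<close>

locale nfield = subfld F for F :: "'a::field_char_0 set" +
  fixes d :: nat and basis :: "nat \<Rightarrow> 'a"
  assumes basis_mem: "i < d \<Longrightarrow> basis i \<in> F"
    and basis_span: "x \<in> F \<Longrightarrow> \<exists>c. (\<forall>i<d. c i \<in> \<rat>) \<and> x = (\<Sum>i<d. c i * basis i)"

lemma number_field_imp_nfield:
  fixes F :: "'a::field_char_0 set"
  assumes "number_field F"
  shows "\<exists>d basis. nfield F d basis"
proof -
  let ?R = "ring_of_type_algebra :: 'a ring"
  interpret R: Ring.field ?R by (rule field_from_type_algebra)
  have R: "x \<otimes>\<^bsub>?R\<^esub> y = x * y" "x \<oplus>\<^bsub>?R\<^esub> y = x + y" "\<zero>\<^bsub>?R\<^esub> = 0" "carrier ?R = UNIV" for x y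
    by (auto simp: ring_of_type_algebra_def)
  have sf: "subfield F ?R" using assms by (simp add: number_field_def)
  interpret subfld F by (rule subfield_imp_subfld[OF sf])
  obtain n where "R.dimension n \<rat> F" using assms by (auto simp: number_field_def)
  then have "\<exists>b. (\<forall>i<n. b i \<in> F) \<and> F = {\<Sum>i<n. c i * b i | c. \<forall>i<n. c i \<in> \<rat>}"
  proof (induction n "\<rat> :: 'a set" F rule: R.dimension.induct)
    case zero_dim
    then show ?case by (auto simp: R)
  next
    case (Suc_dim v E n)
    then obtain b where b: "\<And>i. i < n \<Longrightarrow> b i \<in> E" "E = {\<Sum>i<n. c i * b i | c. \<forall>i<n. c i \<in> \<rat>}"
      by blast
    define b' where "b' = b(n := v)"
    have ext: "R.line_extension \<rat> v E = {k * v + e | k e. k \<in> \<rat> \<and> e \<in> E}"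
      by (auto simp: R.line_extension_mem_iff R) blast+
    have sum_b': "(\<Sum>i<Suc n. c i * b' i) = c n * v + (\<Sum>i<n. c i * b i)" for c
      by (simp add: b'_def add.commute)
    have zero: "0 \<in> E" by (subst b(2)) (auto intro!: exI[of _ "\<lambda>_. 0"])
    have "b' i \<in> R.line_extension \<rat> v E" if "i < Suc n" for i
    proof (cases "i = n")
      case True
      then show ?thesis using zero unfolding ext b'_def by (intro CollectI exI[of _ 1] exI[of _ "0::'a"]) auto
    next
      case False
      then have "b i \<in> E" using that b(1) by simp
      then show ?thesis using False unfolding ext b'_def
        by (intro CollectI exI[of _ 0] exI[of _ "b i"]) auto
    qed
    moreover have "R.line_extension \<rat> v E = {\<Sum>i<Suc n. c i * b' i | c. \<forall>i<Suc n. c i \<in> \<rat>}"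
    proof (intro equalityI subsetI)
      fix x assume "x \<in> R.line_extension \<rat> v E"
      then obtain k e where ke: "k \<in> \<rat>" "e \<in> E" "x = k * v + e" by (auto simp: ext)
      from ke(2) obtain c where c: "\<forall>i<n. c i \<in> \<rat>" "e = (\<Sum>i<n. c i * b i)" by (auto simp: b(2))
      have "x = (\<Sum>i<Suc n. (c(n := k)) i * b' i)" unfolding sum_b' by (simp add: ke c)
      moreover have "\<forall>i<Suc n. (c(n := k)) i \<in> \<rat>" using c ke by auto
      ultimately show "x \<in> {\<Sum>i<Suc n. c i * b' i | c. \<forall>i<Suc n. c i \<in> \<rat>}" by blast
    next
      fix x assume "x \<in> {\<Sum>i<Suc n. c i * b' i | c. \<forall>i<Suc n. c i \<in> \<rat>}"
      then obtain c where c: "\<forall>i<Suc n. c i \<in> \<rat>" "x = (\<Sum>i<Suc n. c i * b' i)" by blast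
      then have "(\<Sum>i<n. c i * b i) \<in> E" by (auto simp: b(2))
      with c show "x \<in> R.line_extension \<rat> v E" unfolding ext sum_b' by auto
    qed
    ultimately show ?case by blast
  qed
  then obtain b where "\<forall>i<n. b i \<in> F" "F = {\<Sum>i<n. c i * b i | c. \<forall>i<n. c i \<in> \<rat>}" by blast
  then have "nfield F n b" by unfold_locales auto
  then show ?thesis by blast
qed

section \<open>Index of additive subgroups\<close>

text \<open>A bare set of cosets, wanted for finiteness and cardinality. An infinite quotient has
  \<open>card\<close> equal to 0, and the index formulas below remain true with this
  convention.\<close>

definition add_quot :: "'a::ab_group_add set \<Rightarrow> 'a set \<Rightarrow> 'a set set" where
  "add_quot A B = (\<lambda>x. (+) x ` B) ` A"

lemma coset_eq_iff:
  assumes "add_sub B"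
  shows "(+) x ` B = (+) y ` B \<longleftrightarrow> x - y \<in> B"
proof
  assume "(+) x ` B = (+) y ` B"
  then have "x \<in> (+) y ` B" using add_sub_zero[OF assms] by force
  then show "x - y \<in> B" by auto
next
  assume *: "x - y \<in> B"
  have sub: "(+) a ` B \<subseteq> (+) b ` B" if "a - b \<in> B" for a b
  proof
    fix z assume "z \<in> (+) a ` B"
    then obtain c where "c \<in> B" "z = a + c" by blast
    then have "z = b + ((a - b) + c)" "(a - b) + c \<in> B" using add_sub_add[OF assms that] by auto
    then show "z \<in> (+) b ` B" by blast
  qed
  have "y - x \<in> B" using add_sub_uminus[OF assms *] by simp
  with sub * show "(+) x ` B = (+) y ` B" by blast
qed

text \<open>Representatives turn statements about quotients into bijections between sets of
  elements, the form in which \<open>bij_betw_add_quotI\<close> consumes them.\<close>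

lemma add_quot_transversal:
  assumes "add_sub B"
  obtains T where "T \<subseteq> A" "bij_betw (\<lambda>x. (+) x ` B) T (add_quot A B)"
    "\<And>x. x \<in> A \<Longrightarrow> \<exists>t\<in>T. x - t \<in> B" "\<And>t u. t \<in> T \<Longrightarrow> u \<in> T \<Longrightarrow> t - u \<in> B \<Longrightarrow> t = u"
proof -
  obtain T where T: "T \<subseteq> A" "inj_on (\<lambda>x. (+) x ` B) T" "add_quot A B = (\<lambda>x. (+) x ` B) ` T"
    using subset_image_inj[of "add_quot A B" "\<lambda>x. (+) x ` B" A] by (force simp: add_quot_def)
  show ?thesis
  proof (rule that[OF T(1)])
    show "bij_betw (\<lambda>x. (+) x ` B) T (add_quot A B)" using T by (simp add: bij_betw_def)
    fix x assume "x \<in> A"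
    then have "(+) x ` B \<in> (\<lambda>x. (+) x ` B) ` T" using T(3) by (auto simp: add_quot_def)
    then show "\<exists>t\<in>T. x - t \<in> B" using coset_eq_iff[OF assms] by blast
  next
    fix t u assume "t \<in> T" "u \<in> T" "t - u \<in> B"
    then show "t = u" using inj_onD[OF T(2), of t u] coset_eq_iff[OF assms, of t u] by blast
  qed
qed

lemma bij_betw_add_quotI:
  assumes "add_sub B" and "\<And>t. t \<in> S \<Longrightarrow> f t \<in> A"
    and "\<And>t u. t \<in> S \<Longrightarrow> u \<in> S \<Longrightarrow> f t - f u \<in> B \<Longrightarrow> t = u"
    and "\<And>x. x \<in> A \<Longrightarrow> \<exists>t\<in>S. x - f t \<in> B"
  shows "bij_betw (\<lambda>t. (+) (f t) ` B) S (add_quot A B)"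
  unfolding bij_betw_def
proof (intro conjI inj_onI equalityI subsetI)
  fix t u assume "t \<in> S" "u \<in> S" "(+) (f t) ` B = (+) (f u) ` B"
  then show "t = u" using assms(3) coset_eq_iff[OF assms(1)] by blast
next
  fix Z assume "Z \<in> (\<lambda>t. (+) (f t) ` B) ` S"
  then show "Z \<in> add_quot A B" using assms(2) by (auto simp: add_quot_def)
next
  fix Z assume "Z \<in> add_quot A B"
  then obtain x where x: "x \<in> A" "Z = (+) x ` B" by (auto simp: add_quot_def)
  then obtain t where "t \<in> S" "x - f t \<in> B" using assms(4) by blast
  then show "Z \<in> (\<lambda>t. (+) (f t) ` B) ` S" using x coset_eq_iff[OF assms(1)] by blast
qed

lemma add_quot_tower:
  assumes A: "add_sub A" and B: "add_sub B" and C: "add_sub C" and sub: "C \<subseteq> B" "B \<subseteq> A"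
  shows "card (add_quot A C) = card (add_quot A B) * card (add_quot B C)"
    and "finite (add_quot A B) \<Longrightarrow> finite (add_quot B C) \<Longrightarrow> finite (add_quot A C)"
proof -
  obtain T where T: "T \<subseteq> A" "bij_betw (\<lambda>x. (+) x ` B) T (add_quot A B)"
    "\<And>x. x \<in> A \<Longrightarrow> \<exists>t\<in>T. x - t \<in> B" "\<And>t u. t \<in> T \<Longrightarrow> u \<in> T \<Longrightarrow> t - u \<in> B \<Longrightarrow> t = u"
    using add_quot_transversal[OF B, of A] by metis
  obtain U where U: "U \<subseteq> B" "bij_betw (\<lambda>x. (+) x ` C) U (add_quot B C)"
    "\<And>x. x \<in> B \<Longrightarrow> \<exists>t\<in>U. x - t \<in> C" "\<And>t u. t \<in> U \<Longrightarrow> u \<in> U \<Longrightarrow> t - u \<in> C \<Longrightarrow> t = u"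
    using add_quot_transversal[OF C, of B] by metis
  have bij: "bij_betw (\<lambda>p. (+) (fst p + snd p) ` C) (T \<times> U) (add_quot A C)"
  proof (rule bij_betw_add_quotI[OF C])
    fix p assume "p \<in> T \<times> U"
    then show "fst p + snd p \<in> A" using T(1) U(1) sub by (auto intro!: add_sub_add[OF A])
  next
    fix p q assume p: "p \<in> T \<times> U" and q: "q \<in> T \<times> U"
      and eq: "(fst p + snd p) - (fst q + snd q) \<in> C"
    have "fst p + snd p - (fst q + snd q) \<in> B" using eq sub by blast
    moreover have "snd q - snd p \<in> B" using p q U(1) by (auto intro!: add_sub_diff[OF B])
    ultimately have "(fst p + snd p - (fst q + snd q)) + (snd q - snd p) \<in> B"
      by (rule add_sub_add[OF B])
    then have 1: "fst p = fst q" using p q by (intro T(4)) (auto simp: algebra_simps)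
    then have "snd p - snd q \<in> C" using eq by simp
    then have "snd p = snd q" using p q by (intro U(4)) auto
    with 1 show "p = q" by (simp add: prod_eq_iff)
  next
    fix x assume "x \<in> A"
    then obtain t where t: "t \<in> T" "x - t \<in> B" using T(3) by blast
    then obtain u where "u \<in> U" "(x - t) - u \<in> C" using U(3) by blast
    then show "\<exists>p\<in>T \<times> U. x - (fst p + snd p) \<in> C"
      using t by (intro bexI[of _ "(t, u)"]) (auto simp: algebra_simps)
  qed
  show "card (add_quot A C) = card (add_quot A B) * card (add_quot B C)"
    using bij_betw_same_card[OF bij] bij_betw_same_card[OF T(2)] bij_betw_same_card[OF U(2)]
    by (simp add: card_cartesian_product)
  show "finite (add_quot A C)" if "finite (add_quot A B)" "finite (add_quot B C)"
    using that bij_betw_finite[OF bij] bij_betw_finite[OF T(2)] bij_betw_finite[OF U(2)] by auto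
qed

text \<open>\<open>f\<close> induces a bijection of \<open>A/B\<close> with \<open>C/D\<close>.
  Phrasing this through differences lets one lemma serve multiplication by an element, Galois
  automorphisms and the inclusion of \<open>Ok\<close> in \<open>OK\<close>.\<close>

lemma add_quot_bij:
  assumes B: "add_sub B" and D: "add_sub D"
    and f: "\<And>x. x \<in> A \<Longrightarrow> f x \<in> C"
    and diff: "\<And>x y. x \<in> A \<Longrightarrow> y \<in> A \<Longrightarrow> f x - f y \<in> D \<longleftrightarrow> x - y \<in> B"
    and surj: "\<And>z. z \<in> C \<Longrightarrow> \<exists>x\<in>A. z - f x \<in> D"
  shows "card (add_quot A B) = card (add_quot C D)"
    and "finite (add_quot A B) \<Longrightarrow> finite (add_quot C D)"
proof -
  obtain T where T: "T \<subseteq> A" "bij_betw (\<lambda>x. (+) x ` B) T (add_quot A B)"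
    "\<And>x. x \<in> A \<Longrightarrow> \<exists>t\<in>T. x - t \<in> B" "\<And>t u. t \<in> T \<Longrightarrow> u \<in> T \<Longrightarrow> t - u \<in> B \<Longrightarrow> t = u"
    using add_quot_transversal[OF B, of A] by metis
  have bij: "bij_betw (\<lambda>t. (+) (f t) ` D) T (add_quot C D)"
  proof (rule bij_betw_add_quotI[OF D])
    fix z assume "z \<in> C"
    then obtain x where x: "x \<in> A" "z - f x \<in> D" using surj by blast
    then obtain t where t: "t \<in> T" "x - t \<in> B" using T(3) by blast
    then have "f x - f t \<in> D" using diff x T(1) by blast
    then have "(z - f x) + (f x - f t) \<in> D" by (intro add_sub_add[OF D] x)
    then show "\<exists>t\<in>T. z - f t \<in> D" using t by auto
  qed (use f diff T in blast)+
  show "card (add_quot A B) = card (add_quot C D)"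
    using bij_betw_same_card[OF bij] bij_betw_same_card[OF T(2)] by simp
  show "finite (add_quot C D)" if "finite (add_quot A B)"
    using that bij_betw_finite[OF bij] bij_betw_finite[OF T(2)] by simp
qed

lemma add_quot_self: "add_sub A \<Longrightarrow> add_quot A A = {A}"
proof -
  assume A: "add_sub A"
  have "(+) x ` A = (+) 0 ` A" if "x \<in> A" for x using coset_eq_iff[OF A, of x 0] that by simp
  then show ?thesis using add_sub_zero[OF A] by (auto simp: add_quot_def)
qed

lemma add_quot_card_one:
  assumes A: "add_sub A" and B: "add_sub B" and sub: "B \<subseteq> A" and card: "card (add_quot A B) = 1"
  shows "A = B"
proof -
  obtain Z where Z: "add_quot A B = {Z}" using card by (auto simp: card_1_singleton_iff)
  have "x \<in> B" if "x \<in> A" for x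
  proof -
    have "(+) x ` B \<in> add_quot A B" "(+) 0 ` B \<in> add_quot A B"
      using that add_sub_zero[OF A] unfolding add_quot_def by blast+
    then have "(+) x ` B = (+) 0 ` B" unfolding Z by simp
    then show ?thesis using coset_eq_iff[OF B, of x 0] by simp
  qed
  with sub show ?thesis by blast
qed

text \<open>
  \<open>R\<close> is a ring with a maximal ideal \<open>p\<close>, and \<open>M / I\<close> is a vector space over the
  residue field \<open>R / p\<close>, whose dimension \<open>m\<close> is at most \<open>n\<close>.
\<close>

lemma residue_space_count:
  fixes R p M I :: "'a::comm_ring_1 set"
  assumes R: "add_sub R" "\<And>x y. x \<in> R \<Longrightarrow> y \<in> R \<Longrightarrow> x * y \<in> R"
    and p: "add_sub p" "p \<subseteq> R" "\<And>x y. x \<in> R \<Longrightarrow> y \<in> p \<Longrightarrow> x * y \<in> p"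
    and maximal: "\<And>c. c \<in> R \<Longrightarrow> c \<notin> p \<Longrightarrow> \<exists>c'\<in>R. c' * c - 1 \<in> p"
    and M: "add_sub M" "\<And>r x. r \<in> R \<Longrightarrow> x \<in> M \<Longrightarrow> r * x \<in> M"
    and I: "add_sub I" "I \<subseteq> M" "\<And>r x. r \<in> R \<Longrightarrow> x \<in> I \<Longrightarrow> r * x \<in> I"
    and pM: "\<And>r x. r \<in> p \<Longrightarrow> x \<in> M \<Longrightarrow> r * x \<in> I"
    and dep: "\<And>x. (\<And>i. i < Suc n \<Longrightarrow> x i \<in> M) \<Longrightarrow>
      \<exists>c. (\<forall>i<Suc n. c i \<in> R) \<and> (\<exists>i<Suc n. c i \<notin> p) \<and> (\<Sum>i<Suc n. c i * x i) \<in> I"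
  obtains m :: nat and x where "m \<le> n" "\<And>i. i < m \<Longrightarrow> x i \<in> M"
    "\<And>y. y \<in> M \<Longrightarrow> \<exists>c. (\<forall>i<m. c i \<in> R) \<and> y - (\<Sum>i<m. c i * x i) \<in> I"
    "card (add_quot M I) = card (add_quot R p) ^ m"
    "finite (add_quot R p) \<Longrightarrow> finite (add_quot M I)"
proof -
  \<comment> \<open>Linear independence in \<open>M / I\<close> over the residue field, expressed by
    representatives.\<close>
  define indep where "indep = (\<lambda>(m::nat) x. (\<forall>i<m. x i \<in> M) \<and>
    (\<forall>c. (\<forall>i<m. c i \<in> R) \<longrightarrow> (\<Sum>i<m. c i * x i) \<in> I \<longrightarrow> (\<forall>i<m. c i \<in> p)))"
  have bound: "m \<le> n" if mx: "indep m x" for m x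
  proof (rule ccontr)
    assume "\<not> m \<le> n"
    then have le: "Suc n \<le> m" by simp
    then have "\<And>i. i < Suc n \<Longrightarrow> x i \<in> M" using mx by (auto simp: indep_def)
    from dep[of x, OF this] obtain c where c: "\<forall>i<Suc n. c i \<in> R" "\<exists>i<Suc n. c i \<notin> p"
      "(\<Sum>i<Suc n. c i * x i) \<in> I" by blast
    define c' where "c' = (\<lambda>i. if i < Suc n then c i else 0)"
    have "(\<Sum>i<m. c' i * x i) = (\<Sum>i<Suc n. c i * x i)"
      using le by (intro sum.mono_neutral_cong_right) (auto simp: c'_def)
    moreover have "\<forall>i<m. c' i \<in> R" using c(1) add_sub_zero[OF R(1)] by (simp add: c'_def)
    ultimately have "\<forall>i<m. c' i \<in> p" using mx c(3) unfolding indep_def by metis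
    then show False using c(2) le unfolding c'_def by (metis less_le_trans)
  qed
  \<comment> \<open>The dimension, as the largest length of an independent family;
    \<open>dep\<close> bounds these lengths by \<open>n\<close>.\<close>
  define m where "m = (GREATEST m. \<exists>x. indep m x)"
  have "indep 0 (\<lambda>_. 0)" by (simp add: indep_def)
  then have ex: "\<exists>x. indep m x" unfolding m_def
    using GreatestI_nat[of "\<lambda>m. \<exists>x. indep m x" 0 n] bound by blast
  then obtain x where x: "indep m x" by blast
  have max: "\<not> indep (Suc m) y" for y
    using Greatest_le_nat[of "\<lambda>m. \<exists>x. indep m x" "Suc m" n] bound unfolding m_def[symmetric]
    by (metis Suc_n_not_le_n)
  have xM: "x i \<in> M" if "i < m" for i using x that by (auto simp: indep_def)
  have comb: "(\<Sum>i<m. c i * x i) \<in> M" if "\<And>i. i < m \<Longrightarrow> c i \<in> R" for c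
    using that xM by (intro add_sub_sum[OF M(1)] M(2)) auto
  have span: "\<exists>c. (\<forall>i<m. c i \<in> R) \<and> y - (\<Sum>i<m. c i * x i) \<in> I" if y: "y \<in> M" for y
  proof -
    define z where "z = x(m := y)"
    have zM: "\<forall>i<Suc m. z i \<in> M" using xM y by (auto simp: z_def less_Suc_eq)
    from max[of z] zM obtain c where c: "\<forall>i<Suc m. c i \<in> R" "(\<Sum>i<Suc m. c i * z i) \<in> I"
      "\<not> (\<forall>i<Suc m. c i \<in> p)" unfolding indep_def by blast
    have sum: "(\<Sum>i<Suc m. c i * z i) = (\<Sum>i<m. c i * x i) + c m * y"
      by (simp add: z_def)
    have "c m \<notin> p"
    proof
      assume cm: "c m \<in> p"
      have "(\<Sum>i<m. c i * x i) = (\<Sum>i<Suc m. c i * z i) - c m * y" unfolding sum by simp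
      also have "\<dots> \<in> I" by (intro add_sub_diff[OF I(1)] c(2) pM cm y)
      finally have "\<forall>i<m. c i \<in> p" using x c(1) unfolding indep_def by auto
      with cm c(3) show False by (auto simp: less_Suc_eq)
    qed
    \<comment> \<open>By maximality, \<open>c m\<close> is invertible modulo \<open>p\<close>;
      solving the relation for \<open>y\<close> expresses it through the family modulo
      \<open>I\<close>.\<close>
    then obtain c' where c': "c' \<in> R" "c' * c m - 1 \<in> p" using maximal c(1) by blast
    define e where "e = (\<lambda>i. - c' * c i)"
    have "y - (\<Sum>i<m. e i * x i) = c' * (\<Sum>i<Suc m. c i * z i) - (c' * c m - 1) * y"
      unfolding sum e_def by (simp add: algebra_simps sum_distrib_left sum_negf)
    also have "\<dots> \<in> I" by (intro add_sub_diff[OF I(1)] I(3) c' c pM y)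
    finally have "y - (\<Sum>i<m. e i * x i) \<in> I" .
    moreover have "\<forall>i<m. e i \<in> R" using R(2)[OF c'(1)] c(1) add_sub_uminus[OF R(1)]
      by (auto simp: e_def)
    ultimately show ?thesis by blast
  qed
  obtain T where T: "T \<subseteq> R" "bij_betw (\<lambda>x. (+) x ` p) T (add_quot R p)"
    "\<And>x. x \<in> R \<Longrightarrow> \<exists>t\<in>T. x - t \<in> p" "\<And>t u. t \<in> T \<Longrightarrow> u \<in> T \<Longrightarrow> t - u \<in> p \<Longrightarrow> t = u"
    using add_quot_transversal[OF p(1), of R] by metis
  \<comment> \<open>Coordinates range over a transversal \<open>T\<close> of \<open>R / p\<close>,
    so a class of \<open>M / I\<close> corresponds to exactly one function from
    \<open>{..<m}\<close> to \<open>T\<close>.\<close>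
  have bij: "bij_betw (\<lambda>c. (+) (\<Sum>i<m. c i * x i) ` I) ({..<m} \<rightarrow>\<^sub>E T) (add_quot M I)"
  proof (rule bij_betw_add_quotI[OF I(1)])
    fix c assume "c \<in> {..<m} \<rightarrow>\<^sub>E T"
    then show "(\<Sum>i<m. c i * x i) \<in> M" using T(1) by (intro comb) auto
  next
    fix c e assume ce: "c \<in> {..<m} \<rightarrow>\<^sub>E T" "e \<in> {..<m} \<rightarrow>\<^sub>E T"
      and "(\<Sum>i<m. c i * x i) - (\<Sum>i<m. e i * x i) \<in> I"
    then have "(\<Sum>i<m. (c i - e i) * x i) \<in> I"
      by (simp add: left_diff_distrib sum_subtractf)
    moreover have "\<forall>i<m. c i - e i \<in> R" using ce T(1) by (auto intro!: add_sub_diff[OF R(1)])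
    ultimately have "\<forall>i<m. c i - e i \<in> p"
      using x[unfolded indep_def, THEN conjunct2, THEN spec, of "\<lambda>i. c i - e i"] by blast
    then have "c i = e i" if "i < m" for i using ce that by (intro T(4)) auto
    then show "c = e" using ce by (intro PiE_ext[of c "{..<m}" "\<lambda>_. T" e]) auto
  next
    fix y assume "y \<in> M"
    then obtain c where c: "\<forall>i<m. c i \<in> R" "y - (\<Sum>i<m. c i * x i) \<in> I" using span by blast
    then have "\<forall>i<m. \<exists>t\<in>T. c i - t \<in> p" using T(3) by blast
    then obtain t where t: "\<forall>i<m. t i \<in> T \<and> c i - t i \<in> p" by metis
    define u where "u = restrict t {..<m}"
    have "(\<Sum>i<m. (c i - u i) * x i) \<in> I"
      using t xM by (intro add_sub_sum[OF I(1)] pM) (auto simp: u_def)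
    then have "(y - (\<Sum>i<m. c i * x i)) + (\<Sum>i<m. (c i - u i) * x i) \<in> I"
      by (intro add_sub_add[OF I(1)] c(2))
    then have "y - (\<Sum>i<m. u i * x i) \<in> I" by (simp add: left_diff_distrib sum_subtractf)
    moreover have "u \<in> {..<m} \<rightarrow>\<^sub>E T" using t by (auto simp: u_def)
    ultimately show "\<exists>t\<in>{..<m} \<rightarrow>\<^sub>E T. y - (\<Sum>i<m. t i * x i) \<in> I" by blast
  qed
  show ?thesis
  proof (rule that[of m x])
    show "m \<le> n" using bound x .
    show "card (add_quot M I) = card (add_quot R p) ^ m"
      using bij_betw_same_card[OF bij] bij_betw_same_card[OF T(2)] by (simp add: card_PiE)
    show "finite (add_quot M I)" if "finite (add_quot R p)"
    proof -
      have "finite T" using that bij_betw_finite[OF T(2)] by simp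
      then have "finite ({..<m} \<rightarrow>\<^sub>E T)" by (intro finite_PiE) auto
      then show ?thesis using bij_betw_finite[OF bij] by simp
    qed
  qed (use xM span in auto)
qed

section \<open>Rings of integers\<close>

lemma ring_on_simps [simp]:
  "carrier (ring_on S) = S" "x \<otimes>\<^bsub>ring_on S\<^esub> y = x * y" "x \<oplus>\<^bsub>ring_on S\<^esub> y = x + y"
  "\<zero>\<^bsub>ring_on S\<^esub> = 0" "\<one>\<^bsub>ring_on S\<^esub> = 1"
  "x \<otimes>\<^bsub>ring_of_type_algebra\<^esub> y = x * y" "x \<oplus>\<^bsub>ring_of_type_algebra\<^esub> y = x + y"
  "\<zero>\<^bsub>ring_of_type_algebra\<^esub> = 0" "\<one>\<^bsub>ring_of_type_algebra\<^esub> = 1"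
  by (auto simp: ring_of_type_algebra_def)

lemma subfld_Rats: "subfld (\<rat> :: 'a::field_char_0 set)"
  by unfold_locales auto

lemma Rats_common_denominator:
  fixes c :: "'b \<Rightarrow> 'a::field_char_0"
  assumes "finite I" "\<And>i. i \<in> I \<Longrightarrow> c i \<in> \<rat>"
  shows "\<exists>N::nat. N > 0 \<and> (\<forall>i\<in>I. of_nat N * c i \<in> \<int>)"
  using assms
proof (induction I rule: finite_induct)
  case empty
  then show ?case by (intro exI[of _ 1]) auto
next
  case (insert j I)
  then obtain N where N: "N > 0" "\<forall>i\<in>I. of_nat N * c i \<in> \<int>" by auto
  from insert.prems have "c j \<in> \<rat>" by blast
  then obtain a b where ab: "b > 0" "c j = of_int a / of_int b" by (cases rule: Rats_cases') auto
  define M where "M = nat b * N"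
  have "of_nat M * c j = of_int (a * int N)" using ab by (simp add: M_def)
  then have "of_nat M * c j \<in> \<int>" by simp
  moreover have "of_nat M * c i \<in> \<int>" if "i \<in> I" for i
  proof -
    have "of_nat M * c i = of_nat (nat b) * (of_nat N * c i)" by (simp add: M_def)
    also have "\<dots> \<in> \<int>" by (rule Ints_mult[OF Ints_of_nat]) (use N(2) that in blast)
    finally show ?thesis .
  qed
  ultimately show ?case using N(1) ab(1) by (intro exI[of _ M]) (auto simp: M_def)
qed

context nfield
begin

lemma rat_dependent:
  assumes x: "\<And>i. i < Suc d \<Longrightarrow> x i \<in> F"
  obtains c :: "nat \<Rightarrow> int" where "\<exists>i<Suc d. c i \<noteq> 0" "(\<Sum>i<Suc d. of_int (c i) * x i) = 0"
proof -
  interpret Q: subfld "\<rat> :: 'a set" by (rule subfld_Rats)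
  have "\<forall>i. \<exists>a. i < Suc d \<longrightarrow> (\<forall>j<d. a j \<in> \<rat>) \<and> x i = (\<Sum>j<d. a j * basis j)"
    using x basis_span by blast
  then obtain a where a: "\<And>i j. i < Suc d \<Longrightarrow> j < d \<Longrightarrow> a i j \<in> \<rat>"
    "\<And>i. i < Suc d \<Longrightarrow> x i = (\<Sum>j<d. a i j * basis j)" by metis
  have "\<exists>c. (\<forall>j\<in>{..<Suc d}. c j \<in> \<rat>) \<and> (\<exists>j\<in>{..<Suc d}. c j \<noteq> 0) \<and>
      (\<forall>i\<in>{..<d}. (\<Sum>j\<in>{..<Suc d}. a j i * c j) = 0)"
    by (rule Q.homogeneous_system) (use a in auto)
  then obtain c where c: "\<And>j. j < Suc d \<Longrightarrow> c j \<in> \<rat>" "\<exists>j<Suc d. c j \<noteq> 0"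
    "\<And>i. i < d \<Longrightarrow> (\<Sum>j<Suc d. a j i * c j) = 0" by blast
  have rel: "(\<Sum>j<Suc d. c j * x j) = 0"
  proof -
    have "(\<Sum>j<Suc d. c j * x j) = (\<Sum>j<Suc d. \<Sum>i<d. c j * a j i * basis i)"
      by (intro sum.cong refl) (simp add: a(2) sum_distrib_left mult.assoc)
    also have "\<dots> = (\<Sum>i<d. \<Sum>j<Suc d. c j * a j i * basis i)" by (rule sum.swap)
    also have "\<dots> = (\<Sum>i<d. (\<Sum>j<Suc d. a j i * c j) * basis i)"
      by (intro sum.cong refl) (simp only: sum_distrib_right mult.commute[of "c _"])
    also have "\<dots> = 0" using c(3) by simp
    finally show ?thesis .
  qed
  have "\<exists>N::nat. N > 0 \<and> (\<forall>i\<in>{..<Suc d}. of_nat N * c i \<in> \<int>)"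
    by (rule Rats_common_denominator) (use c(1) in auto)
  then obtain N :: nat where N: "N > 0" "\<And>i. i < Suc d \<Longrightarrow> of_nat N * c i \<in> \<int>" by blast
  then have "\<forall>i. \<exists>e. i < Suc d \<longrightarrow> of_nat N * c i = of_int e" by (metis Ints_cases)
  then obtain e :: "nat \<Rightarrow> int" where e: "\<And>i. i < Suc d \<Longrightarrow> of_nat N * c i = of_int (e i)"
    by metis
  show ?thesis
  proof (rule that[of e])
    obtain j where j: "j < Suc d" "c j \<noteq> 0" using c(2) by blast
    then have "of_int (e j) \<noteq> (0::'a)" using e[OF j(1)] N(1) by auto
    then show "\<exists>i<Suc d. e i \<noteq> 0" using j(1) by auto
    have "(\<Sum>i<Suc d. of_int (e i) * x i) = (\<Sum>i<Suc d. of_nat N * (c i * x i))"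
      using e by (intro sum.cong refl) (auto simp: mult.assoc[symmetric])
    also have "\<dots> = of_nat N * (\<Sum>i<Suc d. c i * x i)" by (simp only: sum_distrib_left)
    finally show "(\<Sum>i<Suc d. of_int (e i) * x i) = 0" by (simp only: rel mult_zero_right)
  qed
qed

text \<open>Dividing an integral relation by the gcd of its coefficients leaves one that does not
  vanish modulo \<open>q\<close>.\<close>

lemma rat_dependent_prime:
  assumes x: "\<And>i. i < Suc d \<Longrightarrow> x i \<in> F" and q: "Factorial_Ring.prime (q :: int)"
  obtains c :: "nat \<Rightarrow> int" where "\<exists>i<Suc d. \<not> q dvd c i" "(\<Sum>i<Suc d. of_int (c i) * x i) = 0"
proof -
  obtain c :: "nat \<Rightarrow> int" where c: "\<exists>i<Suc d. c i \<noteq> 0" "(\<Sum>i<Suc d. of_int (c i) * x i) = 0"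
    by (rule rat_dependent[OF x])
  define g where "g = Gcd (c ` {..<Suc d})"
  have g: "g \<noteq> 0" using c(1) by (auto simp: g_def Gcd_0_iff)
  define e where "e = (\<lambda>i. c i div g)"
  have ce: "c i = g * e i" if "i < Suc d" for i
    using that by (simp add: e_def g_def Gcd_dvd)
  have "\<exists>i<Suc d. \<not> q dvd e i"
  proof (rule ccontr)
    assume "\<not> (\<exists>i<Suc d. \<not> q dvd e i)"
    then have "g * q dvd c i" if "i < Suc d" for i using that ce by simp
    then have "g * q dvd g" unfolding g_def by (intro Gcd_greatest) auto
    then have "g * q dvd g * 1" by simp
    then have "q dvd 1" using g by (simp only: dvd_mult_cancel_left) simp
    with q show False by (simp add: prime_int_iff)
  qed
  moreover have "(\<Sum>i<Suc d. of_int (e i) * x i) = 0"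
  proof -
    have "of_int g * (\<Sum>i<Suc d. of_int (e i) * x i) = (\<Sum>i<Suc d. of_int (c i) * x i)"
      unfolding sum_distrib_left by (intro sum.cong refl) (simp add: ce mult.assoc)
    then have "of_int g * (\<Sum>i<Suc d. of_int (e i) * x i) = 0" by (simp only: c(2))
    then show ?thesis using g by (simp only: mult_eq_0_iff of_int_eq_0_iff) simp
  qed
  ultimately show ?thesis using that by blast
qed

abbreviation (input) ints ("\<O>") where "\<O> \<equiv> ints_of F"

lemma ints_add_sub: "add_sub \<O>"
proof -
  have "x - y \<in> \<O>" if "x \<in> \<O>" "y \<in> \<O>" for x y
    using that algebraic_int_add[of x "- y"] by (auto simp: ints_of_def diff_mem)
  then show ?thesis by (auto simp: add_sub_def ints_of_def zero_mem)
qed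

lemmas ints_zero = add_sub_zero[OF ints_add_sub]
  and ints_diff = add_sub_diff[OF ints_add_sub]
  and ints_add = add_sub_add[OF ints_add_sub]
  and ints_uminus = add_sub_uminus[OF ints_add_sub]
  and ints_sum = add_sub_sum[OF ints_add_sub]

lemma ints_subset: "x \<in> \<O> \<Longrightarrow> x \<in> F"
  and ints_one: "1 \<in> \<O>"
  and ints_of_int: "of_int n \<in> \<O>"
  and ints_of_nat: "of_nat m \<in> \<O>"
  by (auto simp: ints_of_def one_mem of_int_mem of_nat_mem)

lemma ints_mult: "x \<in> \<O> \<Longrightarrow> y \<in> \<O> \<Longrightarrow> x * y \<in> \<O>"
  by (auto simp: ints_of_def mult_mem algebraic_int_mult)

lemma ints_power: "x \<in> \<O> \<Longrightarrow> x ^ n \<in> \<O>"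
  by (induction n) (auto simp: ints_one ints_mult)

text \<open>If \<open>x\<close> satisfies an integral equation of degree \<open>n\<close> with
  leading coefficient \<open>c n\<close>, then \<open>c n * x\<close> satisfies a monic one.\<close>

lemma ints_denominator:
  assumes x: "x \<in> F"
  obtains m :: nat where "m > 0" "of_nat m * x \<in> \<O>"
proof -
  obtain c :: "nat \<Rightarrow> int" where c: "\<exists>i<Suc d. c i \<noteq> 0" "(\<Sum>i<Suc d. of_int (c i) * x ^ i) = 0"
    using rat_dependent[of "\<lambda>i. x ^ i"] power_mem[OF x] by blast
  define n where "n = (GREATEST i. i < Suc d \<and> c i \<noteq> 0)"
  have n: "n < Suc d \<and> c n \<noteq> 0" unfolding n_def
    using c(1) by (metis (mono_tags, lifting) GreatestI_nat less_imp_le_nat)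
  have above: "c i = 0" if "n < i" "i < Suc d" for i
  proof (rule ccontr)
    assume "c i \<noteq> 0"
    then have "i \<le> n" unfolding n_def using that by (intro Greatest_le_nat[of _ _ "Suc d"]) auto
    with that show False by simp
  qed
  have "(\<Sum>i<Suc d. of_int (c i) * x ^ i) = (\<Sum>i<Suc n. of_int (c i) * x ^ i)"
    using n above by (intro sum.mono_neutral_right) auto
  with c(2) have rel: "of_int (c n) * x ^ n + (\<Sum>i<n. of_int (c i) * x ^ i) = 0"
    by (simp add: add.commute)
  define z where "z = of_int (c n) * x"
  have "algebraic_int z"
  proof (cases n)
    case 0
    with rel n show ?thesis by simp
  next
    case (Suc k)
    \<comment> \<open>With \<open>n = Suc k\<close>, the relation is multiplied by the
      \<open>k\<close>-th power of its leading coefficient and rewritten in powers of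
      \<open>z\<close>.\<close>
    have "(\<Sum>i<n. of_int (- c i * c n ^ (k - i)) * z ^ i) = (\<Sum>i<n. - (of_int (c n) ^ k * (of_int (c i) * x ^ i)))"
    proof (intro sum.cong refl)
      fix i assume "i \<in> {..<n}"
      then have "of_int (c n) ^ k = (of_int (c n) ^ (k - i) * of_int (c n) ^ i :: 'a)"
        using Suc by (simp add: power_add[symmetric])
      then show "of_int (- c i * c n ^ (k - i)) * z ^ i = - (of_int (c n) ^ k * (of_int (c i) * x ^ i))"
        by (simp add: z_def power_mult_distrib)
    qed
    also have "\<dots> = - (of_int (c n) ^ k * (\<Sum>i<n. of_int (c i) * x ^ i))"
      by (simp add: sum_negf sum_distrib_left)
    also have "(\<Sum>i<n. of_int (c i) * x ^ i) = - (of_int (c n) * x ^ n)"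
      using rel by (simp add: eq_neg_iff_add_eq_0 add.commute)
    also have "- (of_int (c n) ^ k * - (of_int (c n) * x ^ n)) = z ^ n"
      by (simp add: z_def power_mult_distrib Suc)
    finally show ?thesis by (intro algebraic_int_powerI[OF sym])
  qed
  then have z: "z \<in> \<O>" by (auto simp: ints_of_def z_def mult_mem of_int_mem x)
  have "of_nat (nat \<bar>c n\<bar>) * x \<in> \<O>"
    using z ints_uminus[OF z] by (cases "c n \<ge> 0") (auto simp: z_def)
  then show ?thesis using n that[of "nat \<bar>c n\<bar>"] by simp
qed

section \<open>Principal ideals and the finiteness of \<open>\<O>\<close> modulo a positive
  integer\<close>

lemma principal_iff: "y \<in> principal F x \<longleftrightarrow> (\<exists>r\<in>\<O>. y = x * r)"
  by (auto simp: principal_def)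

lemma principal_add_sub: "add_sub (principal F x)"
  unfolding add_sub_def
proof (intro conjI ballI)
  show "0 \<in> principal F x" using ints_zero by (force simp: principal_iff)
  fix a b assume "a \<in> principal F x" "b \<in> principal F x"
  then show "a - b \<in> principal F x"
    by (auto simp: principal_iff right_diff_distrib[symmetric] intro!: ints_diff)
qed

text \<open>An instance of \<open>residue_space_count\<close> with \<open>R\<close> the integers and
  \<open>p\<close> the multiples of \<open>q\<close>: by \<open>rat_dependent_prime\<close>,
  \<open>\<O>/q\<O>\<close> has dimension at most \<open>d\<close> over the field with
  \<open>q\<close> elements.\<close>

lemma finite_ints_mod_prime:
  assumes q: "Factorial_Ring.prime (q :: nat)"
  shows "finite (add_quot \<O> (principal F (of_nat q)))"
proof -
  define R :: "'a set" where "R = \<int>"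
  define p :: "'a set" where "p = {of_int (int q * z) | z. True}"
  have q': "Factorial_Ring.prime (int q)" using q by simp
  have R: "add_sub R" by (auto simp: add_sub_def R_def)
  have p: "add_sub p"
    unfolding add_sub_def p_def
  proof (intro conjI ballI)
    show "0 \<in> {of_int (int q * z) | z. True}" by (auto intro!: exI[of _ 0])
    fix x y :: 'a assume "x \<in> {of_int (int q * z) | z. True}" "y \<in> {of_int (int q * z) | z. True}"
    then show "x - y \<in> {of_int (int q * z) | z. True}"
      by (auto simp: right_diff_distrib[symmetric] simp flip: of_int_diff of_int_mult)
  qed
  have p_iff: "of_int c \<in> p \<longleftrightarrow> int q dvd c" for c
    by (auto simp: p_def dvd_def simp del: of_int_mult)
  have dep: "\<exists>c. (\<forall>i<Suc d. c i \<in> R) \<and> (\<exists>i<Suc d. c i \<notin> p) \<and>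
      (\<Sum>i<Suc d. c i * x i) \<in> principal F (of_nat q)"
    if x: "\<And>i. i < Suc d \<Longrightarrow> x i \<in> \<O>" for x
  proof -
    obtain c :: "nat \<Rightarrow> int" where c: "\<exists>i<Suc d. \<not> int q dvd c i" "(\<Sum>i<Suc d. of_int (c i) * x i) = 0"
      using rat_dependent_prime[OF _ q', of x] x ints_subset by blast
    then show ?thesis using add_sub_zero[OF principal_add_sub]
      by (intro exI[of _ "\<lambda>i. of_int (c i)"]) (auto simp: R_def p_iff simp del: sum.lessThan_Suc)
  qed
  have finR: "finite (add_quot R p)"
  proof -
    have "add_quot R p \<subseteq> (\<lambda>x. (+) (of_int x) ` p) ` {0..<int q}"
    proof
      fix Z assume "Z \<in> add_quot R p"
      then obtain x where x: "Z = (+) (of_int x) ` p" by (auto simp: add_quot_def R_def Ints_def)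
      have "of_int x - of_int (x mod int q) = (of_int (int q * (x div int q)) :: 'a)"
        by (simp only: of_int_diff[symmetric] minus_mod_eq_mult_div)
      then have "of_int x - of_int (x mod int q) \<in> p" unfolding p_def by blast
      then have "Z = (+) (of_int (x mod int q)) ` p" using coset_eq_iff[OF p] x by simp
      then show "Z \<in> (\<lambda>x. (+) (of_int x) ` p) ` {0..<int q}"
        using prime_gt_0_nat[OF q] by (intro image_eqI[of _ _ "x mod int q"]) auto
    qed
    then show ?thesis by (rule finite_subset) simp
  qed
  show ?thesis
  proof (rule residue_space_count[of R p \<O> "principal F (of_nat q)" d])
    fix c assume "c \<in> R" "c \<notin> p"
    then obtain z where z: "c = of_int z" "\<not> int q dvd z" by (auto simp: R_def Ints_def p_iff)
    then have "coprime (int q) z" using q' by (simp add: prime_imp_coprime)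
    then obtain u v where "u * int q + v * z = 1" by (metis bezout_int coprime_imp_gcd_eq_1)
    then have "v * z - 1 = int q * (- u)" by (simp add: algebra_simps)
    then have "of_int (v * z - 1) \<in> p" by (simp only: p_iff) simp
    then have "of_int v * c - 1 \<in> p" by (simp add: z)
    then show "\<exists>c'\<in>R. c' * c - 1 \<in> p" by (auto simp: R_def)
  next
    fix r x assume "r \<in> p" "x \<in> \<O>"
    then show "r * x \<in> principal F (of_nat q)"
      by (auto simp: p_def principal_iff mult.assoc intro!: bexI[of _ "of_int _ * x"] ints_mult ints_of_int)
  next
    fix r x assume "r \<in> R" "x \<in> principal F (of_nat q)"
    then obtain z s where "r = of_int z" "s \<in> \<O>" "x = of_nat q * s"
      by (auto simp: R_def Ints_def principal_iff)
    then show "r * x \<in> principal F (of_nat q)"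
      by (auto simp: principal_iff intro!: bexI[of _ "of_int z * s"] ints_mult ints_of_int)
  next
    fix x y assume "x \<in> R" "y \<in> p"
    then show "x * y \<in> p" by (auto simp: R_def Ints_def p_def)
       (metis mult.left_commute of_int_mult of_int_of_nat_eq)
  next
    fix x y assume "x \<in> R" "y \<in> R"
    then show "x * y \<in> R" by (auto simp: R_def)
  next
    show "principal F (of_nat q) \<subseteq> \<O>" by (auto simp: principal_iff ints_mult ints_of_nat)
    show "p \<subseteq> R" by (auto simp: p_def R_def)
  qed (use R p dep finR principal_add_sub ints_add_sub in
      \<open>auto simp: R_def Ints_def intro: ints_mult ints_of_int simp del: sum.lessThan_Suc\<close>)
qed

text \<open>Peel off one prime factor, \<open>m = q * n\<close>: multiplication by \<open>q\<close>
  identifies \<open>\<O>/n\<O>\<close> with \<open>q\<O>/m\<O>\<close>, and the index is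
  multiplicative in towers.\<close>

lemma finite_ints_mod:
  assumes "m > 0"
  shows "finite (add_quot \<O> (principal F (of_nat m)))"
  using assms
proof (induction m rule: less_induct)
  case (less m)
  show ?case
  proof (cases "m = 1")
    case True
    have "principal F 1 = \<O>" by (auto simp: principal_iff)
    with True show ?thesis by (simp add: add_quot_self ints_add_sub)
  next
    case False
    then obtain q where q: "Factorial_Ring.prime q" "q dvd m" using prime_factor_nat by blast
    then obtain n where n: "m = q * n" by auto
    have "n < m" "n > 0" using less.prems n prime_gt_1_nat[OF q(1)] by auto
    then have fin: "finite (add_quot \<O> (principal F (of_nat n)))" by (rule less.IH)
    have q0: "of_nat q \<noteq> (0::'a)" using prime_gt_0_nat[OF q(1)] by simp
    have fin': "finite (add_quot (principal F (of_nat q)) (principal F (of_nat m)))"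
    proof (rule add_quot_bij(2)[OF principal_add_sub principal_add_sub _ _ _ fin, of "\<lambda>x. of_nat q * x"])
      fix x y assume "x \<in> \<O>" "y \<in> \<O>"
      show "of_nat q * x - of_nat q * y \<in> principal F (of_nat m) \<longleftrightarrow> x - y \<in> principal F (of_nat n)"
        using q0 by (auto simp: principal_iff n right_diff_distrib[symmetric] mult.assoc)
    next
      fix z assume "z \<in> principal F (of_nat q)"
      then show "\<exists>x\<in>\<O>. z - of_nat q * x \<in> principal F (of_nat m)"
        using add_sub_zero[OF principal_add_sub] by (force simp: principal_iff[of _ "of_nat q"])
    qed (auto simp: principal_iff)
    have sub: "principal F (of_nat m) \<subseteq> principal F (of_nat q)"
      by (auto simp: principal_iff n mult.assoc intro!: ints_mult ints_of_nat)
    have sub': "principal F (of_nat q) \<subseteq> \<O>"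
      by (auto simp: principal_iff intro!: ints_mult ints_of_nat)
    show ?thesis
      by (rule add_quot_tower(2)[OF ints_add_sub principal_add_sub principal_add_sub sub sub'
            finite_ints_mod_prime[OF q(1)] fin'])
  qed
qed

text \<open>Two of the elements \<open>m x ^ j\<close> are congruent modulo \<open>m\<O>\<close>,
  since there are finitely many residues. Dividing by \<open>m\<close> shows that a difference of
  two powers of \<open>x\<close> is integral, and then so is \<open>x\<close>.\<close>

lemma almost_integral:
  assumes x: "x \<in> F" and m: "m > 0" "\<And>j. of_nat m * x ^ j \<in> \<O>"
  shows "x \<in> \<O>"
proof -
  let ?I = "principal F (of_nat m)"
  define f where "f = (\<lambda>j. (+) (of_nat m * x ^ j) ` ?I)"
  have "range f \<subseteq> add_quot \<O> ?I" using m(2) by (auto simp: f_def add_quot_def)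
  then have "finite (range f)" using finite_ints_mod[OF m(1)] finite_subset by blast
  then have "\<not> inj f" using finite_imageD[of f UNIV] by auto
  then obtain i j where ij: "i < j" "f i = f j" by (metis injI linorder_neqE_nat)
  then have "f j = f i" by simp
  then have "of_nat m * x ^ j - of_nat m * x ^ i \<in> ?I"
    unfolding f_def coset_eq_iff[OF principal_add_sub] .
  then obtain r where "r \<in> \<O>" "of_nat m * (x ^ j - x ^ i) = of_nat m * r"
    by (auto simp: principal_iff right_diff_distrib)
  then have "x ^ j - x ^ i \<in> \<O>" using m(1) by simp
  then have "algebraic_int (x ^ j - x ^ i)" by (simp add: ints_of_def)
  then show ?thesis using algebraic_int_power_diff[OF _ ij(1)] x by (simp add: ints_of_def)
qed

end

section \<open>Products of ideals\<close>

lemma ideal_mult_memI: "a \<in> A \<Longrightarrow> b \<in> B \<Longrightarrow> a * b \<in> ideal_mult A B"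
  unfolding ideal_mult_def
  by (intro CollectI exI[of _ 1] exI[of _ "\<lambda>_. a"] exI[of _ "\<lambda>_. b"]) auto

lemma ideal_mult_zero: "0 \<in> ideal_mult A B"
  unfolding ideal_mult_def by (intro CollectI exI[of _ 0]) auto

lemma ideal_mult_add:
  assumes "x \<in> ideal_mult A B" "y \<in> ideal_mult A B"
  shows "x + y \<in> ideal_mult A B"
proof -
  obtain m :: nat and f g where m: "x = (\<Sum>i<m. f i * g i)" "\<And>i. i < m \<Longrightarrow> f i \<in> A" "\<And>i. i < m \<Longrightarrow> g i \<in> B"
    using assms(1) by (auto simp: ideal_mult_def)
  obtain n :: nat and h k where n: "y = (\<Sum>i<n. h i * k i)" "\<And>i. i < n \<Longrightarrow> h i \<in> A" "\<And>i. i < n \<Longrightarrow> k i \<in> B"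
    using assms(2) by (auto simp: ideal_mult_def)
  define u where "u = (\<lambda>i. if i < m then f i else h (i - m))"
  define v where "v = (\<lambda>i. if i < m then g i else k (i - m))"
  have "(\<Sum>i<m + n. u i * v i) = (\<Sum>i<m. u i * v i) + (\<Sum>i=m..<m + n. u i * v i)"
    by (simp add: lessThan_atLeast0 sum.atLeastLessThan_concat)
  also have "(\<Sum>i=m..<m + n. u i * v i) = (\<Sum>i<n. h i * k i)"
    using sum.shift_bounds_nat_ivl[of "\<lambda>i. u i * v i" 0 m n]
    by (simp add: u_def v_def lessThan_atLeast0 add.commute)
  also have "(\<Sum>i<m. u i * v i) = (\<Sum>i<m. f i * g i)" by (simp add: u_def v_def)
  finally have "x + y = (\<Sum>i<m + n. u i * v i)" by (simp add: m n)
  moreover have "\<forall>i<m + n. u i \<in> A" "\<forall>i<m + n. v i \<in> B" using m n by (auto simp: u_def v_def)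
  ultimately show ?thesis unfolding ideal_mult_def by blast
qed

text \<open>The universal property of the product as the smallest additively closed set containing 0
  and all products \<open>a * b\<close>; inclusions of products are proved through it, not through
  sums.\<close>

lemma ideal_mult_least:
  assumes "0 \<in> C" "\<And>x y. x \<in> C \<Longrightarrow> y \<in> C \<Longrightarrow> x + y \<in> C"
    and "\<And>a b. a \<in> A \<Longrightarrow> b \<in> B \<Longrightarrow> a * b \<in> C"
  shows "ideal_mult A B \<subseteq> C"
proof
  fix x assume "x \<in> ideal_mult A B"
  then obtain n :: nat and f g where n: "x = (\<Sum>i<n. f i * g i)" "\<forall>i<n. f i \<in> A" "\<forall>i<n. g i \<in> B"
    by (auto simp: ideal_mult_def)
  have "(\<Sum>i<k. f i * g i) \<in> C" if "k \<le> n" for k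
    using that by (induction k) (use assms n in auto)
  then show "x \<in> C" using n(1) by simp
qed

lemma ideal_mult_mono: "A \<subseteq> A' \<Longrightarrow> B \<subseteq> B' \<Longrightarrow> ideal_mult A B \<subseteq> ideal_mult A' B'"
  by (intro ideal_mult_least ideal_mult_zero ideal_mult_add ideal_mult_memI) auto

lemma ideal_mult_commute: "ideal_mult A B = ideal_mult B A"
proof -
  have "ideal_mult A B \<subseteq> ideal_mult B A" for A B :: "'a set"
  proof (intro ideal_mult_least ideal_mult_zero ideal_mult_add)
    fix a b assume "a \<in> A" "b \<in> B"
    then show "a * b \<in> ideal_mult B A" using ideal_mult_memI[of b B a A] by (simp add: mult.commute)
  qed
  then show ?thesis by blast
qed

lemma ideal_mult_assoc: "ideal_mult (ideal_mult A B) C = ideal_mult A (ideal_mult B C)"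
proof -
  have sub: "ideal_mult (ideal_mult A B) C \<subseteq> ideal_mult A (ideal_mult B C)" for A B C :: "'a set"
  proof (intro ideal_mult_least ideal_mult_zero ideal_mult_add)
    fix z c assume z: "z \<in> ideal_mult A B" and c: "c \<in> C"
    have "ideal_mult A B \<subseteq> {z. z * c \<in> ideal_mult A (ideal_mult B C)}"
      by (intro ideal_mult_least)
         (auto simp: distrib_right mult.assoc c intro!: ideal_mult_zero ideal_mult_add ideal_mult_memI)
    with z show "z * c \<in> ideal_mult A (ideal_mult B C)" by blast
  qed
  show ?thesis
    using sub[of A B C] sub[of C B A] by (simp add: ideal_mult_commute)
qed

lemma ideal_mult_left_commute: "ideal_mult A (ideal_mult B C) = ideal_mult B (ideal_mult A C)"
  by (metis ideal_mult_assoc ideal_mult_commute)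

lemmas ideal_mult_ac = ideal_mult_assoc ideal_mult_commute ideal_mult_left_commute

section \<open>Ideals of rings of integers\<close>

context nfield
begin

lemma frac_add_sub: "A \<in> frac_ideals F \<Longrightarrow> add_sub A"
proof -
  assume A: "A \<in> frac_ideals F"
  have "x - y \<in> A" if "x \<in> A" "y \<in> A" for x y
  proof -
    have "(-1) * y \<in> A" using A that ints_uminus[OF ints_one] unfolding frac_ideals_def by blast
    moreover have "\<forall>a\<in>A. \<forall>b\<in>A. a + b \<in> A" using A by (simp add: frac_ideals_def)
    ultimately have "x + (-1) * y \<in> A" using that by blast
    then show ?thesis by simp
  qed
  then show ?thesis using A by (auto simp: add_sub_def frac_ideals_def)
qed

lemma frac_mult: "A \<in> frac_ideals F \<Longrightarrow> r \<in> \<O> \<Longrightarrow> a \<in> A \<Longrightarrow> r * a \<in> A"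
  and frac_subset: "A \<in> frac_ideals F \<Longrightarrow> A \<subseteq> F"
  by (auto simp: frac_ideals_def)

lemma frac_nonzero: "A \<in> frac_ideals F \<Longrightarrow> \<exists>a\<in>A. a \<noteq> 0"
  by (auto simp: frac_ideals_def)

text \<open>The common denominator may be any nonzero element of the field;
  \<open>ints_denominator\<close> turns it into an integral one.\<close>

lemma frac_idealI:
  assumes "A \<subseteq> F" "add_sub A" "a \<in> A" "a \<noteq> 0" "\<And>r a. r \<in> \<O> \<Longrightarrow> a \<in> A \<Longrightarrow> r * a \<in> A"
    and "e \<in> F" "e \<noteq> 0" "\<And>a. a \<in> A \<Longrightarrow> e * a \<in> \<O>"
  shows "A \<in> frac_ideals F"
proof -
  obtain m :: nat where m: "m > 0" "of_nat m * e \<in> \<O>" by (rule ints_denominator[OF assms(6)])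
  have "(of_nat m * e) * a \<in> \<O>" if "a \<in> A" for a
    using ints_mult[OF ints_of_nat assms(8)[OF that], of m] by (simp add: mult.assoc)
  then show ?thesis
    using assms m unfolding frac_ideals_def
    by (auto simp: add_sub_zero add_sub_add intro!: bexI[of _ "of_nat m * e"])
qed

lemma integral_iff:
  "A \<in> integral_ideals F \<longleftrightarrow> A \<subseteq> \<O> \<and> add_sub A \<and> A \<noteq> {0} \<and> (\<forall>r\<in>\<O>. \<forall>a\<in>A. r * a \<in> A)"
proof
  assume "A \<in> integral_ideals F"
  then show "A \<subseteq> \<O> \<and> add_sub A \<and> A \<noteq> {0} \<and> (\<forall>r\<in>\<O>. \<forall>a\<in>A. r * a \<in> A)"
    using frac_add_sub by (auto simp: integral_ideals_def frac_ideals_def)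
next
  assume A: "A \<subseteq> \<O> \<and> add_sub A \<and> A \<noteq> {0} \<and> (\<forall>r\<in>\<O>. \<forall>a\<in>A. r * a \<in> A)"
  then obtain a where "a \<in> A" "a \<noteq> 0" using add_sub_zero[of A] by blast
  then have "A \<in> frac_ideals F"
    using A ints_subset by (intro frac_idealI[of A a 1]) (auto simp: one_mem)
  with A show "A \<in> integral_ideals F" by (simp add: integral_ideals_def)
qed

lemma integral_frac: "A \<in> integral_ideals F \<Longrightarrow> A \<in> frac_ideals F"
  by (simp add: integral_ideals_def)

lemma integral_subset: "A \<in> integral_ideals F \<Longrightarrow> A \<subseteq> \<O>"
  by (simp add: integral_ideals_def)

lemma ints_integral: "\<O> \<in> integral_ideals F"
  using ints_one by (auto simp: integral_iff ints_add_sub ints_mult)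

lemma integral_eq_ints: "A \<in> integral_ideals F \<Longrightarrow> 1 \<in> A \<Longrightarrow> A = \<O>"
  using frac_mult[OF integral_frac, of A _ 1] integral_subset[of A] by auto

text \<open>For \<open>a \<noteq> 0\<close> in \<open>A\<close>, some \<open>m * inverse a\<close>
  is integral, and multiplying it by \<open>a\<close> gives \<open>m\<close>.\<close>

lemma integral_contains_nat:
  assumes A: "A \<in> integral_ideals F"
  obtains m :: nat where "m > 0" "of_nat m \<in> A"
proof -
  obtain a where a: "a \<in> A" "a \<noteq> 0" using frac_nonzero[OF integral_frac[OF A]] by blast
  then have "a \<in> F" using A frac_subset[OF integral_frac] by blast
  obtain m :: nat where m: "m > 0" "of_nat m * inverse a \<in> \<O>"
    by (rule ints_denominator[OF inverse_mem[OF \<open>a \<in> F\<close>]])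
  then have "(of_nat m * inverse a) * a \<in> A" by (intro frac_mult[OF integral_frac[OF A]] a)
  then show ?thesis using a m that[of m] by (simp add: mult.assoc)
qed

lemma finite_quot:
  assumes A: "A \<in> integral_ideals F"
  shows "finite (add_quot \<O> A)"
proof -
  obtain m :: nat where m: "m > 0" "of_nat m \<in> A" by (rule integral_contains_nat[OF A])
  have sub: "principal F (of_nat m) \<subseteq> A"
    using frac_mult[OF integral_frac[OF A] _ m(2)] by (auto simp: principal_iff mult.commute)
  obtain T where T: "T \<subseteq> \<O>" "bij_betw (\<lambda>x. (+) x ` principal F (of_nat m)) T (add_quot \<O> (principal F (of_nat m)))"
    "\<And>x. x \<in> \<O> \<Longrightarrow> \<exists>t\<in>T. x - t \<in> principal F (of_nat m)"
    using add_quot_transversal[OF principal_add_sub, of \<O> "of_nat m"] by metis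
  have "finite T" using finite_ints_mod[OF m(1)] bij_betw_finite[OF T(2)] by simp
  moreover have "add_quot \<O> A \<subseteq> (\<lambda>x. (+) x ` A) ` T"
  proof
    fix Z assume "Z \<in> add_quot \<O> A"
    then obtain x where x: "x \<in> \<O>" "Z = (+) x ` A" by (auto simp: add_quot_def)
    then obtain t where "t \<in> T" "x - t \<in> A" using T(3) sub by blast
    then show "Z \<in> (\<lambda>x. (+) x ` A) ` T"
      using x coset_eq_iff[OF frac_add_sub[OF integral_frac[OF A]]] by blast
  qed
  ultimately show ?thesis using finite_subset by blast
qed

text \<open>The absolute norm. Its strict monotonicity, shown next, already makes it an induction
  measure for ideals; its multiplicativity needs the factorization theorem.\<close>

definition nrm :: "'a set \<Rightarrow> nat" where "nrm A = card (add_quot \<O> A)"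

lemma nrm_pos: "A \<in> integral_ideals F \<Longrightarrow> nrm A > 0"
  using finite_quot[of A] ints_zero by (auto simp: nrm_def card_gt_0_iff add_quot_def)

lemma nrm_one: "nrm \<O> = 1"
  by (simp add: nrm_def add_quot_self ints_add_sub)

lemma nrm_tower:
  assumes "A \<in> integral_ideals F" "B \<in> integral_ideals F" "A \<subseteq> B"
  shows "nrm A = nrm B * card (add_quot B A)"
  unfolding nrm_def
  using assms by (intro add_quot_tower(1)) (auto intro: ints_add_sub frac_add_sub integral_frac dest: integral_subset)

lemma nrm_eq_imp_eq:
  assumes "A \<in> integral_ideals F" "B \<in> integral_ideals F" "A \<subseteq> B" "nrm A = nrm B"
  shows "A = B"
proof -
  have "card (add_quot B A) = 1" using nrm_tower[OF assms(1-3)] assms(4) nrm_pos[OF assms(2)] by simp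
  then show ?thesis
    using add_quot_card_one[of B A] assms(1-3) frac_add_sub integral_frac by blast
qed

lemma nrm_less:
  assumes "A \<in> integral_ideals F" "B \<in> integral_ideals F" "A \<subset> B"
  shows "nrm B < nrm A"
proof -
  have 1: "nrm A = nrm B * card (add_quot B A)" using assms by (intro nrm_tower) auto
  have "nrm A \<noteq> nrm B" using nrm_eq_imp_eq[OF assms(1,2)] assms(3) by auto
  moreover have "nrm B \<le> nrm A" using 1 nrm_pos[OF assms(1)] by (cases "card (add_quot B A)") auto
  ultimately show ?thesis by simp
qed

section \<open>Prime ideals\<close>

lemma cring_ints: "cring (ring_on \<O>)"
proof (rule cringI)
  show "abelian_group (ring_on \<O>)"
  proof (rule abelian_groupI)
    fix x assume "x \<in> carrier (ring_on \<O>)"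
    then show "\<exists>y\<in>carrier (ring_on \<O>). y \<oplus>\<^bsub>ring_on \<O>\<^esub> x = \<zero>\<^bsub>ring_on \<O>\<^esub>"
      using ints_uminus by (auto intro!: bexI[of _ "-x"])
  qed (auto simp: ints_add ints_zero)
  show "Group.comm_monoid (ring_on \<O>)"
    by (rule comm_monoidI) (auto simp: ints_mult ints_one)
qed (auto simp: algebra_simps)

lemma primes_iff:
  "P \<in> primes_of F \<longleftrightarrow> P \<in> integral_ideals F \<and> 1 \<notin> P \<and>
     (\<forall>x\<in>\<O>. \<forall>y\<in>\<O>. x * y \<in> P \<longrightarrow> x \<in> P \<or> y \<in> P)"
proof
  assume "P \<in> primes_of F"
  then have P: "primeideal P (ring_on \<O>)" "P \<noteq> {0}" by (auto simp: primes_of_def)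
  interpret primeideal P "ring_on \<O>" by (rule P(1))
  have sub: "P \<subseteq> \<O>" using a_subset by simp
  have mult: "r * a \<in> P" if "r \<in> \<O>" "a \<in> P" for r a using I_l_closed[OF that(2), of r] that(1) by simp
  have "a - b \<in> P" if "a \<in> P" "b \<in> P" for a b
    using additive_subgroup.a_closed[OF additive_subgroup_axioms that(1) mult[OF ints_uminus[OF ints_one] that(2)]] by simp
  moreover have "0 \<in> P" using additive_subgroup.zero_closed[OF additive_subgroup_axioms] by simp
  ultimately have "P \<in> integral_ideals F" using sub mult P(2) by (auto simp: integral_iff add_sub_def)
  moreover have "1 \<notin> P" using integral_eq_ints[OF calculation] I_notcarr by auto
  ultimately show "P \<in> integral_ideals F \<and> 1 \<notin> P \<and>
     (\<forall>x\<in>\<O>. \<forall>y\<in>\<O>. x * y \<in> P \<longrightarrow> x \<in> P \<or> y \<in> P)"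
    using I_prime by auto
next
  assume P: "P \<in> integral_ideals F \<and> 1 \<notin> P \<and>
     (\<forall>x\<in>\<O>. \<forall>y\<in>\<O>. x * y \<in> P \<longrightarrow> x \<in> P \<or> y \<in> P)"
  interpret R: cring "ring_on \<O>" by (rule cring_ints)
  have P': "P \<subseteq> \<O>" "add_sub P" "P \<noteq> {0}" "\<And>r a. r \<in> \<O> \<Longrightarrow> a \<in> P \<Longrightarrow> r * a \<in> P"
    using P by (auto simp: integral_iff)
  have minus: "\<ominus>\<^bsub>ring_on \<O>\<^esub> x = - x" if "x \<in> \<O>" for x
    using R.minus_equality[of "-x" x] that ints_uminus by simp
  have "ideal P (ring_on \<O>)"
  proof (rule idealI[OF R.ring_axioms])
    show "subgroup P (add_monoid (ring_on \<O>))"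
    proof (rule R.add.subgroupI)
      fix a assume "a \<in> P"
      then show "\<ominus>\<^bsub>ring_on \<O>\<^esub> a \<in> P" using minus[of a] P' add_sub_uminus[of P a] by auto
    qed (use P' add_sub_zero[of P] add_sub_add[of P] in auto)
  next
    fix a x assume "a \<in> P" "x \<in> carrier (ring_on \<O>)"
    then show "x \<otimes>\<^bsub>ring_on \<O>\<^esub> a \<in> P" "a \<otimes>\<^bsub>ring_on \<O>\<^esub> x \<in> P"
      using P'(4)[of x a] by (simp_all add: mult.commute)
  qed
  then have "primeideal P (ring_on \<O>)"
    using P ints_one by (intro primeidealI R.is_cring) auto
  then show "P \<in> primes_of F" using P' by (simp add: primes_of_def)
qed

lemma prime_integral: "P \<in> primes_of F \<Longrightarrow> P \<in> integral_ideals F"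
  by (simp add: primes_iff)

lemma prime_frac: "P \<in> primes_of F \<Longrightarrow> P \<in> frac_ideals F"
  by (simp add: primes_iff integral_frac)

lemma prime_notone: "P \<in> primes_of F \<Longrightarrow> 1 \<notin> P"
  by (simp add: primes_iff)

lemma prime_mult: "P \<in> primes_of F \<Longrightarrow> x \<in> \<O> \<Longrightarrow> y \<in> \<O> \<Longrightarrow> x * y \<in> P \<Longrightarrow> x \<in> P \<or> y \<in> P"
  by (simp add: primes_iff)

text \<open>Two powers of \<open>x\<close> agree in the finite ring \<open>\<O>/P\<close>.
  Cancelling the smaller one, as \<open>P\<close> is prime, leaves \<open>x ^ Suc k\<close>
  congruent to 1, so \<open>x ^ k\<close> is an inverse.\<close>

lemma prime_inverse_mod:
  assumes P: "P \<in> primes_of F" and x: "x \<in> \<O>" "x \<notin> P"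
  shows "\<exists>y\<in>\<O>. y * x - 1 \<in> P"
proof -
  define f where "f = (\<lambda>j::nat. (+) (x ^ j) ` P)"
  have "range f \<subseteq> add_quot \<O> P" using x ints_power by (auto simp: f_def add_quot_def)
  then have "finite (range f)" using finite_quot[OF prime_integral[OF P]] finite_subset by blast
  then have "\<not> inj f" using finite_imageD[of f UNIV] by auto
  then obtain i j where "i < j" "f i = f j" by (metis injI linorder_neqE_nat)
  then have ij: "i < j" "x ^ j - x ^ i \<in> P"
    using coset_eq_iff[OF frac_add_sub[OF prime_frac[OF P]], of "x ^ j" "x ^ i"] by (auto simp: f_def)
  obtain k where k: "j = i + Suc k" using ij(1) less_iff_Suc_add by auto
  have pow: "x ^ n \<notin> P" for n
    by (induction n) (use prime_notone[OF P] prime_mult[OF P x(1) ints_power[OF x(1)]] x(2) in auto)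
  have "x ^ i * (x ^ Suc k - 1) \<in> P" using ij(2) by (simp add: k power_add algebra_simps)
  then have "x ^ Suc k - 1 \<in> P"
    using prime_mult[OF P ints_power[OF x(1)] ints_diff[OF ints_power[OF x(1)] ints_one]] pow by blast
  then show ?thesis using ints_power[OF x(1), of k] by (intro bexI[of _ "x ^ k"]) (simp_all add: mult.commute)
qed

lemma prime_maximal:
  assumes P: "P \<in> primes_of F" and A: "A \<in> integral_ideals F" and sub: "P \<subseteq> A" and one: "1 \<notin> A"
  shows "A = P"
proof (rule ccontr)
  assume "A \<noteq> P"
  then obtain x where x: "x \<in> A" "x \<notin> P" using sub by blast
  moreover have "x \<in> \<O>" using integral_subset[OF A] x by blast
  ultimately obtain y where y: "y \<in> \<O>" "y * x - 1 \<in> P" using prime_inverse_mod[OF P] by blast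
  have "y * x - (y * x - 1) \<in> A"
    by (rule add_sub_diff[OF frac_add_sub[OF integral_frac[OF A]]
          frac_mult[OF integral_frac[OF A] y(1) x(1)] subsetD[OF sub y(2)]])
  with one show False by simp
qed

definition adjoin :: "'a set \<Rightarrow> 'a \<Rightarrow> 'a set" where
  "adjoin A x = {a + r * x | a r. a \<in> A \<and> r \<in> \<O>}"

lemma adjoin_integral:
  assumes A: "A \<in> integral_ideals F" and x: "x \<in> \<O>"
  shows "adjoin A x \<in> integral_ideals F" "A \<subseteq> adjoin A x" "x \<in> adjoin A x"
proof -
  note as = frac_add_sub[OF integral_frac[OF A]]
  show sub: "A \<subseteq> adjoin A x"
  proof
    fix a assume "a \<in> A"
    then show "a \<in> adjoin A x" unfolding adjoin_def
      using ints_zero by (intro CollectI exI[of _ a] exI[of _ 0]) auto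
  qed
  show "x \<in> adjoin A x" unfolding adjoin_def
    using ints_one add_sub_zero[OF as] by (intro CollectI exI[of _ 0] exI[of _ 1]) auto
  have "a - b \<in> adjoin A x" if ab: "a \<in> adjoin A x" "b \<in> adjoin A x" for a b
  proof -
    obtain a' r b' s where "a = a' + r * x" "b = b' + s * x" "a' \<in> A" "b' \<in> A" "r \<in> \<O>" "s \<in> \<O>"
      using ab by (auto simp: adjoin_def)
    then have "a - b = (a' - b') + (r - s) * x" "a' - b' \<in> A" "r - s \<in> \<O>"
      by (auto simp: algebra_simps add_sub_diff[OF as] ints_diff)
    then show ?thesis unfolding adjoin_def by blast
  qed
  moreover have "r * a \<in> adjoin A x" if ra: "r \<in> \<O>" "a \<in> adjoin A x" for r a
  proof -
    obtain a' s where "a = a' + s * x" "a' \<in> A" "s \<in> \<O>" using ra by (auto simp: adjoin_def)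
    then have "r * a = r * a' + (r * s) * x" "r * a' \<in> A" "r * s \<in> \<O>"
      using ra by (simp_all add: distrib_left mult.assoc frac_mult[OF integral_frac[OF A]] ints_mult)
    then show ?thesis unfolding adjoin_def by blast
  qed
  moreover have "adjoin A x \<subseteq> \<O>"
    using integral_subset[OF A] x by (auto simp: adjoin_def intro!: ints_add ints_mult)
  moreover have "adjoin A x \<noteq> {0}" using sub A by (auto simp: integral_iff add_sub_def)
  ultimately show "adjoin A x \<in> integral_ideals F"
    using sub add_sub_zero[OF as] by (auto simp: integral_iff add_sub_def)
qed

text \<open>A proper ideal above \<open>A\<close> of least norm: adjoining any outside element
  lowers the norm and therefore produces 1, which forces primality.\<close>

lemma ex_prime_above:
  assumes A: "A \<in> integral_ideals F" "1 \<notin> A"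
  obtains P where "P \<in> primes_of F" "A \<subseteq> P"
proof -
  define S where "S = (\<lambda>B. B \<in> integral_ideals F \<and> 1 \<notin> B \<and> A \<subseteq> B)"
  have "S A" using A by (simp add: S_def)
  then have min: "S (arg_min nrm S)" "\<And>B. S B \<Longrightarrow> nrm (arg_min nrm S) \<le> nrm B"
    using arg_min_natI arg_min_nat_le by metis+
  define P where "P = arg_min nrm S"
  have P: "P \<in> integral_ideals F" "1 \<notin> P" "A \<subseteq> P" using min(1) by (auto simp: S_def P_def)
  have full: "\<exists>a\<in>P. \<exists>r\<in>\<O>. 1 = a + r * x" if x: "x \<in> \<O>" "x \<notin> P" for x
  proof -
    note adj = adjoin_integral[OF P(1) x(1)]
    have "P \<subset> adjoin P x" using adj x(2) by blast
    then have "nrm (adjoin P x) < nrm P" by (intro nrm_less P adj)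
    then have "\<not> S (adjoin P x)" using min(2) unfolding P_def by (metis leD)
    then have "1 \<in> adjoin P x" using adj P(3) by (auto simp: S_def)
    then show ?thesis by (auto simp: adjoin_def)
  qed
  have "x \<in> P \<or> y \<in> P" if xy: "x \<in> \<O>" "y \<in> \<O>" "x * y \<in> P" for x y
  proof (rule ccontr)
    assume "\<not> (x \<in> P \<or> y \<in> P)"
    then obtain a r where ar: "a \<in> P" "r \<in> \<O>" "1 = a + r * x" using full xy by blast
    have "y = y * a + r * (x * y)" using ar(3) by (metis distrib_left mult.commute mult.left_commute mult_1)
    also have "\<dots> \<in> P"
      by (intro add_sub_add[OF frac_add_sub] frac_mult integral_frac P ar xy)
    finally show False using \<open>\<not> (x \<in> P \<or> y \<in> P)\<close> by blast
  qed
  then have "P \<in> primes_of F" using P by (simp add: primes_iff)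
  then show ?thesis using P(3) that by blast
qed

section \<open>Products of ideals and factorization into primes\<close>

lemma ideal_mult_ints:
  assumes "A \<in> frac_ideals F"
  shows "ideal_mult A \<O> = A"
proof
  show "ideal_mult A \<O> \<subseteq> A"
  proof (rule ideal_mult_least)
    fix a b assume "a \<in> A" "b \<in> \<O>"
    then show "a * b \<in> A" using frac_mult[OF assms, of b a] by (simp add: mult.commute)
  qed (use add_sub_zero[OF frac_add_sub[OF assms]] add_sub_add[OF frac_add_sub[OF assms]] in auto)
  show "A \<subseteq> ideal_mult A \<O>" using ideal_mult_memI[OF _ ints_one, of _ A] by auto
qed

lemma ideal_mult_ints_left: "A \<in> frac_ideals F \<Longrightarrow> ideal_mult \<O> A = A"
  using ideal_mult_ints ideal_mult_commute by metis

lemma ideal_mult_frac: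
  assumes A: "A \<in> frac_ideals F" and B: "B \<in> frac_ideals F"
  shows "ideal_mult A B \<in> frac_ideals F"
proof -
  obtain a where a: "a \<in> A" "a \<noteq> 0" using frac_nonzero[OF A] by blast
  obtain b where b: "b \<in> B" "b \<noteq> 0" using frac_nonzero[OF B] by blast
  obtain e where e: "e \<in> \<O>" "e \<noteq> 0" "\<And>a. a \<in> A \<Longrightarrow> e * a \<in> \<O>" using A unfolding frac_ideals_def by blast
  obtain f where f: "f \<in> \<O>" "f \<noteq> 0" "\<And>a. a \<in> B \<Longrightarrow> f * a \<in> \<O>" using B unfolding frac_ideals_def by blast
  have scale: "r * x \<in> ideal_mult A B" if "r \<in> \<O>" "x \<in> ideal_mult A B" for r x
  proof -
    have "ideal_mult A B \<subseteq> {x. r * x \<in> ideal_mult A B}"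
      using ideal_mult_memI[OF frac_mult[OF A that(1)], of _ _ B]
      by (intro ideal_mult_least) (auto simp: distrib_left ideal_mult_zero ideal_mult_add mult.assoc)
    with that show ?thesis by blast
  qed
  show ?thesis
  proof (rule frac_idealI[of _ "a * b" "e * f"])
    show "ideal_mult A B \<subseteq> F"
      using frac_subset[OF A] frac_subset[OF B]
      by (intro ideal_mult_least zero_mem add_mem mult_mem) auto
    show "add_sub (ideal_mult A B)"
      unfolding add_sub_def
    proof (intro conjI ballI ideal_mult_zero)
      fix x y assume xy: "x \<in> ideal_mult A B" "y \<in> ideal_mult A B"
      have "x + (-1) * y \<in> ideal_mult A B"
        by (intro ideal_mult_add scale xy ints_uminus ints_one)
      then show "x - y \<in> ideal_mult A B" by simp
    qed
    have "ideal_mult A B \<subseteq> {x. e * f * x \<in> \<O>}"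
    proof (rule ideal_mult_least)
      fix x y assume "x \<in> A" "y \<in> B"
      then have "(e * x) * (f * y) \<in> \<O>" by (intro ints_mult e f)
      then show "x * y \<in> {x. e * f * x \<in> \<O>}" by (simp add: ac_simps)
    qed (auto simp: distrib_left ints_zero ints_add)
    then show "e * f * x \<in> \<O>" if "x \<in> ideal_mult A B" for x using that by blast
    show "a * b \<in> ideal_mult A B" by (intro ideal_mult_memI a b)
  qed (use a b e f scale ints_subset in \<open>auto intro!: mult_mem\<close>)
qed

lemma ideal_mult_integral:
  assumes "A \<in> integral_ideals F" "B \<in> integral_ideals F"
  shows "ideal_mult A B \<in> integral_ideals F"
proof -
  have "ideal_mult A B \<subseteq> \<O>"
    using assms by (intro ideal_mult_least ints_zero ints_add ints_mult) (auto dest: integral_subset)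
  then show ?thesis using assms by (simp add: integral_ideals_def ideal_mult_frac)
qed

lemma ideal_mult_subset_left:
  assumes "A \<in> integral_ideals F" "B \<in> integral_ideals F"
  shows "ideal_mult A B \<subseteq> A"
  using ideal_mult_mono[of A A B \<O>] ideal_mult_ints[of A] assms
  by (simp add: integral_ideals_def)

text \<open>Lists stand for multisets of primes; \<open>remove1\<close> takes out one
  factor.\<close>

definition prodl :: "'a set list \<Rightarrow> 'a set" where
  "prodl Ps = foldr ideal_mult Ps \<O>"

lemma prodl_simps [simp]: "prodl [] = \<O>" "prodl (P # Ps) = ideal_mult P (prodl Ps)"
  by (simp_all add: prodl_def)

lemma prodl_integral: "set Ps \<subseteq> primes_of F \<Longrightarrow> prodl Ps \<in> integral_ideals F"
  by (induction Ps) (auto simp: ints_integral ideal_mult_integral prime_integral)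

lemma prodl_append:
  "set Ps \<subseteq> primes_of F \<Longrightarrow> set Qs \<subseteq> primes_of F \<Longrightarrow> prodl (Ps @ Qs) = ideal_mult (prodl Ps) (prodl Qs)"
proof (induction Ps)
  case Nil
  then show ?case using ideal_mult_ints_left[OF integral_frac[OF prodl_integral[of Qs]]] by simp
qed (simp add: ideal_mult_assoc)

lemma prodl_remove1: "P \<in> set Ps \<Longrightarrow> prodl Ps = ideal_mult P (prodl (remove1 P Ps))"
  by (induction Ps) (auto simp: ideal_mult_left_commute)

lemma prime_ideal_mult:
  assumes P: "P \<in> primes_of F" and A: "A \<in> integral_ideals F" and B: "B \<in> integral_ideals F"
    and sub: "ideal_mult A B \<subseteq> P"
  shows "A \<subseteq> P \<or> B \<subseteq> P"
proof (rule ccontr)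
  assume "\<not> (A \<subseteq> P \<or> B \<subseteq> P)"
  then obtain a b where "a \<in> A" "a \<notin> P" "b \<in> B" "b \<notin> P" by blast
  then show False
    using prime_mult[OF P, of a b] integral_subset[OF A] integral_subset[OF B] ideal_mult_memI[of a A b B] sub
    by blast
qed

text \<open>A prime containing a product contains one of its factors, and equals it because nonzero
  primes are maximal.\<close>

lemma prime_prodl:
  assumes P: "P \<in> primes_of F"
  shows "set Ps \<subseteq> primes_of F \<Longrightarrow> prodl Ps \<subseteq> P \<Longrightarrow> P \<in> set Ps"
proof (induction Ps)
  case Nil
  then show ?case using prime_notone[OF P] ints_one by auto
next
  case (Cons Q Ps)
  then have "Q \<subseteq> P \<or> prodl Ps \<subseteq> P"
    using prime_ideal_mult[OF P, of Q "prodl Ps"] prodl_integral[of Ps] by (auto simp: prime_integral)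
  moreover have "P = Q" if "Q \<subseteq> P"
    using prime_maximal[of Q P] Cons.prems that P by (auto simp: prime_integral prime_notone)
  ultimately show ?case using Cons by auto
qed

text \<open>Induction on the norm. If \<open>x * y\<close> lies in \<open>A\<close> but neither
  factor does, the product of \<open>A + x\<O>\<close> and \<open>A + y\<O>\<close> is contained in
  \<open>A\<close>, and both have smaller norm.\<close>

lemma contains_prodl:
  "A \<in> integral_ideals F \<Longrightarrow> \<exists>Ps. set Ps \<subseteq> primes_of F \<and> prodl Ps \<subseteq> A"
proof (induction "nrm A" arbitrary: A rule: less_induct)
  case less
  note A = less.prems
  show ?case
  proof (cases "1 \<in> A")
    case True
    then show ?thesis using integral_eq_ints[OF A] by (intro exI[of _ "[]"]) auto
  next
    case nt: False
    show ?thesis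
    proof (cases "A \<in> primes_of F")
      case True
      then show ?thesis
        using ideal_mult_ints[OF integral_frac[OF A]] by (intro exI[of _ "[A]"]) auto
    next
      case False
      then obtain x y where xy: "x \<in> \<O>" "y \<in> \<O>" "x * y \<in> A" "x \<notin> A" "y \<notin> A"
        using A nt by (auto simp: primes_iff)
      note x = adjoin_integral[OF A xy(1)] and y = adjoin_integral[OF A xy(2)]
      have "nrm (adjoin A x) < nrm A" "nrm (adjoin A y) < nrm A"
        using x y xy by (auto intro!: nrm_less A)
      then obtain Ps Qs where PQ: "set Ps \<subseteq> primes_of F" "prodl Ps \<subseteq> adjoin A x"
        "set Qs \<subseteq> primes_of F" "prodl Qs \<subseteq> adjoin A y" using less.hyps x(1) y(1) by metis
      note as = frac_add_sub[OF integral_frac[OF A]] and fm = frac_mult[OF integral_frac[OF A]]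
      have "ideal_mult (adjoin A x) (adjoin A y) \<subseteq> A"
      proof (rule ideal_mult_least[OF add_sub_zero[OF as] add_sub_add[OF as]])
        fix u v assume uv: "u \<in> adjoin A x" "v \<in> adjoin A y"
        then obtain a r where a: "u = a + r * x" "a \<in> A" "r \<in> \<O>" by (auto simp: adjoin_def)
        from uv obtain b s where b: "v = b + s * y" "b \<in> A" "s \<in> \<O>" by (auto simp: adjoin_def)
        have "v \<in> \<O>" using integral_subset[OF y(1)] uv by blast
        have "u * v = v * a + ((r * x) * b + (r * s) * (x * y))" by (simp add: a b algebra_simps)
        also have "\<dots> \<in> A"
          by (intro add_sub_add[OF as] fm[OF \<open>v \<in> \<O>\<close> a(2)] fm[OF ints_mult[OF a(3) xy(1)] b(2)]
              fm[OF ints_mult[OF a(3) b(3)] xy(3)])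
        finally show "u * v \<in> A" .
      qed
      then have "prodl (Ps @ Qs) \<subseteq> A"
        using ideal_mult_mono[OF PQ(2,4)] prodl_append[OF PQ(1,3)] by blast
      then show ?thesis using PQ by (intro exI[of _ "Ps @ Qs"]) auto
    qed
  qed
qed

text \<open>\<open>A\<close> contains a positive integer \<open>m\<close>, hence every
  \<open>m * x ^ j\<close>, so \<open>almost_integral\<close> applies.\<close>

lemma stable_imp_integral:
  assumes A: "A \<in> integral_ideals F" and x: "x \<in> F" "\<And>a. a \<in> A \<Longrightarrow> x * a \<in> A"
  shows "x \<in> \<O>"
proof -
  obtain m :: nat where m: "m > 0" "of_nat m \<in> A" by (rule integral_contains_nat[OF A])
  have "of_nat m * x ^ j \<in> A" for j
    by (induction j) (use m x(2) in \<open>auto simp: mult.left_commute\<close>)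
  then show ?thesis using almost_integral[OF x(1) m(1)] integral_subset[OF A] by blast
qed

text \<open>The candidate for the inverse ideal; only for primes is it shown directly to be the
  inverse.\<close>

definition dual :: "'a set \<Rightarrow> 'a set" where
  "dual A = {x \<in> F. \<forall>a\<in>A. x * a \<in> \<O>}"

lemma dual_frac:
  assumes A: "A \<in> integral_ideals F"
  shows "dual A \<in> frac_ideals F" and "1 \<in> dual A"
proof -
  show one: "1 \<in> dual A" using integral_subset[OF A] by (auto simp: dual_def one_mem)
  obtain a where a: "a \<in> A" "a \<noteq> 0" using frac_nonzero[OF integral_frac[OF A]] by blast
  show "dual A \<in> frac_ideals F"
  proof (rule frac_idealI[of _ 1 a])
    show "add_sub (dual A)"
      using diff_mem zero_mem ints_zero ints_diff by (simp add: add_sub_def dual_def left_diff_distrib)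
    show "r * x \<in> dual A" if "r \<in> \<O>" "x \<in> dual A" for r x
      using that ints_mult mult_mem ints_subset by (simp add: dual_def mult.assoc)
    show "a * x \<in> \<O>" if "x \<in> dual A" for x
      using that a(1) by (auto simp: dual_def mult.commute[of a])
    show "a \<in> F" using a frac_subset[OF integral_frac[OF A]] by blast
  qed (use one a in \<open>auto simp: dual_def\<close>)
qed

lemma principal_frac:
  assumes "x \<in> F" "x \<noteq> 0"
  shows "principal F x \<in> frac_ideals F"
proof (rule frac_idealI[of _ x "inverse x"])
  show "principal F x \<subseteq> F" using assms(1) mult_mem ints_subset by (auto simp: principal_iff)
  show "x \<in> principal F x" using ints_one by (force simp: principal_iff)
  show "r * a \<in> principal F x" if "r \<in> \<O>" "a \<in> principal F x" for r a
    using that ints_mult mult.left_commute[of r x] by (auto simp: principal_iff)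
  show "inverse x * a \<in> \<O>" if "a \<in> principal F x" for a
    using that assms(2) by (auto simp: principal_iff mult.assoc[symmetric])
qed (use assms inverse_mem principal_add_sub in auto)

lemma principal_integral: "x \<in> \<O> \<Longrightarrow> x \<noteq> 0 \<Longrightarrow> principal F x \<in> integral_ideals F"
  by (auto simp: integral_ideals_def principal_frac ints_subset principal_iff ints_mult)

text \<open>Take \<open>a \<noteq> 0\<close> in \<open>P\<close> and a shortest product of primes
  inside \<open>(a)\<close>. \<open>P\<close> is one of its factors, and the product without
  \<open>P\<close> contains some \<open>b\<close> outside \<open>(a)\<close>; then
  \<open>b / a\<close> is a nonintegral element of \<open>dual P\<close>. By maximality
  \<open>P * dual P\<close> is \<open>P\<close> or \<open>\<O>\<close>, and in the first case
  \<open>dual P\<close> would stabilize \<open>P\<close> and be integral.\<close>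

lemma prime_dual:
  assumes P: "P \<in> primes_of F"
  shows "ideal_mult P (dual P) = \<O>" and "\<not> dual P \<subseteq> \<O>"
proof -
  note Pi = prime_integral[OF P] and Pf = prime_frac[OF P]
  obtain a where a: "a \<in> P" "a \<noteq> 0" using frac_nonzero[OF Pf] by blast
  have aO: "a \<in> \<O>" using integral_subset[OF Pi] a by blast
  have aP: "principal F a \<subseteq> P"
    using frac_mult[OF Pf _ a(1)] by (auto simp: principal_iff mult.commute)
  define S where "S = (\<lambda>Ps. set Ps \<subseteq> primes_of F \<and> prodl Ps \<subseteq> principal F a)"
  have "\<exists>Ps. S Ps" using contains_prodl[OF principal_integral[OF aO a(2)]] by (auto simp: S_def)
  then obtain Qs where "S Qs" by blast
  define Ps where "Ps = arg_min length S"
  have Ps: "S Ps" "\<And>Qs. S Qs \<Longrightarrow> length Ps \<le> length Qs"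
    unfolding Ps_def using arg_min_natI[of S Qs length] arg_min_nat_le[of S _ length] \<open>S Qs\<close> by auto
  have PPs: "P \<in> set Ps" using prime_prodl[OF P, of Ps] Ps(1) aP by (auto simp: S_def)
  define Rs where "Rs = remove1 P Ps"
  have Rs: "set Rs \<subseteq> primes_of F" using Ps(1) set_remove1_subset[of P Ps] by (auto simp: Rs_def S_def)
  have "length Rs < length Ps" using PPs length_pos_if_in_set[OF PPs] by (simp add: Rs_def length_remove1)
  then have "\<not> S Rs" using Ps(2)[of Rs] by auto
  then obtain b where b: "b \<in> prodl Rs" "b \<notin> principal F a" using Rs by (auto simp: S_def)
  have bO: "b \<in> \<O>" using integral_subset[OF prodl_integral[OF Rs]] b by blast
  have "b / a * p \<in> \<O>" if "p \<in> P" for p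
  proof -
    have "p * b \<in> prodl Ps"
      unfolding prodl_remove1[OF PPs] Rs_def[symmetric] by (rule ideal_mult_memI[OF that b(1)])
    then have "p * b \<in> principal F a" using Ps(1) by (auto simp: S_def)
    then obtain r where "r \<in> \<O>" "p * b = a * r" by (auto simp: principal_iff)
    then show ?thesis using a(2) by (simp add: field_simps)
  qed
  then have "b / a \<in> dual P" using divide_mem[OF ints_subset[OF bO] ints_subset[OF aO]] by (simp add: dual_def)
  moreover have "b / a \<notin> \<O>"
  proof
    assume "b / a \<in> \<O>"
    then have "b \<in> principal F a" using a(2) by (auto simp: principal_iff intro!: bexI[of _ "b / a"])
    with b show False by simp
  qed
  ultimately show nsub: "\<not> dual P \<subseteq> \<O>" by blast
  let ?M = "ideal_mult P (dual P)"
  have MO: "?M \<subseteq> \<O>"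
    by (intro ideal_mult_least ints_zero ints_add) (auto simp: dual_def mult.commute)
  have Mi: "?M \<in> integral_ideals F"
    using MO ideal_mult_frac[OF Pf dual_frac(1)[OF Pi]] by (simp add: integral_ideals_def)
  have PM: "P \<subseteq> ?M" using ideal_mult_memI[OF _ dual_frac(2)[OF Pi], of _ P] by auto
  show "?M = \<O>"
  proof (rule ccontr)
    assume "?M \<noteq> \<O>"
    then have "1 \<notin> ?M" using integral_eq_ints[OF Mi] by blast
    then have eq: "?M = P" by (rule prime_maximal[OF P Mi PM])
    have "dual P \<subseteq> \<O>"
    proof
      fix x assume x: "x \<in> dual P"
      have "x * p \<in> P" if "p \<in> P" for p
        using ideal_mult_memI[OF that x] eq by (simp add: mult.commute)
      then show "x \<in> \<O>" using x by (intro stable_imp_integral[OF Pi]) (auto simp: dual_def)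
    qed
    with nsub show False by blast
  qed
qed

text \<open>For a prime \<open>P\<close> above \<open>A\<close>, the integral ideal
  \<open>A * dual P\<close> is strictly larger than \<open>A\<close>, since otherwise
  \<open>dual P\<close> would stabilize \<open>A\<close> and be integral. Its norm is smaller, and
  multiplying its factorization by \<open>P\<close> gives that of \<open>A\<close>.\<close>

lemma factorization:
  "A \<in> integral_ideals F \<Longrightarrow> \<exists>Ps. set Ps \<subseteq> primes_of F \<and> A = prodl Ps"
proof (induction "nrm A" arbitrary: A rule: less_induct)
  case less
  note A = less.prems and Af = integral_frac[OF less.prems]
  show ?case
  proof (cases "1 \<in> A")
    case True
    then show ?thesis using integral_eq_ints[OF A] by (intro exI[of _ "[]"]) auto
  next
    case False
    then obtain P where P: "P \<in> primes_of F" "A \<subseteq> P" by (rule ex_prime_above[OF A])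
    note Pi = prime_integral[OF P(1)] and D = dual_frac[OF prime_integral[OF P(1)]]
    define B where "B = ideal_mult A (dual P)"
    have "B \<subseteq> \<O>" unfolding B_def
      using ideal_mult_mono[OF P(2) order_refl, of "dual P"] prime_dual(1)[OF P(1)] by simp
    then have B: "B \<in> integral_ideals F"
      unfolding B_def using ideal_mult_frac[OF Af D(1)] by (simp add: integral_ideals_def)
    have AB: "A \<subseteq> B" using ideal_mult_memI[OF _ D(2), of _ A] by (auto simp: B_def)
    have "A \<noteq> B"
    proof
      assume eq: "A = B"
      have "dual P \<subseteq> \<O>"
      proof
        fix x assume x: "x \<in> dual P"
        have "x * p \<in> A" if "p \<in> A" for p
          using ideal_mult_memI[OF that x, folded B_def, folded eq] by (simp add: mult.commute)
        then show "x \<in> \<O>" using x by (intro stable_imp_integral[OF A]) (auto simp: dual_def)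
      qed
      then show False using prime_dual(2)[OF P(1)] by blast
    qed
    with AB have "A \<subset> B" by blast
    then have "nrm B < nrm A" by (rule nrm_less[OF A B])
    then obtain Ps where Ps: "set Ps \<subseteq> primes_of F" "B = prodl Ps" using less.hyps B by blast
    have "A = ideal_mult A (ideal_mult P (dual P))"
      by (simp add: prime_dual(1)[OF P(1)] ideal_mult_ints[OF Af])
    also have "\<dots> = ideal_mult P B" by (simp add: B_def ideal_mult_left_commute)
    finally show ?thesis using Ps P(1) by (intro exI[of _ "P # Ps"]) simp
  qed
qed

section \<open>The group of fractional ideals\<close>

lemma frac_group_simps [simp]:
  "carrier (frac_group F) = frac_ideals F" "A \<otimes>\<^bsub>frac_group F\<^esub> B = ideal_mult A B"
  "\<one>\<^bsub>frac_group F\<^esub> = \<O>"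
  by (simp_all add: frac_group_def)

lemma prodl_inverse:
  "set Ps \<subseteq> primes_of F \<Longrightarrow> \<exists>C\<in>frac_ideals F. ideal_mult C (prodl Ps) = \<O>"
proof (induction Ps)
  case Nil
  then show ?case
    using ints_integral integral_frac ideal_mult_ints by (intro bexI[of _ \<O>]) auto
next
  case (Cons P Ps)
  then obtain C where C: "C \<in> frac_ideals F" "ideal_mult C (prodl Ps) = \<O>" by auto
  have P: "P \<in> primes_of F" using Cons.prems by simp
  have "ideal_mult (ideal_mult C (dual P)) (prodl (P # Ps)) =
      ideal_mult (ideal_mult P (dual P)) (ideal_mult C (prodl Ps))"
    by (simp add: ideal_mult_ac)
  also have "\<dots> = \<O>" using C prime_dual(1)[OF P] ideal_mult_ints[OF integral_frac[OF ints_integral]] by simp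
  finally show ?case
    using ideal_mult_frac[OF C(1) dual_frac(1)[OF prime_integral[OF P]]] by blast
qed

lemma frac_integral_multiple:
  assumes A: "A \<in> frac_ideals F"
  obtains e where "e \<in> \<O>" "e \<noteq> 0" "ideal_mult (principal F e) A \<in> integral_ideals F"
proof -
  obtain e where e: "e \<in> \<O>" "e \<noteq> 0" "\<And>a. a \<in> A \<Longrightarrow> e * a \<in> \<O>" using A unfolding frac_ideals_def by blast
  have "x * a \<in> \<O>" if xa: "x \<in> principal F e" "a \<in> A" for x a
  proof -
    obtain r where "r \<in> \<O>" "x = e * r" using xa by (auto simp: principal_iff)
    then have "x * a = r * (e * a)" "r * (e * a) \<in> \<O>" using ints_mult[OF _ e(3)[OF xa(2)]] by simp_all
    then show ?thesis by (simp only:)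
  qed
  then have "ideal_mult (principal F e) A \<subseteq> \<O>"
    by (intro ideal_mult_least ints_zero ints_add)
  then show ?thesis
    using that[OF e(1,2)] ideal_mult_frac[OF principal_frac[OF ints_subset[OF e(1)] e(2)] A]
    by (simp add: integral_ideals_def)
qed

lemma comm_group_frac: "comm_group (frac_group F)"
proof (rule comm_groupI)
  fix A assume "A \<in> carrier (frac_group F)"
  then have A: "A \<in> frac_ideals F" by simp
  obtain e where e: "e \<in> \<O>" "e \<noteq> 0" "ideal_mult (principal F e) A \<in> integral_ideals F"
    by (rule frac_integral_multiple[OF A])
  obtain Ps where "set Ps \<subseteq> primes_of F" "ideal_mult (principal F e) A = prodl Ps"
    using factorization[OF e(3)] by blast
  then obtain C where C: "C \<in> frac_ideals F" "ideal_mult C (ideal_mult (principal F e) A) = \<O>"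
    using prodl_inverse by metis
  show "\<exists>B\<in>carrier (frac_group F). B \<otimes>\<^bsub>frac_group F\<^esub> A = \<one>\<^bsub>frac_group F\<^esub>"
    using ideal_mult_frac[OF C(1) principal_frac[OF ints_subset[OF e(1)] e(2)]] C(2)
    by (intro bexI[of _ "ideal_mult C (principal F e)"]) (auto simp: ideal_mult_assoc)
  show "A \<otimes>\<^bsub>frac_group F\<^esub> B = B \<otimes>\<^bsub>frac_group F\<^esub> A" for B
    by (simp only: frac_group_simps ideal_mult_commute)
qed (simp_all add: ideal_mult_frac ideal_mult_assoc ideal_mult_ints_left integral_frac[OF ints_integral])

end

section \<open>Products of powers in an abelian group\<close>

text \<open>The base \<open>u\<close> is a parameter so that the image of a factorization under a
  homomorphism has the same form, see \<open>gexp_hom\<close>: this will be applied to Galois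
  conjugation, extension of ideals and the product of conjugates.\<close>

definition gexp :: "('g, 'm) monoid_scheme \<Rightarrow> ('b \<Rightarrow> 'g) \<Rightarrow> ('b \<Rightarrow> int) \<Rightarrow> 'g" where
  "gexp G u e = finprod G (\<lambda>P. u P [^]\<^bsub>G\<^esub> e P) {P. e P \<noteq> 0}"

context comm_group
begin

lemma gexp_superset:
  assumes "finite S" "{P. e P \<noteq> 0} \<subseteq> S" "\<And>P. P \<in> S \<Longrightarrow> u P \<in> carrier G"
  shows "gexp G u e = finprod G (\<lambda>P. u P [^] e P) S"
  unfolding gexp_def using assms
  by (intro finprod_mono_neutral_cong_left) (auto intro: int_pow_closed)

lemma gexp_closed:
  assumes "\<And>P. e P \<noteq> 0 \<Longrightarrow> u P \<in> carrier G"
  shows "gexp G u e \<in> carrier G"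
  unfolding gexp_def using assms by (intro finprod_closed) auto

lemma gexp_zero: "gexp G u (\<lambda>_. 0) = \<one>"
  by (simp add: gexp_def)

lemma gexp_add:
  assumes "finite {P. e P \<noteq> 0}" "finite {P. f P \<noteq> 0}"
    and "\<And>P. e P \<noteq> 0 \<or> f P \<noteq> 0 \<Longrightarrow> u P \<in> carrier G"
  shows "gexp G u (\<lambda>P. e P + f P) = gexp G u e \<otimes> gexp G u f"
proof -
  let ?S = "{P. e P \<noteq> 0} \<union> {P. f P \<noteq> 0}"
  have u: "u P \<in> carrier G" if "P \<in> ?S" for P using assms(3) that by auto
  have S: "finite ?S" using assms by simp
  have "gexp G u (\<lambda>P. e P + f P) = finprod G (\<lambda>P. u P [^] (e P + f P)) ?S"
    using S u by (intro gexp_superset) auto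
  also have "\<dots> = finprod G (\<lambda>P. u P [^] e P \<otimes> u P [^] f P) ?S"
    using u by (intro finprod_cong') (auto simp: int_pow_mult)
  also have "\<dots> = finprod G (\<lambda>P. u P [^] e P) ?S \<otimes> finprod G (\<lambda>P. u P [^] f P) ?S"
    using u by (intro finprod_multf) auto
  also have "finprod G (\<lambda>P. u P [^] e P) ?S = gexp G u e"
    using S u by (intro gexp_superset[symmetric]) auto
  also have "finprod G (\<lambda>P. u P [^] f P) ?S = gexp G u f"
    using S u by (intro gexp_superset[symmetric]) auto
  finally show ?thesis .
qed

lemma gexp_uminus:
  assumes "finite {P. e P \<noteq> 0}" "\<And>P. e P \<noteq> 0 \<Longrightarrow> u P \<in> carrier G"
  shows "gexp G u (\<lambda>P. - e P) = inv (gexp G u e)"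
proof -
  have "gexp G u (\<lambda>P. - e P) \<otimes> gexp G u e = gexp G u (\<lambda>P. - e P + e P)"
    using assms by (intro gexp_add[symmetric]) auto
  also have "\<dots> = \<one>" by (simp add: gexp_zero)
  finally show ?thesis
    using assms by (intro inv_equality[symmetric] gexp_closed) auto
qed

lemma gexp_single:
  assumes "u P \<in> carrier G"
  shows "gexp G u (\<lambda>Q. if Q = P then n else 0) = u P [^] n"
proof -
  have "gexp G u (\<lambda>Q. if Q = P then n else 0) =
      finprod G (\<lambda>Q. u Q [^] (if Q = P then n else 0)) {P}"
    using assms by (intro gexp_superset) (auto split: if_splits)
  then show ?thesis using assms by simp
qed

lemma hom_finprod_group:
  assumes H: "comm_group H" and h: "h \<in> hom G H" and fin: "finite S"
    and u: "\<And>P. P \<in> S \<Longrightarrow> u P \<in> carrier G"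
  shows "h (finprod G u S) = finprod H (\<lambda>P. h (u P)) S"
proof -
  interpret H: comm_group H by (rule H)
  have hc: "h x \<in> carrier H" if "x \<in> carrier G" for x using h that by (auto simp: hom_def)
  from fin u show ?thesis
  proof (induction S rule: finite_induct)
    case empty
    then show ?case using hom_one[OF h group_axioms H.is_group] by simp
  next
    case (insert P S)
    have "h (finprod G u (insert P S)) = h (u P \<otimes> finprod G u S)"
      using insert by (subst finprod_insert) auto
    also have "\<dots> = h (u P) \<otimes>\<^bsub>H\<^esub> h (finprod G u S)"
      using insert.prems by (intro hom_mult[OF h]) auto
    also have "\<dots> = finprod H (\<lambda>P. h (u P)) (insert P S)"
      using insert hc by (subst H.finprod_insert) auto
    finally show ?case .
  qed
qed

lemma gexp_hom:
  assumes H: "comm_group H" and h: "h \<in> hom G H" and fin: "finite {P. e P \<noteq> 0}"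
    and u: "\<And>P. e P \<noteq> 0 \<Longrightarrow> u P \<in> carrier G"
  shows "h (gexp G u e) = gexp H (\<lambda>P. h (u P)) e"
proof -
  interpret H: comm_group H by (rule H)
  have hc: "h x \<in> carrier H" if "x \<in> carrier G" for x using h that by (auto simp: hom_def)
  have "h (gexp G u e) = finprod H (\<lambda>P. h (u P [^] e P)) {P. e P \<noteq> 0}"
    unfolding gexp_def using u by (intro hom_finprod_group[OF H h fin]) auto
  also have "\<dots> = gexp H (\<lambda>P. h (u P)) e"
    unfolding gexp_def using u hc
    by (intro H.finprod_cong') (auto simp: hom_int_pow[OF h _ group_axioms H.is_group])
  finally show ?thesis .
qed

end

lemma (in comm_group) gexp_cong:
  assumes "\<And>P. e P \<noteq> 0 \<Longrightarrow> u P = w P" "\<And>P. e P \<noteq> 0 \<Longrightarrow> w P \<in> carrier G"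
  shows "gexp G u e = gexp G w e"
  unfolding gexp_def using assms by (intro finprod_cong') auto

section \<open>Valuations\<close>

context nfield
begin

interpretation I: comm_group "frac_group F" by (rule comm_group_frac)

lemma frac_inv_closed: "A \<in> frac_ideals F \<Longrightarrow> inv\<^bsub>frac_group F\<^esub> A \<in> frac_ideals F"
  using I.inv_closed[of A] by simp

lemma frac_inv: "A \<in> frac_ideals F \<Longrightarrow> ideal_mult A (inv\<^bsub>frac_group F\<^esub> A) = \<O>"
  using I.r_inv[of A] by simp

lemma prodl_replicate: "prodl (replicate n P) = P [^]\<^bsub>frac_group F\<^esub> n"
  by (induction n) (simp_all add: ideal_mult_commute)

text \<open>The exponent functions over which the description in \<open>ideal_val\<close> ranges,
  that is, the divisors of the field.\<close>

definition fac :: "('a set \<Rightarrow> int) \<Rightarrow> bool" where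
  "fac e \<longleftrightarrow> finite {P. e P \<noteq> 0} \<and> {P. e P \<noteq> 0} \<subseteq> primes_of F"

lemma fac_prime: "fac e \<Longrightarrow> e P \<noteq> 0 \<Longrightarrow> P \<in> primes_of F"
  and fac_finite: "fac e \<Longrightarrow> finite {P. e P \<noteq> 0}"
  by (auto simp: fac_def)

lemma fac_add:
  assumes "fac e" "fac f"
  shows "fac (\<lambda>P. e P + f P)"
proof -
  have "{P. e P + f P \<noteq> 0} \<subseteq> {P. e P \<noteq> 0} \<union> {P. f P \<noteq> 0}" by auto
  moreover have "finite ({P. e P \<noteq> 0} \<union> {P. f P \<noteq> 0})" using assms by (simp add: fac_def)
  ultimately show ?thesis using assms finite_subset unfolding fac_def by blast
qed

lemma fac_uminus: "fac e \<Longrightarrow> fac (\<lambda>P. - e P)"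
  by (simp add: fac_def)

lemma fac_diff: "fac e \<Longrightarrow> fac f \<Longrightarrow> fac (\<lambda>P. e P - f P)"
  using fac_add[of e "\<lambda>P. - f P"] fac_uminus[of f] by simp

lemma fac_subset:
  assumes "fac e" "\<And>P. f P \<noteq> 0 \<Longrightarrow> e P \<noteq> 0"
  shows "fac f"
proof -
  have sub: "{P. f P \<noteq> 0} \<subseteq> {P. e P \<noteq> 0}" using assms(2) by blast
  with assms(1) show ?thesis using finite_subset[OF sub] by (auto simp: fac_def)
qed

lemma fac_zero: "fac (\<lambda>_. 0)"
  by (simp add: fac_def)

lemma fac_single: "P \<in> primes_of F \<Longrightarrow> fac (\<lambda>Q. if Q = P then n else 0)"
  by (auto simp: fac_def)

abbreviation idl :: "('a set \<Rightarrow> int) \<Rightarrow> 'a set" where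
  "idl e \<equiv> gexp (frac_group F) (\<lambda>P. P) e"

lemma idl_frac: "fac e \<Longrightarrow> idl e \<in> frac_ideals F"
  using I.gexp_closed[of e "\<lambda>P. P"] fac_prime[of e] prime_frac by auto

lemma idl_add: "fac e \<Longrightarrow> fac f \<Longrightarrow> idl (\<lambda>P. e P + f P) = ideal_mult (idl e) (idl f)"
proof -
  assume ef: "fac e" "fac f"
  then have "P \<in> carrier (frac_group F)" if "e P \<noteq> 0 \<or> f P \<noteq> 0" for P
    using that fac_prime[OF ef(1)] fac_prime[OF ef(2)] prime_frac by auto
  then show ?thesis using I.gexp_add[of e f "\<lambda>P. P"] ef by (simp add: fac_finite)
qed

lemma idl_nonneg_prodl:
  assumes e: "fac e" "\<And>P. e P \<ge> 0"
  obtains Ps where "set Ps = {P. e P \<noteq> 0}" "idl e = prodl Ps"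
proof -
  have "\<exists>Ps. set Ps = S \<and> finprod (frac_group F) (\<lambda>P. P [^]\<^bsub>frac_group F\<^esub> e P) S = prodl Ps"
    if "finite S" "S \<subseteq> {P. e P \<noteq> 0}" for S
    using that
  proof (induction S rule: finite_induct)
    case empty
    then show ?case by (intro exI[of _ "[]"]) simp
  next
    case (insert P S)
    then obtain Ps where Ps: "set Ps = S" "finprod (frac_group F) (\<lambda>P. P [^]\<^bsub>frac_group F\<^esub> e P) S = prodl Ps"
      by auto
    have pr: "insert P S \<subseteq> primes_of F" using insert.prems e(1) by (auto simp: fac_def)
    have cl: "Q [^]\<^bsub>frac_group F\<^esub> e Q \<in> frac_ideals F" if "Q \<in> insert P S" for Q
      using I.int_pow_closed[of Q "e Q"] pr prime_frac that by auto
    have eP: "e P = int (nat (e P))" "nat (e P) > 0" using e(2)[of P] insert.prems by auto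
    have "finprod (frac_group F) (\<lambda>P. P [^]\<^bsub>frac_group F\<^esub> e P) (insert P S) =
        ideal_mult (P [^]\<^bsub>frac_group F\<^esub> e P) (prodl Ps)"
      using insert cl Ps(2) by (subst I.finprod_insert) auto
    also have "P [^]\<^bsub>frac_group F\<^esub> e P = prodl (replicate (nat (e P)) P)"
      unfolding prodl_replicate by (metis eP(1) int_pow_int)
    also have "ideal_mult (prodl (replicate (nat (e P)) P)) (prodl Ps) = prodl (replicate (nat (e P)) P @ Ps)"
      using pr Ps(1) by (intro prodl_append[symmetric]) auto
    finally show ?case using eP(2) Ps(1) by (intro exI[of _ "replicate (nat (e P)) P @ Ps"]) auto
  qed
  from this[OF fac_finite[OF e(1)] order_refl] that show ?thesis by (auto simp: gexp_def)
qed

text \<open>Uniqueness of factorization. The positive and negative parts of \<open>e\<close> give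
  equal products of primes, hence have the same support by \<open>prime_prodl\<close>; their
  supports being disjoint, both vanish.\<close>

lemma idl_eq_one_imp:
  assumes e: "fac e" "idl e = \<O>"
  shows "e P = 0"
proof -
  define p where "p = (\<lambda>P. max (e P) 0)"
  define n where "n = (\<lambda>P. max (- e P) 0)"
  have p: "fac p" by (rule fac_subset[OF e(1)]) (simp add: p_def max_def split: if_splits)
  have n: "fac n" by (rule fac_subset[OF e(1)]) (simp add: n_def max_def split: if_splits)
  have pos: "p P \<ge> 0" "n P \<ge> 0" for P by (simp_all add: p_def n_def)
  have "p = (\<lambda>P. e P + n P)" by (auto simp: p_def n_def)
  then have eq: "idl p = idl n"
    using idl_add[OF e(1) n] e(2) ideal_mult_ints_left[OF idl_frac[OF n]] by simp
  obtain Ps where Ps: "set Ps = {P. p P \<noteq> 0}" "idl p = prodl Ps" by (rule idl_nonneg_prodl[OF p pos(1)])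
  obtain Qs where Qs: "set Qs = {P. n P \<noteq> 0}" "idl n = prodl Qs" by (rule idl_nonneg_prodl[OF n pos(2)])
  have sets: "set Ps \<subseteq> primes_of F" "set Qs \<subseteq> primes_of F" using p n Ps(1) Qs(1) by (auto simp: fac_def)
  have sub: "Q \<in> set Ys" if Xs: "set Xs \<subseteq> primes_of F" and Ys: "set Ys \<subseteq> primes_of F"
    and "prodl Xs = prodl Ys" "Q \<in> set Xs" for Xs Ys Q
  proof -
    have Q: "Q \<in> primes_of F" using that by blast
    have "prodl Xs = ideal_mult Q (prodl (remove1 Q Xs))" by (rule prodl_remove1[OF that(4)])
    also have "\<dots> \<subseteq> Q"
      using Xs set_remove1_subset[of Q Xs]
      by (intro ideal_mult_subset_left prime_integral[OF Q] prodl_integral) auto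
    finally show ?thesis using prime_prodl[OF Q Ys] that by simp
  qed
  have "set Ps = set Qs" using sub[of Ps Qs] sub[of Qs Ps] sets eq Ps(2) Qs(2) by auto
  then have "p P \<noteq> 0 \<longleftrightarrow> n P \<noteq> 0" using Ps(1) Qs(1) by auto
  then show ?thesis by (auto simp: p_def n_def max_def split: if_splits)
qed

lemma idl_inj:
  assumes "fac e" "fac f" "idl e = idl f"
  shows "e = f"
proof
  fix P
  have "idl (\<lambda>P. e P + - f P) = ideal_mult (idl e) (idl (\<lambda>P. - f P))"
    by (intro idl_add assms fac_uminus)
  also have "\<dots> = idl (\<lambda>P. f P + - f P)"
    unfolding assms(3) by (intro idl_add[symmetric] assms fac_uminus)
  also have "\<dots> = \<O>" by (simp add: I.gexp_zero[simplified])
  finally show "e P = f P"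
    using idl_eq_one_imp[of "\<lambda>P. e P + - f P" P] assms by (simp add: fac_diff)
qed

lemma prodl_idl: "set Ps \<subseteq> primes_of F \<Longrightarrow> \<exists>e. fac e \<and> (\<forall>P. e P \<ge> 0) \<and> idl e = prodl Ps"
proof (induction Ps)
  case Nil
  then show ?case using I.gexp_zero[of "\<lambda>P. P"] fac_zero by (intro exI[of _ "\<lambda>_. 0"]) simp
next
  case (Cons P Ps)
  then obtain e where e: "fac e" "\<forall>P. e P \<ge> 0" "idl e = prodl Ps" by auto
  have P: "P \<in> primes_of F" using Cons.prems by simp
  let ?s = "\<lambda>Q. if Q = P then 1 else 0 :: int"
  have "idl ?s = P" using I.gexp_single[of "\<lambda>P. P" P 1] prime_frac[OF P] by simp
  then have "idl (\<lambda>Q. ?s Q + e Q) = prodl (P # Ps)"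
    using idl_add[OF fac_single[OF P, of 1] e(1)] e(3) by simp
  then show ?case using fac_add[OF fac_single[OF P, of 1] e(1)] e(2)
    by (intro exI[of _ "\<lambda>Q. ?s Q + e Q"]) auto
qed

lemma integral_idl:
  assumes "A \<in> integral_ideals F"
  obtains e where "fac e" "\<And>P. e P \<ge> 0" "idl e = A"
proof -
  obtain Ps where "set Ps \<subseteq> primes_of F" "A = prodl Ps" using factorization[OF assms] by blast
  with prodl_idl[of Ps] that show ?thesis by blast
qed

lemma frac_idl:
  assumes A: "A \<in> frac_ideals F"
  obtains e where "fac e" "idl e = A"
proof -
  obtain x where x: "x \<in> \<O>" "x \<noteq> 0" "ideal_mult (principal F x) A \<in> integral_ideals F"
    by (rule frac_integral_multiple[OF A])
  note xi = principal_integral[OF x(1,2)]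
  obtain e where e: "fac e" "idl e = ideal_mult (principal F x) A" by (rule integral_idl[OF x(3)])
  obtain f where f: "fac f" "idl f = principal F x" by (rule integral_idl[OF xi])
  have "idl (\<lambda>P. - f P) = inv\<^bsub>frac_group F\<^esub> (principal F x)"
    unfolding f(2)[symmetric] using f(1) by (intro I.gexp_uminus) (auto simp: fac_finite fac_prime[OF f(1)] prime_frac)
  then have "idl (\<lambda>P. e P + - f P) = ideal_mult (ideal_mult (principal F x) A) (inv\<^bsub>frac_group F\<^esub> (principal F x))"
    using idl_add[OF e(1) fac_uminus[OF f(1)]] e(2) by simp
  also have "\<dots> = ideal_mult A (ideal_mult (principal F x) (inv\<^bsub>frac_group F\<^esub> (principal F x)))"
    by (metis ideal_mult_assoc ideal_mult_commute)
  also have "\<dots> = A" using frac_inv[OF integral_frac[OF xi]] ideal_mult_ints[OF A] by simp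
  finally show ?thesis using that[OF fac_add[OF e(1) fac_uminus[OF f(1)]]] by blast
qed

text \<open>Existence and uniqueness of the factorization, which make the description in
  \<open>ideal_val\<close> denote.\<close>

lemma val_unique:
  assumes "fac e"
  shows "ideal_val F (idl e) = e"
  unfolding ideal_val_def
proof (rule the_equality)
  show "finite {P. e P \<noteq> 0} \<and> {P. e P \<noteq> 0} \<subseteq> primes_of F \<and>
      idl e = finprod (frac_group F) (\<lambda>P. P [^]\<^bsub>frac_group F\<^esub> e P) {P. e P \<noteq> 0}"
    using assms by (simp add: fac_def gexp_def)
  fix f :: "'a set \<Rightarrow> int"
  assume "finite {P. f P \<noteq> 0} \<and> {P. f P \<noteq> 0} \<subseteq> primes_of F \<and>
      idl e = finprod (frac_group F) (\<lambda>P. P [^]\<^bsub>frac_group F\<^esub> f P) {P. f P \<noteq> 0}"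
  then have "fac f" "idl f = idl e" by (auto simp: fac_def gexp_def)
  then show "f = e" using idl_inj[OF _ assms] by blast
qed

abbreviation "val \<equiv> ideal_val F"

lemma val_fac: "A \<in> frac_ideals F \<Longrightarrow> fac (val A)"
  and idl_val: "A \<in> frac_ideals F \<Longrightarrow> idl (val A) = A"
proof -
  assume "A \<in> frac_ideals F"
  then obtain e where e: "fac e" "idl e = A" by (rule frac_idl)
  then have "val A = e" using val_unique by blast
  with e show "fac (val A)" "idl (val A) = A" by simp_all
qed

lemma val_prime_of: "A \<in> frac_ideals F \<Longrightarrow> val A P \<noteq> 0 \<Longrightarrow> P \<in> primes_of F"
  by (rule fac_prime[OF val_fac])

lemma val_finite: "A \<in> frac_ideals F \<Longrightarrow> finite {P. val A P \<noteq> 0}"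
  by (rule fac_finite[OF val_fac])

lemma val_inject:
  assumes "A \<in> frac_ideals F" "B \<in> frac_ideals F" "val A = val B"
  shows "A = B"
proof -
  have "A = idl (val A)" by (rule idl_val[OF assms(1), symmetric])
  also have "\<dots> = B" unfolding assms(3) by (rule idl_val[OF assms(2)])
  finally show ?thesis .
qed

lemma val_mult:
  assumes "A \<in> frac_ideals F" "B \<in> frac_ideals F"
  shows "val (ideal_mult A B) P = val A P + val B P"
proof -
  have "ideal_mult A B = idl (\<lambda>P. val A P + val B P)"
    using idl_add[OF val_fac[OF assms(1)] val_fac[OF assms(2)]] idl_val assms by simp
  then show ?thesis using val_unique[OF fac_add[OF val_fac[OF assms(1)] val_fac[OF assms(2)]]] by simp
qed

lemma val_one: "val \<O> P = 0"
  using val_unique[OF fac_zero] I.gexp_zero[of "\<lambda>P. P"] by simp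

lemma val_inv:
  assumes "A \<in> frac_ideals F"
  shows "val (inv\<^bsub>frac_group F\<^esub> A) P = - val A P"
  using val_mult[OF assms frac_inv_closed[OF assms], of P] frac_inv[OF assms] val_one[of P] by simp

lemma val_prime: "P \<in> primes_of F \<Longrightarrow> val P = (\<lambda>Q. if Q = P then 1 else 0)"
  using val_unique[OF fac_single[of P 1]] I.gexp_single[of "\<lambda>P. P" P 1] prime_frac[of P] by simp

lemma val_nat_pow: "A \<in> frac_ideals F \<Longrightarrow> val (A [^]\<^bsub>frac_group F\<^esub> (n::nat)) P = int n * val A P"
  using I.nat_pow_closed[of A] by (induction n) (simp_all add: val_one val_mult distrib_right)

lemma val_finprod:
  assumes "finite S" "\<And>i. i \<in> S \<Longrightarrow> u i \<in> frac_ideals F"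
  shows "val (finprod (frac_group F) u S) P = (\<Sum>i\<in>S. val (u i) P)"
  using assms
proof (induction S rule: finite_induct)
  case (insert i S)
  have "finprod (frac_group F) u S \<in> carrier (frac_group F)" using insert.prems by (intro I.finprod_closed) auto
  then show ?case using insert by (subst I.finprod_insert) (auto simp: val_mult)
qed (simp add: val_one)

lemma val_nonneg_iff:
  assumes A: "A \<in> frac_ideals F"
  shows "A \<subseteq> \<O> \<longleftrightarrow> (\<forall>P. val A P \<ge> 0)"
proof
  assume "A \<subseteq> \<O>"
  then have "A \<in> integral_ideals F" using A by (simp add: integral_ideals_def)
  then obtain e where e: "fac e" "\<And>P. e P \<ge> 0" "idl e = A" using integral_idl[of A] by metis
  then show "\<forall>P. val A P \<ge> 0" using val_unique[OF e(1)] by simp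
next
  assume "\<forall>P. val A P \<ge> 0"
  then have nonneg: "\<And>P. val A P \<ge> 0" by blast
  obtain Ps where Ps: "set Ps = {P. val A P \<noteq> 0}" "idl (val A) = prodl Ps"
    by (rule idl_nonneg_prodl[OF val_fac[OF A] nonneg])
  then have "set Ps \<subseteq> primes_of F" using val_prime_of[OF A] by auto
  then show "A \<subseteq> \<O>" using integral_subset[OF prodl_integral] Ps(2) idl_val[OF A] by metis
qed

text \<open>To contain is to divide: \<open>A \<subseteq> B\<close> means that \<open>A\<close>
  times the inverse of \<open>B\<close> is integral.\<close>

lemma val_le_iff:
  assumes A: "A \<in> frac_ideals F" and B: "B \<in> frac_ideals F"
  shows "A \<subseteq> B \<longleftrightarrow> (\<forall>P. val B P \<le> val A P)"
proof -
  let ?C = "ideal_mult A (inv\<^bsub>frac_group F\<^esub> B)"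
  have C: "?C \<in> frac_ideals F" by (intro ideal_mult_frac A frac_inv_closed B)
  have "A \<subseteq> B \<longleftrightarrow> ?C \<subseteq> \<O>"
  proof
    assume "A \<subseteq> B"
    then show "?C \<subseteq> \<O>" using ideal_mult_mono[of A B] frac_inv[OF B] by blast
  next
    assume "?C \<subseteq> \<O>"
    then have "ideal_mult ?C B \<subseteq> ideal_mult \<O> B" by (intro ideal_mult_mono) auto
    moreover have "ideal_mult ?C B = ideal_mult A (ideal_mult B (inv\<^bsub>frac_group F\<^esub> B))"
      by (metis ideal_mult_assoc ideal_mult_commute)
    ultimately show "A \<subseteq> B" using frac_inv[OF B] ideal_mult_ints[OF A] ideal_mult_ints_left[OF B] by simp
  qed
  then show ?thesis using val_nonneg_iff[OF C] by (simp add: val_mult A B frac_inv_closed val_inv)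
qed

lemma subset_prime_iff:
  assumes A: "A \<in> integral_ideals F" and P: "P \<in> primes_of F"
  shows "A \<subseteq> P \<longleftrightarrow> val A P > 0"
proof -
  have "\<forall>Q. val A Q \<ge> 0" using val_nonneg_iff[OF integral_frac[OF A]] integral_subset[OF A] by blast
  then show ?thesis
    unfolding val_le_iff[OF integral_frac[OF A] prime_frac[OF P]] val_prime[OF P]
    by (auto split: if_splits)
qed

lemma supp_iff:
  assumes A: "A \<in> integral_ideals F"
  shows "P \<in> supp F A \<longleftrightarrow> val A P \<noteq> 0"
proof -
  have nonneg: "\<forall>Q. val A Q \<ge> 0" using val_nonneg_iff[OF integral_frac[OF A]] integral_subset[OF A] by blast
  show ?thesis
  proof
    assume "P \<in> supp F A"
    then obtain C where "P \<in> primes_of F" "C \<in> integral_ideals F" "A = ideal_mult P C" by (auto simp: supp_def)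
    then have "A \<subseteq> P" "P \<in> primes_of F" using ideal_mult_subset_left prime_integral by auto
    then show "val A P \<noteq> 0" using subset_prime_iff[OF A] by auto
  next
    assume nz: "val A P \<noteq> 0"
    then have P: "P \<in> primes_of F" using val_prime_of[OF integral_frac[OF A]] by blast
    let ?C = "ideal_mult A (inv\<^bsub>frac_group F\<^esub> P)"
    note fr = integral_frac[OF A] frac_inv_closed[OF prime_frac[OF P]]
    have C: "?C \<in> frac_ideals F" by (intro ideal_mult_frac fr)
    have "val ?C Q \<ge> 0" for Q
      using nonneg nz by (auto simp: val_mult fr val_inv prime_frac[OF P] val_prime[OF P] order_less_le)
    then have "?C \<in> integral_ideals F" using val_nonneg_iff[OF C] C by (simp add: integral_ideals_def)
    moreover have "A = ideal_mult P ?C"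
      using frac_inv[OF prime_frac[OF P]] ideal_mult_ints[OF fr(1)] by (metis ideal_mult_left_commute)
    ultimately show "P \<in> supp F A" using P by (auto simp: supp_def)
  qed
qed

lemma principal_mult: "principal F (x * y) = ideal_mult (principal F x) (principal F y)"
proof
  show "principal F (x * y) \<subseteq> ideal_mult (principal F x) (principal F y)"
  proof
    fix z assume "z \<in> principal F (x * y)"
    then obtain r where "r \<in> \<O>" "z = x * 1 * (y * r)" by (auto simp: principal_iff mult.assoc)
    then show "z \<in> ideal_mult (principal F x) (principal F y)"
      using ints_one by (auto simp: principal_iff simp del: mult_1_right intro!: ideal_mult_memI)
  qed
  show "ideal_mult (principal F x) (principal F y) \<subseteq> principal F (x * y)"
  proof (rule ideal_mult_least[OF add_sub_zero[OF principal_add_sub] add_sub_add[OF principal_add_sub]])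
    fix a b assume "a \<in> principal F x" "b \<in> principal F y"
    then obtain r s where "r \<in> \<O>" "s \<in> \<O>" "a * b = (x * y) * (r * s)"
      by (auto simp: principal_iff ac_simps)
    then show "a * b \<in> principal F (x * y)" using ints_mult by (auto simp: principal_iff)
  qed
qed

lemma principal_one: "principal F 1 = \<O>"
  by (auto simp: principal_iff)

lemma principal_subset_iff: "A \<in> frac_ideals F \<Longrightarrow> principal F x \<subseteq> A \<longleftrightarrow> x \<in> A"
  using frac_mult[of A _ x] ints_one by (force simp: principal_iff mult.commute)

lemma mem_iff_val:
  assumes "x \<in> F" "x \<noteq> 0" "A \<in> frac_ideals F"
  shows "x \<in> A \<longleftrightarrow> (\<forall>P. val A P \<le> elem_val F x P)"
  using val_le_iff[OF principal_frac[OF assms(1,2)] assms(3)] principal_subset_iff[OF assms(3)]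
  by (simp add: elem_val_def)

lemma elem_val_mult:
  assumes "x \<in> F" "x \<noteq> 0" "y \<in> F" "y \<noteq> 0"
  shows "elem_val F (x * y) P = elem_val F x P + elem_val F y P"
  unfolding elem_val_def principal_mult using assms by (intro val_mult principal_frac)

lemma elem_val_one: "elem_val F 1 P = 0"
  by (simp add: elem_val_def principal_one val_one)

lemma elem_val_inverse:
  assumes "x \<in> F" "x \<noteq> 0"
  shows "elem_val F (inverse x) P = - elem_val F x P"
  using elem_val_mult[OF assms inverse_mem[OF assms(1)], of P] assms(2) elem_val_one[of P] by simp

lemma principal_uminus: "principal F (- x) = principal F x"
  using ints_uminus by (force simp: principal_iff)

text \<open>The ultrametric inequality without localizing: both summands lie in the ideal whose
  exponents are the minima of theirs, and so does the sum.\<close>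

lemma elem_val_add:
  assumes x: "x \<in> F" "x \<noteq> 0" and y: "y \<in> F" "y \<noteq> 0" and z: "x + y \<noteq> 0"
    and n: "n \<le> elem_val F x P" "n \<le> elem_val F y P"
  shows "n \<le> elem_val F (x + y) P"
proof -
  define e where "e = (\<lambda>P. min (elem_val F x P) (elem_val F y P))"
  have "{P. e P \<noteq> 0} \<subseteq> {P. elem_val F x P \<noteq> 0} \<union> {P. elem_val F y P \<noteq> 0}"
    by (auto simp: e_def min_def)
  moreover have "fac (elem_val F x)" "fac (elem_val F y)"
    using val_fac[OF principal_frac[OF x]] val_fac[OF principal_frac[OF y]]
    by (auto simp: elem_val_def[abs_def])
  ultimately have e: "fac e" unfolding fac_def using finite_subset by blast
  note eF = idl_frac[OF e]
  have "x \<in> idl e" "y \<in> idl e"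
    by (simp_all add: mem_iff_val x y eF val_unique[OF e]) (simp_all add: e_def)
  then have "x + y \<in> idl e" by (rule add_sub_add[OF frac_add_sub[OF eF]])
  then have "e P \<le> elem_val F (x + y) P"
    using mem_iff_val[OF add_mem[OF x(1) y(1)] z eF] val_unique[OF e] by simp
  then show ?thesis using n by (simp add: e_def)
qed

section \<open>The absolute norm\<close>

text \<open>No ideal lies strictly between \<open>A * P\<close> and \<open>A\<close>. So an element
  \<open>a\<close> of \<open>A\<close> outside \<open>A * P\<close> generates \<open>A\<close>
  modulo \<open>A * P\<close>, and \<open>r \<mapsto> r * a\<close> identifies \<open>\<O>/P\<close>
  with \<open>A/(A * P)\<close>.\<close>

lemma nrm_mult_prime:
  assumes A: "A \<in> integral_ideals F" and P: "P \<in> primes_of F"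
  shows "nrm (ideal_mult A P) = nrm A * nrm P"
proof -
  let ?B = "ideal_mult A P"
  note Pi = prime_integral[OF P] and Af = integral_frac[OF A] and Pf = prime_frac[OF P]
  have B: "?B \<in> integral_ideals F" by (rule ideal_mult_integral[OF A Pi])
  note Bf = integral_frac[OF B]
  have BA: "?B \<subseteq> A" by (rule ideal_mult_subset_left[OF A Pi])
  have valB: "val ?B Q = val A Q + (if Q = P then 1 else 0)" for Q
    by (simp add: val_mult Af Pf val_prime[OF P])
  have "?B \<noteq> A" using valB[of P] by auto
  then obtain a where a: "a \<in> A" "a \<notin> ?B" using BA by blast
  have aO: "a \<in> \<O>" using a integral_subset[OF A] by blast
  have asB: "add_sub ?B" and asA: "add_sub A" using frac_add_sub Bf Af by auto
  \<comment> \<open>The annihilator of \<open>a\<close> modulo \<open>?B\<close>: a proper ideal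
    containing \<open>P\<close>, hence \<open>P\<close> itself. This gives injectivity.\<close>
  define Q where "Q = {r \<in> \<O>. r * a \<in> ?B}"
  have PQ: "P \<subseteq> Q" using ideal_mult_memI[OF a(1), of _ P] integral_subset[OF Pi]
    by (auto simp: Q_def mult.commute)
  have "add_sub Q" unfolding add_sub_def
  proof (intro conjI ballI)
    show "0 \<in> Q" using ints_zero add_sub_zero[OF asB] by (simp add: Q_def)
    show "x - y \<in> Q" if "x \<in> Q" "y \<in> Q" for x y
      using that ints_diff[of x y] add_sub_diff[OF asB, of "x * a" "y * a"] by (simp add: Q_def left_diff_distrib)
  qed
  moreover have "r * x \<in> Q" if "r \<in> \<O>" "x \<in> Q" for r x
    using that ints_mult[of r x] frac_mult[OF Bf, of r "x * a"] by (simp add: Q_def mult.assoc)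
  moreover have "Q \<noteq> {0}" using PQ frac_nonzero[OF Pf] by blast
  ultimately have "Q \<in> integral_ideals F" unfolding integral_iff by (auto simp: Q_def)
  moreover have "1 \<notin> Q" using a(2) by (simp add: Q_def)
  ultimately have Q: "Q = P" using prime_maximal[OF P _ PQ] by blast
  \<comment> \<open>\<open>?B + a\<O>\<close> lies in \<open>A\<close> and strictly above
    \<open>?B\<close>. The valuations of \<open>A\<close> and \<open>?B\<close> differ only at
    \<open>P\<close>, by one, which leaves only \<open>C = A\<close>. This gives
    surjectivity.\<close>
  define C where "C = adjoin ?B a"
  note C = adjoin_integral[OF B aO, folded C_def]
  have CA: "C \<subseteq> A"
    using BA a(1) frac_mult[OF Af] by (auto simp: C_def adjoin_def intro!: add_sub_add[OF asA])
  have "C = A"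
  proof (rule val_inject[OF integral_frac[OF C(1)] Af], rule ext)
    fix R
    have 1: "\<forall>R. val A R \<le> val C R" using val_le_iff[OF integral_frac[OF C(1)] Af] CA by blast
    have 2: "\<forall>R. val C R \<le> val ?B R" using val_le_iff[OF Bf integral_frac[OF C(1)]] C(2) by blast
    have "val C \<noteq> val ?B" using val_inject[OF integral_frac[OF C(1)] Bf] C(3) a(2) by auto
    then obtain R' where R': "val C R' \<noteq> val ?B R'" by blast
    have "R' = P"
    proof (rule ccontr)
      assume "R' \<noteq> P"
      then have "val ?B R' = val A R'" using valB[of R'] by (simp only: if_False add_0_right)
      with R' 1[rule_format, of R'] 2[rule_format, of R'] show False by linarith
    qed
    then have "val C P < val ?B P" using R' 2[rule_format, of P] by simp
    moreover have "val ?B P = val A P + 1" unfolding valB by simp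
    ultimately have 3: "val C P < val A P + 1" by simp
    have 4: "val C R \<le> val A R + (if R = P then 1 else 0)" using 2 unfolding valB by blast
    have "val C R < val A R + 1"
    proof (cases "R = P")
      case True
      show ?thesis unfolding True by (rule 3)
    next
      case False
      with 4 have "val C R \<le> val A R" by (simp only: if_False add_0_right)
      then show ?thesis by linarith
    qed
    with 1[rule_format, of R] show "val C R = val A R" by linarith
  qed
  have "card (add_quot \<O> P) = card (add_quot A ?B)"
  proof (rule add_quot_bij(1)[OF frac_add_sub[OF Pf] asB, of _ "\<lambda>r. r * a"])
    fix x assume "x \<in> \<O>"
    then show "x * a \<in> A" by (rule frac_mult[OF Af _ a(1)])
  next
    fix x y assume "x \<in> \<O>" "y \<in> \<O>"
    then have "x - y \<in> Q \<longleftrightarrow> x * a - y * a \<in> ?B"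
      by (simp add: Q_def ints_diff left_diff_distrib)
    then show "x * a - y * a \<in> ?B \<longleftrightarrow> x - y \<in> P" unfolding Q by simp
  next
    fix z assume "z \<in> A"
    then have "z \<in> C" unfolding \<open>C = A\<close> .
    then obtain b r where "z = b + r * a" "b \<in> ?B" "r \<in> \<O>" by (auto simp: C_def adjoin_def)
    then show "\<exists>x\<in>\<O>. z - x * a \<in> ?B" by (intro bexI[of _ r]) simp_all
  qed
  then show ?thesis using nrm_tower[OF B A BA] unfolding nrm_def by metis
qed

lemma nrm_mult:
  assumes A: "A \<in> integral_ideals F" and B: "B \<in> integral_ideals F"
  shows "nrm (ideal_mult A B) = nrm A * nrm B"
proof -
  have "nrm (ideal_mult A (prodl Ps)) = nrm A * nrm (prodl Ps)" if "set Ps \<subseteq> primes_of F" for Ps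
    using that
  proof (induction Ps)
    case Nil
    then show ?case by (simp add: ideal_mult_ints integral_frac[OF A] nrm_one)
  next
    case (Cons P Ps)
    have Ps: "prodl Ps \<in> integral_ideals F" and P: "P \<in> primes_of F" using Cons.prems prodl_integral by auto
    have eq: "prodl (P # Ps) = ideal_mult (prodl Ps) P" by (simp, rule ideal_mult_commute)
    have "nrm (ideal_mult A (prodl Ps)) = nrm A * nrm (prodl Ps)" using Cons by simp
    then show ?case
      unfolding eq ideal_mult_assoc[symmetric]
        nrm_mult_prime[OF ideal_mult_integral[OF A Ps] P] nrm_mult_prime[OF Ps P] by simp
  qed
  then show ?thesis using factorization[OF B] by metis
qed

end

section \<open>Homomorphisms of fields\<close>

text \<open>The target is another type, so the locale covers Galois automorphisms as well as real
  and complex embeddings.\<close>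

locale fhom = subfld K for K :: "'a::field_char_0 set" +
  fixes h :: "'a \<Rightarrow> 'b::field_char_0"
  assumes h_add: "x \<in> K \<Longrightarrow> y \<in> K \<Longrightarrow> h (x + y) = h x + h y"
    and h_mult: "x \<in> K \<Longrightarrow> y \<in> K \<Longrightarrow> h (x * y) = h x * h y"
    and h_one: "h 1 = 1"
begin

lemma h_zero: "h 0 = 0"
  using h_add[OF zero_mem zero_mem] by simp

lemma h_uminus: "x \<in> K \<Longrightarrow> h (- x) = - h x"
  using h_add[OF _ uminus_mem, of x x] h_zero by (simp add: eq_neg_iff_add_eq_0 add.commute)

lemma h_diff: "x \<in> K \<Longrightarrow> y \<in> K \<Longrightarrow> h (x - y) = h x - h y"
  using h_add[OF _ uminus_mem, of x y] h_uminus[of y] by simp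

lemma h_sum: "(\<And>i. i \<in> I \<Longrightarrow> f i \<in> K) \<Longrightarrow> h (sum f I) = (\<Sum>i\<in>I. h (f i))"
  by (induction I rule: infinite_finite_induct) (auto simp: h_zero h_add sum_mem)

lemma h_prod: "(\<And>i. i \<in> I \<Longrightarrow> f i \<in> K) \<Longrightarrow> h (prod f I) = (\<Prod>i\<in>I. h (f i))"
  by (induction I rule: infinite_finite_induct) (auto simp: h_one h_mult prod_mem)

lemma h_power: "x \<in> K \<Longrightarrow> h (x ^ n) = h x ^ n"
  by (induction n) (auto simp: h_one h_mult power_mem)

lemma h_of_nat: "h (of_nat n) = of_nat n"
  by (induction n) (auto simp: h_zero h_one h_add one_mem of_nat_mem)

lemma h_of_int: "h (of_int n) = of_int n"
  by (cases n rule: int_cases2) (auto simp: h_of_nat h_uminus of_nat_mem)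

lemma h_nonzero: "x \<in> K \<Longrightarrow> x \<noteq> 0 \<Longrightarrow> h x \<noteq> 0"
  using h_mult[OF _ inverse_mem, of x x] h_one by auto

lemma h_inverse: "x \<in> K \<Longrightarrow> h (inverse x) = inverse (h x)"
  using h_mult[OF _ inverse_mem, of x x] h_one h_zero h_nonzero[of x]
  by (cases "x = 0") (auto simp: field_simps)

lemma h_inj: "inj_on h K"
proof (rule inj_onI)
  fix x y assume "x \<in> K" "y \<in> K" "h x = h y"
  then show "x = y" using h_nonzero[OF diff_mem, of x y] h_diff[of x y] by auto
qed

lemma h_algebraic_int:
  assumes "x \<in> K" "algebraic_int x"
  shows "algebraic_int (h x)"
proof -
  obtain n and c :: "nat \<Rightarrow> int" where c: "x ^ n = (\<Sum>i<n. of_int (c i) * x ^ i)"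
    using algebraic_int_powerE[OF assms(2)] by blast
  have "h x ^ n = h (\<Sum>i<n. of_int (c i) * x ^ i)" using assms(1) by (simp add: h_power c[symmetric])
  also have "\<dots> = (\<Sum>i<n. of_int (c i) * h x ^ i)"
    using assms(1) by (simp add: h_sum h_mult h_power h_of_int of_int_mem power_mem mult_mem)
  finally show ?thesis by (rule algebraic_int_powerI)
qed

end

section \<open>Galois groups\<close>

locale gal_ext = K: nfield K dK bK + k: nfield k dk bk
  for K k :: "'a::field_char_0 set" and dK dk :: nat and bK bk :: "nat \<Rightarrow> 'a" +
  assumes galois: "galois_ext K k"
begin

abbreviation "\<G> \<equiv> carrier (gal_group K k)"
abbreviation gmul (infixl "\<star>" 70) where "s \<star> t \<equiv> s \<otimes>\<^bsub>gal_group K k\<^esub> t"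
abbreviation ginv where "ginv s \<equiv> inv\<^bsub>gal_group K k\<^esub> s"

lemma kK: "x \<in> k \<Longrightarrow> x \<in> K"
  using galois by (auto simp: galois_ext_def)

lemma gal_iff: "s \<in> \<G> \<longleftrightarrow> s \<in> Bij K \<and> (\<forall>x\<in>K. \<forall>y\<in>K. s (x + y) = s x + s y \<and> s (x * y) = s x * s y) \<and>
    (\<forall>x\<in>k. s x = x)"
proof -
  have "s 1 = 1" if "\<forall>x\<in>k. s x = x" using that k.one_mem by blast
  then show ?thesis
    by (auto simp: gal_group_def ring_hom_def dest: Bij_imp_funcset)
qed

lemma gal_Bij: "s \<in> \<G> \<Longrightarrow> s \<in> Bij K"
  and gal_fix: "s \<in> \<G> \<Longrightarrow> x \<in> k \<Longrightarrow> s x = x"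
  by (simp_all add: gal_iff)

lemma gal_fhom: "s \<in> \<G> \<Longrightarrow> fhom K s"
  by unfold_locales (auto simp: gal_iff k.one_mem)

lemma gal_mem: "s \<in> \<G> \<Longrightarrow> x \<in> K \<Longrightarrow> s x \<in> K"
  using gal_Bij[of s] by (auto simp: Bij_def bij_betw_def)

lemma gal_extensional: "s \<in> \<G> \<Longrightarrow> t \<in> \<G> \<Longrightarrow> (\<And>x. x \<in> K \<Longrightarrow> s x = t x) \<Longrightarrow> s = t"
  using gal_Bij[of s] gal_Bij[of t] by (intro extensionalityI[of s K t]) (auto simp: Bij_def)

lemma gal_group: "group (gal_group K k)"
proof -
  interpret B: group "BijGroup K" by (rule group_BijGroup)
  have inv: "inv\<^bsub>BijGroup K\<^esub> s = (\<lambda>x\<in>K. inv_into K s x)" if "s \<in> Bij K" for s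
    using that by (rule inv_BijGroup)
  have "subgroup \<G> (BijGroup K)"
  proof (rule B.subgroupI)
    show "\<G> \<subseteq> carrier (BijGroup K)" by (auto simp: BijGroup_def gal_Bij)
    have "(\<lambda>x\<in>K. x) \<in> \<G>"
      using kK by (auto simp: gal_iff id_Bij K.add_mem K.mult_mem)
    then show "\<G> \<noteq> {}" by blast
  next
    fix s assume s: "s \<in> \<G>"
    note sB = gal_Bij[OF s]
    have bij: "bij_betw s K K" using sB by (simp add: Bij_def)
    interpret s: fhom K s by (rule gal_fhom[OF s])
    let ?t = "\<lambda>x\<in>K. inv_into K s x"
    have t: "?t x = y" if "y \<in> K" "s y = x" for x y
      using that bij gal_mem[OF s] by (auto simp: bij_betw_def inv_into_f_f)
    have ex: "\<exists>y\<in>K. s y = x" if "x \<in> K" for x using bij_betw_imp_surj_on[OF bij] that by (metis imageE)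
    have "?t \<in> \<G>" unfolding gal_iff
    proof (intro conjI ballI)
      show "?t \<in> Bij K" by (rule restrict_inv_into_Bij[OF sB])
      fix x y assume "x \<in> K" "y \<in> K"
      then obtain x' y' where xy: "x' \<in> K" "s x' = x" "y' \<in> K" "s y' = y" using ex by meson
      show "?t (x + y) = ?t x + ?t y"
        using t[of "x' + y'" "x + y"] t[OF xy(1,2)] t[OF xy(3,4)] xy by (simp add: s.h_add K.add_mem)
      show "?t (x * y) = ?t x * ?t y"
        using t[of "x' * y'" "x * y"] t[OF xy(1,2)] t[OF xy(3,4)] xy by (simp add: s.h_mult K.mult_mem)
    next
      fix x assume "x \<in> k"
      then show "?t x = x" using t[OF kK gal_fix[OF s]] by blast
    qed
    then show "inv\<^bsub>BijGroup K\<^esub> s \<in> \<G>" using inv[OF sB] by simp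
  next
    fix s t assume st: "s \<in> \<G>" "t \<in> \<G>"
    interpret s: fhom K s by (rule gal_fhom[OF st(1)])
    interpret t: fhom K t by (rule gal_fhom[OF st(2)])
    have "compose K s t \<in> \<G>" unfolding gal_iff[of "compose K s t"]
    proof (intro conjI ballI)
      show "compose K s t \<in> Bij K" by (rule compose_Bij[OF gal_Bij[OF st(1)] gal_Bij[OF st(2)]])
      fix x y assume xy: "x \<in> K" "y \<in> K"
      note m = gal_mem[OF st(2) xy(1)] gal_mem[OF st(2) xy(2)]
      show "compose K s t (x + y) = compose K s t x + compose K s t y"
        using s.h_add[OF m] t.h_add[OF xy] xy by (simp add: compose_eq K.add_mem)
      show "compose K s t (x * y) = compose K s t x * compose K s t y"
        using s.h_mult[OF m] t.h_mult[OF xy] xy by (simp add: compose_eq K.mult_mem)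
    next
      fix x assume "x \<in> k"
      then show "compose K s t x = x"
        using gal_fix[OF st(1)] gal_fix[OF st(2)] kK by (simp add: compose_eq)
    qed
    then show "s \<otimes>\<^bsub>BijGroup K\<^esub> t \<in> \<G>" using st by (simp add: BijGroup_def gal_Bij)
  qed
  then have "group (BijGroup K\<lparr>carrier := \<G>\<rparr>)" by (rule B.subgroup_imp_group)
  then show ?thesis by (simp add: gal_group_def)
qed

sublocale G: group "gal_group K k" by (rule gal_group)

lemma gal_mult_apply: "s \<in> \<G> \<Longrightarrow> t \<in> \<G> \<Longrightarrow> x \<in> K \<Longrightarrow> (s \<star> t) x = s (t x)"
  using gal_Bij[of s] gal_Bij[of t] by (simp add: gal_group_def BijGroup_def compose_eq)

lemma gal_one_apply: "x \<in> K \<Longrightarrow> \<one>\<^bsub>gal_group K k\<^esub> x = x"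
  by (simp add: gal_group_def BijGroup_def)

lemma gal_inv_apply: "s \<in> \<G> \<Longrightarrow> x \<in> K \<Longrightarrow> ginv s (s x) = x"
  using gal_mult_apply[of "ginv s" s x] gal_one_apply[of x] by simp

lemma gal_apply_inv: "s \<in> \<G> \<Longrightarrow> x \<in> K \<Longrightarrow> s (ginv s x) = x"
  using gal_mult_apply[of s "ginv s" x] gal_one_apply[of x] by simp

lemma fixed_mem: "x \<in> K \<Longrightarrow> (\<And>s. s \<in> \<G> \<Longrightarrow> s x = x) \<Longrightarrow> x \<in> k"
  using galois unfolding galois_ext_def by blast

lemma gal_translate_bij: "t \<in> \<G> \<Longrightarrow> bij_betw (\<lambda>s. t \<star> s) \<G> \<G>"
  by (rule bij_betwI[where g = "\<lambda>s. ginv t \<star> s"]) (auto simp: G.m_assoc[symmetric])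

lemma gal_rtranslate_bij: "t \<in> \<G> \<Longrightarrow> bij_betw (\<lambda>s. s \<star> t) \<G> \<G>"
  by (rule bij_betwI[where g = "\<lambda>s. s \<star> ginv t"]) (auto simp: G.m_assoc)

lemma gal_comb:
  assumes s: "s \<in> \<G>" and c: "\<And>i. i \<in> I \<Longrightarrow> c i \<in> k" and y: "\<And>i. i \<in> I \<Longrightarrow> y i \<in> K"
  shows "s (\<Sum>i\<in>I. c i * y i) = (\<Sum>i\<in>I. c i * s (y i))"
proof -
  interpret s: fhom K s by (rule gal_fhom[OF s])
  have "s (\<Sum>i\<in>I. c i * y i) = (\<Sum>i\<in>I. s (c i * y i))"
    by (rule s.h_sum) (use c y kK in \<open>auto intro!: K.mult_mem\<close>)
  also have "\<dots> = (\<Sum>i\<in>I. c i * s (y i))"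
    by (rule sum.cong[OF refl]) (use c y kK in \<open>auto simp: s.h_mult gal_fix[OF s]\<close>)
  finally show ?thesis .
qed

section \<open>Primitive elements and the order of the Galois group\<close>

lemma gal_eqI:
  assumes "s \<in> \<G>" "t \<in> \<G>" "\<And>i. i < dK \<Longrightarrow> s (bK i) = t (bK i)"
  shows "s = t"
proof (rule gal_extensional[OF assms(1,2)])
  fix x assume "x \<in> K"
  obtain c where c: "\<And>i. i < dK \<Longrightarrow> c i \<in> \<rat>" "x = (\<Sum>i<dK. c i * bK i)"
    using K.basis_span[OF \<open>x \<in> K\<close>] by blast
  have cK: "c i \<in> k" if "i < dK" for i using c(1) k.Rats_subset that by blast
  have "s x = (\<Sum>i<dK. c i * s (bK i))"
    unfolding c(2) by (rule gal_comb[OF assms(1)]) (auto simp: cK K.basis_mem)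
  also have "\<dots> = (\<Sum>i<dK. c i * t (bK i))" using assms(3) by simp
  also have "\<dots> = t x"
    unfolding c(2) by (rule gal_comb[OF assms(2), symmetric]) (auto simp: cK K.basis_mem)
  finally show "s x = t x" .
qed

text \<open>The element is the sum of \<open>bK i * n ^ i\<close> for a natural number
  \<open>n\<close>. Distinct \<open>s\<close> and \<open>t\<close> agree on it only if
  \<open>n\<close> is a root of the nonzero polynomial with coefficients
  \<open>s (bK i) - t (bK i)\<close>, which excludes finitely many \<open>n\<close>. It is stated
  for a finite \<open>S\<close> because the finiteness of \<open>\<G>\<close> is deduced from
  it.\<close>

lemma primitive_element:
  assumes S: "finite S" "S \<subseteq> \<G>"
  obtains \<theta> where "\<theta> \<in> K" "inj_on (\<lambda>s. s \<theta>) S"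
proof -
  define q :: "('a \<Rightarrow> 'a) \<times> ('a \<Rightarrow> 'a) \<Rightarrow> 'a poly" where "q = (\<lambda>(s, t). \<Sum>i<dK. monom (s (bK i) - t (bK i)) i)"
  define D where "D = {(s, t). s \<in> S \<and> t \<in> S \<and> s \<noteq> t}"
  have "D \<subseteq> S \<times> S" by (auto simp: D_def)
  then have finD: "finite D" using finite_subset[OF _ finite_cartesian_product[OF S(1) S(1)]] by blast
  have cq: "Polynomial.coeff (q (s, t)) i = (if i < dK then s (bK i) - t (bK i) else 0)" for s t i
    by (simp add: q_def Polynomial.coeff_sum if_distrib sum.delta' cong: if_cong)
  have "q p \<noteq> 0" if pD: "p \<in> D" for p
  proof
    assume "q p = 0"
    obtain s t where st: "p = (s, t)" "s \<in> \<G>" "t \<in> \<G>" "s \<noteq> t" using pD S by (auto simp: D_def)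
    have "s (bK i) = t (bK i)" if "i < dK" for i
      using \<open>q p = 0\<close> cq[of s t i] that by (simp add: st)
    then show False using gal_eqI[OF st(2,3)] st(4) by blast
  qed
  then have "prod q D \<noteq> 0" using finD by simp
  then have "finite {x. poly (prod q D) x = 0}" by (rule poly_roots_finite)
  moreover have "infinite (range (of_nat :: nat \<Rightarrow> 'a))"
    using finite_imageD[of "of_nat :: nat \<Rightarrow> 'a" UNIV] inj_of_nat by auto
  ultimately have "\<not> range of_nat \<subseteq> {x. poly (prod q D) x = 0}" using finite_subset by blast
  then obtain n :: nat where n: "poly (prod q D) (of_nat n) \<noteq> 0" by blast
  define \<theta> where "\<theta> = (\<Sum>i<dK. bK i * of_nat n ^ i)"
  have \<theta>: "\<theta> \<in> K" unfolding \<theta>_def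
    by (intro K.sum_mem K.mult_mem K.power_mem K.of_nat_mem K.basis_mem) auto
  have im: "s \<theta> = (\<Sum>i<dK. s (bK i) * of_nat n ^ i)" if s: "s \<in> \<G>" for s
  proof -
    have "s \<theta> = s (\<Sum>i<dK. of_nat n ^ i * bK i)" by (simp add: \<theta>_def mult.commute)
    also have "\<dots> = (\<Sum>i<dK. of_nat n ^ i * s (bK i))"
      by (rule gal_comb[OF s]) (auto intro: k.power_mem k.of_nat_mem K.basis_mem)
    finally show ?thesis by (simp add: mult.commute)
  qed
  have "inj_on (\<lambda>s. s \<theta>) S"
  proof (rule inj_onI, rule ccontr)
    fix s t assume st: "s \<in> S" "t \<in> S" "s \<theta> = t \<theta>" "s \<noteq> t"
    then have "poly (q (s, t)) (of_nat n) = s \<theta> - t \<theta>"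
      using S by (simp add: q_def poly_sum poly_monom im subsetD left_diff_distrib sum_subtractf)
    then have "poly (q (s, t)) (of_nat n) = 0" using st by simp
    moreover have "(s, t) \<in> D" using st by (simp add: D_def)
    ultimately have "poly (prod q D) (of_nat n) = 0"
      using finD by (auto simp: poly_prod)
    with n show False by simp
  qed
  with \<theta> that show ?thesis by blast
qed

text \<open>A relation is a polynomial over \<open>k\<close> of degree less than
  \<open>card S\<close> which has the \<open>card S\<close> distinct conjugates of
  \<open>\<theta>\<close> as roots.\<close>

lemma powers_independent:
  assumes S: "finite S" "S \<subseteq> \<G>" and \<theta>: "\<theta> \<in> K" "inj_on (\<lambda>s. s \<theta>) S"
    and c: "\<And>i. i < card S \<Longrightarrow> c i \<in> k" and rel: "(\<Sum>i<card S. c i * \<theta> ^ i) = 0"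
    and i: "i < card S"
  shows "c i = 0"
proof -
  define p where "p = (\<Sum>i<card S. monom (c i) i)"
  have cp: "Polynomial.coeff p j = (if j < card S then c j else 0)" for j
    by (simp add: p_def Polynomial.coeff_sum if_distrib sum.delta' cong: if_cong)
  have root: "poly p (s \<theta>) = 0" if s: "s \<in> S" for s
  proof -
    have sG: "s \<in> \<G>" using s S by blast
    interpret s: fhom K s by (rule gal_fhom[OF sG])
    have "poly p (s \<theta>) = (\<Sum>i<card S. c i * s (\<theta> ^ i))"
      by (simp add: p_def poly_sum poly_monom s.h_power[OF \<theta>(1)])
    also have "\<dots> = s (\<Sum>i<card S. c i * \<theta> ^ i)"
      by (rule gal_comb[OF sG, symmetric]) (auto simp: c K.power_mem[OF \<theta>(1)])
    also have "\<dots> = 0" by (simp only: rel s.h_zero)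
    finally show ?thesis .
  qed
  have "p = 0"
  proof (rule ccontr)
    assume p: "p \<noteq> 0"
    have "card S = card ((\<lambda>s. s \<theta>) ` S)" using card_image[OF \<theta>(2)] by simp
    also have "\<dots> \<le> card {x. poly p x = 0}"
      using root by (intro card_mono poly_roots_finite[OF p]) auto
    also have "\<dots> \<le> Polynomial.degree p" by (rule card_poly_roots_bound[OF p])
    finally have "card S \<le> Polynomial.degree p" .
    moreover have "Polynomial.degree p < card S"
      using i by (intro degree_lessI) (auto simp: cp)
    ultimately show False by simp
  qed
  then show ?thesis using cp[of i] i by simp
qed

text \<open>\<open>Suc dK\<close> automorphisms would yield \<open>Suc dK\<close> powers of one
  element independent over \<open>k\<close>, whereas \<open>dK\<close> elements span
  \<open>K\<close> over the rationals.\<close>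

lemma finite_gal: "finite \<G>"
proof -
  have "card S \<le> dK" if S: "finite S" "S \<subseteq> \<G>" for S
  proof (rule ccontr)
    assume "\<not> card S \<le> dK"
    then obtain T where T: "T \<subseteq> S" "card T = Suc dK"
      using obtain_subset_with_card_n[of "Suc dK" S] by auto
    have T': "finite T" "T \<subseteq> \<G>" using T S finite_subset by auto
    obtain \<theta> where \<theta>: "\<theta> \<in> K" "inj_on (\<lambda>s. s \<theta>) T" by (rule primitive_element[OF T'])
    obtain c :: "nat \<Rightarrow> int" where c: "\<exists>i<Suc dK. c i \<noteq> 0" "(\<Sum>i<Suc dK. of_int (c i) * \<theta> ^ i) = 0"
      by (rule K.rat_dependent[of "\<lambda>i. \<theta> ^ i"]) (use \<theta>(1) K.power_mem in auto)
    have "of_int (c i) = (0 :: 'a)" if "i < Suc dK" for i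
      using powers_independent[OF T' \<theta>, of "\<lambda>i. of_int (c i)" i] T(2) c(2) that k.of_int_mem by simp
    with c(1) show False by auto
  qed
  then show ?thesis by (meson finite_if_finite_subsets_card_bdd)
qed

text \<open>In effect the degree \<open>[K : k]\<close>: \<open>powers_independent\<close> bounds
  the degree from below by this number, \<open>gal_dependent\<close> from above.\<close>

abbreviation "n \<equiv> card \<G>"

lemma n_pos: "n > 0"
  using finite_gal G.one_closed by (auto simp: card_gt_0_iff)

section \<open>Trace, norm and linear dependence over \<open>k\<close>\<close>

definition tr :: "'a \<Rightarrow> 'a" where "tr x = (\<Sum>s\<in>\<G>. s x)"

lemma gal_norm_aux:
  assumes "t \<in> \<G>" "x \<in> K"
  shows "(\<Sum>s\<in>\<G>. t (s x)) = (\<Sum>s\<in>\<G>. s x)" and "(\<Prod>s\<in>\<G>. t (s x)) = (\<Prod>s\<in>\<G>. s x)"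
  using sum.reindex_bij_betw[OF gal_translate_bij[OF assms(1)], of "\<lambda>s. s x"]
    prod.reindex_bij_betw[OF gal_translate_bij[OF assms(1)], of "\<lambda>s. s x"] assms
  by (simp_all add: gal_mult_apply)

lemma tr_mem: "x \<in> K \<Longrightarrow> tr x \<in> k"
proof (rule fixed_mem)
  assume x: "x \<in> K"
  show "tr x \<in> K" unfolding tr_def by (rule K.sum_mem) (rule gal_mem[OF _ x])
  fix t assume t: "t \<in> \<G>"
  interpret t: fhom K t by (rule gal_fhom[OF t])
  show "t (tr x) = tr x" using gal_norm_aux(1)[OF t x] by (simp add: tr_def t.h_sum gal_mem x)
qed

lemma norm_mem: "x \<in> K \<Longrightarrow> elem_norm K k x \<in> k"
proof (rule fixed_mem)
  assume x: "x \<in> K"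
  show "elem_norm K k x \<in> K" unfolding elem_norm_def by (rule K.prod_mem) (rule gal_mem[OF _ x])
  fix t assume t: "t \<in> \<G>"
  interpret t: fhom K t by (rule gal_fhom[OF t])
  show "t (elem_norm K k x) = elem_norm K k x"
    using gal_norm_aux(2)[OF t x] by (simp add: elem_norm_def t.h_prod gal_mem x)
qed

lemma tr_add: "x \<in> K \<Longrightarrow> y \<in> K \<Longrightarrow> tr (x + y) = tr x + tr y"
  unfolding tr_def sum.distrib[symmetric] by (intro sum.cong refl fhom.h_add[OF gal_fhom])

lemma tr_diff: "x \<in> K \<Longrightarrow> y \<in> K \<Longrightarrow> tr (x - y) = tr x - tr y"
  unfolding tr_def sum_subtractf[symmetric] by (intro sum.cong refl fhom.h_diff[OF gal_fhom])

lemma tr_scale: "a \<in> k \<Longrightarrow> x \<in> K \<Longrightarrow> tr (a * x) = a * tr x"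
  unfolding tr_def sum_distrib_left
  by (rule sum.cong[OF refl]) (metis fhom.h_mult[OF gal_fhom] kK gal_fix)

lemma tr_sum: "(\<And>i. i \<in> I \<Longrightarrow> f i \<in> K) \<Longrightarrow> tr (sum f I) = (\<Sum>i\<in>I. tr (f i))"
proof -
  assume f: "\<And>i. i \<in> I \<Longrightarrow> f i \<in> K"
  have "tr (sum f I) = (\<Sum>s\<in>\<G>. \<Sum>i\<in>I. s (f i))" 
    unfolding tr_def by (intro sum.cong refl fhom.h_sum[OF gal_fhom] f)
  also have "\<dots> = (\<Sum>i\<in>I. tr (f i))" unfolding tr_def by (rule sum.swap)
  finally show ?thesis .
qed

lemma tr_of_nat: "tr (of_nat m) = of_nat m * of_nat n"
proof -
  have "tr (of_nat m) = (\<Sum>s\<in>\<G>. of_nat m)"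
    unfolding tr_def by (intro sum.cong refl fhom.h_of_nat[OF gal_fhom])
  then show ?thesis by (simp add: mult.commute)
qed

text \<open>Artin's bound; in characteristic 0 the trace of \<open>1\<close> does not vanish.\<close>

lemma gal_dependent:
  assumes x: "\<And>i. i < Suc n \<Longrightarrow> x i \<in> K"
  obtains c where "\<And>i. i < Suc n \<Longrightarrow> c i \<in> k" "\<exists>i<Suc n. c i \<noteq> 0" "(\<Sum>i<Suc n. c i * x i) = 0"
proof -
  \<comment> \<open>One equation for each automorphism, in one more unknown; the solution has
    coefficients in \<open>K\<close>, and taking traces will bring them down to
    \<open>k\<close>.\<close>
  have "\<exists>c. (\<forall>j\<in>{..<Suc n}. c j \<in> K) \<and> (\<exists>j\<in>{..<Suc n}. c j \<noteq> 0) \<and>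
      (\<forall>s\<in>\<G>. (\<Sum>j\<in>{..<Suc n}. s (x j) * c j) = 0)"
    by (rule K.homogeneous_system) (use x finite_gal gal_mem in auto)
  then obtain c where c: "\<And>j. j < Suc n \<Longrightarrow> c j \<in> K" "\<exists>j<Suc n. c j \<noteq> 0"
    "\<And>s. s \<in> \<G> \<Longrightarrow> (\<Sum>j<Suc n. s (x j) * c j) = 0" by blast
  obtain l where l: "l < Suc n" "c l \<noteq> 0" using c(2) by blast
  \<comment> \<open>Normalized so that \<open>e l = 1\<close>, whose trace \<open>n\<close> is
    nonzero.\<close>
  define e where "e = (\<lambda>j. c j / c l)"
  have eK: "e j \<in> K" if "j < Suc n" for j
    using c(1)[OF that] c(1)[OF l(1)] by (simp add: e_def K.divide_mem)
  have rel: "(\<Sum>j<Suc n. x j * s (e j)) = 0" if s: "s \<in> \<G>" for s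
  proof -
    interpret s: fhom K s by (rule gal_fhom[OF s])
    \<comment> \<open>Applying \<open>s\<close> to the equation for \<open>ginv s\<close> moves the
      automorphism from the elements \<open>x j\<close> to the coefficients; summation over
      \<open>s\<close> then produces traces.\<close>
    have "(\<Sum>j<Suc n. ginv s (x j) * e j) = (\<Sum>j<Suc n. ginv s (x j) * c j) / c l"
      unfolding sum_divide_distrib e_def by simp
    also have "\<dots> = 0" using c(3)[OF G.inv_closed[OF s]] by (simp only: div_0)
    finally have "s (\<Sum>j<Suc n. ginv s (x j) * e j) = 0" by (simp only: s.h_zero)
    moreover have "s (\<Sum>j<Suc n. ginv s (x j) * e j) = (\<Sum>j<Suc n. x j * s (e j))"
    proof -
      have "s (\<Sum>j<Suc n. ginv s (x j) * e j) = (\<Sum>j<Suc n. s (ginv s (x j) * e j))"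
        by (rule s.h_sum) (use x eK gal_mem[OF G.inv_closed[OF s]] in \<open>auto intro!: K.mult_mem\<close>)
      also have "\<dots> = (\<Sum>j<Suc n. x j * s (e j))"
        by (rule sum.cong[OF refl])
           (use x eK gal_mem[OF G.inv_closed[OF s]] gal_apply_inv[OF s] in \<open>auto simp: s.h_mult\<close>)
      finally show ?thesis .
    qed
    ultimately show ?thesis by simp
  qed
  show ?thesis
  proof (rule that[of "\<lambda>i. tr (e i)"])
    show "tr (e i) \<in> k" if "i < Suc n" for i using that by (intro tr_mem eK)
    have "tr (e l) = of_nat n" using l tr_of_nat[of 1] by (simp add: e_def)
    then show "\<exists>i<Suc n. tr (e i) \<noteq> 0" using l(1) n_pos by auto
    have "(\<Sum>i<Suc n. tr (e i) * x i) = (\<Sum>i<Suc n. \<Sum>s\<in>\<G>. x i * s (e i))"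
      by (rule sum.cong[OF refl]) (simp add: tr_def sum_distrib_left mult.commute)
    also have "\<dots> = (\<Sum>s\<in>\<G>. \<Sum>i<Suc n. x i * s (e i))" by (rule sum.swap)
    also have "\<dots> = 0" using rel by simp
    finally show "(\<Sum>i<Suc n. tr (e i) * x i) = 0" .
  qed
qed

end

context nfield
begin

interpretation I: comm_group "frac_group F" by (rule comm_group_frac)

lemma frac_int_pow_closed: "A \<in> frac_ideals F \<Longrightarrow> A [^]\<^bsub>frac_group F\<^esub> (i::int) \<in> frac_ideals F"
  using I.int_pow_closed[of A i] by simp

lemma val_int_pow:
  assumes A: "A \<in> frac_ideals F"
  shows "val (A [^]\<^bsub>frac_group F\<^esub> (i::int)) P = i * val A P"
proof (cases i rule: int_cases2)
  case (nonneg m)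
  then show ?thesis using val_nat_pow[OF A, of m P] by (simp add: int_pow_int)
next
  case (nonpos m)
  have "A [^]\<^bsub>frac_group F\<^esub> m \<in> frac_ideals F" using I.nat_pow_closed[of A m] A by simp
  then show ?thesis
    using I.int_pow_neg_int[of A m] val_nat_pow[OF A, of m P] A nonpos by (simp add: val_inv)
qed

lemma val_gexp:
  assumes fin: "finite {R. e R \<noteq> 0}" and u: "\<And>R. e R \<noteq> 0 \<Longrightarrow> u R \<in> frac_ideals F"
  shows "val (gexp (frac_group F) u e) P = (\<Sum>R | e R \<noteq> 0. e R * val (u R) P)"
proof -
  have "val (gexp (frac_group F) u e) P = (\<Sum>R | e R \<noteq> 0. val (u R [^]\<^bsub>frac_group F\<^esub> e R) P)"
    unfolding gexp_def by (rule val_finprod[OF fin]) (auto intro: frac_int_pow_closed u)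
  also have "\<dots> = (\<Sum>R | e R \<noteq> 0. e R * val (u R) P)"
    by (rule sum.cong[OF refl]) (simp add: val_int_pow u)
  finally show ?thesis .
qed

end

section \<open>Galois action and extension of ideals\<close>

context gal_ext
begin

interpretation IK: comm_group "frac_group K" by (rule K.comm_group_frac)
interpretation Ik: comm_group "frac_group k" by (rule k.comm_group_frac)

abbreviation "OK \<equiv> ints_of K"
abbreviation "Ok \<equiv> ints_of k"

lemma ints_k_iff: "x \<in> Ok \<longleftrightarrow> x \<in> OK \<and> x \<in> k"
  using kK by (auto simp: ints_of_def)

lemma gal_ints: "s \<in> \<G> \<Longrightarrow> x \<in> OK \<Longrightarrow> s x \<in> OK"
  using fhom.h_algebraic_int[OF gal_fhom, of s x] gal_mem[of s x] by (simp add: ints_of_def)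

lemma gal_image_ints: "s \<in> \<G> \<Longrightarrow> s ` OK = OK"
proof -
  assume s: "s \<in> \<G>"
  have "x \<in> s ` OK" if "x \<in> OK" for x
    using gal_apply_inv[OF s K.ints_subset[OF that]] gal_ints[OF G.inv_closed[OF s] that]
    by (metis image_eqI)
  then show ?thesis using gal_ints[OF s] by blast
qed

lemma ideal_mult_subset_field: "A \<subseteq> K \<Longrightarrow> B \<subseteq> K \<Longrightarrow> ideal_mult A B \<subseteq> K"
  by (rule ideal_mult_least[OF K.zero_mem K.add_mem]) (auto intro: K.mult_mem)

lemma act_mult:
  assumes s: "s \<in> \<G>" and AB: "A \<subseteq> K" "B \<subseteq> K"
  shows "s ` ideal_mult A B = ideal_mult (s ` A) (s ` B)"
proof
  interpret s: fhom K s by (rule gal_fhom[OF s])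
  note sub = ideal_mult_subset_field[OF AB]
  have "ideal_mult A B \<subseteq> {x \<in> K. s x \<in> ideal_mult (s ` A) (s ` B)}"
  proof (rule ideal_mult_least)
    fix a b assume ab: "a \<in> A" "b \<in> B"
    then have "a \<in> K" "b \<in> K" using AB by auto
    then show "a * b \<in> {x \<in> K. s x \<in> ideal_mult (s ` A) (s ` B)}"
      using ab by (simp add: s.h_mult K.mult_mem ideal_mult_memI)
  qed (auto simp: s.h_zero s.h_add K.zero_mem K.add_mem ideal_mult_zero ideal_mult_add)
  then show "s ` ideal_mult A B \<subseteq> ideal_mult (s ` A) (s ` B)" by blast
  show "ideal_mult (s ` A) (s ` B) \<subseteq> s ` ideal_mult A B"
  proof (rule ideal_mult_least)
    show "0 \<in> s ` ideal_mult A B" using s.h_zero ideal_mult_zero by (metis image_eqI)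
    fix x y assume "x \<in> s ` ideal_mult A B" "y \<in> s ` ideal_mult A B"
    then obtain a b where ab: "a \<in> ideal_mult A B" "b \<in> ideal_mult A B" "x = s a" "y = s b" by blast
    then have "s (a + b) = x + y" using sub by (simp add: s.h_add subsetD)
    then show "x + y \<in> s ` ideal_mult A B" using ideal_mult_add[OF ab(1,2)] by (metis image_eqI)
  next
    fix x y assume "x \<in> s ` A" "y \<in> s ` B"
    then obtain a b where ab: "a \<in> A" "b \<in> B" "x = s a" "y = s b" by blast
    then have "s (a * b) = x * y" using AB by (simp add: s.h_mult subsetD)
    then show "x * y \<in> s ` ideal_mult A B" using ideal_mult_memI[OF ab(1,2)] by (metis image_eqI)
  qed
qed

lemma act_comp: "s \<in> \<G> \<Longrightarrow> t \<in> \<G> \<Longrightarrow> A \<subseteq> K \<Longrightarrow> s ` (t ` A) = (s \<star> t) ` A"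
  unfolding image_image by (rule image_cong[OF refl]) (simp add: gal_mult_apply subsetD)

lemma act_one: "A \<subseteq> K \<Longrightarrow> \<one>\<^bsub>gal_group K k\<^esub> ` A = A"
  using gal_one_apply by (force simp: subset_iff image_def)

lemma act_inv: "s \<in> \<G> \<Longrightarrow> A \<subseteq> K \<Longrightarrow> ginv s ` (s ` A) = A"
  using act_comp[of "ginv s" s A] act_one[of A] by simp

lemma act_inv': "s \<in> \<G> \<Longrightarrow> A \<subseteq> K \<Longrightarrow> s ` (ginv s ` A) = A"
  using act_comp[of s "ginv s" A] act_one[of A] by simp

lemma act_frac:
  assumes s: "s \<in> \<G>" and A: "A \<in> frac_ideals K"
  shows "s ` A \<in> frac_ideals K"
proof -
  interpret s: fhom K s by (rule gal_fhom[OF s])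
  note AK = K.frac_subset[OF A] and as = K.frac_add_sub[OF A]
  obtain a where a: "a \<in> A" "a \<noteq> 0" using K.frac_nonzero[OF A] by blast
  obtain e where e: "e \<in> OK" "e \<noteq> 0" "\<And>a. a \<in> A \<Longrightarrow> e * a \<in> OK" using A unfolding frac_ideals_def by blast
  show ?thesis
  proof (rule K.frac_idealI[of _ "s a" "s e"])
    show "s ` A \<subseteq> K" using AK gal_mem[OF s] by blast
    show "add_sub (s ` A)" unfolding add_sub_def
    proof (intro conjI ballI)
      show "0 \<in> s ` A" using s.h_zero add_sub_zero[OF as] by (metis image_eqI)
      fix x y assume "x \<in> s ` A" "y \<in> s ` A"
      then obtain a b where ab: "a \<in> A" "b \<in> A" "x = s a" "y = s b" by blast
      then have "s (a - b) = x - y" using AK by (simp add: s.h_diff subsetD)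
      then show "x - y \<in> s ` A" using add_sub_diff[OF as ab(1,2)] by (metis image_eqI)
    qed
    show "r * x \<in> s ` A" if rx: "r \<in> OK" "x \<in> s ` A" for r x
    proof -
      obtain r' where r': "r' \<in> OK" "s r' = r" using rx(1) gal_image_ints[OF s] by (metis imageE)
      obtain b where b: "b \<in> A" "x = s b" using rx(2) by blast
      then have "s (r' * b) = r * x" using r' AK K.ints_subset by (simp add: s.h_mult subsetD)
      then show ?thesis using K.frac_mult[OF A r'(1) b(1)] by (metis image_eqI)
    qed
    show "s e * x \<in> OK" if x: "x \<in> s ` A" for x
    proof -
      obtain b where b: "b \<in> A" "x = s b" using x by blast
      then have "s (e * b) = s e * x" using e(1) AK K.ints_subset by (simp add: s.h_mult subsetD)
      then show ?thesis using gal_ints[OF s e(3)[OF b(1)]] by simp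
    qed
    show "s a \<noteq> 0" using s.h_nonzero[of a] a AK by blast
    show "s e \<noteq> 0" using s.h_nonzero[OF K.ints_subset[OF e(1)] e(2)] .
    show "s e \<in> K" using gal_mem[OF s K.ints_subset[OF e(1)]] .
  qed (use a in blast)
qed

lemma act_integral:
  assumes s: "s \<in> \<G>" and A: "A \<in> integral_ideals K"
  shows "s ` A \<in> integral_ideals K"
  using act_frac[OF s K.integral_frac[OF A]] K.integral_subset[OF A] gal_ints[OF s]
  by (auto simp: integral_ideals_def)

lemma prime_subset: "P \<in> primes_of K \<Longrightarrow> P \<subseteq> K"
  using K.frac_subset K.prime_frac by blast

lemma act_prime:
  assumes s: "s \<in> \<G>" and P: "P \<in> primes_of K"
  shows "s ` P \<in> primes_of K"
  unfolding K.primes_iff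
proof (intro conjI ballI impI)
  let ?t = "ginv s"
  have t: "?t \<in> \<G>" using s by simp
  interpret t: fhom K ?t by (rule gal_fhom[OF t])
  have mem: "x \<in> s ` P \<longleftrightarrow> ?t x \<in> P" if "x \<in> OK" for x
  proof
    assume "x \<in> s ` P"
    then have "?t x \<in> ?t ` (s ` P)" by (rule imageI)
    then show "?t x \<in> P" by (simp only: act_inv[OF s prime_subset[OF P]])
  next
    assume "?t x \<in> P"
    then have "s (?t x) \<in> s ` P" by (rule imageI)
    then show "x \<in> s ` P" by (simp only: gal_apply_inv[OF s K.ints_subset[OF that]])
  qed
  show "s ` P \<in> integral_ideals K" by (rule act_integral[OF s K.prime_integral[OF P]])
  show "1 \<notin> s ` P" using mem[OF K.ints_one] t.h_one K.prime_notone[OF P] by simp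
  fix x y assume xy: "x \<in> OK" "y \<in> OK" "x * y \<in> s ` P"
  then have "?t x * ?t y \<in> P" using mem[OF K.ints_mult[OF xy(1,2)]] t.h_mult[of x y] K.ints_subset by simp
  then show "x \<in> s ` P \<or> y \<in> s ` P"
    using K.prime_mult[OF P gal_ints[OF t xy(1)] gal_ints[OF t xy(2)]] mem xy by blast
qed

lemma act_principal:
  assumes s: "s \<in> \<G>" and x: "x \<in> K"
  shows "s ` principal K x = principal K (s x)"
proof -
  interpret s: fhom K s by (rule gal_fhom[OF s])
  have "s ` principal K x = (\<lambda>r. s x * s r) ` OK"
    unfolding principal_def image_image
    by (rule image_cong[OF refl]) (simp add: s.h_mult x K.ints_subset)
  also have "\<dots> = (\<lambda>r. s x * r) ` (s ` OK)" by (simp add: image_image)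
  finally show ?thesis by (simp add: gal_image_ints[OF s] principal_def)
qed

lemma act_hom: "s \<in> \<G> \<Longrightarrow> (\<lambda>A. s ` A) \<in> hom (frac_group K) (frac_group K)"
  by (auto simp: hom_def act_frac act_mult K.frac_subset simp del: image_iff)

lemma act_eq_iff: "s \<in> \<G> \<Longrightarrow> A \<subseteq> K \<Longrightarrow> B \<subseteq> K \<Longrightarrow> s ` A = s ` B \<longleftrightarrow> A = B"
  using act_inv[of s A] act_inv[of s B] by metis

text \<open>Conjugation is a homomorphism that permutes the primes, so it carries the factorization
  of \<open>A\<close> to that of its image with the same exponents.\<close>

lemma act_val:
  assumes s: "s \<in> \<G>" and A: "A \<in> frac_ideals K" and P: "P \<in> primes_of K"
  shows "K.val (s ` A) (s ` P) = K.val A P"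
proof -
  let ?e = "K.val A"
  have pr: "R \<in> primes_of K" if "?e R \<noteq> 0" for R using K.val_prime_of[OF A that] .
  have "s ` A = s ` K.idl ?e" by (simp only: K.idl_val[OF A])
  also have "\<dots> = gexp (frac_group K) (\<lambda>R. s ` R) ?e"
    by (rule IK.gexp_hom[OF K.comm_group_frac act_hom[OF s] K.val_finite[OF A]])
       (simp add: K.prime_frac pr)
  finally have "K.val (s ` A) (s ` P) = (\<Sum>R | ?e R \<noteq> 0. ?e R * K.val (s ` R) (s ` P))"
    using K.val_gexp[OF K.val_finite[OF A], of "\<lambda>R. s ` R" "s ` P"] act_frac[OF s K.prime_frac[OF pr]] by simp
  also have "\<dots> = (\<Sum>R | ?e R \<noteq> 0. if R = P then ?e R else 0)"
  proof (rule sum.cong[OF refl])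
    fix R assume "R \<in> {R. ?e R \<noteq> 0}"
    then have R: "R \<in> primes_of K" using pr by simp
    have "s ` P = s ` R \<longleftrightarrow> R = P" using act_eq_iff[OF s prime_subset[OF P] prime_subset[OF R]] by blast
    then show "?e R * K.val (s ` R) (s ` P) = (if R = P then ?e R else 0)"
      by (simp add: K.val_prime[OF act_prime[OF s R]])
  qed
  also have "\<dots> = ?e P" using K.val_finite[OF A] by (simp add: sum.delta)
  finally show ?thesis .
qed

section \<open>Extension of ideals from \<open>k\<close> to \<open>K\<close>\<close>

abbreviation "ext a \<equiv> modulus_ext K a"

lemma frac_k_subset: "a \<in> frac_ideals k \<Longrightarrow> a \<subseteq> K"
  using k.frac_subset kK by blast

lemma ints_mult_ints: "ideal_mult OK OK = OK"
  by (rule K.ideal_mult_ints[OF K.integral_frac[OF K.ints_integral]])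

lemma sub_ext: "a \<subseteq> ext a"
proof
  fix x assume "x \<in> a"
  then have "x * 1 \<in> ideal_mult a OK" by (intro ideal_mult_memI K.ints_one)
  then show "x \<in> ext a" by (simp add: modulus_ext_def)
qed

lemma ext_mult: "ext (ideal_mult a b) = ideal_mult (ext a) (ext b)"
proof -
  have "ideal_mult (ext a) (ext b) = ideal_mult (ideal_mult a b) (ideal_mult OK OK)"
    unfolding modulus_ext_def by (simp only: ideal_mult_ac)
  then show ?thesis by (simp only: ints_mult_ints modulus_ext_def)
qed

lemma ext_frac:
  assumes a: "a \<in> frac_ideals k"
  shows "ext a \<in> frac_ideals K"
proof -
  note aK = frac_k_subset[OF a]
  obtain x where x: "x \<in> a" "x \<noteq> 0" using k.frac_nonzero[OF a] by blast
  obtain e where e: "e \<in> Ok" "e \<noteq> 0" "\<And>x. x \<in> a \<Longrightarrow> e * x \<in> Ok" using a unfolding frac_ideals_def by blast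
  have scale: "r * y \<in> ext a" if "r \<in> OK" "y \<in> ext a" for r y
  proof -
    have "ideal_mult a OK \<subseteq> {y. r * y \<in> ideal_mult a OK}"
    proof (rule ideal_mult_least)
      fix u v assume "u \<in> a" "v \<in> OK"
      then have "u * (r * v) \<in> ideal_mult a OK" using that by (intro ideal_mult_memI K.ints_mult)
      then show "u * v \<in> {y. r * y \<in> ideal_mult a OK}" by (simp add: mult.left_commute)
    qed (auto simp: ideal_mult_zero distrib_left ideal_mult_add)
    then show ?thesis using that by (auto simp: modulus_ext_def)
  qed
  show ?thesis
  proof (rule K.frac_idealI[of _ x e])
    show "ext a \<subseteq> K" unfolding modulus_ext_def
      using aK K.ints_subset by (intro ideal_mult_subset_field) auto
    show "add_sub (ext a)" unfolding add_sub_def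
    proof (intro conjI ballI)
      show "0 \<in> ext a" by (simp add: modulus_ext_def ideal_mult_zero)
      fix u v assume uv: "u \<in> ext a" "v \<in> ext a"
      have "(-1) * v \<in> ext a" by (rule scale[OF K.ints_uminus[OF K.ints_one] uv(2)])
      then have "u + (-1) * v \<in> ext a" using uv(1) unfolding modulus_ext_def by (intro ideal_mult_add)
      then show "u - v \<in> ext a" by simp
    qed
    show "x \<in> ext a" using sub_ext x by blast
    have "ideal_mult a OK \<subseteq> {y. e * y \<in> OK}"
    proof (rule ideal_mult_least)
      fix u v assume uv: "u \<in> a" "v \<in> OK"
      then have "(e * u) * v \<in> OK" using K.ints_mult[of "e * u" v] e(3)[of u] by (simp add: ints_k_iff)
      then show "u * v \<in> {y. e * y \<in> OK}" by (simp add: mult.assoc)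
    qed (auto simp: K.ints_zero distrib_left K.ints_add)
    then show "e * y \<in> OK" if "y \<in> ext a" for y using that by (auto simp: modulus_ext_def)
    show "e \<in> K" using e(1) k.ints_subset kK by blast
  qed (use x e scale in auto)
qed

lemma ext_one: "ext Ok = OK"
proof
  show "ext Ok \<subseteq> OK" unfolding modulus_ext_def
    by (rule ideal_mult_least[OF K.ints_zero K.ints_add]) (auto simp: ints_k_iff K.ints_mult)
  show "OK \<subseteq> ext Ok"
    using ideal_mult_memI[OF k.ints_one, of _ OK] by (auto simp: modulus_ext_def)
qed

lemma ext_hom: "ext \<in> hom (frac_group k) (frac_group K)"
  by (simp add: hom_def ext_frac ext_mult)

lemma ext_principal:
  assumes x: "x \<in> k"
  shows "ext (principal k x) = principal K x"
proof
  show "ext (principal k x) \<subseteq> principal K x" unfolding modulus_ext_def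
  proof (rule ideal_mult_least[OF add_sub_zero[OF K.principal_add_sub] add_sub_add[OF K.principal_add_sub]])
    fix u v assume uv: "u \<in> principal k x" "v \<in> OK"
    then obtain r where "r \<in> Ok" "u = x * r" by (auto simp: k.principal_iff)
    then have "u * v = x * (r * v)" "r * v \<in> OK" using uv by (auto simp: ints_k_iff K.ints_mult)
    then show "u * v \<in> principal K x" unfolding K.principal_iff by blast
  qed
  show "principal K x \<subseteq> ext (principal k x)"
  proof
    fix y assume "y \<in> principal K x"
    then obtain r where r: "r \<in> OK" "y = x * r" by (auto simp: K.principal_iff)
    have "x \<in> principal k x" using k.ints_one by (force simp: k.principal_iff)
    then show "y \<in> ext (principal k x)" unfolding r(2) modulus_ext_def by (rule ideal_mult_memI[OF _ r(1)])
  qed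
qed

lemma ext_integral: "a \<in> integral_ideals k \<Longrightarrow> ext a \<in> integral_ideals K"
proof -
  assume a: "a \<in> integral_ideals k"
  have "ext a \<subseteq> ext Ok" unfolding modulus_ext_def
    by (rule ideal_mult_mono[OF k.integral_subset[OF a] order_refl])
  then show ?thesis using ext_frac[OF k.integral_frac[OF a]] by (simp add: integral_ideals_def ext_one)
qed

lemma act_ext:
  assumes s: "s \<in> \<G>" and a: "a \<in> frac_ideals k"
  shows "s ` ext a = ext a"
proof -
  have "s ` a = (\<lambda>x. x) ` a" by (rule image_cong[OF refl]) (use gal_fix[OF s] k.frac_subset[OF a] in blast)
  then have "s ` a = a" by simp
  then show ?thesis
    using act_mult[OF s frac_k_subset[OF a], of OK] K.ints_subset gal_image_ints[OF s]
    by (auto simp: modulus_ext_def)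
qed

text \<open>An ideal of \<open>k\<close> is contained in its extension, so \<open>ext c = OK\<close>
  makes \<open>c\<close> integral. The inverse of \<open>c\<close> also extends to \<open>OK\<close>
  and is integral too, hence all valuations of \<open>c\<close> vanish.\<close>

lemma ext_eq_one:
  assumes c: "c \<in> frac_ideals k" and eq: "ext c = OK"
  shows "c = Ok"
proof -
  have sub: "d \<subseteq> Ok" if "d \<in> frac_ideals k" "ext d = OK" for d
    using sub_ext[of d] that k.frac_subset[OF that(1)] ints_k_iff by blast
  let ?c' = "inv\<^bsub>frac_group k\<^esub> c"
  have c': "?c' \<in> frac_ideals k" by (rule k.frac_inv_closed[OF c])
  have "ideal_mult (ext c) (ext ?c') = OK"
    unfolding ext_mult[symmetric] k.frac_inv[OF c] by (rule ext_one)
  then have "ext ?c' = OK" unfolding eq by (simp only: K.ideal_mult_ints_left[OF ext_frac[OF c']])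
  then have "?c' \<subseteq> Ok" by (rule sub[OF c'])
  then have 1: "\<forall>P. k.val ?c' P \<ge> 0" using k.val_nonneg_iff[OF c'] by blast
  have 2: "\<forall>P. k.val c P \<ge> 0" using k.val_nonneg_iff[OF c] sub[OF c eq] by blast
  have "k.val c P = k.val Ok P" for P
    using 1[rule_format, of P] 2[rule_format, of P] by (simp add: k.val_inv[OF c] k.val_one)
  then show ?thesis by (intro k.val_inject[OF c k.integral_frac[OF k.ints_integral]] ext)
qed

lemma ext_inject:
  assumes a: "a \<in> frac_ideals k" and b: "b \<in> frac_ideals k" and eq: "ext a = ext b"
  shows "a = b"
proof -
  let ?b' = "inv\<^bsub>frac_group k\<^esub> b"
  have b': "?b' \<in> frac_ideals k" by (rule k.frac_inv_closed[OF b])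
  have "ext (ideal_mult a ?b') = ext (ideal_mult b ?b')" by (simp only: ext_mult eq)
  also have "\<dots> = OK" by (simp only: k.frac_inv[OF b] ext_one)
  finally have ab: "ideal_mult a ?b' = Ok" by (rule ext_eq_one[OF k.ideal_mult_frac[OF a b']])
  have "a = ideal_mult a (ideal_mult b ?b')" by (simp only: k.frac_inv[OF b] k.ideal_mult_ints[OF a])
  also have "\<dots> = ideal_mult b (ideal_mult a ?b')" by (rule ideal_mult_left_commute)
  also have "\<dots> = b" by (simp only: ab k.ideal_mult_ints[OF b])
  finally show ?thesis .
qed

section \<open>Primes of \<open>K\<close> above primes of \<open>k\<close>\<close>

definition contr :: "'a set \<Rightarrow> 'a set" where "contr P = P \<inter> Ok"

lemma contr_prime:
  assumes P: "P \<in> primes_of K"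
  shows "contr P \<in> primes_of k"
proof -
  note Pi = K.prime_integral[OF P]
  obtain m :: nat where m: "m > 0" "of_nat m \<in> P" by (rule K.integral_contains_nat[OF Pi])
  then have "of_nat m \<in> contr P" "of_nat m \<noteq> (0::'a)" using k.ints_of_nat by (auto simp: contr_def)
  then have "contr P \<noteq> {0}" by blast
  moreover have "add_sub (contr P)"
    using K.frac_add_sub[OF K.prime_frac[OF P]] k.ints_add_sub by (auto simp: add_sub_def contr_def)
  ultimately have "contr P \<in> integral_ideals k"
    using K.frac_mult[OF K.prime_frac[OF P]] k.ints_mult
    by (auto simp: k.integral_iff contr_def ints_k_iff)
  then show ?thesis
    using K.prime_notone[OF P] K.prime_mult[OF P] by (auto simp: k.primes_iff contr_def ints_k_iff)
qed

lemma ext_subset_prime_iff: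
  assumes P: "P \<in> primes_of K" and a: "a \<in> integral_ideals k"
  shows "ext a \<subseteq> P \<longleftrightarrow> a \<subseteq> contr P"
proof
  assume "ext a \<subseteq> P"
  then show "a \<subseteq> contr P" using sub_ext[of a] k.integral_subset[OF a] by (auto simp: contr_def)
next
  assume sub: "a \<subseteq> contr P"
  note as = K.frac_add_sub[OF K.prime_frac[OF P]]
  show "ext a \<subseteq> P" unfolding modulus_ext_def
  proof (rule ideal_mult_least[OF add_sub_zero[OF as] add_sub_add[OF as]])
    fix u v assume "u \<in> a" "v \<in> OK"
    then have "v * u \<in> P" using sub by (intro K.frac_mult[OF K.prime_frac[OF P]]) (auto simp: contr_def)
    then show "u * v \<in> P" by (simp add: mult.commute)
  qed
qed

lemma val_ext_prime_iff:
  assumes P: "P \<in> primes_of K" and q: "q \<in> primes_of k"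
  shows "K.val (ext q) P > 0 \<longleftrightarrow> q = contr P"
proof -
  note qi = k.prime_integral[OF q]
  have "K.val (ext q) P > 0 \<longleftrightarrow> q \<subseteq> contr P"
    using K.subset_prime_iff[OF ext_integral[OF qi] P] ext_subset_prime_iff[OF P qi] by blast
  also have "\<dots> \<longleftrightarrow> q = contr P"
    using k.prime_maximal[OF q k.prime_integral[OF contr_prime[OF P]]] k.prime_notone[OF contr_prime[OF P]] by blast
  finally show ?thesis .
qed

lemma val_ext_nonneg: "a \<in> integral_ideals k \<Longrightarrow> K.val (ext a) P \<ge> 0"
  using K.val_nonneg_iff[OF ext_frac] k.integral_frac K.integral_subset[OF ext_integral] by blast

text \<open>The second factor is the ramification index of \<open>P\<close>. In the extended
  factorization of \<open>a\<close> only the prime below \<open>P\<close> contributes at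
  \<open>P\<close>.\<close>

lemma val_ext:
  assumes P: "P \<in> primes_of K" and a: "a \<in> frac_ideals k"
  shows "K.val (ext a) P = k.val a (contr P) * K.val (ext (contr P)) P"
proof -
  let ?e = "k.val a"
  have pr: "q \<in> primes_of k" if "?e q \<noteq> 0" for q using k.val_prime_of[OF a that] .
  have "ext a = ext (k.idl ?e)" by (simp only: k.idl_val[OF a])
  also have "\<dots> = gexp (frac_group K) (\<lambda>q. ext q) ?e"
    by (rule Ik.gexp_hom[OF K.comm_group_frac ext_hom k.val_finite[OF a]]) (simp add: k.prime_frac pr)
  finally have "K.val (ext a) P = (\<Sum>q | ?e q \<noteq> 0. ?e q * K.val (ext q) P)"
    using K.val_gexp[OF k.val_finite[OF a], of "\<lambda>q. ext q" P] ext_frac[OF k.prime_frac[OF pr]] by simp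
  also have "\<dots> = (\<Sum>q | ?e q \<noteq> 0. if q = contr P then ?e q * K.val (ext q) P else 0)"
  proof (rule sum.cong[OF refl])
    fix q assume "q \<in> {q. ?e q \<noteq> 0}"
    then have q: "q \<in> primes_of k" using pr by simp
    show "?e q * K.val (ext q) P = (if q = contr P then ?e q * K.val (ext q) P else 0)"
      using val_ext_prime_iff[OF P q] val_ext_nonneg[OF k.prime_integral[OF q], of P] by auto
  qed
  also have "\<dots> = ?e (contr P) * K.val (ext (contr P)) P"
    using k.val_finite[OF a] by (simp add: sum.delta)
  finally show ?thesis .
qed

lemma val_ext_contr_pos: "P \<in> primes_of K \<Longrightarrow> K.val (ext (contr P)) P > 0"
  using val_ext_prime_iff[OF _ contr_prime] by blast

text \<open>By \<open>ext_eq_one\<close> a prime of \<open>k\<close> cannot extend to the whole ring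
  \<open>OK\<close>, so some prime of \<open>K\<close> contains its extension.\<close>

lemma ex_prime_over:
  assumes q: "q \<in> primes_of k"
  obtains P where "P \<in> primes_of K" "contr P = q"
proof -
  note qi = k.prime_integral[OF q]
  have "1 \<notin> ext q"
  proof
    assume "1 \<in> ext q"
    then have "ext q = OK" by (rule K.integral_eq_ints[OF ext_integral[OF qi]])
    then have "q = Ok" by (rule ext_eq_one[OF k.integral_frac[OF qi]])
    then show False using k.ints_one k.prime_notone[OF q] by simp
  qed
  then obtain P where P: "P \<in> primes_of K" "ext q \<subseteq> P" by (rule K.ex_prime_above[OF ext_integral[OF qi]])
  then have "K.val (ext q) P > 0" using K.subset_prime_iff[OF ext_integral[OF qi]] by blast
  then show ?thesis using val_ext_prime_iff[OF P(1) q] P(1) that by blast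
qed

section \<open>The product of the conjugates of an ideal\<close>

definition gnorm :: "'a set \<Rightarrow> 'a set" where
  "gnorm A = finprod (frac_group K) (\<lambda>s. s ` A) \<G>"

lemma gnorm_frac: "A \<in> frac_ideals K \<Longrightarrow> gnorm A \<in> frac_ideals K"
  unfolding gnorm_def using IK.finprod_closed[of "\<lambda>s. s ` A" \<G>] act_frac by auto

lemma gnorm_hom: "gnorm \<in> hom (frac_group K) (frac_group K)"
proof (rule homI)
  fix A assume "A \<in> carrier (frac_group K)"
  then show "gnorm A \<in> carrier (frac_group K)" using gnorm_frac by simp
next
  fix A B assume "A \<in> carrier (frac_group K)" "B \<in> carrier (frac_group K)"
  then have AB: "A \<in> frac_ideals K" "B \<in> frac_ideals K" by simp_all
  have "gnorm (A \<otimes>\<^bsub>frac_group K\<^esub> B) = finprod (frac_group K) (\<lambda>s. s ` A \<otimes>\<^bsub>frac_group K\<^esub> s ` B) \<G>"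
    unfolding gnorm_def
  proof (rule IK.finprod_cong'[OF refl])
    show "(\<lambda>s. s ` A \<otimes>\<^bsub>frac_group K\<^esub> s ` B) \<in> \<G> \<rightarrow> carrier (frac_group K)"
      using AB act_frac by (auto intro!: K.ideal_mult_frac)
    fix s assume "s \<in> \<G>"
    then show "s ` (A \<otimes>\<^bsub>frac_group K\<^esub> B) = s ` A \<otimes>\<^bsub>frac_group K\<^esub> s ` B"
      using act_mult[of s A B] K.frac_subset AB by simp
  qed
  also have "\<dots> = gnorm A \<otimes>\<^bsub>frac_group K\<^esub> gnorm B" unfolding gnorm_def
    by (rule IK.finprod_multf) (use AB act_frac in auto)
  finally show "gnorm (A \<otimes>\<^bsub>frac_group K\<^esub> B) = gnorm A \<otimes>\<^bsub>frac_group K\<^esub> gnorm B" .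
qed

lemma gnorm_act:
  assumes t: "t \<in> \<G>" and A: "A \<in> frac_ideals K"
  shows "gnorm (t ` A) = gnorm A" and "t ` gnorm A = gnorm A"
proof -
  note AK = K.frac_subset[OF A]
  have c: "(\<lambda>s. s ` A) \<in> \<G> \<rightarrow> carrier (frac_group K)" using act_frac A by auto
  have r: "finprod (frac_group K) (\<lambda>s. f s ` A) \<G> = gnorm A" if "bij_betw f \<G> \<G>" for f
    using IK.finprod_reindex[of "\<lambda>s. s ` A" f \<G>] that c by (simp add: bij_betw_def gnorm_def)
  have "gnorm (t ` A) = finprod (frac_group K) (\<lambda>s. (s \<star> t) ` A) \<G>"
    unfolding gnorm_def
    by (rule IK.finprod_cong'[OF refl]) (use act_frac A t act_comp[OF _ t AK] in auto)
  then show "gnorm (t ` A) = gnorm A" using r[OF gal_rtranslate_bij[OF t]] by simp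
  have "t ` gnorm A = finprod (frac_group K) (\<lambda>s. t ` (s ` A)) \<G>"
    unfolding gnorm_def
    by (rule IK.hom_finprod_group[OF K.comm_group_frac act_hom[OF t] finite_gal]) (use act_frac A in auto)
  also have "\<dots> = finprod (frac_group K) (\<lambda>s. (t \<star> s) ` A) \<G>"
    by (rule IK.finprod_cong'[OF refl]) (use act_frac A t act_comp[OF t _ AK] in auto)
  finally show "t ` gnorm A = gnorm A" using r[OF gal_translate_bij[OF t]] by simp
qed

lemma val_gnorm:
  assumes A: "A \<in> frac_ideals K"
  shows "K.val (gnorm A) P = (\<Sum>s\<in>\<G>. K.val (s ` A) P)"
  unfolding gnorm_def by (rule K.val_finprod[OF finite_gal act_frac[OF _ A]])

lemma gnorm_principal:
  assumes y: "y \<in> K" "y \<noteq> 0"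
  shows "gnorm (principal K y) = principal K (elem_norm K k y)"
proof -
  have fin: "finprod (frac_group K) (\<lambda>s. principal K (s y)) S = principal K (\<Prod>s\<in>S. s y)"
    if "finite S" "S \<subseteq> \<G>" for S
    using that
  proof (induction S rule: finite_induct)
    case empty
    then show ?case by (simp add: K.principal_one)
  next
    case (insert s S)
    have c: "principal K (t y) \<in> frac_ideals K" if "t \<in> insert s S" for t
    proof -
      have "t \<in> \<G>" using that insert.prems by blast
      then show ?thesis using gal_mem[of t y] fhom.h_nonzero[OF gal_fhom, of t y] y K.principal_frac by blast
    qed
    then show ?case using insert
      by (subst IK.finprod_insert) (auto simp: K.principal_mult)
  qed
  have "gnorm (principal K y) = finprod (frac_group K) (\<lambda>s. principal K (s y)) \<G>"
    unfolding gnorm_def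
    by (rule IK.finprod_cong'[OF refl])
       (use act_principal[OF _ y(1)] act_frac[OF _ K.principal_frac[OF y]] in auto)
  then show ?thesis using fin[OF finite_gal order_refl] by (simp add: elem_norm_def)
qed

end

section \<open>Counting residues\<close>

text \<open>\<open>res_degree\<close> is defined through \<open>dimension\<close>, while norms count
  residues; each line extension multiplies the number of elements by \<open>card K\<close>.\<close>

lemma (in ring) dimension_card:
  "dimension m K E \<Longrightarrow> subfield K R \<Longrightarrow> card E = card K ^ m"
proof (induction m K E rule: dimension.induct)
  case (zero_dim K)
  then show ?case by simp
next
  case (Suc_dim v E m K)
  note sf = Suc_dim.prems
  note E = space_subgroup_props[OF sf Suc_dim.hyps(3)]
  note Kc = subfieldE(3)[OF sf] and sr = subringE[OF subfieldE(1)[OF sf]]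
  have "bij_betw (\<lambda>(a, e). a \<otimes> v \<oplus> e) (K \<times> E) (line_extension K v E)"
    unfolding bij_betw_def
  proof (intro conjI inj_onI)
    fix p q assume "p \<in> K \<times> E" "q \<in> K \<times> E" and eq: "(\<lambda>(a, e). a \<otimes> v \<oplus> e) p = (\<lambda>(a, e). a \<otimes> v \<oplus> e) q"
    then obtain a e b f where pq: "p = (a, e)" "q = (b, f)" "a \<in> K" "b \<in> K" "e \<in> E" "f \<in> E" by auto
    have c: "a \<in> carrier R" "b \<in> carrier R" "e \<in> carrier R" "f \<in> carrier R"
      using pq Kc E(1) by auto
    note v = Suc_dim.hyps(1)
    have "(a \<ominus> b) \<otimes> v = f \<ominus> e"
    proof -
      have "(a \<ominus> b) \<otimes> v = (a \<otimes> v \<oplus> e) \<ominus> (b \<otimes> v \<oplus> e)"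
        using c v by algebra
      also have "\<dots> = (b \<otimes> v \<oplus> f) \<ominus> (b \<otimes> v \<oplus> e)" using eq pq by simp
      also have "\<dots> = f \<ominus> e" using c v by algebra
      finally show ?thesis .
    qed
    moreover have "f \<ominus> e \<in> E" using E(3,4) pq unfolding a_minus_def by blast
    ultimately have abv: "(a \<ominus> b) \<otimes> v \<in> E" by simp
    have ab: "a \<ominus> b \<in> K" unfolding a_minus_def by (rule sr(7)[OF pq(3) sr(5)[OF pq(4)]])
    \<comment> \<open>A nonzero \<open>a \<ominus> b\<close> would put \<open>v\<close> into
      \<open>E\<close>.\<close>
    have "a \<ominus> b = \<zero>" using E(6)[of "a \<ominus> b" v] ab v abv Suc_dim.hyps(2) by blast
    then have "a = b" using c by (simp add: r_right_minus_eq)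
    moreover have "e = f" using eq pq c v \<open>a = b\<close> by simp
    ultimately show "p = q" by (simp add: pq)
  next
    show "(\<lambda>(a, e). a \<otimes> v \<oplus> e) ` (K \<times> E) = line_extension K v E"
      by (auto simp: line_extension_mem_iff image_iff) blast
  qed
  then have "card (line_extension K v E) = card (K \<times> E)" by (rule bij_betw_same_card[symmetric])
  then show ?case using Suc_dim.IH[OF sf] by (simp add: card_cartesian_product)
qed

lemma (in ring) finite_carrier_dimension:
  assumes sf: "subfield K R" and fin: "finite (carrier R)"
  shows "finite_dimension K (carrier R)"
proof -
  obtain us where us: "set us = carrier R" using finite_list[OF fin] by blast
  have "Span K us = carrier R"
    using Span_base_incl[OF sf, of us] Span_in_carrier[of K us] subfieldE(3)[OF sf] us by auto
  then show ?thesis using Span_finite_dimension[OF sf, of us] us by simp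
qed

context nfield
begin

lemma nrm_finprod:
  assumes "finite S" "\<And>i. i \<in> S \<Longrightarrow> u i \<in> integral_ideals F"
  shows "finprod (frac_group F) u S \<in> integral_ideals F \<and> nrm (finprod (frac_group F) u S) = (\<Prod>i\<in>S. nrm (u i))"
proof -
  interpret I: comm_group "frac_group F" by (rule comm_group_frac)
  from assms show ?thesis
  proof (induction S rule: finite_induct)
    case empty
    then show ?case by (simp add: ints_integral nrm_one)
  next
    case (insert i S)
    have "finprod (frac_group F) u (insert i S) = ideal_mult (u i) (finprod (frac_group F) u S)"
      using insert by (subst I.finprod_insert) (auto simp: integral_frac)
    then show ?case using insert by (simp add: ideal_mult_integral nrm_mult)
  qed
qed

lemma nrm_nat_pow:
  assumes A: "A \<in> integral_ideals F"
  shows "A [^]\<^bsub>frac_group F\<^esub> (m::nat) \<in> integral_ideals F \<and> nrm (A [^]\<^bsub>frac_group F\<^esub> m) = nrm A ^ m"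
  by (induction m) (use A in \<open>simp_all add: ints_integral nrm_one ideal_mult_integral nrm_mult\<close>)

lemma ints_prod: "(\<And>i. i \<in> I \<Longrightarrow> f i \<in> \<O>) \<Longrightarrow> prod f I \<in> \<O>"
  by (induction I rule: infinite_finite_induct) (auto simp: ints_one ints_mult)

text \<open>A substitute for localizing at \<open>p\<close>. Let \<open>a\<close> be the fractional
  ideal generated by the \<open>c i\<close>. Multiplication by an element \<open>t\<close> of its
  inverse makes all \<open>c i\<close> integral, and if every such \<open>t\<close> sent all of them
  into \<open>p\<close>, the product of \<open>a\<close> with its inverse, which is
  \<open>\<O>\<close>, would be contained in \<open>p\<close>.\<close>

lemma clear_denominators:
  fixes c :: "nat \<Rightarrow> 'a"
  assumes p: "p \<in> primes_of F" and c: "\<And>i. i < m \<Longrightarrow> c i \<in> F" and nz: "\<exists>i<m. c i \<noteq> 0"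
  obtains t where "t \<in> F" "\<And>i. i < m \<Longrightarrow> t * c i \<in> \<O>" "\<exists>i<m. t * c i \<notin> p"
proof -
  define a where "a = {\<Sum>i<m. r i * c i | r. \<forall>i<m. r i \<in> \<O>}"
  have "\<forall>i. \<exists>e::nat. i < m \<longrightarrow> e > 0 \<and> of_nat e * c i \<in> \<O>" using c ints_denominator by metis
  then obtain e :: "nat \<Rightarrow> nat" where e: "\<And>i. i < m \<Longrightarrow> e i > 0 \<and> of_nat (e i) * c i \<in> \<O>" by metis
  define N where "N = (\<Prod>i<m. e i)"
  have N: "N > 0" using e by (auto simp: N_def intro!: prod_pos)
  have Nc: "of_nat N * c i \<in> \<O>" if "i < m" for i
  proof -
    have "N = (\<Prod>j\<in>{..<m} - {i}. e j) * e i" using that by (simp add: N_def prod.remove[of _ i] mult.commute)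
    then have "of_nat N * c i = of_nat (\<Prod>j\<in>{..<m} - {i}. e j) * (of_nat (e i) * c i)" by simp
    then show ?thesis using ints_mult[OF ints_of_nat] e[OF that] by metis
  qed
  have ca: "c i \<in> a" if "i < m" for i
  proof -
    have "(\<Sum>j<m. (if j = i then 1 else 0) * c j) = (\<Sum>j<m. if j = i then c j else 0)"
      by (rule sum.cong) auto
    also have "\<dots> = c i" using that by simp
    finally show ?thesis unfolding a_def using ints_one ints_zero
      by (intro CollectI exI[of _ "\<lambda>j. if j = i then 1 else 0"]) auto
  qed
  obtain l where l: "l < m" "c l \<noteq> 0" using nz by blast
  have a: "a \<in> frac_ideals F"
  proof (rule frac_idealI[of _ "c l" "of_nat N"])
    show "a \<subseteq> F" using c ints_subset by (auto simp: a_def intro!: sum_mem mult_mem)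
    show "add_sub a" unfolding add_sub_def
    proof (intro conjI ballI)
      show "0 \<in> a" unfolding a_def using ints_zero by (intro CollectI exI[of _ "\<lambda>_. 0"]) auto
      fix x y assume "x \<in> a" "y \<in> a"
      then obtain r s where rs: "x = (\<Sum>i<m. r i * c i)" "\<forall>i<m. r i \<in> \<O>" "y = (\<Sum>i<m. s i * c i)" "\<forall>i<m. s i \<in> \<O>"
        by (auto simp: a_def)
      then have "x - y = (\<Sum>i<m. (r i - s i) * c i)" by (simp add: sum_subtractf left_diff_distrib)
      moreover have "\<forall>i<m. r i - s i \<in> \<O>" using rs ints_diff by blast
      ultimately show "x - y \<in> a" unfolding a_def by (intro CollectI exI[of _ "\<lambda>i. r i - s i"] conjI)
    qed
    show "r * x \<in> a" if rx: "r \<in> \<O>" "x \<in> a" for r x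
    proof -
      obtain s where s: "x = (\<Sum>i<m. s i * c i)" "\<forall>i<m. s i \<in> \<O>" using rx by (auto simp: a_def)
      then have "r * x = (\<Sum>i<m. (r * s i) * c i)" by (simp add: sum_distrib_left mult.assoc)
      moreover have "\<forall>i<m. r * s i \<in> \<O>" using s rx ints_mult by blast
      ultimately show ?thesis unfolding a_def by (intro CollectI exI[of _ "\<lambda>i. r * s i"] conjI)
    qed
    show "of_nat N * x \<in> \<O>" if x: "x \<in> a" for x
    proof -
      obtain s where s: "x = (\<Sum>i<m. s i * c i)" "\<forall>i<m. s i \<in> \<O>" using x by (auto simp: a_def)
      have "of_nat N * x = (\<Sum>i<m. s i * (of_nat N * c i))" unfolding s(1)
        by (simp add: sum_distrib_left mult.left_commute)
      also have "\<dots> \<in> \<O>" by (rule ints_sum, rule ints_mult) (use Nc s(2) in auto)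
      finally show ?thesis .
    qed
  qed (use l ca N of_nat_mem in auto)
  let ?b = "inv\<^bsub>frac_group F\<^esub> a"
  note ab = frac_inv[OF a]
  have tO: "t * c i \<in> \<O>" if "t \<in> ?b" "i < m" for t i
    using ideal_mult_memI[OF ca[OF that(2)] that(1)] unfolding ab by (simp add: mult.commute)
  have "\<exists>t\<in>?b. \<exists>i<m. t * c i \<notin> p"
  proof (rule ccontr)
    assume neg: "\<not> (\<exists>t\<in>?b. \<exists>i<m. t * c i \<notin> p)"
    note as = frac_add_sub[OF prime_frac[OF p]]
    have "ideal_mult a ?b \<subseteq> p"
    proof (rule ideal_mult_least[OF add_sub_zero[OF as] add_sub_add[OF as]])
      fix x t assume xt: "x \<in> a" "t \<in> ?b"
      then obtain s where s: "x = (\<Sum>i<m. s i * c i)" "\<forall>i<m. s i \<in> \<O>" by (auto simp: a_def)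
      then have "x * t = (\<Sum>i<m. s i * (t * c i))" by (simp add: sum_distrib_left sum_distrib_right ac_simps)
      moreover have "s i * (t * c i) \<in> p" if "i < m" for i
        by (rule frac_mult[OF prime_frac[OF p]]) (use neg xt(2) s(2) that in auto)
      ultimately show "x * t \<in> p" by (auto intro!: add_sub_sum[OF as])
    qed
    then show False using ab ints_one prime_notone[OF p] by blast
  qed
  then obtain t where t: "t \<in> ?b" "\<exists>i<m. t * c i \<notin> p" by blast
  have "t \<in> F" using t(1) frac_subset[OF frac_inv_closed[OF a]] by blast
  then show ?thesis using that[of t] tO[OF t(1)] t(2) by blast
qed

end

context gal_ext
begin

interpretation IK: comm_group "frac_group K" by (rule K.comm_group_frac)
interpretation Ik: comm_group "frac_group k" by (rule k.comm_group_frac)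

lemma prime_prod:
  assumes P: "P \<in> primes_of K" and fin: "finite S" and f: "\<And>i. i \<in> S \<Longrightarrow> f i \<in> OK"
    and prod: "prod f S \<in> P"
  shows "\<exists>i\<in>S. f i \<in> P"
  using fin f prod
proof (induction S rule: finite_induct)
  case empty
  then show ?case using K.prime_notone[OF P] by simp
next
  case (insert i S)
  have "prod f S \<in> OK" using insert.prems(1) by (intro K.ints_prod) auto
  moreover have "f i * prod f S \<in> P" using insert by simp
  ultimately have "f i \<in> P \<or> prod f S \<in> P" using K.prime_mult[OF P] insert.prems(1) by blast
  then show ?case using insert by blast
qed

text \<open>If \<open>P'\<close> is no conjugate of \<open>P\<close>, some \<open>a\<close> in
  \<open>P'\<close> is congruent to 1 modulo every conjugate of \<open>P\<close>. Its norm lies in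
  \<open>contr P' = contr P\<close>, so some \<open>s a\<close> lies in \<open>P\<close> and
  \<open>a\<close> lies in a conjugate of \<open>P\<close>, a contradiction.\<close>

lemma gal_transitive:
  assumes P: "P \<in> primes_of K" and P': "P' \<in> primes_of K" and eq: "contr P = contr P'"
  shows "\<exists>s\<in>\<G>. P' = s ` P"
proof (rule ccontr)
  assume neg: "\<not> (\<exists>s\<in>\<G>. P' = s ` P)"
  note Pf = K.prime_frac[OF P]
  have int: "gnorm P \<in> integral_ideals K"
    unfolding gnorm_def using K.nrm_finprod[OF finite_gal, of "\<lambda>s. s ` P"] act_integral[OF _ K.prime_integral[OF P]] by blast
  have "K.val (gnorm P) P' = (\<Sum>s\<in>\<G>. 0)" unfolding val_gnorm[OF Pf]
    by (rule sum.cong[OF refl]) (use neg K.val_prime[OF act_prime[OF _ P]] in auto)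
  then have "\<not> gnorm P \<subseteq> P'" using K.subset_prime_iff[OF int P'] by simp
  \<comment> \<open>\<open>x\<close> lies in every conjugate of \<open>P\<close> and is invertible
    modulo \<open>P'\<close>; the element \<open>a\<close> below is 1 minus a suitable multiple of
    it.\<close>
  then obtain x where x: "x \<in> gnorm P" "x \<notin> P'" by blast
  have xO: "x \<in> OK" using x(1) K.integral_subset[OF int] by blast
  obtain y where y: "y \<in> OK" "y * x - 1 \<in> P'" using K.prime_inverse_mod[OF P' xO x(2)] by blast
  define a where "a = 1 - y * x"
  have aP': "a \<in> P'" using add_sub_uminus[OF K.frac_add_sub[OF K.prime_frac[OF P']] y(2)] by (simp add: a_def)
  have aO: "a \<in> OK" using aP' K.integral_subset[OF K.prime_integral[OF P']] by blast
  have all: "s ` P \<supseteq> gnorm P" if s: "s \<in> \<G>" for s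
  proof -
    have "K.val (gnorm P) (s ` P) \<ge> K.val (s ` P) (s ` P)" unfolding val_gnorm[OF Pf]
      by (rule member_le_sum[OF s _ finite_gal]) (simp add: K.val_prime[OF act_prime[OF _ P]])
    then have "K.val (gnorm P) (s ` P) > 0" by (simp add: K.val_prime[OF act_prime[OF s P]])
    then show ?thesis using K.subset_prime_iff[OF int act_prime[OF s P]] by blast
  qed
  have "elem_norm K k a = a * (\<Prod>s\<in>\<G> - {\<one>\<^bsub>gal_group K k\<^esub>}. s a)"
    unfolding elem_norm_def using finite_gal gal_one_apply[OF K.ints_subset[OF aO]]
    by (subst prod.remove[of _ "\<one>\<^bsub>gal_group K k\<^esub>"]) auto
  moreover have pr: "(\<Prod>s\<in>S. s a) \<in> OK" if "finite S" "S \<subseteq> \<G>" for S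
    using that by (induction S rule: finite_induct) (auto simp: K.ints_one K.ints_mult gal_ints[OF _ aO])
  ultimately have "elem_norm K k a \<in> P'"
    using K.frac_mult[OF K.prime_frac[OF P'] pr aP', of "\<G> - {\<one>\<^bsub>gal_group K k\<^esub>}"] finite_gal
    by (simp add: mult.commute)
  moreover have "elem_norm K k a \<in> Ok"
    using norm_mem[OF K.ints_subset[OF aO]] pr[OF finite_gal order_refl] by (simp add: ints_k_iff elem_norm_def)
  ultimately have "elem_norm K k a \<in> contr P'" by (simp add: contr_def)
  then have "elem_norm K k a \<in> P" using eq by (auto simp: contr_def)
  then obtain s where s: "s \<in> \<G>" "s a \<in> P"
    using prime_prod[OF P finite_gal, of "\<lambda>s. s a"] gal_ints[OF _ aO] by (auto simp: elem_norm_def)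
  let ?Q = "ginv s ` P"
  have Q: "?Q \<in> primes_of K" by (rule act_prime[OF G.inv_closed[OF s(1)] P])
  have "ginv s (s a) \<in> ?Q" using s(2) by (rule imageI)
  then have "a \<in> ?Q" by (simp only: gal_inv_apply[OF s(1) K.ints_subset[OF aO]])
  moreover have "y * x \<in> ?Q"
    by (rule K.frac_mult[OF K.prime_frac[OF Q] y(1)]) (use all[OF G.inv_closed[OF s(1)]] x in blast)
  ultimately have "a + y * x \<in> ?Q" by (rule add_sub_add[OF K.frac_add_sub[OF K.prime_frac[OF Q]]])
  then show False using K.prime_notone[OF Q] by (simp add: a_def)
qed

text \<open>Let \<open>m\<close> be the dimension of \<open>OK / ext p\<close> over
  \<open>Ok / p\<close>. Then \<open>m \<le> n\<close>, because a relation from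
  \<open>gal_dependent\<close> can be scaled by \<open>clear_denominators\<close>. If
  \<open>m < n\<close>, some trace form kills lifts of a basis of the residue space, and its image
  \<open>L\<close> on \<open>OK\<close> would satisfy \<open>L \<subseteq> p L\<close>, which is
  impossible for a fractional ideal.\<close>

lemma nrm_ext_prime:
  assumes p: "p \<in> primes_of k"
  shows "K.nrm (ext p) = k.nrm p ^ n"
proof -
  note pin = k.prime_integral[OF p] and pf = k.prime_frac[OF p]
  note ei = ext_integral[OF pin] note ef = K.integral_frac[OF ei]
  have dep: "\<exists>c. (\<forall>i<Suc n. c i \<in> Ok) \<and> (\<exists>i<Suc n. c i \<notin> p) \<and> (\<Sum>i<Suc n. c i * x i) \<in> ext p"
    if x: "\<And>i. i < Suc n \<Longrightarrow> x i \<in> OK" for x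
  proof -
    obtain c where c: "\<And>i. i < Suc n \<Longrightarrow> c i \<in> k" "\<exists>i<Suc n. c i \<noteq> 0" "(\<Sum>i<Suc n. c i * x i) = 0"
      by (rule gal_dependent[of x]) (use x K.ints_subset in blast)+
    obtain t where t: "t \<in> k" "\<And>i. i < Suc n \<Longrightarrow> t * c i \<in> Ok" "\<exists>i<Suc n. t * c i \<notin> p"
      using k.clear_denominators[OF p c(1,2)] by metis
    have "(\<Sum>i<Suc n. t * c i * x i) = t * (\<Sum>i<Suc n. c i * x i)"
      by (simp only: sum_distrib_left mult.assoc)
    also have "\<dots> = 0" by (simp only: c(3) mult_zero_right)
    finally have "(\<Sum>i<Suc n. t * c i * x i) \<in> ext p" using add_sub_zero[OF K.frac_add_sub[OF ef]] by (simp only:)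
    then show ?thesis using t by (intro exI[of _ "\<lambda>i. t * c i"]) blast
  qed
  have pM: "r * x \<in> ext p" if "r \<in> p" "x \<in> OK" for r x
    using ideal_mult_memI[OF that] by (simp add: modulus_ext_def)
  obtain m x where m: "m \<le> n" "\<And>i. i < m \<Longrightarrow> x i \<in> OK"
    "\<And>y. y \<in> OK \<Longrightarrow> \<exists>c. (\<forall>i<m. c i \<in> Ok) \<and> y - (\<Sum>i<m. c i * x i) \<in> ext p"
    "card (add_quot OK (ext p)) = card (add_quot Ok p) ^ m"
    by (rule residue_space_count[of Ok p OK "ext p" n])
       (use k.ints_add_sub k.ints_mult k.frac_add_sub[OF pf] k.integral_subset[OF pin] k.frac_mult[OF pf]
         k.prime_inverse_mod[OF p] K.ints_add_sub K.ints_mult K.frac_add_sub[OF ef] K.integral_subset[OF ei]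
         K.frac_mult[OF ef] ints_k_iff pM dep in \<open>auto simp del: sum.lessThan_Suc\<close>)
  have "\<not> m < n"
  proof
    assume mn: "m < n"
    obtain \<theta> where \<theta>: "\<theta> \<in> K" "inj_on (\<lambda>s. s \<theta>) \<G>" by (rule primitive_element[OF finite_gal order_refl])
    have \<theta>K: "\<theta> ^ j \<in> K" for j by (rule K.power_mem[OF \<theta>(1)])
    have xK: "x i \<in> K" if "i < m" for i using m(2)[OF that] K.ints_subset by blast
    \<comment> \<open>Fewer equations than unknowns: among the combinations of the powers of
      \<open>\<theta>\<close> there is a nonzero \<open>c\<close> with
      \<open>tr (c * x i) = 0\<close> for all \<open>i < m\<close>.\<close>
    have "\<exists>c. (\<forall>j\<in>{..<n}. c j \<in> k) \<and> (\<exists>j\<in>{..<n}. c j \<noteq> 0) \<and>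
        (\<forall>i\<in>{..<m}. (\<Sum>j\<in>{..<n}. tr (\<theta> ^ j * x i) * c j) = 0)"
      by (rule k.homogeneous_system) (use mn xK \<theta>K in \<open>auto intro!: tr_mem K.mult_mem\<close>)
    then obtain e where e: "\<And>j. j < n \<Longrightarrow> e j \<in> k" "\<exists>j<n. e j \<noteq> 0"
      "\<And>i. i < m \<Longrightarrow> (\<Sum>j<n. tr (\<theta> ^ j * x i) * e j) = 0" by blast
    define c where "c = (\<Sum>j<n. e j * \<theta> ^ j)"
    have c0: "c \<noteq> 0"
      using powers_independent[OF finite_gal order_refl \<theta>, of e] e(1,2) unfolding c_def by blast
    have cK: "c \<in> K" unfolding c_def using e(1) kK \<theta>K by (intro K.sum_mem K.mult_mem) auto
    have tx: "tr (c * x i) = 0" if i: "i < m" for i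
    proof -
      have "tr (c * x i) = tr (\<Sum>j<n. e j * (\<theta> ^ j * x i))" by (simp add: c_def sum_distrib_right mult.assoc)
      also have "\<dots> = (\<Sum>j<n. tr (e j * (\<theta> ^ j * x i)))"
        by (rule tr_sum) (use e(1) kK \<theta>K xK[OF i] in \<open>auto intro!: K.mult_mem\<close>)
      also have "\<dots> = (\<Sum>j<n. tr (\<theta> ^ j * x i) * e j)"
        by (rule sum.cong[OF refl]) (use e(1) \<theta>K xK[OF i] in \<open>auto simp: tr_scale K.mult_mem mult.commute\<close>)
      also have "\<dots> = 0" by (rule e(3)[OF i])
      finally show ?thesis .
    qed
    \<comment> \<open>The image of \<open>OK\<close> under the trace form of \<open>c\<close>, a
      fractional ideal of \<open>k\<close>.\<close>
    define L where "L = (\<lambda>y. tr (c * y)) ` OK"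
    have cyK: "c * y \<in> K" if "y \<in> OK" for y using K.mult_mem[OF cK K.ints_subset[OF that]] .
    have L: "L \<in> frac_ideals k"
    proof -
      obtain m0 :: nat where m0: "m0 > 0" "of_nat m0 * inverse c \<in> OK"
        by (rule K.ints_denominator[OF K.inverse_mem[OF cK]])
      obtain m1 :: nat where m1: "m1 > 0" "of_nat m1 * c \<in> OK" by (rule K.ints_denominator[OF cK])
      \<comment> \<open>A nonzero element of \<open>L\<close>: the integral element
        \<open>m0 * inverse c\<close> is sent to the trace of \<open>m0\<close>, which is
        \<open>m0 * n\<close>.\<close>
      have "c * (of_nat m0 * inverse c) = of_nat m0" using c0 by simp
      then have w: "of_nat m0 * of_nat n \<in> L" using m0(2) tr_of_nat[of m0] unfolding L_def by (metis image_eqI)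
      show ?thesis
      proof (rule k.frac_idealI[OF _ _ w, of "of_nat m1"])
        show "L \<subseteq> k" using cyK tr_mem by (auto simp: L_def)
        show "add_sub L" unfolding add_sub_def
        proof (intro conjI ballI)
          have "tr (c * 0) = 0" using tr_of_nat[of 0] by simp
          then show "0 \<in> L" using K.ints_zero unfolding L_def by (metis image_eqI)
          fix u v assume "u \<in> L" "v \<in> L"
          then obtain a b where ab: "a \<in> OK" "b \<in> OK" "u = tr (c * a)" "v = tr (c * b)" by (auto simp: L_def)
          then have "tr (c * (a - b)) = u - v" using cyK by (simp add: right_diff_distrib tr_diff)
          then show "u - v \<in> L" using K.ints_diff[OF ab(1,2)] unfolding L_def by (metis image_eqI)
        qed
        show "r * u \<in> L" if ru: "r \<in> Ok" "u \<in> L" for r u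
        proof -
          obtain a where a: "a \<in> OK" "u = tr (c * a)" using ru by (auto simp: L_def)
          then have "tr (c * (r * a)) = r * u"
            using tr_scale[OF k.ints_subset[OF ru(1)] cyK[OF a(1)]] by (simp add: mult.left_commute)
          moreover have "r * a \<in> OK" using ru a by (auto simp: ints_k_iff K.ints_mult)
          ultimately show ?thesis unfolding L_def by (metis image_eqI)
        qed
        show "of_nat m1 * u \<in> Ok" if u: "u \<in> L" for u
        proof -
          obtain a where a: "a \<in> OK" "u = tr (c * a)" using u by (auto simp: L_def)
          have "of_nat m1 * u = tr (of_nat m1 * (c * a))"
            unfolding a(2) by (rule tr_scale[OF k.of_nat_mem cyK[OF a(1)], symmetric])
          also have "\<dots> = tr (of_nat m1 * c * a)" by (simp add: mult.assoc)
          finally have eq: "of_nat m1 * u = tr (of_nat m1 * c * a)" .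
          have "of_nat m1 * c * a \<in> OK" by (rule K.ints_mult[OF m1(2) a(1)])
          then have "tr (of_nat m1 * c * a) \<in> OK" unfolding tr_def
            by (intro K.ints_sum) (rule gal_ints[OF _ \<open>of_nat m1 * c * a \<in> OK\<close>])
          moreover have "tr (of_nat m1 * c * a) \<in> k"
            by (rule tr_mem[OF K.ints_subset[OF \<open>of_nat m1 * c * a \<in> OK\<close>]])
          ultimately show ?thesis unfolding eq by (simp add: ints_k_iff)
        qed
      qed (use m0 m1 n_pos k.of_nat_mem in auto)
    qed
    have pL: "tr (c * z) \<in> ideal_mult p L" if z: "z \<in> ext p" for z
    proof -
      have "ideal_mult p OK \<subseteq> {z \<in> K. tr (c * z) \<in> ideal_mult p L}"
      proof (rule ideal_mult_least)
        show "0 \<in> {z \<in> K. tr (c * z) \<in> ideal_mult p L}"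
          using tr_of_nat[of 0] ideal_mult_zero K.zero_mem by simp
        fix u v assume "u \<in> {z \<in> K. tr (c * z) \<in> ideal_mult p L}" "v \<in> {z \<in> K. tr (c * z) \<in> ideal_mult p L}"
        then show "u + v \<in> {z \<in> K. tr (c * z) \<in> ideal_mult p L}"
          using cK by (simp add: distrib_left tr_add K.mult_mem K.add_mem ideal_mult_add)
      next
        fix a b assume ab: "a \<in> p" "b \<in> OK"
        have ak: "a \<in> k" using ab(1) k.frac_subset[OF pf] by blast
        have "tr (c * (a * b)) = a * tr (c * b)" using tr_scale[OF ak cyK[OF ab(2)]] by (simp add: mult.left_commute)
        also have "\<dots> \<in> ideal_mult p L" by (rule ideal_mult_memI[OF ab(1)]) (use ab(2) in \<open>auto simp: L_def\<close>)
        finally show "a * b \<in> {z \<in> K. tr (c * z) \<in> ideal_mult p L}"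
          using K.mult_mem[OF kK[OF ak] K.ints_subset[OF ab(2)]] by simp
      qed
      then show ?thesis using z by (auto simp: modulus_ext_def)
    qed
    \<comment> \<open>Modulo \<open>ext p\<close> every \<open>y\<close> is a combination of the
      \<open>x i\<close>, whose contribution is 0, so only elements of \<open>ext p\<close> count.
      Comparing valuations at \<open>p\<close> then gives the contradiction.\<close>
    have "L \<subseteq> ideal_mult p L"
    proof
      fix u assume "u \<in> L"
      then obtain y where y: "y \<in> OK" "u = tr (c * y)" by (auto simp: L_def)
      obtain r where r: "\<forall>i<m. r i \<in> Ok" "y - (\<Sum>i<m. r i * x i) \<in> ext p" using m(3)[OF y(1)] by blast
      have rk: "r i \<in> k" if "i < m" for i using r(1) that k.ints_subset by blast
      define z where "z = y - (\<Sum>i<m. r i * x i)"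
      have zp: "z \<in> ext p" using r(2) by (simp add: z_def)
      have zK: "z \<in> K" using zp K.frac_subset[OF ef] by blast
      have "c * y = c * z + (\<Sum>i<m. r i * (c * x i))"
        by (simp add: z_def right_diff_distrib sum_distrib_left mult.left_commute)
      moreover have "(\<Sum>i<m. r i * (c * x i)) \<in> K"
        by (rule K.sum_mem) (use rk kK cK xK in \<open>auto intro!: K.mult_mem\<close>)
      ultimately have "u = tr (c * z) + tr (\<Sum>i<m. r i * (c * x i))"
        using y(2) tr_add[OF K.mult_mem[OF cK zK]] by simp
      also have "tr (\<Sum>i<m. r i * (c * x i)) = (\<Sum>i<m. tr (r i * (c * x i)))"
        by (rule tr_sum) (use rk kK cK xK in \<open>auto intro!: K.mult_mem\<close>)
      also have "\<dots> = (\<Sum>i<m. 0)"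
        by (rule sum.cong[OF refl]) (use rk cK xK tx in \<open>auto simp: tr_scale K.mult_mem\<close>)
      finally show "u \<in> ideal_mult p L" using pL[OF zp] by simp
    qed
    then have "k.val (ideal_mult p L) p \<le> k.val L p"
      using k.val_le_iff[OF L k.ideal_mult_frac[OF pf L]] by blast
    then show False by (simp add: k.val_mult[OF pf L] k.val_prime[OF p])
  qed
  with m(1) have "m = n" by simp
  then show ?thesis using m(4) by (simp add: K.nrm_def k.nrm_def)
qed

end

section \<open>Norms of ideals\<close>

context gal_ext
begin

interpretation IK: comm_group "frac_group K" by (rule K.comm_group_frac)
interpretation Ik: comm_group "frac_group k" by (rule k.comm_group_frac)

text \<open>The description in \<open>res_degree\<close> denotes because \<open>OK / P\<close> is a
  finite field, hence of a unique finite dimension over the image of \<open>Ok\<close>; that image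
  is a subfield with \<open>nrm (contr P)\<close> elements.\<close>

lemma nrm_prime_res_degree:
  assumes P: "P \<in> primes_of K"
  shows "K.nrm P = k.nrm (contr P) ^ res_degree K k P"
proof -
  let ?R = "ring_on OK"
  let ?Q = "?R Quot P"
  let ?h = "\<lambda>x. P +>\<^bsub>?R\<^esub> x"
  note as = K.frac_add_sub[OF K.prime_frac[OF P]]
  interpret R: cring ?R by (rule K.cring_ints)
  interpret P: primeideal P ?R using P by (simp add: primes_of_def)
  have h: "?h x = (+) x ` P" for x by (auto simp: a_r_coset_def' add.commute)
  have carr: "carrier ?Q = add_quot OK P"
    unfolding FactRing_def A_RCOSETS_def' by (auto simp: h add_quot_def)
  have h_eq: "?h x = ?h y \<longleftrightarrow> x - y \<in> P" for x y unfolding h by (rule coset_eq_iff[OF as])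
  interpret Q: cring ?Q by (rule P.quotient_is_cring[OF K.cring_ints])
  interpret h: ring_hom_ring ?R ?Q ?h by (rule P.rcos_ring_hom_ring)
  have one: "\<one>\<^bsub>?Q\<^esub> = ?h 1" and zero: "\<zero>\<^bsub>?Q\<^esub> = ?h 0"
    using h.hom_one h.hom_zero by simp_all
  have inv: "\<exists>y\<in>S. ?h y \<otimes>\<^bsub>?Q\<^esub> ?h x = \<one>\<^bsub>?Q\<^esub>"
    if "x \<in> OK" "y \<in> OK" "y \<in> S" "y * x - 1 \<in> P" for x y S
  proof -
    have "?h y \<otimes>\<^bsub>?Q\<^esub> ?h x = ?h (y * x)" using h.hom_mult[of y x] that by simp
    also have "\<dots> = \<one>\<^bsub>?Q\<^esub>" unfolding one h_eq by (rule that(4))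
    finally show ?thesis using that(3) by blast
  qed
  have field: "Ring.field ?Q"
  proof (rule Q.cring_fieldI2)
    show "\<zero>\<^bsub>?Q\<^esub> \<noteq> \<one>\<^bsub>?Q\<^esub>" unfolding one zero h_eq
      using add_sub_uminus[OF as, of "-1"] K.prime_notone[OF P] by auto
    fix a assume a: "a \<in> carrier ?Q" "a \<noteq> \<zero>\<^bsub>?Q\<^esub>"
    then obtain x where x: "x \<in> OK" "a = ?h x" unfolding carr by (auto simp: add_quot_def h)
    then have "x \<notin> P" using a(2) h_eq[of x 0] unfolding zero by simp
    then obtain y where y: "y \<in> OK" "y * x - 1 \<in> P" using K.prime_inverse_mod[OF P x(1)] by blast
    have yc: "?h y \<in> carrier ?Q" using h.hom_closed[of y] y(1) by simp
    have "?h y \<otimes>\<^bsub>?Q\<^esub> a = \<one>\<^bsub>?Q\<^esub>" using inv[OF x(1) y(1), of "{y}"] y(2) x(2) by simp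
    then show "\<exists>b\<in>carrier ?Q. a \<otimes>\<^bsub>?Q\<^esub> b = \<one>\<^bsub>?Q\<^esub>" using Q.m_comm[OF a(1) yc] yc by metis
  qed
  interpret Q: Ring.field ?Q by (rule field)
  let ?k = "?h ` Ok"
  have okO: "x \<in> OK" if "x \<in> Ok" for x using that ints_k_iff by blast
  have "subring Ok ?R"
  proof (rule R.subringI)
    fix x assume x: "x \<in> Ok"
    have "\<ominus>\<^bsub>?R\<^esub> x = - x"
      using R.minus_equality[of "-x" x] okO[OF x] K.ints_uminus[OF okO[OF x]] by simp
    then show "\<ominus>\<^bsub>?R\<^esub> x \<in> Ok" using k.ints_uminus[OF x] by simp
  qed (use okO k.ints_one k.ints_mult k.ints_add in auto)
  then have sr: "subring ?k ?Q" by (rule h.img_is_subring)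
  have sf: "subfield ?k ?Q"
  proof (rule Q.subfieldI'[OF sr])
    fix a assume a: "a \<in> ?k - {\<zero>\<^bsub>?Q\<^esub>}"
    then obtain x where x: "x \<in> Ok" "a = ?h x" by blast
    then have "x \<notin> contr P" using a h_eq[of x 0] unfolding zero by (auto simp: contr_def)
    then obtain y where y: "y \<in> Ok" "y * x - 1 \<in> contr P"
      using k.prime_inverse_mod[OF contr_prime[OF P] x(1)] by blast
    have eq: "?h y \<otimes>\<^bsub>?Q\<^esub> a = \<one>\<^bsub>?Q\<^esub>"
      using inv[OF okO[OF x(1)] okO[OF y(1)], of "{y}"] y(2) x(2) by (simp add: contr_def)
    have "a \<in> carrier ?Q" "?h y \<in> carrier ?Q" using h.hom_closed x y okO by auto
    then have "inv\<^bsub>?Q\<^esub> a = ?h y" using Q.comm_inv_char[of a "?h y"] eq Q.m_comm by metis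
    then show "inv\<^bsub>?Q\<^esub> a \<in> ?k" using y(1) by simp
  qed
  have fin: "finite (carrier ?Q)" unfolding carr by (rule K.finite_quot[OF K.prime_integral[OF P]])
  have "\<exists>!m. Q.dimension m ?k (carrier ?Q)"
    by (rule Q.unique_dimension[OF sf Q.finite_carrier_dimension[OF sf fin]])
  then have "Q.dimension (res_degree K k P) ?k (carrier ?Q)"
    unfolding res_degree_def Let_def by (rule theI')
  then have "card (carrier ?Q) = card ?k ^ res_degree K k P" using Q.dimension_card[OF _ sf] by blast
  moreover have "card ?k = k.nrm (contr P)"
  proof -
    have "card (add_quot Ok (contr P)) = card (add_quot Ok P)"
      by (rule add_quot_bij(1)[OF k.frac_add_sub[OF k.prime_frac[OF contr_prime[OF P]]] as, of _ "\<lambda>x. x"])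
         (use k.ints_diff add_sub_zero[OF as] in \<open>auto simp: contr_def intro!: bexI\<close>)
    then show ?thesis by (simp add: h add_quot_def k.nrm_def)
  qed
  ultimately show ?thesis by (simp add: carr K.nrm_def)
qed

lemma nrm_act:
  assumes s: "s \<in> \<G>" and A: "A \<in> integral_ideals K"
  shows "K.nrm (s ` A) = K.nrm A"
proof -
  interpret s: fhom K s by (rule gal_fhom[OF s])
  note AK = K.frac_subset[OF K.integral_frac[OF A]]
  have "card (add_quot OK A) = card (add_quot OK (s ` A))"
  proof (rule add_quot_bij(1)[OF K.frac_add_sub K.frac_add_sub, of _ _ _ s])
    show "A \<in> frac_ideals K" "s ` A \<in> frac_ideals K" using A act_frac[OF s] K.integral_frac by auto
    fix x assume "x \<in> OK"
    then show "s x \<in> OK" by (rule gal_ints[OF s])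
  next
    fix x y assume xy: "x \<in> OK" "y \<in> OK"
    note xyK = K.ints_subset[OF xy(1)] K.ints_subset[OF xy(2)]
    have "s x - s y = s (x - y)" by (simp add: s.h_diff xyK)
    also have "\<dots> \<in> s ` A \<longleftrightarrow> x - y \<in> A"
      using inj_on_image_mem_iff[OF s.h_inj K.diff_mem[OF xyK] AK] .
    finally show "s x - s y \<in> s ` A \<longleftrightarrow> x - y \<in> A" .
  next
    fix z assume "z \<in> OK"
    then obtain x where "x \<in> OK" "z = s x" using gal_image_ints[OF s] by blast
    moreover have "0 \<in> s ` A" using add_sub_zero[OF K.frac_add_sub[OF act_frac[OF s K.integral_frac[OF A]]]] .
    ultimately show "\<exists>x\<in>OK. z - s x \<in> s ` A" by (intro bexI[of _ x]) simp_all
  qed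
  then show ?thesis by (simp add: K.nrm_def)
qed

text \<open>
  Both sides are Galois invariant and supported on the orbit of \<open>P\<close>, so one contains the
  other; they are equal because their absolute norms agree.
\<close>

lemma gnorm_prime:
  assumes P: "P \<in> primes_of K"
  shows "gnorm P = ext (contr P) [^]\<^bsub>frac_group K\<^esub> res_degree K k P"
proof -
  let ?f = "res_degree K k P" and ?p = "contr P"
  let ?E = "ext ?p [^]\<^bsub>frac_group K\<^esub> ?f"
  note Pf = K.prime_frac[OF P] and Pi = K.prime_integral[OF P]
  note p = contr_prime[OF P] note ei = ext_integral[OF k.prime_integral[OF p]]
  have g: "gnorm P \<in> integral_ideals K" "K.nrm (gnorm P) = (\<Prod>s\<in>\<G>. K.nrm (s ` P))"
    unfolding gnorm_def using K.nrm_finprod[OF finite_gal, of "\<lambda>s. s ` P"] act_integral[OF _ Pi] by blast+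
  have E: "?E \<in> integral_ideals K" "K.nrm ?E = K.nrm (ext ?p) ^ ?f" using K.nrm_nat_pow[OF ei] by blast+
  \<comment> \<open>Both sides have norm \<open>nrm (contr P)\<close> to the power
    \<open>n * ?f\<close>: on the left \<open>n\<close> conjugates of norm exponent
    \<open>?f\<close>, on the right the \<open>?f\<close>-th power of an ideal of norm exponent
    \<open>n\<close>.\<close>
  have "K.nrm (gnorm P) = (\<Prod>s\<in>\<G>. K.nrm P)" unfolding g(2) by (rule prod.cong[OF refl nrm_act[OF _ Pi]])
  also have "\<dots> = K.nrm (ext ?p) ^ ?f"
    unfolding nrm_ext_prime[OF p] by (simp add: nrm_prime_res_degree[OF P] power_mult[symmetric] mult.commute)
  finally have nrm: "K.nrm (gnorm P) = K.nrm ?E" unfolding E(2) .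
  note gf = K.integral_frac[OF g(1)] and Ef = K.integral_frac[OF E(1)]
  have valE: "K.val ?E Q = int ?f * K.val (ext ?p) Q" for Q by (rule K.val_nat_pow[OF K.integral_frac[OF ei]])
  have orb: "K.val (gnorm P) (s ` P) = K.val (gnorm P) P" "K.val ?E (s ` P) = K.val ?E P" if s: "s \<in> \<G>" for s
    using act_val[OF s gf P] gnorm_act(2)[OF s Pf] act_val[OF s K.integral_frac[OF ei] P]
      act_ext[OF s k.prime_frac[OF p]] by (simp_all add: valE)
  have off: "K.val (gnorm P) Q = 0 \<and> K.val ?E Q = 0" if no: "\<not> (\<exists>s\<in>\<G>. Q = s ` P)" for Q
  proof (cases "Q \<in> primes_of K")
    case True
    have "K.val (gnorm P) Q = (\<Sum>s\<in>\<G>. 0)" unfolding val_gnorm[OF Pf]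
      by (rule sum.cong[OF refl]) (use no K.val_prime[OF act_prime[OF _ P]] in auto)
    moreover have "?p \<noteq> contr Q" using gal_transitive[OF P True] no by blast
    then have "K.val (ext ?p) Q = 0"
      using val_ext_prime_iff[OF True p] val_ext_nonneg[OF k.prime_integral[OF p], of Q] by linarith
    ultimately show ?thesis by (simp add: valE)
  next
    case False
    then show ?thesis using K.val_prime_of[OF gf] K.val_prime_of[OF Ef] by blast
  qed
  \<comment> \<open>Along the orbit all exponents equal the one at \<open>P\<close>, and elsewhere
    they vanish, so the comparison at \<open>P\<close> decides inclusion.\<close>
  have cmp: "(\<forall>Q. K.val A Q \<le> K.val B Q)"
    if le: "K.val A P \<le> K.val B P" and AB: "A \<in> {gnorm P, ?E}" "B \<in> {gnorm P, ?E}" for A B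
  proof
    fix Q
    show "K.val A Q \<le> K.val B Q"
    proof (cases "\<exists>s\<in>\<G>. Q = s ` P")
      case True
      then obtain s where s: "s \<in> \<G>" "Q = s ` P" by blast
      then show ?thesis using le AB orb[OF s(1)] by auto
    next
      case False
      then show ?thesis using off[OF False] AB by auto
    qed
  qed
  show ?thesis
  proof (cases "K.val ?E P \<le> K.val (gnorm P) P")
    case True
    then have "gnorm P \<subseteq> ?E" using cmp[of ?E "gnorm P"] K.val_le_iff[OF gf Ef] by blast
    then show ?thesis by (rule K.nrm_eq_imp_eq[OF g(1) E(1) _ nrm])
  next
    case False
    then have "?E \<subseteq> gnorm P" using cmp[of "gnorm P" ?E] K.val_le_iff[OF Ef gf] by (simp add: linear)
    then show ?thesis using K.nrm_eq_imp_eq[OF E(1) g(1) _ nrm[symmetric]] by simp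
  qed
qed

section \<open>The ideal norm through the product of conjugates\<close>

lemma contr_pow_frac: "P \<in> primes_of K \<Longrightarrow> contr P [^]\<^bsub>frac_group k\<^esub> (m::nat) \<in> frac_ideals k"
  using Ik.nat_pow_closed[of "contr P" m] k.prime_frac[OF contr_prime] by simp

text \<open>Separating the residue degree from the valuation puts the definition into the form to
  which \<open>gexp_hom\<close> applies, with a base that depends on the prime only.\<close>

lemma ideal_norm_gexp:
  assumes A: "A \<in> frac_ideals K"
  shows "ideal_norm K k A = gexp (frac_group k) (\<lambda>P. contr P [^]\<^bsub>frac_group k\<^esub> res_degree K k P) (K.val A)"
proof -
  have set: "{P \<in> primes_of K. K.val A P \<noteq> 0} = {P. K.val A P \<noteq> 0}" using K.val_prime_of[OF A] by blast
  show ?thesis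
    unfolding ideal_norm_def gexp_def set contr_def[symmetric]
  proof (rule Ik.finprod_cong'[OF refl])
    show "(\<lambda>P. (contr P [^]\<^bsub>frac_group k\<^esub> res_degree K k P) [^]\<^bsub>frac_group k\<^esub> K.val A P)
        \<in> {P. K.val A P \<noteq> 0} \<rightarrow> carrier (frac_group k)"
      using contr_pow_frac K.val_prime_of[OF A] k.frac_int_pow_closed by auto
    fix P assume "P \<in> {P. K.val A P \<noteq> 0}"
    then have c: "contr P \<in> carrier (frac_group k)"
      using K.val_prime_of[OF A] k.prime_frac[OF contr_prime] by auto
    show "contr P [^]\<^bsub>frac_group k\<^esub> (int (res_degree K k P) * K.val A P) =
        (contr P [^]\<^bsub>frac_group k\<^esub> res_degree K k P) [^]\<^bsub>frac_group k\<^esub> K.val A P"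
      using Ik.int_pow_pow[OF c, of "int (res_degree K k P)" "K.val A P"] by (simp add: int_pow_int)
  qed
qed

lemma ideal_norm_frac: "A \<in> frac_ideals K \<Longrightarrow> ideal_norm K k A \<in> frac_ideals k"
  using Ik.gexp_closed[of "K.val A" "\<lambda>P. contr P [^]\<^bsub>frac_group k\<^esub> res_degree K k P"]
    contr_pow_frac[OF K.val_prime_of] by (simp add: ideal_norm_gexp)

lemma ext_ideal_norm:
  assumes A: "A \<in> frac_ideals K"
  shows "ext (ideal_norm K k A) = gnorm A"
proof -
  let ?u = "\<lambda>P. contr P [^]\<^bsub>frac_group k\<^esub> res_degree K k P"
  note pr = K.val_prime_of[OF A]
  have "ext (ideal_norm K k A) = gexp (frac_group K) (\<lambda>P. ext (?u P)) (K.val A)"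
    unfolding ideal_norm_gexp[OF A]
    by (rule Ik.gexp_hom[OF K.comm_group_frac ext_hom K.val_finite[OF A]]) (use contr_pow_frac pr in simp)
  also have "\<dots> = gexp (frac_group K) gnorm (K.val A)"
  proof (rule IK.gexp_cong)
    fix P assume "K.val A P \<noteq> 0"
    then have P: "P \<in> primes_of K" by (rule pr)
    have "ext (?u P) = ext (contr P) [^]\<^bsub>frac_group K\<^esub> res_degree K k P"
      using hom_nat_pow[OF ext_hom _ Ik.is_group IK.is_group, of "contr P" "res_degree K k P"]
        k.prime_frac[OF contr_prime[OF P]] by simp
    then show "ext (?u P) = gnorm P" using gnorm_prime[OF P] by simp
    show "gnorm P \<in> carrier (frac_group K)" using gnorm_frac[OF K.prime_frac[OF P]] by simp
  qed
  also have "\<dots> = gnorm (K.idl (K.val A))"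
    by (rule IK.gexp_hom[OF K.comm_group_frac gnorm_hom K.val_finite[OF A], symmetric]) (use K.prime_frac pr in simp)
  finally show ?thesis by (simp only: K.idl_val[OF A])
qed

lemma ideal_norm_mult:
  assumes A: "A \<in> frac_ideals K" and B: "B \<in> frac_ideals K"
  shows "ideal_norm K k (ideal_mult A B) = ideal_mult (ideal_norm K k A) (ideal_norm K k B)"
proof (rule ext_inject)
  show "ext (ideal_norm K k (ideal_mult A B)) = ext (ideal_mult (ideal_norm K k A) (ideal_norm K k B))"
    unfolding ext_mult ext_ideal_norm[OF A] ext_ideal_norm[OF B] ext_ideal_norm[OF K.ideal_mult_frac[OF A B]]
    using hom_mult[OF gnorm_hom, of A B] A B by simp
qed (use A B in \<open>simp_all add: ideal_norm_frac K.ideal_mult_frac k.ideal_mult_frac\<close>)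

lemma ideal_norm_act:
  assumes s: "s \<in> \<G>" and A: "A \<in> frac_ideals K"
  shows "ideal_norm K k (s ` A) = ideal_norm K k A"
  by (rule ext_inject[OF ideal_norm_frac[OF act_frac[OF s A]] ideal_norm_frac[OF A]])
     (simp only: ext_ideal_norm[OF A] ext_ideal_norm[OF act_frac[OF s A]] gnorm_act(1)[OF s A])

lemma ideal_norm_principal:
  assumes y: "y \<in> K" "y \<noteq> 0"
  shows "ideal_norm K k (principal K y) = principal k (elem_norm K k y)"
proof -
  have "elem_norm K k y \<noteq> 0"
    unfolding elem_norm_def using finite_gal fhom.h_nonzero[OF gal_fhom y] by (simp add: prod_zero_iff)
  then have pf: "principal k (elem_norm K k y) \<in> frac_ideals k" by (rule k.principal_frac[OF norm_mem[OF y(1)]])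
  show ?thesis
    by (rule ext_inject[OF ideal_norm_frac[OF K.principal_frac[OF y]] pf])
       (simp only: ext_ideal_norm[OF K.principal_frac[OF y]] gnorm_principal[OF y] ext_principal[OF norm_mem[OF y(1)]])
qed

lemma elem_norm_one: "elem_norm K k 1 = 1"
proof -
  have "elem_norm K k 1 = (\<Prod>s\<in>\<G>. 1)"
    unfolding elem_norm_def by (rule prod.cong[OF refl fhom.h_one[OF gal_fhom]])
  then show ?thesis by simp
qed

lemma ideal_norm_one: "ideal_norm K k OK = Ok"
  using ideal_norm_principal[OF K.one_mem] by (simp add: K.principal_one k.principal_one elem_norm_one)

lemma ideal_norm_inv:
  assumes A: "A \<in> frac_ideals K"
  shows "ideal_norm K k (inv\<^bsub>frac_group K\<^esub> A) = inv\<^bsub>frac_group k\<^esub> (ideal_norm K k A)"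
proof -
  note iA = K.frac_inv_closed[OF A]
  have "ideal_mult (ideal_norm K k (inv\<^bsub>frac_group K\<^esub> A)) (ideal_norm K k A) = Ok"
    unfolding ideal_norm_mult[OF iA A, symmetric]
    using K.frac_inv[OF A] ideal_norm_one by (simp only: ideal_mult_commute[of "inv\<^bsub>frac_group K\<^esub> A"])
  then show ?thesis
    using Ik.inv_equality[of "ideal_norm K k (inv\<^bsub>frac_group K\<^esub> A)" "ideal_norm K k A"]
      ideal_norm_frac[OF A] ideal_norm_frac[OF iA] by simp
qed

end

section \<open>Cyclic extensions\<close>

locale cyc_ext = gal_ext +
  fixes \<sigma> :: "'a \<Rightarrow> 'a"
  assumes \<sigma>: "\<sigma> \<in> carrier (gal_group K k)" and cyclic: "carrier (gal_group K k) = generate (gal_group K k) {\<sigma>}"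
begin

interpretation IK: comm_group "frac_group K" by (rule K.comm_group_frac)

abbreviation \<sigma>pow :: "nat \<Rightarrow> 'a \<Rightarrow> 'a" where "\<sigma>pow i \<equiv> \<sigma> [^]\<^bsub>gal_group K k\<^esub> i"

lemma \<sigma>pow: "\<sigma>pow i \<in> \<G>"
  using \<sigma> by (rule G.nat_pow_closed)

lemma \<sigma>pow_bij: "bij_betw \<sigma>pow {..<n} \<G>"
proof -
  have ord: "G.ord \<sigma> = n" using G.generate_pow_card[OF \<sigma>] cyclic by simp
  have "inj_on \<sigma>pow {0..n - 1}" using G.ord_inj[OF \<sigma>] by (simp add: ord)
  moreover have "{0..n - 1} = {..<n}" using n_pos by auto
  ultimately have inj: "inj_on \<sigma>pow {..<n}" by simp
  have "\<sigma>pow ` {..<n} = \<G>"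
    by (rule card_subset_eq[OF finite_gal]) (use \<sigma>pow card_image[OF inj] in auto)
  with inj show ?thesis by (simp add: bij_betw_def)
qed

text \<open>
  Hilbert 90 for ideals: \<open>A\<^sup>n\<close> is \<open>B\<^bsup>1-\<sigma>\<^esup>\<close> for a double product \<open>B\<close> of conjugates, and the
  exponents of \<open>B\<close> are constant modulo \<open>n\<close> along \<open>\<sigma>\<close>-orbits, so they may be divided by \<open>n\<close>,
  rounding down.
\<close>

lemma ideal_Hilbert90:
  assumes A: "A \<in> frac_ideals K" and N: "ideal_norm K k A = Ok"
    and T: "\<And>s P. s \<in> \<G> \<Longrightarrow> P \<in> T \<Longrightarrow> s ` P \<in> T" "T \<subseteq> primes_of K"
    and AT: "\<And>P. P \<in> T \<Longrightarrow> K.val A P = 0"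
  obtains B where "B \<in> frac_ideals K" "\<And>P. P \<in> T \<Longrightarrow> K.val B P = 0"
    "A = ideal_mult B (inv\<^bsub>frac_group K\<^esub> (\<sigma> ` B))"
proof -
  define a where "a = (\<lambda>i P. K.val (\<sigma>pow i ` A) P)"
  \<comment> \<open>The exponent at \<open>P\<close> of the product of all conjugates of
    \<open>A\<close> by \<open>\<sigma>pow j\<close> with \<open>j < i < n\<close>.\<close>
  define w where "w = (\<lambda>P. \<Sum>i<n. \<Sum>j<i. a j P)"
  define v where "v = (\<lambda>P. w P div int n)"
  have frac: "\<sigma>pow i ` A \<in> frac_ideals K" for i by (rule act_frac[OF \<sigma>pow A])
  have a0: "a 0 P = K.val A P" for P by (simp add: a_def act_one[OF K.frac_subset[OF A]])
  have shift: "a i (ginv \<sigma> ` P) = a (Suc i) P" if P: "P \<in> primes_of K" for i P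
  proof -
    have "a i (ginv \<sigma> ` P) = K.val (\<sigma> ` (\<sigma>pow i ` A)) (\<sigma> ` (ginv \<sigma> ` P))"
      unfolding a_def by (rule act_val[OF \<sigma> frac act_prime[OF G.inv_closed[OF \<sigma>] P], symmetric])
    also have "\<sigma> ` (ginv \<sigma> ` P) = P" by (rule act_inv'[OF \<sigma> prime_subset[OF P]])
    also have "\<sigma> ` (\<sigma>pow i ` A) = (\<sigma> \<star> \<sigma>pow i) ` A" by (rule act_comp[OF \<sigma> \<sigma>pow K.frac_subset[OF A]])
    also have "\<sigma> \<star> \<sigma>pow i = \<sigma>pow (Suc i)" by (rule G.nat_pow_Suc2[OF \<sigma>, symmetric])
    finally show ?thesis by (simp only: a_def)
  qed
  \<comment> \<open>This is where the norm of \<open>A\<close> being 1 enters: the product of all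
    conjugates is trivial.\<close>
  have total: "(\<Sum>i<n. a i P) = 0" for P
  proof -
    have "K.val (gnorm A) P = (\<Sum>i<n. a i P)"
      unfolding val_gnorm[OF A] a_def by (rule sum.reindex_bij_betw[OF \<sigma>pow_bij, symmetric])
    moreover have "gnorm A = OK" using ext_ideal_norm[OF A] N ext_one by simp
    ultimately show ?thesis using K.val_one[of P] by simp
  qed
  \<comment> \<open>Replacing \<open>P\<close> by its conjugate shifts the inner sums by one step;
    they telescope, and the surplus is \<open>n\<close> times the exponent of \<open>A\<close>, the
    total being 0.\<close>
  have wshift: "w (ginv \<sigma> ` P) = w P - int n * K.val A P" if P: "P \<in> primes_of K" for P
  proof -
    have "w (ginv \<sigma> ` P) = (\<Sum>i<n. \<Sum>j<i. a (Suc j) P)" by (simp add: w_def shift[OF P])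
    also have "\<dots> = (\<Sum>i<n. (\<Sum>j<i. a j P) + (a i P - a 0 P))"
    proof (rule sum.cong[OF refl])
      fix i :: nat
      have "(\<Sum>j<i. a (Suc j) P - a j P) = a i P - a 0 P" by (rule sum_lessThan_telescope)
      then show "(\<Sum>j<i. a (Suc j) P) = (\<Sum>j<i. a j P) + (a i P - a 0 P)" by (simp add: sum_subtractf)
    qed
    also have "\<dots> = w P + ((\<Sum>i<n. a i P) - int n * a 0 P)" by (simp add: w_def sum.distrib sum_subtractf)
    finally show ?thesis by (simp add: total a0)
  qed
  have v: "K.fac v"
  proof -
    have "{P. v P \<noteq> 0} \<subseteq> (\<Union>i<n. {P. a i P \<noteq> 0})"
    proof
      fix P assume "P \<in> {P. v P \<noteq> 0}"
      then have "w P \<noteq> 0" by (auto simp: v_def)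
      then obtain i where i: "i < n" "(\<Sum>j<i. a j P) \<noteq> 0" unfolding w_def by (meson lessThan_iff sum.neutral)
      then obtain j where "j < i" "a j P \<noteq> 0" by (meson lessThan_iff sum.neutral)
      then show "P \<in> (\<Union>i<n. {P. a i P \<noteq> 0})" using i(1) by (auto intro!: bexI[of _ j])
    qed
    moreover have "finite (\<Union>i<n. {P. a i P \<noteq> 0})" unfolding a_def using K.val_finite[OF frac] by blast
    moreover have "(\<Union>i<n. {P. a i P \<noteq> 0}) \<subseteq> primes_of K" unfolding a_def using K.val_prime_of[OF frac] by blast
    ultimately show ?thesis unfolding K.fac_def using finite_subset by blast
  qed
  define B where "B = K.idl v"
  have B: "B \<in> frac_ideals K" unfolding B_def by (rule K.idl_frac[OF v])
  have valB: "K.val B = v" unfolding B_def by (rule K.val_unique[OF v])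
  note sB = act_frac[OF \<sigma> B] note isB = K.frac_inv_closed[OF sB]
  show ?thesis
  proof (rule that[OF B])
    fix P assume P: "P \<in> T"
    \<comment> \<open>\<open>T\<close> is stable under the Galois group, so all conjugates of
      \<open>A\<close> are prime to it, and hence so is \<open>B\<close>.\<close>
    have "a i P = 0" for i
    proof -
      let ?s = "\<sigma>pow i"
      have Pp: "P \<in> primes_of K" using T(2) P by blast
      have "K.val (?s ` A) (?s ` (ginv ?s ` P)) = K.val A (ginv ?s ` P)"
        by (rule act_val[OF \<sigma>pow A act_prime[OF G.inv_closed[OF \<sigma>pow] Pp]])
      then show ?thesis
        using AT[OF T(1)[OF G.inv_closed[OF \<sigma>pow] P]] act_inv'[OF \<sigma>pow prime_subset[OF Pp]] by (simp add: a_def)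
    qed
    then show "K.val B P = 0" by (simp add: valB v_def w_def)
  next
    show "A = ideal_mult B (inv\<^bsub>frac_group K\<^esub> (\<sigma> ` B))"
    proof (rule K.val_inject[OF A K.ideal_mult_frac[OF B isB]], rule ext)
      fix P
      show "K.val A P = K.val (ideal_mult B (inv\<^bsub>frac_group K\<^esub> (\<sigma> ` B))) P"
      proof (cases "P \<in> primes_of K")
        case True
        let ?P' = "ginv \<sigma> ` P"
        have "K.val (\<sigma> ` B) P = K.val (\<sigma> ` B) (\<sigma> ` ?P')"
          by (simp only: act_inv'[OF \<sigma> prime_subset[OF True]])
        also have "\<dots> = v ?P'"
          using act_val[OF \<sigma> B act_prime[OF G.inv_closed[OF \<sigma>] True]] by (simp only: valB)
        \<comment> \<open>The shift is an exact multiple of \<open>n\<close>, so it passes through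
          the rounded division even where \<open>n\<close> does not divide
          \<open>w P\<close>.\<close>
        also have "\<dots> = (w P + int n * (- K.val A P)) div int n" by (simp add: v_def wshift[OF True])
        also have "\<dots> = v P - K.val A P" using n_pos by (simp only: v_def div_mult_self2)
        finally show ?thesis by (simp add: K.val_mult[OF B isB] K.val_inv[OF sB] valB)
      next
        case False
        then show ?thesis using K.val_prime_of[OF A] K.val_prime_of[OF K.ideal_mult_frac[OF B isB]] by metis
      qed
    qed
  qed
qed

end

section \<open>Norms of totally positive elements\<close>

lemma (in subfld) ring_hom_iff_fhom:
  fixes h :: "'a \<Rightarrow> 'b::field_char_0"
  shows "h \<in> ring_hom (ring_on F) (ring_of_type_algebra :: 'b ring) \<longleftrightarrow> fhom F h"
proof
  assume "h \<in> ring_hom (ring_on F) (ring_of_type_algebra :: 'b ring)"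
  then show "fhom F h" by unfold_locales (auto simp: ring_hom_def)
next
  assume "fhom F h"
  then interpret fhom F h .
  show "h \<in> ring_hom (ring_on F) (ring_of_type_algebra :: 'b ring)"
    by (auto simp: ring_hom_def h_add h_mult h_one) (simp add: ring_of_type_algebra_def)
qed

lemma (in subfld) tot_pos_iff: "x \<in> tot_pos F \<longleftrightarrow> x \<in> F \<and> x \<noteq> 0 \<and> (\<forall>h::'a \<Rightarrow> real. fhom F h \<longrightarrow> h x > 0)"
  by (auto simp: tot_pos_def ring_hom_iff_fhom)

lemma poly_eval_monic:
  fixes c :: "nat \<Rightarrow> 'b::field_char_0"
  obtains p :: "'b poly" where "p \<noteq> 0" "Polynomial.degree p = m"
    "\<And>x. poly p x = x ^ m - (\<Sum>i<m. c i * x ^ i)"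
proof -
  define p where "p = monom 1 m - (\<Sum>i<m. monom (c i) i)"
  have "Polynomial.coeff (\<Sum>i<m. monom (c i) i) j = (if j < m then c j else 0)" for j
    by (simp add: Polynomial.coeff_sum if_distrib cong: if_cong)
  then have cp: "Polynomial.coeff p j = (if j = m then 1 else if j < m then - c j else 0)" for j
    by (simp add: p_def)
  have deg: "Polynomial.degree p = m"
  proof (rule antisym)
    show "Polynomial.degree p \<le> m" by (rule degree_le) (simp add: cp)
    show "m \<le> Polynomial.degree p" by (rule le_degree) (simp add: cp)
  qed
  show ?thesis
  proof (rule that[OF _ deg])
    show "p \<noteq> 0" using cp[of m] by auto
    show "poly p x = x ^ m - (\<Sum>i<m. c i * x ^ i)" for x by (simp add: p_def poly_sum poly_monom)
  qed
qed

section \<open>Extending a real embedding of \<open>k\<close> to a complex embedding of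
  \<open>K\<close>\<close>

context gal_ext
begin

text \<open>Send a primitive element \<open>\<theta>\<close> to a complex root \<open>z\<close> of
  its monic equation of degree \<open>n\<close>, transported by \<open>\<tau>\<close>. The
  transported coefficients are real, so conjugation maps roots to roots; as the images of the
  conjugates of \<open>\<theta>\<close> are all the roots, conjugation on the image of
  \<open>K\<close> comes from an automorphism \<open>j\<close>.\<close>

lemma embedding_extension:
  fixes \<tau> :: "'a \<Rightarrow> real"
  assumes \<tau>: "fhom k \<tau>"
  obtains \<rho> :: "'a \<Rightarrow> complex" and j
    where "fhom K \<rho>" "\<And>a. a \<in> k \<Longrightarrow> \<rho> a = of_real (\<tau> a)"
      "j \<in> \<G>" "\<And>x. x \<in> K \<Longrightarrow> cnj (\<rho> x) = \<rho> (j x)"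
proof -
  interpret \<tau>: fhom k \<tau> by (rule \<tau>)
  obtain \<theta> where \<theta>: "\<theta> \<in> K" "inj_on (\<lambda>s. s \<theta>) \<G>" by (rule primitive_element[OF finite_gal order_refl])
  have \<theta>K: "\<theta> ^ i \<in> K" for i by (rule K.power_mem[OF \<theta>(1)])
  note indep = powers_independent[OF finite_gal order_refl \<theta>]
  \<comment> \<open>The \<open>n\<close> powers of \<open>\<theta>\<close> together with
    \<open>x\<close> are dependent, and by independence of the powers the coefficient of
    \<open>x\<close> is nonzero.\<close>
  have ex: "\<exists>c. (\<forall>i<n. c i \<in> k) \<and> x = (\<Sum>i<n. c i * \<theta> ^ i)" if x: "x \<in> K" for x
  proof -
    define u where "u = (\<lambda>i. if i < n then \<theta> ^ i else x)"
    obtain c where c: "\<And>i. i < Suc n \<Longrightarrow> c i \<in> k" "\<exists>i<Suc n. c i \<noteq> 0" "(\<Sum>i<Suc n. c i * u i) = 0"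
      by (rule gal_dependent[of u]) (use x \<theta>K in \<open>auto simp: u_def\<close>)
    have rel: "(\<Sum>i<n. c i * \<theta> ^ i) + c n * x = 0" using c(3) by (simp add: u_def)
    have cn: "c n \<noteq> 0"
    proof
      assume z: "c n = 0"
      then have "c i = 0" if "i < n" for i using indep[of c i] c(1) rel that by simp
      then show False using z c(2) by (auto simp: less_Suc_eq)
    qed
    have "x = (\<Sum>i<n. (- c i / c n) * \<theta> ^ i)"
    proof -
      have "c n * (\<Sum>i<n. (- c i / c n) * \<theta> ^ i) = - (\<Sum>i<n. c i * \<theta> ^ i)"
        unfolding sum_distrib_left sum_negf[symmetric] by (rule sum.cong) (use cn in auto)
      also have "\<dots> = c n * x" using rel by (simp add: eq_neg_iff_add_eq_0 neg_eq_iff_add_eq_0 add.commute)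
      finally show ?thesis using cn by simp
    qed
    moreover have "\<forall>i<n. - c i / c n \<in> k" using c(1) by (auto intro!: k.divide_mem k.uminus_mem)
    ultimately show ?thesis by (intro exI[of _ "\<lambda>i. - c i / c n"]) blast
  qed
  have uniq: "c i = e i"
    if "\<And>i. i < n \<Longrightarrow> c i \<in> k" "\<And>i. i < n \<Longrightarrow> e i \<in> k"
      and "(\<Sum>i<n. c i * \<theta> ^ i) = (\<Sum>i<n. e i * \<theta> ^ i)" "i < n" for c e i
    using indep[of "\<lambda>i. c i - e i" i] that by (simp add: k.diff_mem left_diff_distrib sum_subtractf)
  have "\<exists>co. \<forall>x\<in>K. (\<forall>i<n. co x i \<in> k) \<and> x = (\<Sum>i<n. co x i * \<theta> ^ i)"
    by (rule bchoice) (use ex in blast)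
  then obtain co where co: "\<And>x i. x \<in> K \<Longrightarrow> i < n \<Longrightarrow> co x i \<in> k"
    "\<And>x. x \<in> K \<Longrightarrow> x = (\<Sum>i<n. co x i * \<theta> ^ i)" by blast
  obtain g where g: "\<And>i. i < n \<Longrightarrow> g i \<in> k" "\<theta> ^ n = (\<Sum>i<n. g i * \<theta> ^ i)" using ex[OF \<theta>K[of n]] by blast
  obtain p :: "complex poly" where p: "p \<noteq> 0" "Polynomial.degree p = n"
    "\<And>x. poly p x = x ^ n - (\<Sum>i<n. of_real (\<tau> (g i)) * x ^ i)"
    using poly_eval_monic[of n "\<lambda>i. complex_of_real (\<tau> (g i))"] by metis
  have "\<not> Fundamental_Theorem_Algebra.constant (poly p)" using constant_degree[of p] p(2) n_pos by simp
  then obtain z where "poly p z = 0" using fundamental_theorem_of_algebra by blast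
  then have z: "z ^ n = (\<Sum>i<n. of_real (\<tau> (g i)) * z ^ i)" using p(3) by simp
  \<comment> \<open>Defined on coordinates with respect to the powers of \<open>\<theta>\<close>;
    additivity is immediate, multiplicativity is reduced to multiplication by
    \<open>\<theta>\<close>.\<close>
  define \<rho> where "\<rho> = (\<lambda>x. \<Sum>i<n. complex_of_real (\<tau> (co x i)) * z ^ i)"
  have \<rho>: "\<rho> (\<Sum>i<n. c i * \<theta> ^ i) = (\<Sum>i<n. of_real (\<tau> (c i)) * z ^ i)" if c: "\<And>i. i < n \<Longrightarrow> c i \<in> k" for c
  proof -
    let ?x = "\<Sum>i<n. c i * \<theta> ^ i"
    have x: "?x \<in> K" by (rule K.sum_mem) (use c kK \<theta>K in \<open>auto intro!: K.mult_mem\<close>)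
    have "co ?x i = c i" if "i < n" for i
      using uniq[of "co ?x" c i] co(1)[OF x] co(2)[OF x] c that by metis
    then show ?thesis by (simp add: \<rho>_def)
  qed
  have \<rho>_add: "\<rho> (x + y) = \<rho> x + \<rho> y" if xy: "x \<in> K" "y \<in> K" for x y
  proof -
    have "x + y = (\<Sum>i<n. co x i * \<theta> ^ i) + (\<Sum>i<n. co y i * \<theta> ^ i)"
      using co(2)[OF xy(1)] co(2)[OF xy(2)] by simp
    also have "\<dots> = (\<Sum>i<n. (co x i + co y i) * \<theta> ^ i)" by (simp add: sum.distrib distrib_right)
    finally have "\<rho> (x + y) = (\<Sum>i<n. of_real (\<tau> (co x i + co y i)) * z ^ i)"
      using \<rho>[of "\<lambda>i. co x i + co y i"] co(1) xy k.add_mem by simp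
    also have "\<dots> = \<rho> x + \<rho> y" unfolding \<rho>_def sum.distrib[symmetric]
      by (rule sum.cong[OF refl]) (use co(1) xy in \<open>simp add: \<tau>.h_add distrib_right\<close>)
    finally show ?thesis .
  qed
  have \<rho>_scale: "\<rho> (a * x) = of_real (\<tau> a) * \<rho> x" if a: "a \<in> k" and x: "x \<in> K" for a x
  proof -
    have "a * x = a * (\<Sum>i<n. co x i * \<theta> ^ i)" using co(2)[OF x] by simp
    also have "\<dots> = (\<Sum>i<n. (a * co x i) * \<theta> ^ i)" by (simp add: sum_distrib_left mult.assoc)
    finally have "\<rho> (a * x) = (\<Sum>i<n. of_real (\<tau> (a * co x i)) * z ^ i)"
      using \<rho>[of "\<lambda>i. a * co x i"] co(1)[OF x] k.mult_mem[OF a] by simp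
    also have "\<dots> = of_real (\<tau> a) * \<rho> x" unfolding \<rho>_def sum_distrib_left
      by (rule sum.cong[OF refl]) (use co(1)[OF x] a in \<open>simp add: \<tau>.h_mult mult.assoc\<close>)
    finally show ?thesis .
  qed
  have \<rho>_pow: "\<rho> (\<theta> ^ i) = z ^ i" if i: "i < n" for i
  proof -
    have "(\<Sum>j<n. (if j = i then 1 else 0) * \<theta> ^ j) = (\<Sum>j<n. if j = i then \<theta> ^ j else 0)" by (rule sum.cong) auto
    then have 1: "(\<Sum>j<n. (if j = i then 1 else 0) * \<theta> ^ j) = \<theta> ^ i" using i by simp
    have "(\<Sum>j<n. complex_of_real (\<tau> (if j = i then 1 else 0)) * z ^ j) = (\<Sum>j<n. if j = i then z ^ j else 0)"
      by (rule sum.cong) (auto simp: \<tau>.h_one \<tau>.h_zero)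
    also have "\<dots> = z ^ i" using i by simp
    finally show ?thesis using \<rho>[of "\<lambda>j. if j = i then 1 else 0"] 1 k.one_mem k.zero_mem by simp
  qed
  have \<rho>_sum: "\<rho> (\<Sum>i\<in>I. f i) = (\<Sum>i\<in>I. \<rho> (f i))" if "finite I" "\<And>i. i \<in> I \<Longrightarrow> f i \<in> K" for I :: "nat set" and f
    using that
  proof (induction I rule: finite_induct)
    case empty
    have "\<rho> (0 + 0) = \<rho> 0 + \<rho> 0" by (rule \<rho>_add[OF K.zero_mem K.zero_mem])
    then show ?case by simp
  qed (simp add: \<rho>_add K.sum_mem)
  \<comment> \<open>Only the top power is in question: there \<open>\<theta> ^ n\<close> is
    rewritten by its equation, and \<open>z\<close> satisfies the transported one.\<close>
  have \<rho>_theta: "\<rho> (\<theta> * x) = z * \<rho> x" if x: "x \<in> K" for x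
  proof -
    obtain m where m: "n = Suc m" using n_pos by (cases n) auto
    have pow: "\<rho> (\<theta> * \<theta> ^ i) = z * z ^ i" if i: "i < n" for i
    proof (cases "Suc i < n")
      case True
      then show ?thesis using \<rho>_pow[OF True] by simp
    next
      case False
      then have eq: "Suc i = n" using i by simp
      have "\<rho> (\<theta> ^ n) = z ^ n" unfolding g(2) z by (rule \<rho>[OF g(1)])
      then show ?thesis unfolding eq[symmetric] by simp
    qed
    have "\<theta> * x = \<theta> * (\<Sum>i<n. co x i * \<theta> ^ i)" using co(2)[OF x] by simp
    also have "\<dots> = (\<Sum>i<n. co x i * (\<theta> * \<theta> ^ i))" by (simp only: sum_distrib_left mult.left_commute)
    finally have "\<rho> (\<theta> * x) = (\<Sum>i<n. \<rho> (co x i * (\<theta> * \<theta> ^ i)))"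
      using \<rho>_sum[of "{..<n}" "\<lambda>i. co x i * (\<theta> * \<theta> ^ i)"] co(1)[OF x] kK \<theta>K \<theta>(1) K.mult_mem by simp
    also have "\<dots> = (\<Sum>i<n. z * (of_real (\<tau> (co x i)) * z ^ i))"
    proof (rule sum.cong[OF refl])
      fix i assume "i \<in> {..<n}"
      then have i: "i < n" by simp
      have "\<rho> (co x i * (\<theta> * \<theta> ^ i)) = of_real (\<tau> (co x i)) * (z * z ^ i)"
        unfolding pow[OF i, symmetric] by (rule \<rho>_scale[OF co(1)[OF x i] K.mult_mem[OF \<theta>(1) \<theta>K]])
      then show "\<rho> (co x i * (\<theta> * \<theta> ^ i)) = z * (of_real (\<tau> (co x i)) * z ^ i)"
        by (simp only: mult.left_commute)
    qed
    finally show ?thesis by (simp add: \<rho>_def sum_distrib_left)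
  qed
  have \<rho>_thetas: "\<rho> (\<theta> ^ i * x) = z ^ i * \<rho> x" if x: "x \<in> K" for i x
  proof (induction i)
    case (Suc i)
    have "\<rho> (\<theta> ^ Suc i * x) = \<rho> (\<theta> * (\<theta> ^ i * x))" by (simp add: mult.assoc)
    then show ?case using Suc \<rho>_theta[OF K.mult_mem[OF \<theta>K x]] by (simp add: mult.assoc)
  qed simp
  have hom: "fhom K \<rho>"
  proof
    show "\<rho> 1 = 1" using \<rho>_pow[of 0] n_pos by simp
    fix x y assume xy: "x \<in> K" "y \<in> K"
    show "\<rho> (x + y) = \<rho> x + \<rho> y" by (rule \<rho>_add[OF xy])
    have "x * y = (\<Sum>i<n. co x i * \<theta> ^ i) * y" using co(2)[OF xy(1)] by simp
    also have "\<dots> = (\<Sum>i<n. co x i * (\<theta> ^ i * y))" by (simp add: sum_distrib_right mult.assoc)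
    finally have "\<rho> (x * y) = (\<Sum>i<n. \<rho> (co x i * (\<theta> ^ i * y)))"
      using \<rho>_sum[of "{..<n}" "\<lambda>i. co x i * (\<theta> ^ i * y)"] co(1)[OF xy(1)] kK \<theta>K xy(2) K.mult_mem by simp
    also have "\<dots> = (\<Sum>i<n. of_real (\<tau> (co x i)) * z ^ i * \<rho> y)"
      by (rule sum.cong[OF refl])
         (use co(1)[OF xy(1)] \<rho>_thetas[OF xy(2)] \<rho>_scale[OF _ K.mult_mem[OF \<theta>K xy(2)]] in \<open>simp add: mult.assoc\<close>)
    finally show "\<rho> (x * y) = \<rho> x * \<rho> y" by (simp add: \<rho>_def sum_distrib_right)
  qed
  then interpret \<rho>: fhom K \<rho> .
  have \<rho>k: "\<rho> a = of_real (\<tau> a)" if "a \<in> k" for a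
    using \<rho>_scale[OF that K.one_mem] \<rho>.h_one by simp
  have roots: "poly p (\<rho> (s \<theta>)) = 0" if s: "s \<in> \<G>" for s
  proof -
    interpret s: fhom K s by (rule gal_fhom[OF s])
    have s\<theta>: "s \<theta> \<in> K" by (rule gal_mem[OF s \<theta>(1)])
    have "(s \<theta>) ^ n = s (\<Sum>i<n. g i * \<theta> ^ i)" by (simp add: s.h_power[OF \<theta>(1), symmetric] g(2))
    also have "\<dots> = (\<Sum>i<n. g i * s (\<theta> ^ i))" by (rule gal_comb[OF s]) (use g(1) \<theta>K in auto)
    finally have "\<rho> (s \<theta>) ^ n = \<rho> (\<Sum>i<n. g i * s \<theta> ^ i)"
      by (simp add: \<rho>.h_power[OF s\<theta>, symmetric] s.h_power[OF \<theta>(1)])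
    also have "\<dots> = (\<Sum>i<n. \<rho> (g i * s \<theta> ^ i))"
      by (rule \<rho>.h_sum) (use g(1) kK s\<theta> in \<open>auto intro!: K.mult_mem K.power_mem\<close>)
    also have "\<dots> = (\<Sum>i<n. of_real (\<tau> (g i)) * \<rho> (s \<theta>) ^ i)"
      by (rule sum.cong[OF refl]) (use g(1) kK s\<theta> in \<open>simp add: \<rho>.h_mult \<rho>.h_power \<rho>k K.power_mem\<close>)
    finally show ?thesis using p(3) by simp
  qed
  have "poly p (cnj z) = 0"
  proof -
    have "cnj z ^ n = cnj (\<Sum>i<n. of_real (\<tau> (g i)) * z ^ i)" unfolding z[symmetric] by simp
    then show ?thesis using p(3) by simp
  qed
  \<comment> \<open>The \<open>n\<close> distinct values \<open>\<rho> (s \<theta>)\<close> already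
    exhaust the roots of a polynomial of degree \<open>n\<close>.\<close>
  have "\<exists>j\<in>\<G>. cnj z = \<rho> (j \<theta>)"
  proof (rule ccontr)
    assume neg: "\<not> (\<exists>j\<in>\<G>. cnj z = \<rho> (j \<theta>))"
    let ?S = "insert (cnj z) ((\<lambda>s. \<rho> (s \<theta>)) ` \<G>)"
    have inj: "inj_on (\<lambda>s. \<rho> (s \<theta>)) \<G>"
    proof (rule inj_onI)
      fix s t assume st: "s \<in> \<G>" "t \<in> \<G>" "\<rho> (s \<theta>) = \<rho> (t \<theta>)"
      then have "s \<theta> = t \<theta>" using inj_onD[OF \<rho>.h_inj] gal_mem[OF _ \<theta>(1)] by metis
      then show "s = t" using inj_onD[OF \<theta>(2)] st by metis
    qed
    have "Suc n = card ?S" using neg finite_gal card_image[OF inj] by (subst card_insert_disjoint) auto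
    also have "\<dots> \<le> card {x. poly p x = 0}"
      by (rule card_mono[OF poly_roots_finite[OF p(1)]]) (use roots \<open>poly p (cnj z) = 0\<close> in auto)
    also have "\<dots> \<le> n" using card_poly_roots_bound[OF p(1)] p(2) by simp
    finally show False by simp
  qed
  then obtain j where j: "j \<in> \<G>" "cnj z = \<rho> (j \<theta>)" by blast
  interpret j: fhom K j by (rule gal_fhom[OF j(1)])
  have "cnj (\<rho> x) = \<rho> (j x)" if x: "x \<in> K" for x
  proof -
    have j\<theta>: "j \<theta> \<in> K" by (rule gal_mem[OF j(1) \<theta>(1)])
    have "j x = j (\<Sum>i<n. co x i * \<theta> ^ i)" using co(2)[OF x] by simp
    also have "\<dots> = (\<Sum>i<n. co x i * j (\<theta> ^ i))" by (rule gal_comb[OF j(1)]) (use co(1)[OF x] \<theta>K in auto)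
    finally have "\<rho> (j x) = \<rho> (\<Sum>i<n. co x i * j \<theta> ^ i)" by (simp add: j.h_power[OF \<theta>(1)])
    also have "\<dots> = (\<Sum>i<n. \<rho> (co x i * j \<theta> ^ i))"
      by (rule \<rho>.h_sum) (use co(1)[OF x] kK j\<theta> in \<open>auto intro!: K.mult_mem K.power_mem\<close>)
    also have "\<dots> = (\<Sum>i<n. of_real (\<tau> (co x i)) * cnj z ^ i)"
      by (rule sum.cong[OF refl])
         (use co(1)[OF x] kK j\<theta> in \<open>simp add: \<rho>.h_mult \<rho>.h_power \<rho>k K.power_mem j(2)\<close>)
    finally show ?thesis by (simp add: \<rho>_def)
  qed
  then show ?thesis using that[OF hom \<rho>k j(1)] by blast
qed

end

context cyc_ext
begin

text \<open>If \<open>j\<close> is trivial, \<open>\<rho>\<close> is real on \<open>K\<close> and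
  every factor of the norm is the value of \<open>y\<close> at a real embedding. Otherwise
  \<open>j\<close> is an involution \<open>\<sigma>pow m\<close> with \<open>n = 2 m\<close>; the
  factors with indices \<open>i\<close> and \<open>m + i\<close> are complex conjugate, and the norm
  becomes a product of squared absolute values.\<close>

lemma norm_tot_pos:
  assumes y: "y \<in> tot_pos K"
  shows "elem_norm K k y \<in> tot_pos k"
  unfolding k.tot_pos_iff
proof (intro conjI allI impI)
  have yK: "y \<in> K" "y \<noteq> 0" using y by (auto simp: K.tot_pos_iff)
  show "elem_norm K k y \<in> k" by (rule norm_mem[OF yK(1)])
  show "elem_norm K k y \<noteq> 0"
    unfolding elem_norm_def using finite_gal fhom.h_nonzero[OF gal_fhom yK] by (simp add: prod_zero_iff)
  fix \<tau> :: "'a \<Rightarrow> real" assume \<tau>: "fhom k \<tau>"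
  obtain \<rho> :: "'a \<Rightarrow> complex" and j where \<rho>: "fhom K \<rho>" "\<And>a. a \<in> k \<Longrightarrow> \<rho> a = of_real (\<tau> a)"
    and j: "j \<in> \<G>" "\<And>x. x \<in> K \<Longrightarrow> cnj (\<rho> x) = \<rho> (j x)"
    using embedding_extension[OF \<tau>] by metis
  interpret \<rho>: fhom K \<rho> by (rule \<rho>(1))
  have "of_real (\<tau> (elem_norm K k y)) = \<rho> (elem_norm K k y)"
    using \<rho>(2)[OF norm_mem[OF yK(1)]] by simp
  also have "\<dots> = (\<Prod>s\<in>\<G>. \<rho> (s y))" unfolding elem_norm_def by (rule \<rho>.h_prod) (rule gal_mem[OF _ yK(1)])
  also have "\<dots> = (\<Prod>i<n. \<rho> (\<sigma>pow i y))" by (rule prod.reindex_bij_betw[OF \<sigma>pow_bij, symmetric])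
  finally have N: "of_real (\<tau> (elem_norm K k y)) = (\<Prod>i<n. \<rho> (\<sigma>pow i y))" .
  have sy: "\<sigma>pow i y \<in> K" "\<sigma>pow i y \<noteq> 0" for i
    using gal_mem[OF \<sigma>pow yK(1)] fhom.h_nonzero[OF gal_fhom[OF \<sigma>pow] yK] by auto
  show "\<tau> (elem_norm K k y) > 0"
  proof (cases "j = \<one>\<^bsub>gal_group K k\<^esub>")
    case True
    then have real: "\<rho> x = of_real (Re (\<rho> x))" if "x \<in> K" for x
      using j(2)[OF that] gal_one_apply[OF that] by (simp add: complex_eq_iff)
    have pos: "Re (\<rho> (s y)) > 0" if s: "s \<in> \<G>" for s
    proof -
      interpret s: fhom K s by (rule gal_fhom[OF s])
      note m = gal_mem[OF s]
      have mult: "Re (\<rho> (a * b)) = Re (\<rho> a) * Re (\<rho> b)" if ab: "a \<in> K" "b \<in> K" for a b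
      proof -
        have "complex_of_real (Re (\<rho> (a * b))) = of_real (Re (\<rho> a)) * of_real (Re (\<rho> b))"
          using \<rho>.h_mult[OF ab] real[OF ab(1)] real[OF ab(2)] real[OF K.mult_mem[OF ab]] by metis
        then show ?thesis by (metis of_real_mult of_real_eq_iff)
      qed
      \<comment> \<open>Total positivity of \<open>y\<close> is applied to the real embedding
        obtained by composing \<open>\<rho>\<close> with \<open>s\<close>.\<close>
      have "fhom K (\<lambda>x. Re (\<rho> (s x)))"
        by unfold_locales (simp_all add: s.h_add s.h_mult s.h_one \<rho>.h_add \<rho>.h_one mult m)
      then show ?thesis by (rule y[unfolded K.tot_pos_iff, THEN conjunct2, THEN conjunct2, rule_format])
    qed
    have "complex_of_real (\<tau> (elem_norm K k y)) = of_real (\<Prod>i<n. Re (\<rho> (\<sigma>pow i y)))"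
      unfolding N of_real_prod by (rule prod.cong[OF refl real[OF sy(1)]])
    then have "\<tau> (elem_norm K k y) = (\<Prod>i<n. Re (\<rho> (\<sigma>pow i y)))" by (simp only: of_real_eq_iff)
    then show ?thesis using pos[OF \<sigma>pow] by (simp add: prod_pos)
  next
    case False
    obtain m where m: "m < n" "j = \<sigma>pow m" using j(1) \<sigma>pow_bij by (auto simp: bij_betw_def)
    have jj: "j \<star> j = \<one>\<^bsub>gal_group K k\<^esub>"
    proof (rule gal_extensional[OF G.m_closed[OF j(1) j(1)] G.one_closed])
      fix x assume x: "x \<in> K"
      have "\<rho> (j (j x)) = cnj (cnj (\<rho> x))" using j(2)[OF x] j(2)[OF gal_mem[OF j(1) x]] by simp
      then have "j (j x) = x"
        using inj_onD[OF \<rho>.h_inj, of "j (j x)" x] gal_mem[OF j(1)] x by simp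
      then show "(j \<star> j) x = \<one>\<^bsub>gal_group K k\<^esub> x" by (simp add: gal_mult_apply[OF j(1) j(1) x] gal_one_apply[OF x])
    qed
    have ord: "G.ord \<sigma> = n" using G.generate_pow_card[OF \<sigma>] cyclic by simp
    have "\<sigma>pow (m + m) = \<one>\<^bsub>gal_group K k\<^esub>" using jj G.nat_pow_mult[OF \<sigma>, of m m] m(2) by simp
    \<comment> \<open>Together with \<open>0 < m < n\<close> this leaves only
      \<open>n = m + m\<close>.\<close>
    then have "n dvd m + m" using G.pow_eq_id[OF \<sigma>] ord by simp
    moreover have "m > 0" using False m(2) by (cases m) auto
    ultimately have nm: "n = m + m"
    proof -
      assume "n dvd m + m" "m > 0"
      then obtain q where q: "m + m = n * q" "q \<noteq> 0" by (metis add_is_0 dvdE less_not_refl mult_0_right)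
      have "\<not> q \<ge> 2"
      proof
        assume "q \<ge> 2"
        then have "n * 2 \<le> n * q" by simp
        with q(1) m(1) show False by linarith
      qed
      then have "q = 1" using q(2) by linarith
      with q(1) show ?thesis by simp
    qed
    have split: "(\<Prod>i<a + b. f i) = (\<Prod>i<a. f i) * (\<Prod>i<b. f (a + i))" for f :: "nat \<Rightarrow> complex" and a b
      by (induction b) (simp_all add: mult.assoc)
    have "(\<Prod>i<n. \<rho> (\<sigma>pow i y)) = (\<Prod>i<m. \<rho> (\<sigma>pow i y)) * (\<Prod>i<m. \<rho> (\<sigma>pow (m + i) y))"
      using split[of "\<lambda>i. \<rho> (\<sigma>pow i y)" m m] nm by simp
    also have "(\<Prod>i<m. \<rho> (\<sigma>pow (m + i) y)) = (\<Prod>i<m. cnj (\<rho> (\<sigma>pow i y)))"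
    proof (rule prod.cong[OF refl])
      fix i
      have "\<sigma>pow (m + i) = j \<star> \<sigma>pow i" using G.nat_pow_mult[OF \<sigma>, of m i] m(2) by simp
      then show "\<rho> (\<sigma>pow (m + i) y) = cnj (\<rho> (\<sigma>pow i y))"
        using gal_mult_apply[OF j(1) \<sigma>pow yK(1)] j(2)[OF sy(1)] by simp
    qed
    also have "(\<Prod>i<m. \<rho> (\<sigma>pow i y)) * \<dots> = (\<Prod>i<m. of_real ((cmod (\<rho> (\<sigma>pow i y)))\<^sup>2))"
      unfolding prod.distrib[symmetric] by (simp only: complex_norm_square)
    finally have "complex_of_real (\<tau> (elem_norm K k y)) = of_real (\<Prod>i<m. (cmod (\<rho> (\<sigma>pow i y)))\<^sup>2)"
      unfolding N by simp
    then have "\<tau> (elem_norm K k y) = (\<Prod>i<m. (cmod (\<rho> (\<sigma>pow i y)))\<^sup>2)" by (simp only: of_real_eq_iff)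
    then show ?thesis using \<rho>.h_nonzero[OF sy] by (simp add: prod_pos)
  qed
qed

end

section \<open>Ray class groups\<close>

context nfield
begin

interpretation I: comm_group "frac_group F" by (rule comm_group_frac)

lemma tot_pos_mult:
  assumes "x \<in> tot_pos F" "y \<in> tot_pos F"
  shows "x * y \<in> tot_pos F"
  unfolding tot_pos_iff
proof (intro conjI allI impI)
  have xy: "x \<in> F" "y \<in> F" "x \<noteq> 0" "y \<noteq> 0" using assms by (auto simp: tot_pos_iff)
  show "x * y \<in> F" "x * y \<noteq> 0" using xy mult_mem by auto
  fix h :: "'a \<Rightarrow> real" assume h: "fhom F h"
  have "h x > 0" "h y > 0" using assms h unfolding tot_pos_iff by blast+
  then show "h (x * y) > 0" using fhom.h_mult[OF h xy(1,2)] by simp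
qed

lemma tot_pos_one: "1 \<in> tot_pos F"
proof -
  have "h 1 > 0" if "fhom F h" for h :: "'a \<Rightarrow> real" using fhom.h_one[OF that] by simp
  then show ?thesis unfolding tot_pos_iff using one_mem by simp
qed

lemma tot_pos_inverse:
  assumes "x \<in> tot_pos F"
  shows "inverse x \<in> tot_pos F"
  unfolding tot_pos_iff
proof (intro conjI allI impI)
  have x: "x \<in> F" "x \<noteq> 0" using assms by (auto simp: tot_pos_iff)
  show "inverse x \<in> F" "inverse x \<noteq> 0" using x inverse_mem by auto
  fix h :: "'a \<Rightarrow> real" assume h: "fhom F h"
  have "h x > 0" using assms h unfolding tot_pos_iff by blast
  then show "h (inverse x) > 0" using fhom.h_inverse[OF h x(1)] by simp
qed

section \<open>Ray elements, ray groups and ray classes of one field\<close>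

lemma ray_elems_field: "x \<in> ray_elems F m \<Longrightarrow> x \<in> F" "x \<in> ray_elems F m \<Longrightarrow> x \<noteq> 0"
  by (auto simp: ray_elems_def tot_pos_iff)

text \<open>Write \<open>x * y - 1\<close> as \<open>x * (y - 1) + (x - 1)\<close> and use the
  ultrametric inequality. The cases in which a difference vanishes are separated first, because the
  valuation of 0 carries no meaning here.\<close>

lemma cong_one_mult:
  assumes x: "x \<in> F" "x \<noteq> 0" "\<And>P. P \<in> supp F m \<Longrightarrow> elem_val F x P = 0" "cong_one F m x"
    and y: "y \<in> F" "y \<noteq> 0" "cong_one F m y"
  shows "cong_one F m (x * y)"
proof (cases "x = 1 \<or> y = 1 \<or> x * y = 1")
  case True
  then show ?thesis using x(4) y(3) by (auto simp: cong_one_def)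
next
  case False
  have "ideal_val F m P \<le> elem_val F (x * y - 1) P" if P: "P \<in> supp F m" for P
  proof -
    have "ideal_val F m P \<le> elem_val F (x * (y - 1)) P"
      using elem_val_mult[OF x(1,2) diff_mem[OF y(1) one_mem], of P] x(3)[OF P] y(3) P False
      by (auto simp: cong_one_def)
    moreover have "ideal_val F m P \<le> elem_val F (x - 1) P" using x(4) P False by (auto simp: cong_one_def)
    ultimately have "ideal_val F m P \<le> elem_val F (x * (y - 1) + (x - 1)) P"
      using False x y by (intro elem_val_add) (auto intro!: mult_mem diff_mem one_mem simp: algebra_simps)
    then show ?thesis by (simp add: algebra_simps)
  qed
  then show ?thesis by (simp add: cong_one_def)
qed

lemma cong_one_inverse:
  assumes x: "x \<in> F" "x \<noteq> 0" "\<And>P. P \<in> supp F m \<Longrightarrow> elem_val F x P = 0" "cong_one F m x"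
  shows "cong_one F m (inverse x)"
proof (cases "x = 1")
  case False
  have "elem_val F (inverse x - 1) P = elem_val F (x - 1) P" if P: "P \<in> supp F m" for P
  proof -
    have "inverse x - 1 = - (inverse x * (x - 1))" using x(2) by (simp add: algebra_simps)
    then have "elem_val F (inverse x - 1) P = elem_val F (inverse x * (x - 1)) P"
      by (simp only: elem_val_def principal_uminus)
    also have "\<dots> = elem_val F (x - 1) P"
      using elem_val_mult[OF inverse_mem[OF x(1)] _ diff_mem[OF x(1) one_mem], of P] False x(2)
        elem_val_inverse[OF x(1,2), of P] x(3)[OF P] by simp
    finally show ?thesis .
  qed
  then show ?thesis using x(4) False by (auto simp: cong_one_def)
qed (simp add: cong_one_def)

lemma ray_elems_one: "1 \<in> ray_elems F m"
  by (simp add: ray_elems_def tot_pos_one elem_val_one cong_one_def)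

lemma ray_elems_mult:
  assumes "x \<in> ray_elems F m" "y \<in> ray_elems F m"
  shows "x * y \<in> ray_elems F m"
  using assms ray_elems_field[OF assms(1)] ray_elems_field[OF assms(2)] cong_one_mult[of x m y]
  by (simp add: ray_elems_def tot_pos_mult elem_val_mult)

lemma ray_elems_inverse:
  assumes "x \<in> ray_elems F m"
  shows "inverse x \<in> ray_elems F m"
  using assms ray_elems_field[OF assms] cong_one_inverse[of x m]
  by (simp add: ray_elems_def tot_pos_inverse elem_val_inverse)

lemma principal_inverse:
  assumes "x \<in> F" "x \<noteq> 0"
  shows "inv\<^bsub>frac_group F\<^esub> (principal F x) = principal F (inverse x)"
proof -
  have "ideal_mult (principal F (inverse x)) (principal F x) = \<O>"
    using principal_mult[of "inverse x" x] assms(2) by (simp add: principal_one)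
  then show ?thesis
    using I.inv_equality[of "principal F (inverse x)" "principal F x"] principal_frac[OF assms]
      principal_frac[OF inverse_mem[OF assms(1)]] assms(2) by simp
qed

lemma principal_eq_ints_iff:
  assumes "x \<in> F" "x \<noteq> 0"
  shows "principal F x = \<O> \<longleftrightarrow> x \<in> Units (ring_on \<O>)"
proof
  assume eq: "principal F x = \<O>"
  have "x \<in> \<O>" using eq ints_one by (force simp: principal_iff)
  moreover have "1 \<in> principal F x" using eq ints_one by simp
  then obtain r where "r \<in> \<O>" "1 = x * r" by (auto simp: principal_iff)
  ultimately show "x \<in> Units (ring_on \<O>)" by (auto simp: Units_def mult.commute intro!: bexI[of _ r])
next
  assume "x \<in> Units (ring_on \<O>)"
  then obtain r where r: "x \<in> \<O>" "r \<in> \<O>" "x * r = 1" by (auto simp: Units_def)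
  have "1 \<in> principal F x" using r by (force simp: principal_iff)
  then show "principal F x = \<O>" by (rule integral_eq_ints[OF principal_integral[OF r(1) assms(2)]])
qed

text \<open>In this form ray units appear as quotients of ray elements that generate the same ideal,
  which is how the kernel of \<open>\<phi>\<close> produces them.\<close>

lemma ray_units_iff: "x \<in> ray_units F m \<longleftrightarrow> x \<in> ray_elems F m \<and> principal F x = \<O>"
proof
  assume x: "x \<in> ray_units F m"
  then have xF: "x \<in> F" "x \<noteq> 0" by (auto simp: ray_units_def tot_pos_iff)
  have pr: "principal F x = \<O>" using x principal_eq_ints_iff[OF xF] by (simp add: ray_units_def)
  then show "x \<in> ray_elems F m \<and> principal F x = \<O>"
    using x by (simp add: ray_units_def ray_elems_def elem_val_def val_one)
next
  assume x: "x \<in> ray_elems F m \<and> principal F x = \<O>"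
  then show "x \<in> ray_units F m"
    using principal_eq_ints_iff[of x] ray_elems_field[of x m] by (simp add: ray_units_def ray_elems_def)
qed

lemma ideal_group_simps:
  "A \<in> carrier (ideal_group F T) \<longleftrightarrow> A \<in> frac_ideals F \<and> (\<forall>P\<in>T. val A P = 0)"
  "A \<otimes>\<^bsub>ideal_group F T\<^esub> B = ideal_mult A B" "\<one>\<^bsub>ideal_group F T\<^esub> = \<O>"
  by (auto simp: ideal_group_def)

lemma ideal_group_subgroup: "subgroup (carrier (ideal_group F T)) (frac_group F)"
proof (rule I.subgroupI)
  have "\<O> \<in> carrier (ideal_group F T)"
    by (simp add: ideal_group_simps val_one integral_frac[OF ints_integral])
  then show "carrier (ideal_group F T) \<noteq> {}" by blast
qed (auto simp: ideal_group_simps val_inv frac_inv_closed val_mult ideal_mult_frac)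

lemma comm_group_ideal_group: "comm_group (ideal_group F T)"
proof -
  have "group (ideal_group F T)"
    using I.subgroup_imp_group[OF ideal_group_subgroup[of T]] by (simp add: ideal_group_def)
  then show ?thesis
    by (rule group.group_comm_groupI) (simp only: ideal_group_simps ideal_mult_commute)
qed

lemma ideal_group_inv:
  assumes "A \<in> carrier (ideal_group F T)"
  shows "inv\<^bsub>ideal_group F T\<^esub> A = inv\<^bsub>frac_group F\<^esub> A"
  using I.m_inv_consistent[OF ideal_group_subgroup assms] by (simp add: ideal_group_def)

lemma ray_group_subgroup: "subgroup (ray_group F m) (ideal_group F (supp F m))"
proof -
  interpret J: comm_group "ideal_group F (supp F m)" by (rule comm_group_ideal_group)
  have c: "principal F x \<in> carrier (ideal_group F (supp F m))" if "x \<in> ray_elems F m" for x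
    using that ray_elems_field[OF that] principal_frac by (auto simp: ideal_group_simps ray_elems_def elem_val_def)
  show ?thesis
  proof (rule J.subgroupI)
    show "ray_group F m \<subseteq> carrier (ideal_group F (supp F m))" using c by (auto simp: ray_group_def)
    show "ray_group F m \<noteq> {}" using ray_elems_one by (auto simp: ray_group_def)
    fix A assume "A \<in> ray_group F m"
    then obtain x where x: "x \<in> ray_elems F m" "A = principal F x" by (auto simp: ray_group_def)
    then have "inv\<^bsub>ideal_group F (supp F m)\<^esub> A = principal F (inverse x)"
      using ideal_group_inv[OF c[OF x(1)]] principal_inverse[OF ray_elems_field[OF x(1)]] by simp
    then show "inv\<^bsub>ideal_group F (supp F m)\<^esub> A \<in> ray_group F m"
      using ray_elems_inverse[OF x(1)] by (simp add: ray_group_def)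
    fix B assume "B \<in> ray_group F m"
    then obtain y where y: "y \<in> ray_elems F m" "B = principal F y" by (auto simp: ray_group_def)
    have "A \<otimes>\<^bsub>ideal_group F (supp F m)\<^esub> B = principal F (x * y)"
      by (simp add: ideal_group_simps x y principal_mult)
    then show "A \<otimes>\<^bsub>ideal_group F (supp F m)\<^esub> B \<in> ray_group F m"
      using ray_elems_mult[OF x(1) y(1)] by (simp add: ray_group_def)
  qed
qed

lemma ray_group_normal: "ray_group F m \<lhd> ideal_group F (supp F m)"
  by (rule comm_group.subgroup_imp_normal[OF comm_group_ideal_group ray_group_subgroup])

lemma comm_group_ray_class: "comm_group (ray_class_group F m)"
  unfolding ray_class_group_def
  by (rule comm_group.abelian_FactGroup[OF comm_group_ideal_group ray_group_subgroup])

lemma ray_class_hom: "ray_class F m \<in> hom (ideal_group F (supp F m)) (ray_class_group F m)"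
  using normal.r_coset_hom_Mod[OF ray_group_normal[of m]]
  by (simp add: ray_class_group_def ray_class_def[abs_def])

lemma ray_class_mem: "B \<in> ray_class F m A \<longleftrightarrow> (\<exists>y\<in>ray_elems F m. B = ideal_mult (principal F y) A)"
  by (auto simp: ray_class_def r_coset_def ray_group_def ideal_group_simps)

lemma ray_class_eq_iff:
  assumes A: "A \<in> carrier (ideal_group F (supp F m))" and B: "B \<in> carrier (ideal_group F (supp F m))"
  shows "ray_class F m A = ray_class F m B \<longleftrightarrow> (\<exists>y\<in>ray_elems F m. A = ideal_mult (principal F y) B)"
proof -
  interpret J: comm_group "ideal_group F (supp F m)" by (rule comm_group_ideal_group)
  have "ray_class F m A = ray_class F m B \<longleftrightarrow> A \<in> ray_class F m B"
  proof
    assume "ray_class F m A = ray_class F m B"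
    moreover have "A \<in> ray_class F m A" unfolding ray_class_def by (rule J.rcos_self[OF A ray_group_subgroup])
    ultimately show "A \<in> ray_class F m B" by simp
  next
    assume "A \<in> ray_class F m B"
    then show "ray_class F m A = ray_class F m B"
      unfolding ray_class_def using J.repr_independence[OF _ B ray_group_subgroup] by metis
  qed
  then show ?thesis by (simp only: ray_class_mem)
qed

end

section \<open>Ray class groups in a cyclic extension\<close>

locale ray_ext = cyc_ext +
  fixes \<mm> :: "'a set"
  assumes modulus: "\<mm> \<in> integral_ideals k"
begin

abbreviation "\<mm>K \<equiv> modulus_ext K \<mm>"
abbreviation "T \<equiv> supp K \<mm>K"
abbreviation "JK \<equiv> ideal_group K T"
abbreviation "Jk \<equiv> ideal_group k (supp k \<mm>)"
abbreviation "UK \<equiv> ray_elems K \<mm>K"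
abbreviation "Uk \<equiv> ray_elems k \<mm>"
abbreviation "cl \<equiv> ray_class K \<mm>K"
abbreviation "ClK \<equiv> ray_class_group K \<mm>K"
abbreviation "Clk \<equiv> ray_class_group k \<mm>"
abbreviation "Nm \<equiv> ideal_norm K k"

lemma mK: "\<mm>K \<in> integral_ideals K"
  by (rule ext_integral[OF modulus])

text \<open>Ramification indices are positive, so the extended modulus is divisible by exactly the
  primes above those dividing \<open>\<mm>\<close>. In particular \<open>T\<close> is Galois
  stable.\<close>

lemma T_iff: "P \<in> T \<longleftrightarrow> P \<in> primes_of K \<and> contr P \<in> supp k \<mm>"
proof -
  have "K.val \<mm>K P \<noteq> 0 \<longleftrightarrow> k.val \<mm> (contr P) \<noteq> 0" if "P \<in> primes_of K"
    using val_ext[OF that k.integral_frac[OF modulus]] val_ext_contr_pos[OF that] by simp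
  then show ?thesis
    using K.supp_iff[OF mK] k.supp_iff[OF modulus] K.val_prime_of[OF K.integral_frac[OF mK]] by auto
qed

lemma contr_act:
  assumes s: "s \<in> \<G>" and P: "P \<in> primes_of K"
  shows "contr (s ` P) = contr P"
proof -
  have sub: "contr Q \<subseteq> contr (t ` Q)" if t: "t \<in> \<G>" for t Q
  proof
    fix x assume x: "x \<in> contr Q"
    then have "t x \<in> t ` Q" by (auto simp: contr_def)
    moreover have "t x = x" using x gal_fix[OF t] by (simp add: contr_def ints_k_iff)
    ultimately show "x \<in> contr (t ` Q)" using x by (simp add: contr_def)
  qed
  show ?thesis
    using sub[OF s, of P] sub[OF G.inv_closed[OF s], of "s ` P"] act_inv[OF s prime_subset[OF P]] by auto
qed

lemma T_act: "s \<in> \<G> \<Longrightarrow> P \<in> T \<Longrightarrow> s ` P \<in> T"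
  using T_iff act_prime contr_act by simp

lemma T_primes: "T \<subseteq> primes_of K"
  using T_iff by blast

lemma JK_frac: "A \<in> carrier JK \<Longrightarrow> A \<in> frac_ideals K"
  by (simp add: K.ideal_group_simps)

lemma val_act_T:
  assumes s: "s \<in> \<G>" and A: "A \<in> frac_ideals K" and P: "P \<in> primes_of K"
  shows "K.val (s ` A) P = K.val A (ginv s ` P)"
  using act_val[OF s A act_prime[OF G.inv_closed[OF s] P]] act_inv'[OF s prime_subset[OF P]] by simp

lemma JK_act:
  assumes s: "s \<in> \<G>" and A: "A \<in> carrier JK"
  shows "s ` A \<in> carrier JK"
  using A act_frac[OF s] val_act_T[OF s] T_act[OF G.inv_closed[OF s]] T_primes
  by (auto simp: K.ideal_group_simps subsetD)

text \<open>The valuation of the norm at \<open>q\<close>, multiplied by the ramification index of a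
  prime \<open>P\<close> above \<open>q\<close>, is the valuation at \<open>P\<close> of the product
  of the conjugates, all of which are prime to \<open>T\<close>.\<close>

lemma norm_JK:
  assumes A: "A \<in> carrier JK"
  shows "Nm A \<in> carrier Jk"
proof -
  note Af = JK_frac[OF A]
  have "k.val (Nm A) q = 0" if q: "q \<in> supp k \<mm>" for q
  proof -
    have "q \<in> primes_of k" using q by (simp add: supp_def)
    then obtain P where P: "P \<in> primes_of K" "contr P = q" by (rule ex_prime_over)
    have PT: "P \<in> T" using P q T_iff by simp
    have "K.val (gnorm A) P = (\<Sum>s\<in>\<G>. 0)" unfolding val_gnorm[OF Af]
    proof (rule sum.cong[OF refl])
      fix s assume "s \<in> \<G>"
      then show "K.val (s ` A) P = 0" using JK_act[OF _ A] PT by (simp add: K.ideal_group_simps)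
    qed
    then have "k.val (Nm A) q * K.val (ext (contr P)) P = 0"
      using val_ext[OF P(1) ideal_norm_frac[OF Af]] P(2) by (simp add: ext_ideal_norm[OF Af])
    then show ?thesis using val_ext_contr_pos[OF P(1)] by simp
  qed
  then show ?thesis using ideal_norm_frac[OF Af] by (simp add: k.ideal_group_simps)
qed

text \<open>The modulus comes from \<open>k\<close>, so its support and its exponents are Galois
  stable; total positivity survives because a real embedding composed with \<open>s\<close> is again
  one.\<close>

lemma UK_act:
  assumes s: "s \<in> \<G>" and y: "y \<in> UK"
  shows "s y \<in> UK"
proof -
  interpret s: fhom K s by (rule gal_fhom[OF s])
  note yK = K.ray_elems_field[OF y]
  have val: "elem_val K (s x) P = elem_val K x (ginv s ` P)" if "x \<in> K" "x \<noteq> 0" "P \<in> primes_of K" for x P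
    unfolding elem_val_def act_principal[OF s that(1), symmetric]
    by (rule val_act_T[OF s K.principal_frac[OF that(1,2)] that(3)])
  have "s y \<in> tot_pos K" unfolding K.tot_pos_iff
  proof (intro conjI allI impI)
    show "s y \<in> K" "s y \<noteq> 0" using gal_mem[OF s yK(1)] s.h_nonzero[OF yK] by auto
    fix h :: "'a \<Rightarrow> real" assume "fhom K h"
    then interpret h: fhom K h .
    have "fhom K (\<lambda>x. h (s x))"
      by unfold_locales (simp_all add: s.h_add s.h_mult s.h_one h.h_add h.h_mult h.h_one gal_mem[OF s])
    moreover have "y \<in> tot_pos K" using y by (simp add: ray_elems_def)
    ultimately show "h (s y) > 0" unfolding K.tot_pos_iff by blast
  qed
  moreover have "elem_val K (s y) P = 0" if "P \<in> T" for P
    using val[OF yK, of P] that T_primes y T_act[OF G.inv_closed[OF s] that] by (auto simp: ray_elems_def)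
  moreover have "cong_one K \<mm>K (s y)"
  proof (cases "y = 1")
    case False
    have "K.val \<mm>K P \<le> elem_val K (s y - 1) P" if P: "P \<in> T" for P
    proof -
      have Pp: "P \<in> primes_of K" using P T_primes by blast
      have "s y - 1 = s (y - 1)" using s.h_diff[OF yK(1) K.one_mem] s.h_one by simp
      then have "elem_val K (s y - 1) P = elem_val K (y - 1) (ginv s ` P)"
        using val[OF K.diff_mem[OF yK(1) K.one_mem] _ Pp] False by simp
      moreover have "K.val \<mm>K (ginv s ` P) \<le> elem_val K (y - 1) (ginv s ` P)"
        using y False T_act[OF G.inv_closed[OF s] P] by (auto simp: ray_elems_def cong_one_def)
      moreover have "K.val \<mm>K P = K.val \<mm>K (ginv s ` P)"
        using val_act_T[OF s K.integral_frac[OF mK] Pp] act_ext[OF s k.integral_frac[OF modulus]] by simp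
      ultimately show ?thesis by simp
    qed
    then show ?thesis by (simp add: cong_one_def)
  qed (simp add: s.h_one cong_one_def)
  ultimately show ?thesis by (simp add: ray_elems_def)
qed

text \<open>As a product of conjugates the norm lies in \<open>UK\<close>. For elements of
  \<open>k\<close>, valuations in \<open>K\<close> and the exponents of the modulus are both
  multiplied by the positive ramification index, so the conditions at \<open>T\<close> descend to
  \<open>k\<close>. Positivity does not descend this way and is taken from
  \<open>norm_tot_pos\<close>.\<close>

lemma norm_UK:
  assumes y: "y \<in> UK"
  shows "elem_norm K k y \<in> Uk"
proof -
  note yK = K.ray_elems_field[OF y]
  let ?N = "elem_norm K k y"
  have pos: "?N \<in> tot_pos k" by (rule norm_tot_pos) (use y in \<open>simp add: ray_elems_def\<close>)
  have Nk: "?N \<in> k" "?N \<noteq> 0" using pos by (auto simp: k.tot_pos_iff)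
  have NU: "?N \<in> UK"
  proof -
    have "(\<Prod>s\<in>S. s y) \<in> UK" if "finite S" "S \<subseteq> \<G>" for S
      using that
    proof (induction S rule: finite_induct)
      case empty
      then show ?case by (simp add: K.ray_elems_one)
    next
      case (insert s S)
      then show ?case using K.ray_elems_mult[OF UK_act[OF _ y, of s]] by simp
    qed
    then show ?thesis unfolding elem_norm_def using finite_gal by blast
  qed
  have val: "elem_val K x P = elem_val k x (contr P) * K.val (ext (contr P)) P"
    if "x \<in> k" "x \<noteq> 0" "P \<in> primes_of K" for x P
    unfolding elem_val_def ext_principal[OF that(1), symmetric]
    by (rule val_ext[OF that(3) k.principal_frac[OF that(1,2)]])
  have over: "\<exists>P\<in>T. contr P = q" if q: "q \<in> supp k \<mm>" for q
  proof -
    have "q \<in> primes_of k" using q by (simp add: supp_def)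
    then obtain P where "P \<in> primes_of K" "contr P = q" by (rule ex_prime_over)
    then show ?thesis using T_iff q by auto
  qed
  have "elem_val k ?N q = 0" if q: "q \<in> supp k \<mm>" for q
  proof -
    obtain P where P: "P \<in> T" "contr P = q" using over[OF q] by blast
    have Pp: "P \<in> primes_of K" using P(1) T_primes by blast
    have "elem_val K ?N P = 0" using NU P by (simp add: ray_elems_def)
    then show ?thesis using val[OF Nk Pp] val_ext_contr_pos[OF Pp] P(2) by simp
  qed
  moreover have "cong_one k \<mm> ?N"
  proof (cases "?N = 1")
    case False
    have "k.val \<mm> q \<le> elem_val k (?N - 1) q" if q: "q \<in> supp k \<mm>" for q
    proof -
      obtain P where P: "P \<in> T" "contr P = q" using over[OF q] by blast
      have Pp: "P \<in> primes_of K" using P(1) T_primes by blast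
      have "K.val \<mm>K P \<le> elem_val K (?N - 1) P" using NU P False by (auto simp: ray_elems_def cong_one_def)
      then show ?thesis
        using val[OF k.diff_mem[OF Nk(1) k.one_mem] _ Pp] val_ext[OF Pp k.integral_frac[OF modulus]]
          val_ext_contr_pos[OF Pp] P(2) False by simp
    qed
    then show ?thesis by (simp add: cong_one_def)
  qed (simp add: cong_one_def)
  ultimately show ?thesis using pos by (simp add: ray_elems_def)
qed

lemma norm_principal_UK: "y \<in> UK \<Longrightarrow> Nm (principal K y) = principal k (elem_norm K k y)"
  by (rule ideal_norm_principal[OF K.ray_elems_field])

lemma UK_principal_JK: "y \<in> UK \<Longrightarrow> principal K y \<in> carrier JK"
  using subgroup.subset[OF K.ray_group_subgroup[of \<mm>K]] by (auto simp: ray_group_def)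

lemma class_act_cl:
  assumes s: "s \<in> \<G>" and A: "A \<in> carrier JK"
  shows "class_act s (cl A) = cl (s ` A)"
proof (rule Set.set_eqI)
  fix B
  note AK = K.frac_subset[OF JK_frac[OF A]]
  have img: "s ` ideal_mult (principal K y) A = ideal_mult (principal K (s y)) (s ` A)" if "y \<in> UK" for y
    using act_mult[OF s K.frac_subset[OF JK_frac[OF UK_principal_JK[OF that]]] AK]
      act_principal[OF s K.ray_elems_field(1)[OF that]] by simp
  show "B \<in> class_act s (cl A) \<longleftrightarrow> B \<in> cl (s ` A)"
  proof
    assume "B \<in> class_act s (cl A)"
    then obtain C where "C \<in> cl A" "B = s ` C" by (auto simp: class_act_def)
    then obtain y where "y \<in> UK" "B = s ` ideal_mult (principal K y) A" by (auto simp: K.ray_class_mem)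
    then show "B \<in> cl (s ` A)" using img UK_act[OF s] by (auto simp: K.ray_class_mem)
  next
    assume "B \<in> cl (s ` A)"
    then obtain y where y: "y \<in> UK" "B = ideal_mult (principal K y) (s ` A)" by (auto simp: K.ray_class_mem)
    let ?z = "ginv s y"
    have z: "?z \<in> UK" by (rule UK_act[OF G.inv_closed[OF s] y(1)])
    have "s ?z = y" by (rule gal_apply_inv[OF s K.ray_elems_field(1)[OF y(1)]])
    then have "B = s ` ideal_mult (principal K ?z) A" using img[OF z] y(2) by simp
    moreover have "ideal_mult (principal K ?z) A \<in> cl A" using z by (auto simp: K.ray_class_mem)
    ultimately show "B \<in> class_act s (cl A)" unfolding class_act_def by blast
  qed
qed

text \<open>Members of one class differ by some \<open>(y)\<close> with \<open>y\<close> in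
  \<open>UK\<close>, and their norms by an element of the ray group of \<open>k\<close>, by
  \<open>norm_UK\<close>. So the union in \<open>class_norm\<close> is over equal cosets.\<close>

lemma class_norm_cl:
  assumes A: "A \<in> carrier JK"
  shows "class_norm K k \<mm> (cl A) = ray_class k \<mm> (Nm A)"
proof -
  have "ray_class k \<mm> (Nm B) = ray_class k \<mm> (Nm A)" if B: "B \<in> cl A" for B
  proof -
    obtain y where y: "y \<in> UK" "B = ideal_mult (principal K y) A" using B by (auto simp: K.ray_class_mem)
    note yf = JK_frac[OF UK_principal_JK[OF y(1)]]
    have "B \<in> carrier JK"
      using y A UK_principal_JK[OF y(1)] by (auto simp: K.ideal_group_simps K.ideal_mult_frac K.val_mult)
    moreover have "Nm B = ideal_mult (principal k (elem_norm K k y)) (Nm A)"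
      using ideal_norm_mult[OF yf JK_frac[OF A]] norm_principal_UK[OF y(1)] y(2) by simp
    ultimately show ?thesis
      using k.ray_class_eq_iff[OF norm_JK norm_JK[OF A]] norm_UK[OF y(1)] by blast
  qed
  moreover have "A \<in> cl A" unfolding ray_class_def
    using group.rcos_self[OF comm_group.axioms(2)[OF K.comm_group_ideal_group] A K.ray_group_subgroup] .
  ultimately show ?thesis unfolding class_norm_def by blast
qed

lemma class_norm_one_iff:
  assumes A: "A \<in> carrier JK"
  shows "class_norm K k \<mm> (cl A) = \<one>\<^bsub>Clk\<^esub> \<longleftrightarrow> (\<exists>x\<in>Uk. Nm A = principal k x)"
proof -
  interpret Clk: comm_group Clk by (rule k.comm_group_ray_class)
  interpret Jk: comm_group Jk by (rule k.comm_group_ideal_group)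
  have one: "Ok \<in> carrier Jk" using Jk.one_closed by (simp add: k.ideal_group_simps)
  have "\<one>\<^bsub>Clk\<^esub> = ray_class k \<mm> Ok"
    using hom_one[OF k.ray_class_hom Jk.is_group Clk.is_group] by (simp add: k.ideal_group_simps)
  then have "class_norm K k \<mm> (cl A) = \<one>\<^bsub>Clk\<^esub> \<longleftrightarrow> ray_class k \<mm> (Nm A) = ray_class k \<mm> Ok"
    by (simp add: class_norm_cl[OF A])
  also have "\<dots> \<longleftrightarrow> (\<exists>x\<in>Uk. Nm A = ideal_mult (principal k x) Ok)"
    by (rule k.ray_class_eq_iff[OF norm_JK[OF A] one])
  also have "\<dots> \<longleftrightarrow> (\<exists>x\<in>Uk. Nm A = principal k x)"
    using k.ideal_mult_ints[OF k.principal_frac[OF k.ray_elems_field]] by (metis (no_types))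
  finally show ?thesis .
qed

end

section \<open>The exact sequence\<close>

lemma group_mult_group_on:
  assumes "0 \<notin> S" "1 \<in> S" "\<And>x y. x \<in> S \<Longrightarrow> y \<in> S \<Longrightarrow> x * y \<in> S" "\<And>x. x \<in> S \<Longrightarrow> inverse x \<in> S"
  shows "group (mult_group_on S)"
proof (rule groupI)
  fix x assume "x \<in> carrier (mult_group_on S)"
  then have x: "x \<in> S" by (simp add: mult_group_on_def)
  then have "x \<noteq> 0" using assms(1) by blast
  then show "\<exists>y\<in>carrier (mult_group_on S). y \<otimes>\<^bsub>mult_group_on S\<^esub> x = \<one>\<^bsub>mult_group_on S\<^esub>"
    using assms(4)[OF x] by (intro bexI[of _ "inverse x"]) (simp_all add: mult_group_on_def)
qed (use assms in \<open>auto simp: mult_group_on_def mult.assoc\<close>)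

context ray_ext
begin

text \<open>One fact, \<open>key\<close> below, carries the use of Hilbert 90. With
  \<open>y = 1\<close> it makes \<open>\<phi>\<close> well defined; with \<open>A' = OK\<close> it
  is the inclusion of the left-hand group in the kernel.\<close>

lemma exact_sequence:
  fixes \<I> :: "'a set set"
  defines "H \<equiv> cl ` (\<I> <#>\<^bsub>JK\<^esub> ray_group K \<mm>K)"
    and "\<delta> \<equiv> (\<lambda>h. h \<otimes>\<^bsub>ClK\<^esub> inv\<^bsub>ClK\<^esub> (class_act \<sigma> h))"
  defines "H' \<equiv> {h \<in> carrier ClK. \<delta> h \<in> H}"
    and "NH \<equiv> kernel (ClK\<lparr>carrier := H\<rparr>) Clk (class_norm K k \<mm>)"
    and "\<Lambda> \<equiv> {x \<in> Uk. principal k x \<in> Nm ` \<I>}"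
  assumes I: "subgroup \<I> JK" and H: "subgroup H ClK"
  shows "\<delta> ` H' \<subseteq> NH \<and>
    (\<exists>\<phi>. short_exact
           (mult_group_on ({\<epsilon> * elem_norm K k y | \<epsilon> y. \<epsilon> \<in> ray_units k \<mm> \<and> y \<in> UK} \<inter> \<Lambda>))
           (\<lambda>x. x) (mult_group_on \<Lambda>) \<phi> (ClK\<lparr>carrier := NH\<rparr> Mod (\<delta> ` H')) \<and>
         (\<forall>x\<in>\<Lambda>. \<forall>A\<in>\<I>. Nm A = principal k x \<longrightarrow> \<phi> x = (\<delta> ` H') #>\<^bsub>ClK\<^esub> cl A))"
proof -
  interpret C: comm_group ClK by (rule K.comm_group_ray_class)
  interpret J: comm_group JK by (rule K.comm_group_ideal_group)
  interpret FK: comm_group "frac_group K" by (rule K.comm_group_frac)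
  interpret Fk: comm_group "frac_group k" by (rule k.comm_group_frac)
  interpret cl: group_hom JK ClK cl
    by (simp add: group_hom_def group_hom_axioms_def J.is_group C.is_group K.ray_class_hom)
  interpret I: subgroup \<I> JK by (rule I)
  note mult_JK = K.ideal_group_simps(2) and one_JK = K.ideal_group_simps(3)
  let ?inv = "\<lambda>A. inv\<^bsub>frac_group K\<^esub> A"

  have cl_mult: "cl (ideal_mult A B) = cl A \<otimes>\<^bsub>ClK\<^esub> cl B" if "A \<in> carrier JK" "B \<in> carrier JK" for A B
    using cl.hom_mult[OF that] by (simp add: mult_JK)
  have JK_mult: "ideal_mult A B \<in> carrier JK" if "A \<in> carrier JK" "B \<in> carrier JK" for A B
    using J.m_closed[OF that] by (simp add: mult_JK)
  have JK_inv: "?inv A \<in> carrier JK" if "A \<in> carrier JK" for A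
    using J.inv_closed[OF that] K.ideal_group_inv[OF that] by simp
  have cl_inv: "cl (?inv A) = inv\<^bsub>ClK\<^esub> cl A" if "A \<in> carrier JK" for A
    using cl.hom_inv[OF that] K.ideal_group_inv[OF that] by simp
  have cl_one: "cl OK = \<one>\<^bsub>ClK\<^esub>" using cl.hom_one by (simp add: one_JK)
  have OKJ: "OK \<in> carrier JK" and OKI: "OK \<in> \<I>" using J.one_closed I.one_closed by (simp_all add: one_JK)
  have surj: "\<exists>A\<in>carrier JK. h = cl A" if "h \<in> carrier ClK" for h
    using that by (auto simp: ray_class_group_def carrier_FactGroup ray_class_def)
  have I_JK: "A \<in> carrier JK" if "A \<in> \<I>" for A using I.subset that by blast
  have I_mult: "ideal_mult A B \<in> \<I>" if "A \<in> \<I>" "B \<in> \<I>" for A B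
    using I.m_closed[OF that] by (simp add: mult_JK)
  have I_inv: "?inv A \<in> \<I>" if "A \<in> \<I>" for A
    using I.m_inv_closed[OF that] K.ideal_group_inv[OF I_JK[OF that]] by simp

  have cl_ray: "cl (principal K y) = \<one>\<^bsub>ClK\<^esub>" if "y \<in> UK" for y
  proof -
    have "principal K y = ideal_mult (principal K y) OK"
      using K.ideal_mult_ints[OF JK_frac[OF UK_principal_JK[OF that]]] by simp
    then have "cl (principal K y) = cl OK"
      using K.ray_class_eq_iff[OF UK_principal_JK[OF that] OKJ] that by blast
    then show ?thesis by (simp add: cl_one)
  qed
  \<comment> \<open>The ray group dies in \<open>ClK\<close>, so every class in \<open>H\<close> has
    a representative in \<open>\<I>\<close> itself, as the definition of \<open>\<phi>\<close>
    demands.\<close>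
  have H_eq: "H = cl ` \<I>"
  proof
    show "H \<subseteq> cl ` \<I>"
    proof
      fix h assume "h \<in> H"
      then obtain A y where Ay: "A \<in> \<I>" "y \<in> UK" "h = cl (ideal_mult A (principal K y))"
        unfolding H_def by (auto simp: set_mult_def ray_group_def mult_JK)
      then have "h = cl A"
        using cl_mult[OF I_JK[OF Ay(1)] UK_principal_JK[OF Ay(2)]] cl_ray[OF Ay(2)] cl.hom_closed[OF I_JK[OF Ay(1)]]
        by simp
      then show "h \<in> cl ` \<I>" using Ay(1) by blast
    qed
    show "cl ` \<I> \<subseteq> H"
    proof
      fix h assume "h \<in> cl ` \<I>"
      then obtain A where A: "A \<in> \<I>" "h = cl A" by blast
      have "principal K 1 \<in> ray_group K \<mm>K" using K.ray_elems_one by (auto simp: ray_group_def)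
      moreover have "A \<otimes>\<^bsub>JK\<^esub> principal K 1 = A"
        using K.ideal_mult_ints[OF JK_frac[OF I_JK[OF A(1)]]] by (simp add: mult_JK K.principal_one)
      ultimately have "A \<in> \<I> <#>\<^bsub>JK\<^esub> ray_group K \<mm>K" using A(1) unfolding set_mult_def by force
      then show "h \<in> H" unfolding H_def A(2) by (rule imageI)
    qed
  qed

  \<comment> \<open>The lift of \<open>\<delta>\<close> from classes to ideals; its values have norm
    1 as ideals, not only as classes.\<close>
  define \<Psi> where "\<Psi> = (\<lambda>B. ideal_mult B (?inv (\<sigma> ` B)))"
  have \<Psi>: "\<Psi> B \<in> carrier JK" "\<delta> (cl B) = cl (\<Psi> B)" "Nm (\<Psi> B) = Ok" if B: "B \<in> carrier JK" for B
  proof -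
    note sB = JK_act[OF \<sigma> B] note Bf = JK_frac[OF B] and sBf = JK_frac[OF sB]
    show "\<Psi> B \<in> carrier JK" unfolding \<Psi>_def by (rule JK_mult[OF B JK_inv[OF sB]])
    show "\<delta> (cl B) = cl (\<Psi> B)"
      unfolding \<delta>_def \<Psi>_def class_act_cl[OF \<sigma> B] cl_mult[OF B JK_inv[OF sB]] cl_inv[OF sB] by (rule refl)
    have "Nm (\<Psi> B) = ideal_mult (Nm B) (inv\<^bsub>frac_group k\<^esub> (Nm B))"
      unfolding \<Psi>_def ideal_norm_mult[OF Bf K.frac_inv_closed[OF sBf]] ideal_norm_inv[OF sBf]
        ideal_norm_act[OF \<sigma> Bf] by (rule refl)
    then show "Nm (\<Psi> B) = Ok" using k.frac_inv[OF ideal_norm_frac[OF Bf]] by simp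
  qed
  have act_closed: "class_act \<sigma> h \<in> carrier ClK" if h: "h \<in> carrier ClK" for h
  proof -
    obtain A where A: "A \<in> carrier JK" "h = cl A" using surj[OF h] by blast
    show ?thesis unfolding A(2) class_act_cl[OF \<sigma> A(1)] by (rule cl.hom_closed[OF JK_act[OF \<sigma> A(1)]])
  qed
  have act_mult: "class_act \<sigma> (h \<otimes>\<^bsub>ClK\<^esub> h') = class_act \<sigma> h \<otimes>\<^bsub>ClK\<^esub> class_act \<sigma> h'"
    if h: "h \<in> carrier ClK" "h' \<in> carrier ClK" for h h'
  proof -
    obtain A where A: "A \<in> carrier JK" "h = cl A" using surj[OF h(1)] by blast
    obtain B where B: "B \<in> carrier JK" "h' = cl B" using surj[OF h(2)] by blast
    have "\<sigma> ` ideal_mult A B = ideal_mult (\<sigma> ` A) (\<sigma> ` B)"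
      by (rule act_mult[OF \<sigma> K.frac_subset[OF JK_frac[OF A(1)]] K.frac_subset[OF JK_frac[OF B(1)]]])
    then show ?thesis
      unfolding A(2) B(2) cl_mult[OF A(1) B(1), symmetric] class_act_cl[OF \<sigma> A(1)] class_act_cl[OF \<sigma> B(1)]
        class_act_cl[OF \<sigma> JK_mult[OF A(1) B(1)]]
      using cl_mult[OF JK_act[OF \<sigma> A(1)] JK_act[OF \<sigma> B(1)]] by simp
  qed
  have \<delta>_hom: "\<delta> \<in> hom ClK ClK"
  proof (rule homI)
    fix h assume "h \<in> carrier ClK"
    then show "\<delta> h \<in> carrier ClK" using act_closed by (simp add: \<delta>_def)
  next
    fix h h' assume "h \<in> carrier ClK" "h' \<in> carrier ClK"
    then show "\<delta> (h \<otimes>\<^bsub>ClK\<^esub> h') = \<delta> h \<otimes>\<^bsub>ClK\<^esub> \<delta> h'"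
      using act_closed act_mult by (simp add: \<delta>_def C.inv_mult C.m_ac)
  qed
  interpret \<delta>: group_hom ClK ClK \<delta>
    by (simp add: group_hom_def group_hom_axioms_def C.is_group \<delta>_hom)
  \<comment> \<open>\<open>H'\<close> is the preimage of the subgroup \<open>H\<close> under the
    endomorphism \<open>\<delta>\<close>.\<close>
  have H'_sub: "subgroup H' ClK"
    unfolding H'_def
    by (rule C.subgroupI) (use subgroup.one_closed[OF H] subgroup.m_closed[OF H] subgroup.m_inv_closed[OF H] in
        \<open>auto intro!: exI[of _ "\<one>\<^bsub>ClK\<^esub>"]\<close>)
  define D where "D = \<delta> ` H'"
  have D_sub: "subgroup D ClK" unfolding D_def by (rule \<delta>.subgroup_img_is_subgroup[OF H'_sub])

  have NH_cl: "cl A \<in> NH \<longleftrightarrow> cl A \<in> H \<and> (\<exists>x\<in>Uk. Nm A = principal k x)" if "A \<in> carrier JK" for A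
    unfolding NH_def kernel_def using class_norm_one_iff[OF that] by simp
  have NH_H: "NH \<subseteq> H" unfolding NH_def kernel_def by auto
  have NH_sub: "subgroup NH ClK"
  proof (rule C.subgroupI)
    show "NH \<subseteq> carrier ClK" using NH_H subgroup.subset[OF H] by blast
    have "Nm OK = principal k 1" by (simp add: ideal_norm_one k.principal_one)
    then have "cl OK \<in> NH" using NH_cl[OF OKJ] k.ray_elems_one OKI H_eq by blast
    then show "NH \<noteq> {}" by blast
    fix h assume h: "h \<in> NH"
    then obtain A where A: "A \<in> \<I>" "h = cl A" using NH_H H_eq by blast
    obtain x where x: "x \<in> Uk" "Nm A = principal k x" using h NH_cl[OF I_JK[OF A(1)]] A(2) by blast
    have "Nm (?inv A) = principal k (inverse x)"
      using ideal_norm_inv[OF JK_frac[OF I_JK[OF A(1)]]] x k.principal_inverse[OF k.ray_elems_field[OF x(1)]] by simp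
    then have "cl (?inv A) \<in> NH"
      using NH_cl[OF JK_inv[OF I_JK[OF A(1)]]] k.ray_elems_inverse[OF x(1)] I_inv[OF A(1)] H_eq by blast
    then show "inv\<^bsub>ClK\<^esub> h \<in> NH" using cl_inv[OF I_JK[OF A(1)]] A(2) by simp
    fix h' assume h': "h' \<in> NH"
    then obtain B where B: "B \<in> \<I>" "h' = cl B" using NH_H H_eq by blast
    obtain y where y: "y \<in> Uk" "Nm B = principal k y" using h' NH_cl[OF I_JK[OF B(1)]] B(2) by blast
    have "Nm (ideal_mult A B) = principal k (x * y)"
      using ideal_norm_mult[OF JK_frac[OF I_JK[OF A(1)]] JK_frac[OF I_JK[OF B(1)]]] x(2) y(2) k.principal_mult by simp
    then have "cl (ideal_mult A B) \<in> NH"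
      using NH_cl[OF JK_mult[OF I_JK[OF A(1)] I_JK[OF B(1)]]] k.ray_elems_mult[OF x(1) y(1)] I_mult[OF A(1) B(1)] H_eq
      by blast
    then show "h \<otimes>\<^bsub>ClK\<^esub> h' \<in> NH" using cl_mult[OF I_JK[OF A(1)] I_JK[OF B(1)]] A(2) B(2) by simp
  qed
  have D_NH: "D \<subseteq> NH"
  proof
    fix d assume "d \<in> D"
    then obtain h where h: "h \<in> carrier ClK" "\<delta> h \<in> H" "d = \<delta> h" by (auto simp: D_def H'_def)
    obtain B where B: "B \<in> carrier JK" "h = cl B" using surj[OF h(1)] by blast
    have "Nm (\<Psi> B) = principal k 1" using \<Psi>(3)[OF B(1)] by (simp add: k.principal_one)
    then show "d \<in> NH"
      using NH_cl[OF \<Psi>(1)[OF B(1)]] \<Psi>(2)[OF B(1)] h B(2) k.ray_elems_one by metis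
  qed

  \<comment> \<open>Ideals of \<open>\<I>\<close> whose norms differ by the norm of some
    \<open>y\<close> in \<open>UK\<close> have the same class modulo \<open>D\<close>.\<close>
  have key: "cl A \<otimes>\<^bsub>ClK\<^esub> inv\<^bsub>ClK\<^esub> cl A' \<in> D"
    if A: "A \<in> \<I>" "A' \<in> \<I>" and y: "y \<in> UK" and eq: "Nm A = ideal_mult (Nm A') (principal k (elem_norm K k y))"
    for A A' y
  proof -
    note AJ = I_JK[OF A(1)] I_JK[OF A(2)] and yJ = UK_principal_JK[OF y]
    define E where "E = ideal_mult A' (principal K y)"
    have E: "E \<in> carrier JK" unfolding E_def by (rule JK_mult[OF AJ(2) yJ])
    have NE: "Nm E = Nm A"
      unfolding E_def ideal_norm_mult[OF JK_frac[OF AJ(2)] JK_frac[OF yJ]] norm_principal_UK[OF y] eq by (rule refl)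
    \<comment> \<open>Correcting \<open>A'\<close> by \<open>(y)\<close> makes the norms equal
      exactly, so that the quotient \<open>c\<close> has trivial norm while its class is still that
      of \<open>A\<close> over \<open>A'\<close>.\<close>
    define c where "c = ideal_mult A (?inv E)"
    have c: "c \<in> carrier JK" unfolding c_def by (rule JK_mult[OF AJ(1) JK_inv[OF E]])
    have "Nm c = ideal_mult (Nm A) (inv\<^bsub>frac_group k\<^esub> (Nm A))"
      unfolding c_def ideal_norm_mult[OF JK_frac[OF AJ(1)] K.frac_inv_closed[OF JK_frac[OF E]]]
        ideal_norm_inv[OF JK_frac[OF E]] NE by (rule refl)
    then have Nc: "Nm c = Ok" using k.frac_inv[OF ideal_norm_frac[OF JK_frac[OF AJ(1)]]] by simp
    have cT: "\<And>P. P \<in> T \<Longrightarrow> K.val c P = 0" using c by (simp add: K.ideal_group_simps)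
    obtain B where B: "B \<in> frac_ideals K" "\<And>P. P \<in> T \<Longrightarrow> K.val B P = 0" "c = \<Psi> B"
      unfolding \<Psi>_def using ideal_Hilbert90[OF JK_frac[OF c] Nc T_act T_primes cT] by metis
    have BJ: "B \<in> carrier JK" using B(1,2) by (simp add: K.ideal_group_simps)
    have "cl E = cl A'" unfolding E_def using cl_mult[OF AJ(2) yJ] cl_ray[OF y] cl.hom_closed[OF AJ(2)] by simp
    then have clc: "cl c = cl A \<otimes>\<^bsub>ClK\<^esub> inv\<^bsub>ClK\<^esub> cl A'"
      unfolding c_def using cl_mult[OF AJ(1) JK_inv[OF E]] cl_inv[OF E] by simp
    \<comment> \<open>Hilbert 90 alone gives \<open>\<delta>\<close> of some class; membership in
      \<open>H\<close> is what puts that class into \<open>H'\<close>, as \<open>D\<close>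
      requires.\<close>
    have "cl A \<otimes>\<^bsub>ClK\<^esub> inv\<^bsub>ClK\<^esub> cl A' \<in> H"
      by (rule subgroup.m_closed[OF H _ subgroup.m_inv_closed[OF H]]) (use A H_eq in blast)+
    then have "\<delta> (cl B) \<in> H" using \<Psi>(2)[OF BJ] B(3) clc by simp
    then have "cl B \<in> H'" unfolding H'_def using cl.hom_closed[OF BJ] by simp
    then have "\<delta> (cl B) \<in> D" unfolding D_def by (rule imageI)
    then show ?thesis using \<Psi>(2)[OF BJ] B(3) clc by simp
  qed

  define Q where "Q = ClK\<lparr>carrier := NH\<rparr>"
  have Qg: "group Q" unfolding Q_def by (rule C.subgroup_imp_group[OF NH_sub])
  have Qc: "comm_group Q"
    by (rule group.group_comm_groupI[OF Qg]) (use subgroup.subset[OF NH_sub] C.m_comm in \<open>auto simp: Q_def\<close>)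
  interpret Q: comm_group Q by (rule Qc)
  have DQ: "subgroup D Q" unfolding Q_def by (rule C.subgroup_incl[OF D_sub NH_sub D_NH])
  have Dn: "D \<lhd> Q" by (rule Q.subgroup_imp_normal[OF DQ])
  have QD: "group (Q Mod D)" by (rule normal.factorgroup_is_group[OF Dn])
  \<comment> \<open>Restricting the carrier does not change the multiplication, so cosets may be
    computed in \<open>ClK\<close>.\<close>
  have coset_Q: "D #>\<^bsub>Q\<^esub> h = D #>\<^bsub>ClK\<^esub> h" for h by (simp add: r_coset_def Q_def)
  have coset_one: "D #>\<^bsub>ClK\<^esub> h = D \<longleftrightarrow> h \<in> D" if "h \<in> carrier ClK" for h
    using C.coset_join1[OF _ that D_sub] C.coset_join2[OF that D_sub] by blast

  \<comment> \<open>An arbitrary choice of \<open>A\<close>; independence of it is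
    \<open>\<phi>_eq\<close>.\<close>
  define \<phi> where "\<phi> = (\<lambda>x. D #>\<^bsub>ClK\<^esub> cl (SOME A. A \<in> \<I> \<and> Nm A = principal k x))"
  have \<phi>_eq: "\<phi> x = D #>\<^bsub>ClK\<^esub> cl A" if A: "A \<in> \<I>" "Nm A = principal k x" for x A
  proof -
    define B where "B = (SOME A. A \<in> \<I> \<and> Nm A = principal k x)"
    have B: "B \<in> \<I> \<and> Nm B = principal k x" unfolding B_def by (rule someI[of _ A]) (use A in blast)
    \<comment> \<open>The hypothesis of \<open>key\<close> with \<open>y = 1\<close>.\<close>
    have "Nm B = ideal_mult (Nm A) (principal k (elem_norm K k 1))"
      using B A k.ideal_mult_ints[OF ideal_norm_frac[OF JK_frac[OF I_JK[OF A(1)]]]] by (simp add: elem_norm_one k.principal_one)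
    then have d: "cl B \<otimes>\<^bsub>ClK\<^esub> inv\<^bsub>ClK\<^esub> cl A \<in> D" using key[OF _ A(1) K.ray_elems_one] B by blast
    have cc: "cl A \<in> carrier ClK" "cl B \<in> carrier ClK" using cl.hom_closed I_JK A(1) B by auto
    have "cl B = (cl B \<otimes>\<^bsub>ClK\<^esub> inv\<^bsub>ClK\<^esub> cl A) \<otimes>\<^bsub>ClK\<^esub> cl A" using cc by (simp add: C.m_assoc)
    then have "cl B \<in> D #>\<^bsub>ClK\<^esub> cl A" using d unfolding r_coset_def by blast
    then have "D #>\<^bsub>ClK\<^esub> cl A = D #>\<^bsub>ClK\<^esub> cl B" by (rule C.repr_independence[OF _ cc(1) D_sub])
    then show ?thesis by (simp add: \<phi>_def B_def)
  qed
  have \<Lambda>_obtain: "\<exists>A\<in>\<I>. Nm A = principal k x \<and> cl A \<in> NH \<and> \<phi> x = D #>\<^bsub>ClK\<^esub> cl A" if x: "x \<in> \<Lambda>" for x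
  proof -
    obtain A where A: "A \<in> \<I>" "Nm A = principal k x" "x \<in> Uk" using x by (auto simp: \<Lambda>_def)
    then have "cl A \<in> NH" using NH_cl[OF I_JK[OF A(1)]] H_eq by blast
    then show ?thesis using A \<phi>_eq[OF A(1,2)] by blast
  qed

  have \<Lambda>_U: "x \<in> Uk" if "x \<in> \<Lambda>" for x using that by (simp add: \<Lambda>_def)
  have \<Lambda>_one: "1 \<in> \<Lambda>"
    using OKI k.ray_elems_one ideal_norm_one k.principal_one by (auto simp: \<Lambda>_def intro!: image_eqI[of _ _ OK])
  have \<Lambda>_mult: "x * y \<in> \<Lambda>" if xy: "x \<in> \<Lambda>" "y \<in> \<Lambda>" for x y
  proof -
    obtain A where A: "A \<in> \<I>" "Nm A = principal k x" using \<Lambda>_obtain[OF xy(1)] by blast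
    obtain B where B: "B \<in> \<I>" "Nm B = principal k y" using \<Lambda>_obtain[OF xy(2)] by blast
    have "principal k (x * y) = Nm (ideal_mult A B)"
      using ideal_norm_mult[OF JK_frac[OF I_JK[OF A(1)]] JK_frac[OF I_JK[OF B(1)]]] A(2) B(2) k.principal_mult by simp
    then show ?thesis
      using I_mult[OF A(1) B(1)] k.ray_elems_mult[OF \<Lambda>_U[OF xy(1)] \<Lambda>_U[OF xy(2)]] by (auto simp: \<Lambda>_def)
  qed
  have \<Lambda>_inv: "inverse x \<in> \<Lambda>" if x: "x \<in> \<Lambda>" for x
  proof -
    obtain A where A: "A \<in> \<I>" "Nm A = principal k x" using \<Lambda>_obtain[OF x] by blast
    have "principal k (inverse x) = Nm (?inv A)"
      using ideal_norm_inv[OF JK_frac[OF I_JK[OF A(1)]]] A(2) k.principal_inverse[OF k.ray_elems_field[OF \<Lambda>_U[OF x]]] by simp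
    then show ?thesis using I_inv[OF A(1)] k.ray_elems_inverse[OF \<Lambda>_U[OF x]] by (auto simp: \<Lambda>_def)
  qed
  have \<Lambda>_nz: "0 \<notin> \<Lambda>" using k.ray_elems_field(2) \<Lambda>_U by blast
  have \<Lambda>g: "group (mult_group_on \<Lambda>)" by (rule group_mult_group_on[OF \<Lambda>_nz \<Lambda>_one \<Lambda>_mult \<Lambda>_inv])

  define E where "E = {\<epsilon> * elem_norm K k y | \<epsilon> y. \<epsilon> \<in> ray_units k \<mm> \<and> y \<in> UK} \<inter> \<Lambda>"
  have E_iff: "x \<in> E \<longleftrightarrow> \<phi> x = D" if x: "x \<in> \<Lambda>" for x
  proof -
    obtain A where A: "A \<in> \<I>" "Nm A = principal k x" "\<phi> x = D #>\<^bsub>ClK\<^esub> cl A" using \<Lambda>_obtain[OF x] by blast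
    note AJ = I_JK[OF A(1)] note AC = cl.hom_closed[OF AJ]
    have "\<phi> x = D \<longleftrightarrow> cl A \<in> D" unfolding A(3) by (rule coset_one[OF AC])
    also have "\<dots> \<longleftrightarrow> x \<in> E"
    proof
      assume "x \<in> E"
      then obtain \<epsilon> y where ey: "x = \<epsilon> * elem_norm K k y" "\<epsilon> \<in> ray_units k \<mm>" "y \<in> UK" by (auto simp: E_def)
      have "principal k x = ideal_mult Ok (principal k (elem_norm K k y))"
        using k.principal_mult[of \<epsilon> "elem_norm K k y"] ey(1,2) k.ray_units_iff by simp
      \<comment> \<open>The unit generates the trivial ideal, so \<open>key\<close> applies with
        \<open>OK\<close> in place of \<open>A'\<close>.\<close>
      then have "Nm A = ideal_mult (Nm OK) (principal k (elem_norm K k y))" by (simp add: A(2) ideal_norm_one)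
      then have "cl A \<otimes>\<^bsub>ClK\<^esub> inv\<^bsub>ClK\<^esub> cl OK \<in> D" by (rule key[OF A(1) OKI ey(3)])
      then show "cl A \<in> D" using AC by (simp add: cl_one)
    next
      assume "cl A \<in> D"
      then obtain h where h: "h \<in> carrier ClK" "cl A = \<delta> h" by (auto simp: D_def H'_def)
      obtain B where B: "B \<in> carrier JK" "h = cl B" using surj[OF h(1)] by blast
      have "cl A = cl (\<Psi> B)" using h(2) \<Psi>(2)[OF B(1)] B(2) by simp
      \<comment> \<open>Equality of classes is made an equality of ideals at the price of a factor
        \<open>(y)\<close>; taking norms removes \<open>\<Psi> B\<close>.\<close>
      then obtain y where y: "y \<in> UK" "A = ideal_mult (principal K y) (\<Psi> B)"
        using K.ray_class_eq_iff[OF AJ \<Psi>(1)[OF B(1)]] by blast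
      let ?N = "elem_norm K k y"
      note NU = norm_UK[OF y(1)] note Nf = k.ray_elems_field[OF NU] and xf = k.ray_elems_field[OF \<Lambda>_U[OF x]]
      have "principal k x = Nm A" by (simp add: A(2))
      also have "\<dots> = ideal_mult (principal k ?N) Ok"
        unfolding y(2) ideal_norm_mult[OF JK_frac[OF UK_principal_JK[OF y(1)]] JK_frac[OF \<Psi>(1)[OF B(1)]]]
          norm_principal_UK[OF y(1)] \<Psi>(3)[OF B(1)] by (rule refl)
      also have "\<dots> = principal k ?N" by (rule k.ideal_mult_ints[OF k.principal_frac[OF Nf]])
      finally have px: "principal k x = principal k ?N" .
      \<comment> \<open>Two generators of the same ideal differ by a unit; it satisfies the ray
        conditions because \<open>x\<close> and the norm of \<open>y\<close> both do.\<close>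
      define \<epsilon> where "\<epsilon> = x * inverse ?N"
      have "principal k \<epsilon> = ideal_mult (principal k ?N) (principal k (inverse ?N))"
        unfolding \<epsilon>_def k.principal_mult px by (rule refl)
      also have "\<dots> = Ok" using k.principal_mult[of ?N "inverse ?N"] Nf(2) by (simp add: k.principal_one)
      finally have "\<epsilon> \<in> ray_units k \<mm>"
        using k.ray_elems_mult[OF \<Lambda>_U[OF x] k.ray_elems_inverse[OF NU]] by (simp add: k.ray_units_iff \<epsilon>_def)
      moreover have "x = \<epsilon> * ?N" using Nf(2) by (simp add: \<epsilon>_def)
      ultimately show "x \<in> E" using x y(1) unfolding E_def by blast
    qed
    finally show ?thesis by simp
  qed

  have \<phi>_hom: "\<phi> \<in> hom (mult_group_on \<Lambda>) (Q Mod D)"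
  proof (rule homI)
    fix x assume "x \<in> carrier (mult_group_on \<Lambda>)"
    then have "x \<in> \<Lambda>" by (simp add: mult_group_on_def)
    then obtain A where "A \<in> \<I>" "cl A \<in> NH" "\<phi> x = D #>\<^bsub>ClK\<^esub> cl A" using \<Lambda>_obtain by blast
    then show "\<phi> x \<in> carrier (Q Mod D)" by (auto simp: carrier_FactGroup coset_Q Q_def)
  next
    fix x y assume "x \<in> carrier (mult_group_on \<Lambda>)" "y \<in> carrier (mult_group_on \<Lambda>)"
    then have xy: "x \<in> \<Lambda>" "y \<in> \<Lambda>" by (simp_all add: mult_group_on_def)
    obtain A where A: "A \<in> \<I>" "Nm A = principal k x" "cl A \<in> NH" "\<phi> x = D #>\<^bsub>ClK\<^esub> cl A"
      using \<Lambda>_obtain[OF xy(1)] by blast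
    obtain B where B: "B \<in> \<I>" "Nm B = principal k y" "cl B \<in> NH" "\<phi> y = D #>\<^bsub>ClK\<^esub> cl B"
      using \<Lambda>_obtain[OF xy(2)] by blast
    have "Nm (ideal_mult A B) = principal k (x * y)"
      using ideal_norm_mult[OF JK_frac[OF I_JK[OF A(1)]] JK_frac[OF I_JK[OF B(1)]]] A(2) B(2) k.principal_mult by simp
    then have "\<phi> (x * y) = D #>\<^bsub>Q\<^esub> (cl A \<otimes>\<^bsub>Q\<^esub> cl B)"
      using \<phi>_eq[OF I_mult[OF A(1) B(1)]] cl_mult[OF I_JK[OF A(1)] I_JK[OF B(1)]] coset_Q by (simp add: Q_def)
    also have "\<dots> = (D #>\<^bsub>Q\<^esub> cl A) \<otimes>\<^bsub>Q Mod D\<^esub> (D #>\<^bsub>Q\<^esub> cl B)"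
      by (rule hom_mult[OF normal.r_coset_hom_Mod[OF Dn]]) (use A(3) B(3) in \<open>simp_all add: Q_def\<close>)
    finally show "\<phi> (x \<otimes>\<^bsub>mult_group_on \<Lambda>\<^esub> y) = \<phi> x \<otimes>\<^bsub>Q Mod D\<^esub> \<phi> y"
      using A(4) B(4) coset_Q by (simp add: mult_group_on_def)
  qed
  interpret \<phi>: group_hom "mult_group_on \<Lambda>" "Q Mod D" \<phi>
    by (simp add: group_hom_def group_hom_axioms_def \<Lambda>g QD \<phi>_hom)
  have ker: "E = kernel (mult_group_on \<Lambda>) (Q Mod D) \<phi>"
    unfolding kernel_def using E_iff by (auto simp: mult_group_on_def E_def)
  \<comment> \<open>The group structure on the left-hand term is inherited from its being the
    kernel.\<close>
  have "subgroup E (mult_group_on \<Lambda>)" unfolding ker by (rule \<phi>.subgroup_kernel)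
  then have "group ((mult_group_on \<Lambda>)\<lparr>carrier := E\<rparr>)" by (rule \<phi>.G.subgroup_imp_group)
  then have Eg: "group (mult_group_on E)" by (simp add: mult_group_on_def)
  have "E \<subseteq> \<Lambda>" by (simp add: E_def)
  then have incl: "group_hom (mult_group_on E) (mult_group_on \<Lambda>) (\<lambda>x. x)"
    using Eg \<Lambda>g by (auto simp: group_hom_def group_hom_axioms_def hom_def mult_group_on_def)
  have onto: "\<phi> ` \<Lambda> = carrier (Q Mod D)"
  proof
    show "\<phi> ` \<Lambda> \<subseteq> carrier (Q Mod D)" using \<phi>.hom_closed by (auto simp: mult_group_on_def)
    show "carrier (Q Mod D) \<subseteq> \<phi> ` \<Lambda>"
    proof
      fix c assume "c \<in> carrier (Q Mod D)"
      then obtain h where h: "h \<in> NH" "c = D #>\<^bsub>ClK\<^esub> h" by (auto simp: carrier_FactGroup coset_Q Q_def)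
      \<comment> \<open>A class of \<open>NH\<close> has a representative in \<open>\<I>\<close>,
        and triviality of its norm class supplies a generator in \<open>Uk\<close>; that generator
        is the preimage.\<close>
      then obtain A where A: "A \<in> \<I>" "h = cl A" using NH_H H_eq by blast
      obtain x where x: "x \<in> Uk" "Nm A = principal k x" using h NH_cl[OF I_JK[OF A(1)]] A(2) by blast
      have "x \<in> \<Lambda>" using x A(1) unfolding \<Lambda>_def by (metis (mono_tags, lifting) image_eqI mem_Collect_eq)
      moreover have "\<phi> x = c" using \<phi>_eq[OF A(1) x(2)] h(2) A(2) by simp
      ultimately show "c \<in> \<phi> ` \<Lambda>" by blast
    qed
  qed
  have "short_exact (mult_group_on E) (\<lambda>x. x) (mult_group_on \<Lambda>) \<phi> (Q Mod D)"
    unfolding short_exact_def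
  proof (intro conjI)
    show "group_hom (mult_group_on \<Lambda>) (Q Mod D) \<phi>" by (rule \<phi>.group_hom_axioms)
    show "(\<lambda>x. x) ` carrier (mult_group_on E) = kernel (mult_group_on \<Lambda>) (Q Mod D) \<phi>"
      using ker by (simp add: mult_group_on_def)
    show "\<phi> ` carrier (mult_group_on \<Lambda>) = carrier (Q Mod D)" using onto by (simp add: mult_group_on_def)
  qed (use incl in auto)
  moreover have "\<forall>x\<in>\<Lambda>. \<forall>A\<in>\<I>. Nm A = principal k x \<longrightarrow> \<phi> x = D #>\<^bsub>ClK\<^esub> cl A" using \<phi>_eq by blast
  ultimately show ?thesis using D_NH unfolding D_def Q_def E_def by blast
qed

end

theorem theorem3p3:
  fixes K k \<mm> :: "'a::field_char_0 set"
    and \<sigma> :: "'a \<Rightarrow> 'a"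
    and \<I> :: "'a set set"
  defines "G \<equiv> gal_group K k"
    and "\<mm>K \<equiv> modulus_ext K \<mm>"
  defines "IK \<equiv> ideal_group K (supp K \<mm>K)"
    and "ClK \<equiv> ray_class_group K \<mm>K"
    and "Clk \<equiv> ray_class_group k \<mm>"
  defines "H \<equiv> ray_class K \<mm>K ` (\<I> <#>\<^bsub>IK\<^esub> ray_group K \<mm>K)"
    and "\<delta> \<equiv> (\<lambda>h. h \<otimes>\<^bsub>ClK\<^esub> inv\<^bsub>ClK\<^esub> (class_act \<sigma> h))"
  defines "H' \<equiv> {h \<in> carrier ClK. \<delta> h \<in> H}"
    and "NH \<equiv> kernel (ClK\<lparr>carrier := H\<rparr>) Clk (class_norm K k \<mm>)"
    and "\<Lambda> \<equiv> {x \<in> ray_elems k \<mm>. principal k x \<in> ideal_norm K k ` \<I>}"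
  assumes "number_field k" and "number_field K" and "galois_ext K k"
    and "\<sigma> \<in> carrier G" and "carrier G = generate G {\<sigma>}"
    and "\<mm> \<in> integral_ideals k"
    and "subgroup \<I> IK"
    and "subgroup H ClK" and "\<forall>s \<in> carrier G. \<forall>h \<in> H. class_act s h \<in> H"
  shows "\<delta> ` H' \<subseteq> NH \<and>
    (\<exists>\<phi>. short_exact
           (mult_group_on ({\<epsilon> * elem_norm K k y | \<epsilon> y.
               \<epsilon> \<in> ray_units k \<mm> \<and> y \<in> ray_elems K \<mm>K} \<inter> \<Lambda>))
           (\<lambda>x. x)
           (mult_group_on \<Lambda>)
           \<phi>
           (ClK\<lparr>carrier := NH\<rparr> Mod (\<delta> ` H')) \<and>
         (\<forall>x\<in>\<Lambda>. \<forall>A\<in>\<I>. ideal_norm K k A = principal k x \<longrightarrow>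
            \<phi> x = (\<delta> ` H') #>\<^bsub>ClK\<^esub> ray_class K \<mm>K A))"
proof -
  obtain dk bk where k: "nfield k dk bk" using number_field_imp_nfield[OF assms(11)] by blast
  obtain dK bK where K: "nfield K dK bK" using number_field_imp_nfield[OF assms(12)] by blast
  interpret ray_ext K k dK dk bK bk \<sigma> \<mm>
    using k K assms(13-16) unfolding G_def
    by (simp add: ray_ext_def ray_ext_axioms_def cyc_ext_def cyc_ext_axioms_def gal_ext_def gal_ext_axioms_def)
  show ?thesis
    using exact_sequence[of \<I>] assms(17,18)
    unfolding \<Lambda>_def NH_def H'_def \<delta>_def H_def Clk_def ClK_def IK_def \<mm>K_def by blast
qed

end
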